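(* The following statements hold. (a) Two almost conjugate finite subgroups of $\mathrm{SU}(2)$ are conjugate in $\mathrm{SU}(2)$. (b) Two almost conjugate finite subgroups of $\mathrm{Spin}(4)=\mathrm{SU}(2)\times\mathrm{SU}(2)$ are conjugate in $\mathrm{Spin}(4)$. (c) Each of the groups $\mathrm{O}(6)$, $\mathrm{Spin}(6)$ and $\mathrm{Pin}(6)$ admits a pair of almost conjugate finite subgroups that are not conjugate in it.
   Context: A pair of finite subgroups $\Gamma_1,\Gamma_2$ of a Lie group $G$ are almost conjugate (in $G$) if there is a bijection $\phi:\Gamma_1\to\Gamma_2$ preserving conjugacy classes of elements in $G$, i.e. for each $\gamma\in\Gamma_1$ there is $x=x(\gamma)\in G$ with $\phi(\gamma)=x\gamma x^{-1}$. $\mathrm{Pin}(n)$ is the group generated by unit vectors in the Clifford algebra of Euclidean $\mathbb{R}^n$ (convention $v\cdot v=-|v|^2$), a two-fold cover of $\mathrm{O}(n)$, and $\mathrm{Spin}(n)\subset\mathrm{Pin}(n)$ is the preimage of $\mathrm{SO}(n)$. *)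

theory Defs
  imports "HOL-Analysis.Analysis" "HOL-Algebra.Generated_Groups"
begin

section \<open>Almost conjugate subgroups\<close>

definition almost_conjugate :: "('a, 'b) monoid_scheme \<Rightarrow> 'a set \<Rightarrow> 'a set \<Rightarrow> bool" where
  "almost_conjugate G H K \<longleftrightarrow>
     subgroup H G \<and> finite H \<and> subgroup K G \<and> finite K \<and>
     (\<exists>\<phi>. bij_betw \<phi> H K \<and>
        (\<forall>\<gamma>\<in>H. \<exists>x\<in>carrier G. \<phi> \<gamma> = x \<otimes>\<^bsub>G\<^esub> \<gamma> \<otimes>\<^bsub>G\<^esub> inv\<^bsub>G\<^esub> x))"

definition conjugate_subgroups :: "('a, 'b) monoid_scheme \<Rightarrow> 'a set \<Rightarrow> 'a set \<Rightarrow> bool" where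
  "conjugate_subgroups G H K \<longleftrightarrow>
     (\<exists>x\<in>carrier G. K = (\<lambda>\<gamma>. x \<otimes>\<^bsub>G\<^esub> \<gamma> \<otimes>\<^bsub>G\<^esub> inv\<^bsub>G\<^esub> x) ` H)"

section \<open>Matrix groups\<close>

definition conj_transpose :: "complex^'n^'m \<Rightarrow> complex^'m^'n" where
  "conj_transpose A = (\<chi> i j. cnj (A $ j $ i))"

definition special_unitary_group :: "(complex^'n^'n) monoid" where
  "special_unitary_group =
     \<lparr>carrier = {A. conj_transpose A ** A = mat 1 \<and> A ** conj_transpose A = mat 1 \<and> det A = 1},
      monoid.mult = (**), one = mat 1\<rparr>"

definition orthogonal_group :: "(real^'n^'n) monoid" where
  "orthogonal_group = \<lparr>carrier = {A. orthogonal_matrix A}, monoid.mult = (**), one = mat 1\<rparr>"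

section \<open>The real Clifford algebra of Euclidean space\<close>

text \<open>
  The index type is linearly ordered, say by \<open>i\<^sub>1 < \<dots> < i\<^sub>n\<close>.  An element of the Clifford algebra
  of \<open>real^'n\<close> is given by its coordinates in the basis of the products
  \<open>e\<^sub>A = e\<^bsub>a\<^sub>1\<^esub> \<cdots> e\<^bsub>a\<^sub>k\<^esub>\<close>, where \<open>A = {a\<^sub>1 < \<dots> < a\<^sub>k}\<close> ranges over the sets of indices.
\<close>

datatype 'n clifford = Clifford (cl_coeff: "'n set \<Rightarrow> real")

text \<open>
  The relations \<open>e\<^sub>i e\<^sub>j = - e\<^sub>j e\<^sub>i\<close> for \<open>i \<noteq> j\<close> and \<open>e\<^sub>i e\<^sub>i = - 1\<close> give
  \<open>e\<^sub>A e\<^sub>B = cl_sign A B e\<^sub>C\<close> with \<open>C\<close> the symmetric difference of \<open>A\<close> and \<open>B\<close>: sorting the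
  product costs one sign for each pair \<open>j < i\<close> with \<open>i \<in> A\<close>, \<open>j \<in> B\<close>, and cancelling equal
  factors costs one sign for each \<open>i \<in> A \<inter> B\<close>.
\<close>

definition cl_sign :: "'n::linorder set \<Rightarrow> 'n set \<Rightarrow> real" where
  "cl_sign A B = (- 1) ^ card {(i, j). i \<in> A \<and> j \<in> B \<and> j \<le> i}"

lemma cl_eqI: "(\<And>A. cl_coeff x A = cl_coeff y A) \<Longrightarrow> x = y"
  by (cases x; cases y) auto

lemma cl_sign_prod:
  fixes A B :: "'n::{finite,linorder} set"
  shows "cl_sign A B = (\<Prod>i\<in>A. \<Prod>j\<in>B. if j \<le> i then - 1 else 1)"
proof -
  have "(\<Prod>i\<in>A. \<Prod>j\<in>B. if j \<le> i then - 1 else 1 :: real)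
      = (\<Prod>p\<in>A \<times> B. if snd p \<le> fst p then - 1 else 1)"
    by (simp add: prod.cartesian_product case_prod_unfold)
  also have "\<dots> = (\<Prod>p\<in>{p \<in> A \<times> B. snd p \<le> fst p}. - 1)"
    by (rule prod.inter_filter[symmetric]) simp
  also have "{p \<in> A \<times> B. snd p \<le> fst p} = {(i, j). i \<in> A \<and> j \<in> B \<and> j \<le> i}"
    by auto
  finally show ?thesis
    by (simp add: cl_sign_def)
qed

lemma prod_sym_diff:
  fixes f :: "'n::finite \<Rightarrow> real"
  assumes "\<And>i. f i * f i = 1"
  shows "prod f (sym_diff A B) = prod f A * prod f B"
proof -
  have "prod f A = prod f (A - B) * prod f (A \<inter> B)"
    by (metis finite_code prod.Int_Diff mult.commute)
  moreover have "prod f B = prod f (B - A) * prod f (A \<inter> B)"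
    by (metis finite_code prod.Int_Diff mult.commute Int_commute)
  moreover have "prod f (sym_diff A B) = prod f (A - B) * prod f (B - A)"
    by (rule prod.union_disjoint) auto
  moreover have "prod f (A \<inter> B) * prod f (A \<inter> B) = 1"
    by (simp add: assms flip: prod.distrib)
  ultimately show ?thesis
    by (simp add: algebra_simps)
qed

lemma cl_sign_square: "cl_sign A B * cl_sign A B = 1"
  by (simp add: cl_sign_def flip: power_mult_distrib)

lemma cl_sign_sym_diff_left:
  fixes A B C :: "'n::{finite,linorder} set"
  shows "cl_sign (sym_diff A B) C = cl_sign A C * cl_sign B C"
  unfolding cl_sign_prod by (rule prod_sym_diff) (simp flip: prod.distrib, rule prod.neutral, simp)

lemma cl_sign_sym_diff_right:
  fixes A B C :: "'n::{finite,linorder} set"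
  shows "cl_sign C (sym_diff A B) = cl_sign C A * cl_sign C B"
proof -
  have "cl_sign C D = (\<Prod>j\<in>D. \<Prod>i\<in>C. if j \<le> i then - 1 else 1)" for D
    unfolding cl_sign_prod by (rule prod.swap)
  then show ?thesis
    by (simp only:) (rule prod_sym_diff, simp flip: prod.distrib, rule prod.neutral, simp)
qed

lemma bij_sym_diff: "bij (\<lambda>B. sym_diff A B)"
  by (rule involuntory_imp_bij) blast

instantiation clifford :: ("{finite,linorder}") real_algebra_1
begin

definition "0 = Clifford (\<lambda>A. 0)"
definition "1 = Clifford (\<lambda>A. if A = {} then 1 else 0)"
definition "x + y = Clifford (\<lambda>A. cl_coeff x A + cl_coeff y A)"
definition "- x = Clifford (\<lambda>A. - cl_coeff x A)"
definition "x - y = Clifford (\<lambda>A. cl_coeff x A - cl_coeff y A)"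
definition "r *\<^sub>R x = Clifford (\<lambda>A. r * cl_coeff x A)"

text \<open>For fixed \<open>A\<close> and \<open>C\<close>, the only \<open>B\<close> whose symmetric difference with \<open>A\<close> is \<open>C\<close> is \<open>sym_diff A C\<close>.\<close>
definition "x * y = Clifford (\<lambda>C. \<Sum>A\<in>UNIV.
  cl_sign A (sym_diff A C) * cl_coeff x A * cl_coeff y (sym_diff A C))"

instance
proof
  fix x y z :: "'a clifford" and r s :: real
  show "x * y * z = x * (y * z)"
  proof (rule cl_eqI)
    fix D :: "'a set"
    have "cl_coeff (x * y * z) D = (\<Sum>C\<in>UNIV. \<Sum>A\<in>UNIV.
        cl_sign C (sym_diff C D) * cl_sign A (sym_diff A C)
          * cl_coeff x A * cl_coeff y (sym_diff A C) * cl_coeff z (sym_diff C D))"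
      by (simp add: times_clifford_def sum_distrib_left sum_distrib_right mult_ac)
    also have "\<dots> = (\<Sum>A\<in>UNIV. \<Sum>C\<in>UNIV.
        cl_sign C (sym_diff C D) * cl_sign A (sym_diff A C)
          * cl_coeff x A * cl_coeff y (sym_diff A C) * cl_coeff z (sym_diff C D))"
      by (rule sum.swap)
    also have "\<dots> = (\<Sum>A\<in>UNIV. \<Sum>B\<in>UNIV.
        cl_sign A (sym_diff A D) * cl_sign B (sym_diff B (sym_diff A D))
          * cl_coeff x A * cl_coeff y B * cl_coeff z (sym_diff B (sym_diff A D)))"
    proof (rule sum.cong[OF refl])
      fix A :: "'a set"
      let ?f = "\<lambda>C. cl_sign C (sym_diff C D) * cl_sign A (sym_diff A C)
          * cl_coeff x A * cl_coeff y (sym_diff A C) * cl_coeff z (sym_diff C D)"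
      have "sum ?f UNIV = (\<Sum>B\<in>UNIV. ?f (sym_diff A B))"
        using sum.reindex_bij_betw[OF bij_sym_diff[of A], of ?f] by simp
      also have "\<dots> = (\<Sum>B\<in>UNIV.
        cl_sign A (sym_diff A D) * cl_sign B (sym_diff B (sym_diff A D))
          * cl_coeff x A * cl_coeff y B * cl_coeff z (sym_diff B (sym_diff A D)))"
      proof (rule sum.cong[OF refl])
        fix B :: "'a set"
        have 1: "sym_diff A (sym_diff A B) = B"
          by blast
        have 2: "sym_diff (sym_diff A B) D = sym_diff B (sym_diff A D)"
          by blast
        let ?E = "sym_diff B (sym_diff A D)"
        have "sym_diff A D = sym_diff B ?E"
          by blast
        then have "cl_sign A (sym_diff A D) = cl_sign A B * cl_sign A ?E"
          using cl_sign_sym_diff_right[of A B ?E] by (simp only:)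
        moreover have "cl_sign (sym_diff A B) ?E = cl_sign A ?E * cl_sign B ?E"
          by (rule cl_sign_sym_diff_left)
        ultimately show "?f (sym_diff A B) =
            cl_sign A (sym_diff A D) * cl_sign B ?E * cl_coeff x A * cl_coeff y B * cl_coeff z ?E"
          unfolding 1 2 by (simp only: mult_ac)
      qed
      finally show "sum ?f UNIV = \<dots>" .
    qed
    also have "\<dots> = cl_coeff (x * (y * z)) D"
      by (simp add: times_clifford_def sum_distrib_left sum_distrib_right mult_ac)
    finally show "cl_coeff (x * y * z) D = cl_coeff (x * (y * z)) D" .
  qed
  have s1: "cl_sign {} C = 1" "cl_sign C {} = 1" for C :: "'a set"
    by (auto simp: cl_sign_def)
  show "1 * x = x"
  proof (rule cl_eqI)
    fix C
    have "cl_coeff (1 * x) C = (\<Sum>A\<in>(UNIV::'a set set). if A = {} then cl_coeff x C else 0)"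
      unfolding times_clifford_def one_clifford_def clifford.sel
      by (rule sum.cong) (auto simp: s1)
    then show "cl_coeff (1 * x) C = cl_coeff x C" by simp
  qed
  show "x * 1 = x"
  proof (rule cl_eqI)
    fix C
    have "cl_coeff (x * 1) C = (\<Sum>A\<in>UNIV. if A = C then cl_coeff x C else 0)"
      unfolding times_clifford_def one_clifford_def clifford.sel
      by (rule sum.cong) (auto simp: s1)
    then show "cl_coeff (x * 1) C = cl_coeff x C" by simp
  qed
  show "(0 :: 'a clifford) \<noteq> 1"
    by (auto simp: zero_clifford_def one_clifford_def dest: fun_cong[of _ _ "{}"])
qed (auto simp: zero_clifford_def plus_clifford_def uminus_clifford_def minus_clifford_def
      scaleR_clifford_def times_clifford_def algebra_simps sum.distrib sum_distrib_left
      intro!: cl_eqI)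

end

definition cl_basis :: "'n set \<Rightarrow> 'n clifford" where
  "cl_basis A = Clifford (\<lambda>B. if B = A then 1 else 0)"

text \<open>The inclusion of Euclidean space into its Clifford algebra.\<close>
definition cl_vec :: "real^('n::{finite,linorder}) \<Rightarrow> 'n::{finite,linorder} clifford" where
  "cl_vec v = (\<Sum>i\<in>UNIV. v $ i *\<^sub>R cl_basis {i})"

text \<open>The automorphism of the Clifford algebra that extends \<open>v \<mapsto> - v\<close>.\<close>
definition cl_grade :: "'n clifford \<Rightarrow> 'n clifford" where
  "cl_grade x = Clifford (\<lambda>A. (- 1) ^ card A * cl_coeff x A)"

lemma cl_basis_mult:
  "cl_basis A * cl_basis B = cl_sign A B *\<^sub>R cl_basis (sym_diff A B)"
proof (rule cl_eqI)
  fix C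
  have "cl_coeff (cl_basis A * cl_basis B) C =
      (\<Sum>D\<in>UNIV. if D = A then (if C = sym_diff A B then cl_sign A B else 0) else 0)"
    unfolding times_clifford_def cl_basis_def clifford.sel
  proof (rule sum.cong[OF refl])
    fix D :: "'a set"
    have "sym_diff A C = B \<longleftrightarrow> C = sym_diff A B" by blast
    then show "cl_sign D (sym_diff D C) * (if D = A then 1 else 0)
        * (if sym_diff D C = B then 1 else 0)
      = (if D = A then if C = sym_diff A B then cl_sign A B else 0 else 0)"
      by (auto simp del: Un_Diff)
  qed
  then show "cl_coeff (cl_basis A * cl_basis B) C =
      cl_coeff (cl_sign A B *\<^sub>R cl_basis (sym_diff A B)) C"
    by (simp add: scaleR_clifford_def cl_basis_def)
qed

lemma cl_basis_empty: "cl_basis {} = 1"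
  by (simp add: cl_basis_def one_clifford_def)

lemma cl_basis_singleton_anticommute:
  "cl_basis {i} * cl_basis {j} + cl_basis {j} * cl_basis {i} =
     (if i = j then - 2 else 0) *\<^sub>R (1 :: 'n::{finite,linorder} clifford)"
proof -
  have s: "cl_sign {i} {j} = (if j \<le> i then - 1 else 1)" for i j :: 'n
    by (simp add: cl_sign_prod)
  show ?thesis
  proof (cases "i = j")
    case True
    have "- (1::'n clifford) - 1 = (- 2) *\<^sub>R 1"
      by (simp add: scaleR_2 algebra_simps flip: scaleR_left_distrib)
    then show ?thesis
      using True by (simp add: cl_basis_mult s cl_basis_empty)
  next
    case False
    moreover have "sym_diff {j} {i} = sym_diff {i} {j}"
      by blast
    ultimately show ?thesis
      by (cases "i \<le> j") (auto simp: cl_basis_mult s insert_commute)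
  qed
qed

lemma cl_vec_anticommute:
  "cl_vec v * cl_vec w + cl_vec w * cl_vec v = (- 2 * (v \<bullet> w)) *\<^sub>R 1"
proof -
  have "cl_vec v * cl_vec w = (\<Sum>i\<in>UNIV. \<Sum>j\<in>UNIV. (v $ i * w $ j) *\<^sub>R (cl_basis {i} * cl_basis {j}))"
    by (simp add: cl_vec_def sum_product mult.commute)
  moreover have "cl_vec w * cl_vec v = (\<Sum>i\<in>UNIV. \<Sum>j\<in>UNIV. (v $ i * w $ j) *\<^sub>R (cl_basis {j} * cl_basis {i}))"
    by (subst sum.swap) (simp add: cl_vec_def sum_product mult.commute)
  ultimately have "cl_vec v * cl_vec w + cl_vec w * cl_vec v
      = (\<Sum>i\<in>UNIV. \<Sum>j\<in>UNIV. (v $ i * w $ j) *\<^sub>R (cl_basis {i} * cl_basis {j} + cl_basis {j} * cl_basis {i}))"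
    by (simp add: sum.distrib scaleR_right_distrib)
  also have "\<dots> = (\<Sum>i\<in>UNIV. \<Sum>j\<in>UNIV. if i = j then (- 2 * (v $ i * w $ j)) *\<^sub>R 1 else 0)"
    unfolding cl_basis_singleton_anticommute by (intro sum.cong refl) auto
  also have "\<dots> = (- 2 * (v \<bullet> w)) *\<^sub>R 1"
    by (simp add: inner_vec_def sum_distrib_left scaleR_sum_left flip: sum_negf)
  finally show ?thesis .
qed

lemma cl_vec_square: "cl_vec v * cl_vec v = - ((norm v)\<^sup>2 *\<^sub>R 1)"
proof -
  have "2 *\<^sub>R (cl_vec v * cl_vec v) = 2 *\<^sub>R (- ((norm v)\<^sup>2 *\<^sub>R 1))"
    using cl_vec_anticommute[of v v] by (simp add: scaleR_2 power2_norm_eq_inner flip: scaleR_left_distrib)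
  then show ?thesis
    by (metis scaleR_cancel_left zero_neq_numeral)
qed

section \<open>Pin and Spin groups\<close>

definition clifford_monoid :: "'n::{finite,linorder} clifford monoid" where
  "clifford_monoid = \<lparr>carrier = UNIV, monoid.mult = (*), one = 1\<rparr>"

definition pin_group :: "'n::{finite,linorder} clifford monoid" where
  "pin_group = (units_of clifford_monoid)
     \<lparr>carrier := generate (units_of clifford_monoid) {cl_vec v |v. norm v = 1}\<rparr>"

text \<open>
  The two-fold cover from Pin(n) to O(n), given by the twisted adjoint representation: a unit
  vector is sent to the reflection in its orthogonal hyperplane.
\<close>
definition pin_cover ::
  "'n::{finite,linorder} clifford \<Rightarrow> real^('n::{finite,linorder})^('n::{finite,linorder})" where
  "pin_cover x = (THE A. \<forall>v. cl_vec (A *v v) = cl_grade x * cl_vec v * inv\<^bsub>clifford_monoid\<^esub> x)"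

definition spin_group :: "'n::{finite,linorder} clifford monoid" where
  "spin_group = pin_group\<lparr>carrier := {x \<in> carrier pin_group. rotation_matrix (pin_cover x)}\<rparr>"

text \<open>On Pin(n), the matrix in the definition of \<open>pin_cover\<close> exists, is unique and is orthogonal.\<close>

lemma clifford_monoid: "Group.monoid clifford_monoid"
  by (rule monoidI) (auto simp: clifford_monoid_def mult.assoc)

lemma cl_vec_unit_inverse:
  assumes "norm v = 1"
  shows "cl_vec v * - cl_vec v = 1" "- cl_vec v * cl_vec v = 1"
  using assms cl_vec_square[of v] by auto

lemma clifford_Units_iff:
  "x \<in> Units clifford_monoid \<longleftrightarrow> (\<exists>y. x * y = 1 \<and> y * x = 1)"
  by (auto simp: Units_def clifford_monoid_def)

lemma clifford_inv_eq:
  assumes "x * y = 1" "y * x = 1"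
  shows "inv\<^bsub>clifford_monoid\<^esub> x = y"
  using monoid.inv_unique'[OF clifford_monoid, of x y] assms
  by (simp add: clifford_monoid_def)

lemma cl_vec_in_Units:
  "{cl_vec v |v :: real^'n::{finite,linorder}. norm v = 1} \<subseteq> carrier (units_of clifford_monoid)"
proof clarify
  fix v :: "real^'n::{finite,linorder}"
  assume "norm v = 1"
  then show "cl_vec v \<in> carrier (units_of clifford_monoid)"
    unfolding units_of_carrier clifford_Units_iff by (intro exI[of _ "- cl_vec v"] conjI cl_vec_unit_inverse)
qed

lemma pin_group: "group pin_group"
proof -
  interpret U: group "units_of clifford_monoid"
    by (rule monoid.units_group[OF clifford_monoid])
  show ?thesis
    unfolding pin_group_def
    by (rule U.subgroup_imp_group[OF U.generate_is_subgroup[OF cl_vec_in_Units]])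
qed

lemma cl_coeff_sum: "cl_coeff (sum f I) A = (\<Sum>i\<in>I. cl_coeff (f i) A)"
  by (induction I rule: infinite_finite_induct) (auto simp: zero_clifford_def plus_clifford_def)

lemma cl_coeff_cl_vec: "cl_coeff (cl_vec v) {i} = v $ i"
proof -
  have "cl_coeff (cl_vec v) {i} = (\<Sum>j\<in>UNIV. if j = i then v $ i else 0)"
    unfolding cl_vec_def cl_coeff_sum
    by (rule sum.cong) (auto simp: scaleR_clifford_def cl_basis_def)
  then show ?thesis by simp
qed

lemma cl_vec_inject: "cl_vec v = cl_vec w \<longleftrightarrow> v = w"
  by (metis cl_coeff_cl_vec vec_eq_iff)

lemma cl_vec_diff: "cl_vec (v - w) = cl_vec v - cl_vec w"
  by (simp add: cl_vec_def scaleR_diff_left sum_subtractf)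

lemma cl_vec_scaleR: "cl_vec (r *\<^sub>R v) = r *\<^sub>R cl_vec v"
  by (simp add: cl_vec_def scaleR_sum_right)

lemma cl_grade_add: "cl_grade (x + y) = cl_grade x + cl_grade y"
  by (simp add: cl_grade_def plus_clifford_def algebra_simps)

lemma cl_grade_one: "cl_grade 1 = (1 :: 'n::{finite,linorder} clifford)"
  by (rule cl_eqI) (simp add: cl_grade_def one_clifford_def)

lemma cl_grade_uminus: "cl_grade (- x) = - cl_grade x"
  by (simp add: cl_grade_def uminus_clifford_def)

lemma cl_grade_cl_vec: "cl_grade (cl_vec v) = - cl_vec v"
  unfolding cl_vec_def
  by (rule cl_eqI)
    (auto simp: cl_grade_def cl_coeff_sum uminus_clifford_def scaleR_clifford_def cl_basis_def
      sum_distrib_left simp flip: sum_negf intro!: sum.cong)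

lemma cl_grade_mult: "cl_grade (x * y) = cl_grade x * cl_grade y"
proof (rule cl_eqI)
  fix C
  have "prod (\<lambda>_. - 1 :: real) (sym_diff A C) = prod (\<lambda>_. - 1) A * prod (\<lambda>_. - 1) C"
    for A :: "'a set"
    by (rule prod_sym_diff) simp
  then have "(- 1 :: real) ^ card (sym_diff A C) = (- 1) ^ card A * (- 1) ^ card C" for A :: "'a set"
    by simp
  moreover have "(- 1 :: real) ^ card A * (- 1) ^ card A = 1" for A :: "'a set"
    by (simp flip: power_mult_distrib)
  ultimately have sgn: "(- 1 :: real) ^ card C = (- 1) ^ card A * (- 1) ^ card (sym_diff A C)" for A
    by (metis mult.assoc mult_1)
  show "cl_coeff (cl_grade (x * y)) C = cl_coeff (cl_grade x * cl_grade y) C"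
    unfolding times_clifford_def cl_grade_def clifford.sel sum_distrib_left
  proof (rule sum.cong[OF refl])
    fix A :: "'a set"
    show "(- 1) ^ card C * (cl_sign A (sym_diff A C) * cl_coeff x A * cl_coeff y (sym_diff A C)) =
        cl_sign A (sym_diff A C) * ((- 1) ^ card A * cl_coeff x A)
          * ((- 1) ^ card (sym_diff A C) * cl_coeff y (sym_diff A C))"
      unfolding sgn[of A] by (simp only: mult_ac)
  qed
qed

lemma pin_reflection:
  assumes "norm h = 1"
  shows "\<exists>A. orthogonal_matrix A \<and> (\<forall>v. cl_vec (A *v v) = - cl_vec h * cl_vec v * - cl_vec h)"
proof -
  let ?f = "\<lambda>v. v - (2 * (h \<bullet> v)) *\<^sub>R h"
  have "linear ?f"
    by (rule linearI) (auto simp: algebra_simps)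
  moreover have "?f v \<bullet> ?f w = v \<bullet> w" for v w
  proof -
    have "h \<bullet> h = 1"
      using assms by (simp add: norm_eq_1)
    then show ?thesis
      by (simp add: inner_diff_left inner_diff_right inner_commute algebra_simps)
  qed
  ultimately have ort: "orthogonal_transformation ?f"
    by (simp add: orthogonal_transformation_def)
  have "cl_vec (matrix ?f *v v) = - cl_vec h * cl_vec v * - cl_vec h" for v
  proof -
    have "cl_vec v * cl_vec h = (- 2 * (h \<bullet> v)) *\<^sub>R 1 - cl_vec h * cl_vec v"
      using cl_vec_anticommute[of h v] by (simp add: algebra_simps)
    then have "cl_vec h * (cl_vec v * cl_vec h)
        = (- 2 * (h \<bullet> v)) *\<^sub>R cl_vec h - cl_vec h * cl_vec h * cl_vec v"
      by (simp add: right_diff_distrib mult.assoc)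
    also have "\<dots> = cl_vec (?f v)"
      using assms by (simp add: cl_vec_square cl_vec_diff cl_vec_scaleR)
    finally show ?thesis
      using \<open>linear ?f\<close> by (simp add: matrix_works mult.assoc)
  qed
  then show ?thesis
    using ort by (auto simp: orthogonal_transformation_matrix)
qed

lemma pin_cover_exists:
  assumes "x \<in> carrier pin_group"
  shows "\<exists>A. orthogonal_matrix A \<and>
    (\<forall>v. cl_vec (A *v v) = cl_grade x * cl_vec v * inv\<^bsub>clifford_monoid\<^esub> x)"
proof -
  interpret U: group "units_of clifford_monoid"
    by (rule monoid.units_group[OF clifford_monoid])
  have [simp]: "inv\<^bsub>units_of clifford_monoid\<^esub> h = - h"
      "inv\<^bsub>clifford_monoid\<^esub> h = - h" "inv\<^bsub>clifford_monoid\<^esub> (- h) = h"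
    if "h = cl_vec v" "norm v = 1" for h v
  proof -
    note * = cl_vec_unit_inverse[OF that(2), folded that(1)]
    show "inv\<^bsub>clifford_monoid\<^esub> h = - h" "inv\<^bsub>clifford_monoid\<^esub> (- h) = h"
      using * by (simp_all only: clifford_inv_eq)
    moreover have "h \<in> Units clifford_monoid"
      using * clifford_Units_iff by blast
    ultimately show "inv\<^bsub>units_of clifford_monoid\<^esub> h = - h"
      by (simp add: monoid.units_of_inv[OF clifford_monoid])
  qed
  have "x \<in> generate (units_of clifford_monoid) {cl_vec v |v. norm v = 1}"
    using assms by (simp add: pin_group_def)
  then show ?thesis
  proof induction
    case one
    have "inv\<^bsub>clifford_monoid\<^esub> (1 :: 'a clifford) = 1"
      by (rule clifford_inv_eq) auto
    then show ?case
      by (intro exI[of _ "mat 1"])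
        (auto simp: orthogonal_matrix_id units_of_one clifford_monoid_def cl_grade_one)
  next
    case (incl h)
    then obtain v where v: "h = cl_vec v" "norm v = 1" by auto
    show ?case
      using pin_reflection[OF v(2)] v by (auto simp: cl_grade_cl_vec)
  next
    case (inv h)
    then obtain v where v: "h = cl_vec v" "norm v = 1" by auto
    show ?case
      using pin_reflection[OF v(2)] v by (auto simp: cl_grade_cl_vec cl_grade_uminus)
  next
    case (eng x y)
    from eng.IH obtain A B where A: "orthogonal_matrix A"
        "\<And>v. cl_vec (A *v v) = cl_grade x * cl_vec v * inv\<^bsub>clifford_monoid\<^esub> x"
      and B: "orthogonal_matrix B"
        "\<And>v. cl_vec (B *v v) = cl_grade y * cl_vec v * inv\<^bsub>clifford_monoid\<^esub> y"
      by blast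
    have units: "x \<in> Units clifford_monoid" "y \<in> Units clifford_monoid"
      using eng.hyps U.generate_in_carrier[OF cl_vec_in_Units] by (auto simp: units_of_carrier)
    have inv_xy: "inv\<^bsub>clifford_monoid\<^esub> (x * y) = inv\<^bsub>clifford_monoid\<^esub> y * inv\<^bsub>clifford_monoid\<^esub> x"
    proof -
      obtain x' y' where x': "x * x' = 1" "x' * x = 1" and y': "y * y' = 1" "y' * y = 1"
        using units clifford_Units_iff by metis
      have "x * y * (y' * x') = x * (y * y') * x'" "y' * x' * (x * y) = y' * (x' * x) * y"
        by (simp_all only: mult.assoc)
      then have "inv\<^bsub>clifford_monoid\<^esub> (x * y) = y' * x'"
        using x' y' by (intro clifford_inv_eq) simp_all
      then show ?thesis
        by (simp add: clifford_inv_eq[OF x'] clifford_inv_eq[OF y'])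
    qed
    have "cl_vec (A ** B *v v) = cl_grade (x * y) * cl_vec v * inv\<^bsub>clifford_monoid\<^esub> (x * y)" for v
      by (simp add: inv_xy A(2) B(2) cl_grade_mult mult.assoc flip: matrix_vector_mul_assoc)
    moreover have "x \<otimes>\<^bsub>units_of clifford_monoid\<^esub> y = x * y"
      by (simp add: units_of_mult clifford_monoid_def)
    ultimately show ?case
      using orthogonal_matrix_mul[OF A(1) B(1)] by auto
  qed
qed

lemma pin_cover_eqI:
  assumes "\<And>v. cl_vec (A *v v) = cl_grade x * cl_vec v * inv\<^bsub>clifford_monoid\<^esub> x"
  shows "pin_cover x = A"
  unfolding pin_cover_def
  using assms by (intro the_equality) (auto simp: matrix_eq simp flip: cl_vec_inject)

lemma pin_cover:
  assumes "x \<in> carrier pin_group"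
  shows "orthogonal_matrix (pin_cover x)"
    and "cl_vec (pin_cover x *v v) = cl_grade x * cl_vec v * inv\<^bsub>clifford_monoid\<^esub> x"
proof -
  obtain A where A: "orthogonal_matrix A"
      "\<And>v. cl_vec (A *v v) = cl_grade x * cl_vec v * inv\<^bsub>clifford_monoid\<^esub> x"
    using pin_cover_exists[OF assms] by blast
  have "pin_cover x = A"
    by (rule pin_cover_eqI) (rule A(2))
  then show "orthogonal_matrix (pin_cover x)"
      "cl_vec (pin_cover x *v v) = cl_grade x * cl_vec v * inv\<^bsub>clifford_monoid\<^esub> x"
    using A by simp_all
qed

end

theory Submission
  imports Defs
begin

text \<open>
  Identify \<open>SU(2)\<close> with the group of unit quaternions, in which two elements are conjugate iff
  they have the same real part. A finite subgroup is cyclic, binary dihedral, or generated by a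
  pair \<open>a\<close>, \<open>b\<close> of elements of maximal real part \<open>c < 1\<close> with \<open>re (a b) = 1 / 2\<close>. The distribution
  of the real parts determines the type and the order, and pairs \<open>a\<close>, \<open>b\<close> are determined up to
  simultaneous conjugation by the real parts of \<open>a\<close>, \<open>b\<close> and \<open>a b\<close>; this gives (a).

  For (b), conjugate two almost conjugate subgroups of \<open>SU(2) \<times> SU(2)\<close> so that they have the same
  projections \<open>L\<close>, \<open>R\<close> and the same kernels \<open>M\<close>, \<open>N\<close>. By Goursat they are the graphs of two
  isomorphisms from \<open>L / M\<close> to \<open>R / N\<close>, which agree if the index is at most 2. Otherwise, for
  generators \<open>a\<close>, \<open>b\<close> of \<open>L\<close>, one chooses lifts \<open>(a, y)\<close> and \<open>(b, z)\<close> in both groups; the common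
  distribution of pairs of real parts matches the real parts of \<open>y\<close>, and the types of \<open>L\<close> and \<open>R\<close>
  leave so few possibilities for \<open>z\<close> that one conjugation matches both lifts modulo \<open>N\<close>.

  For (c), two binary codes of length 6 and even weights have the same weight enumerator but are
  not equivalent. The groups of diagonal sign matrices, respectively of signed products of basis
  vectors, indexed by their words are almost conjugate. They are not conjugate, by a trace
  argument in \<open>O(6)\<close> and because only one of them is commutative in \<open>Pin(6)\<close>.
\<close>

section \<open>Quaternions\<close>

text \<open>The obstacle in (b) is that equal projections and kernels still leave an automorphism of
  \<open>R / N\<close> undetermined, and an automorphism of a quotient need not come from
  conjugation. The distribution speaks about single elements only, so it can fix the lift of one
  generator of \<open>L\<close>; the lift of the other has to be tied to it by a relation in
  \<open>L\<close>. For polyhedral \<open>L\<close> this is the braid relation, which also makes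
  \<open>b\<close> a conjugate of \<open>a\<close>; for dihedral \<open>L\<close> it is
  \<open>b * a = inverse a * b\<close>. In the hard cases what stays free is an element of order 1
  or 3, or a generator of a cyclic group of order dividing 4, in a quotient of the rotations of
  \<open>R\<close>. Either is determined up to inversion, and inversion comes from a conjugation on
  one of the two sides. The types in (a) come from the smallest angle, whose cosine is
  \<open>c\<close>: a commutator of two elements of small angle has an even smaller angle, which
  leaves only pi/3, pi/4 and pi/5 once two axes occur and \<open>c\<close> is positive. In (c) even
  weights serve twice: the products of basis vectors lie in \<open>Spin(6)\<close>, and two of them
  anticommute exactly when their index sets meet in an odd number of elements.\<close>

datatype quat = Quat (qre: real) (qi: real) (qj: real) (qk: real)

lemma quat_eq_iff: "x = y \<longleftrightarrow> qre x = qre y \<and> qi x = qi y \<and> qj x = qj y \<and> qk x = qk y"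
  by (cases x; cases y) simp

definition qnorm2 :: "quat \<Rightarrow> real" where
  "qnorm2 x = (qre x)\<^sup>2 + (qi x)\<^sup>2 + (qj x)\<^sup>2 + (qk x)\<^sup>2"

definition qcnj :: "quat \<Rightarrow> quat" where
  "qcnj x = Quat (qre x) (- qi x) (- qj x) (- qk x)"

instantiation quat :: real_div_algebra
begin

definition "0 = Quat 0 0 0 0"
definition "1 = Quat 1 0 0 0"
definition "x + y = Quat (qre x + qre y) (qi x + qi y) (qj x + qj y) (qk x + qk y)"
definition "- x = Quat (- qre x) (- qi x) (- qj x) (- qk x)"
definition "x - y = Quat (qre x - qre y) (qi x - qi y) (qj x - qj y) (qk x - qk y)"
definition "r *\<^sub>R x = Quat (r * qre x) (r * qi x) (r * qj x) (r * qk x)"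
definition "x * y = Quat
  (qre x * qre y - qi x * qi y - qj x * qj y - qk x * qk y)
  (qre x * qi y + qi x * qre y + qj x * qk y - qk x * qj y)
  (qre x * qj y - qi x * qk y + qj x * qre y + qk x * qi y)
  (qre x * qk y + qi x * qj y - qj x * qi y + qk x * qre y)"
definition "inverse x = (1 / qnorm2 x) *\<^sub>R qcnj x"
definition "x div y = x * inverse y" for x y :: quat

lemmas quat_defs = zero_quat_def one_quat_def plus_quat_def uminus_quat_def minus_quat_def
  scaleR_quat_def times_quat_def qcnj_def

instance
proof
  fix x y z :: quat and r s :: real
  show "x * y * z = x * (y * z)" "(x + y) * z = x * z + y * z" "x * (y + z) = x * y + x * z"
    by (simp_all add: quat_defs algebra_simps)
  have nz: "qnorm2 x \<noteq> 0" if "x \<noteq> 0" for x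
    using that by (auto simp: qnorm2_def zero_quat_def quat_eq_iff add_nonneg_eq_0_iff)
  have "qcnj x * x = qnorm2 x *\<^sub>R 1" "x * qcnj x = qnorm2 x *\<^sub>R 1" for x
    by (simp_all add: quat_defs qnorm2_def power2_eq_square)
  then show "inverse x * x = 1" "x * inverse x = 1" if "x \<noteq> 0"
    using nz[OF that] by (auto simp: inverse_quat_def quat_defs quat_eq_iff field_simps)
  show "inverse (0::quat) = 0"
    by (simp add: inverse_quat_def quat_defs)
qed (auto simp: quat_defs divide_quat_def algebra_simps)

end

lemma quat_sel [simp]:
  "qre 0 = 0" "qre 1 = 1" "qre (x + y) = qre x + qre y" "qre (x - y) = qre x - qre y"
  "qre (- x) = - qre x" "qre (r *\<^sub>R x) = r * qre x" "qre (qcnj x) = qre x"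
  by (simp_all add: quat_defs)

lemma qcnj_simps [simp]: "qcnj (x + y) = qcnj x + qcnj y" "qcnj (x - y) = qcnj x - qcnj y"
  "qcnj (- x) = - qcnj x" "qcnj (x * y) = qcnj y * qcnj x" "qcnj (r *\<^sub>R x) = r *\<^sub>R qcnj x"
  "qcnj (qcnj x) = x" "qcnj 0 = 0" "qcnj 1 = 1"
  by (simp_all add: quat_defs algebra_simps)

lemma mult_qcnj: "x * qcnj x = of_real (qnorm2 x)" "qcnj x * x = of_real (qnorm2 x)"
  by (simp_all add: quat_defs qnorm2_def power2_eq_square of_real_def)

lemma add_qcnj: "x + qcnj x = of_real (2 * qre x)"
  by (simp add: quat_defs of_real_def)

lemma of_real_quat_commute: "of_real r * (x::quat) = x * of_real r"
  by (simp add: of_real_def)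

lemma qre_of_real [simp]: "qre (of_real r) = r"
  by (simp add: of_real_def)

lemma qnorm2_one [simp]: "qnorm2 1 = 1" and qnorm2_zero [simp]: "qnorm2 0 = 0"
  by (simp_all add: qnorm2_def quat_defs)

lemma qnorm2_eq_0_iff [simp]: "qnorm2 x = 0 \<longleftrightarrow> x = 0"
  by (auto simp: qnorm2_def zero_quat_def quat_eq_iff add_nonneg_eq_0_iff)

lemma qnorm2_nonneg [simp]: "qnorm2 x \<ge> 0"
  by (simp add: qnorm2_def)

lemma qnorm2_mult: "qnorm2 (x * y) = qnorm2 x * qnorm2 y"
  by (simp add: qnorm2_def quat_defs power2_eq_square algebra_simps)

lemma qnorm2_uminus [simp]: "qnorm2 (- x) = qnorm2 x" and qnorm2_qcnj [simp]: "qnorm2 (qcnj x) =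
  qnorm2 x"
  by (simp_all add: qnorm2_def quat_defs)

lemma qnorm2_scaleR: "qnorm2 (r *\<^sub>R x) = r\<^sup>2 * qnorm2 x"
  by (simp add: qnorm2_def quat_defs algebra_simps power_mult_distrib)

lemma qre_mult_commute: "qre (x * y) = qre (y * x)"
  by (simp add: times_quat_def algebra_simps)

text \<open>The commutator is twice the cross product of the imaginary parts, and
  \<open>qre a * qre b - qre (a * b)\<close> is their scalar product, so this is Lagrange's
  identity.\<close>

lemma qnorm2_commutator:
  "qnorm2 (a * b - b * a) = 4 * ((qnorm2 a - (qre a)\<^sup>2) * (qnorm2 b - (qre b)\<^sup>2) - (qre a * qre b -
    qre (a * b))\<^sup>2)"
  by (simp add: qnorm2_def quat_defs power2_eq_square) algebra

abbreviation uq :: "quat set" where "uq \<equiv> {x. qnorm2 x = 1}"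

abbreviation cj :: "quat \<Rightarrow> quat \<Rightarrow> quat" where "cj g x \<equiv> g * x * inverse g"

lemma uq_inverse: "qnorm2 x = 1 \<Longrightarrow> inverse x = qcnj x"
  by (simp add: inverse_quat_def)

lemma uq_nonzero: "qnorm2 x = 1 \<Longrightarrow> x \<noteq> 0"
  by auto

lemma uq_right_inverse [simp]: "qnorm2 x = 1 \<Longrightarrow> x * inverse x = 1"
  and uq_left_inverse [simp]: "qnorm2 x = 1 \<Longrightarrow> inverse x * x = 1"
  by (auto simp: right_inverse left_inverse uq_nonzero)

lemma uq_closed [simp]: "qnorm2 x = 1 \<Longrightarrow> qnorm2 y = 1 \<Longrightarrow> qnorm2 (x * y) = 1"
  and uq_inverse_closed [simp]: "qnorm2 x = 1 \<Longrightarrow> qnorm2 (inverse x) = 1"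
  by (simp_all add: qnorm2_mult uq_inverse)

lemma uq_power [simp]: "qnorm2 x = 1 \<Longrightarrow> qnorm2 (x ^ n) = 1"
  by (induction n) auto

lemma qre_inverse [simp]: "qnorm2 x = 1 \<Longrightarrow> qre (inverse x) = qre x"
  by (simp add: uq_inverse)

lemma uq_quadratic: "qnorm2 x = 1 \<Longrightarrow> x * x = (2 * qre x) *\<^sub>R x - 1"
proof -
  assume "qnorm2 x = 1"
  have "x * x = x * (x + qcnj x) - x * qcnj x" by (simp add: algebra_simps)
  then show ?thesis using \<open>qnorm2 x = 1\<close> unfolding add_qcnj mult_qcnj by (simp add: of_real_def)
qed

lemma uq_add_inverse: "qnorm2 x = 1 \<Longrightarrow> x + inverse x = (2 * qre x) *\<^sub>R 1"
  using add_qcnj[of x] by (simp add: uq_inverse of_real_def)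

lemma inverse_cancel [simp]: "g \<noteq> 0 \<Longrightarrow> inverse g * (g * x) = x" "g \<noteq> 0 \<Longrightarrow> g * (inverse g * x) = x"
  for g x :: "'a::division_ring"
  by (simp_all add: mult.assoc[symmetric])

lemma qre_cj [simp]: "g \<noteq> 0 \<Longrightarrow> qre (cj g x) = qre x"
  by (subst qre_mult_commute) (simp add: mult.assoc[symmetric])

lemma cj_mult: "g \<noteq> 0 \<Longrightarrow> cj g (x * y) = cj g x * cj g y"
  by (simp add: mult.assoc)

lemma cj_cj: "cj g (cj h x) = cj (g * h) x" 
  by (cases "g = 0 \<or> h = 0") (auto simp: mult.assoc nonzero_inverse_mult_distrib)

lemma cj_one [simp]: "cj 1 x = x"
  by simp

lemma cj_cancel [simp]: "g \<noteq> 0 \<Longrightarrow> cj (inverse g) (cj g x) = x" "g \<noteq> 0 \<Longrightarrow> cj g (cj (inverse g) x) = x"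
  by (simp_all add: mult.assoc)

lemma cj_inverse: "g \<noteq> 0 \<Longrightarrow> cj g (inverse x) = inverse (cj g x)"
  by (cases "x = 0") (auto simp: nonzero_inverse_mult_distrib mult.assoc)

lemma cj_eq_iff: "g \<noteq> 0 \<Longrightarrow> cj g x = y \<longleftrightarrow> g * x = y * g"
proof -
  assume g: "g \<noteq> 0"
  have "cj g x = y \<Longrightarrow> g * x = y * g" using g by (auto simp: mult.assoc)
  moreover have "g * x = y * g \<Longrightarrow> cj g x = y" using g by (simp add: mult.assoc)
  ultimately show ?thesis by blast
qed

lemma qnorm2_cj [simp]: "qnorm2 g = 1 \<Longrightarrow> qnorm2 (cj g x) = qnorm2 x"
  by (simp add: qnorm2_mult)

lemma inj_cj: "g \<noteq> 0 \<Longrightarrow> inj_on (cj g) A"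
  by (rule inj_on_inverseI[of _ "cj (inverse g)"]) (rule cj_cancel)

lemma qre_uq_bound: "qnorm2 x = 1 \<Longrightarrow> \<bar>qre x\<bar> \<le> 1"
  unfolding abs_square_le_1[symmetric] qnorm2_def by (smt (verit) zero_le_power2)

lemma qre_eq_one: "qnorm2 x = 1 \<Longrightarrow> qre x = 1 \<longleftrightarrow> x = 1"
  by (auto simp: qnorm2_def quat_defs quat_eq_iff add_nonneg_eq_0_iff)

lemma qre_eq_minus_one: "qnorm2 x = 1 \<Longrightarrow> qre x = -1 \<longleftrightarrow> x = -1"
  using qre_eq_one[of "- x"] by (auto simp: minus_equation_iff)

section \<open>Conjugacy of unit quaternions and of pairs of them\<close>

lemma scale_to_uq:
  assumes "g \<noteq> 0"
  obtains g' where "qnorm2 g' = 1" "\<And>x y. g * x = y * g \<Longrightarrow> cj g' x = y" "\<And>x. cj g' x = cj g x"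
proof -
  define g' where "g' = (1 / sqrt (qnorm2 g)) *\<^sub>R g"
  have p: "qnorm2 g > 0" using assms qnorm2_nonneg[of g] by (simp add: less_le del: qnorm2_nonneg)
  have 1: "qnorm2 g' = 1" using p assms by (simp add: g'_def qnorm2_scaleR power_divide)
  have 2: "cj g' x = y" if "g * x = y * g" for x y
    using that by (subst cj_eq_iff[OF uq_nonzero[OF 1]]) (simp add: g'_def)
  have "cj g' x = cj g x" for x
    by (rule 2) (use assms in \<open>simp add: mult.assoc\<close>)
  with 1 2 show thesis by (rule that)
qed

text \<open>A nonzero intertwiner suffices, since scaling it does not change the conjugation. As
  \<open>x\<close> and \<open>y\<close> are roots of the same real quadratic,
  \<open>y * q - q * qcnj x\<close> intertwines them for every \<open>q\<close>. If all of these
  vanish, \<open>q = 1\<close> gives \<open>y = qcnj x\<close>, which then commutes with i and j and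
  so is real.\<close>

lemma conj_same_re:
  assumes "qnorm2 x = qnorm2 y" "qre x = qre y"
  shows "\<exists>g\<in>uq. cj g x = y"
proof -
  have "\<exists>g. g \<noteq> 0 \<and> g * x = y * g"
  proof (cases "\<exists>q. y * q \<noteq> q * qcnj x")
    case True
    then obtain q where q: "y * q - q * qcnj x \<noteq> 0" by auto
    have "y * y + of_real (qnorm2 x) = of_real (2 * qre x) * y"
      unfolding assms mult_qcnj(1)[of y, symmetric] add_qcnj[symmetric] 
      by (simp add: algebra_simps) (metis mult_qcnj)
    then have e: "y * y = of_real (2 * qre x) * y - of_real (qnorm2 x)" by (simp add: algebra_simps)
    have "(y * q - q * qcnj x) * x = y * q * x - of_real (qnorm2 x) * q"
      by (simp add: algebra_simps mult.assoc mult_qcnj of_real_quat_commute)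
    moreover have "y * (y * q - q * qcnj x) = (y * y) * q - y * q * qcnj x"
      by (simp add: algebra_simps)
    moreover have "\<dots> = of_real (2 * qre x) * y * q - y * q * qcnj x - of_real (qnorm2 x) * q"
      unfolding e by (simp add: algebra_simps)
    moreover have "of_real (2 * qre x) * y * q = y * q * x + y * q * qcnj x"
      unfolding distrib_left[symmetric] add_qcnj by (metis of_real_quat_commute mult.assoc)
    ultimately show ?thesis using q by (intro exI[of _ "y * q - q * qcnj x"]) simp
  next
    case False
    then have a: "y * q = q * qcnj x" for q by auto
    from a[of 1] have y: "y = qcnj x" by simp
    have "qcnj x = x"
      using a[of "Quat 0 1 0 0"] a[of "Quat 0 0 1 0"]  unfolding y
      by (simp add: quat_defs quat_eq_iff)
    then show ?thesis using y by (intro exI[of _ 1]) simp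
  qed
  then obtain g where g: "g \<noteq> 0" "g * x = y * g" by blast
  obtain h where h: "qnorm2 h = 1" "\<And>x y. g * x = y * g \<Longrightarrow> cj h x = y"
    by (rule scale_to_uq[OF g(1)]) blast
  then show ?thesis using h(2)[OF g(2)] by blast
qed

lemma pure_mult_self: "qre u = 0 \<Longrightarrow> u * u = - of_real (qnorm2 u)"
  by (simp add: qnorm2_def quat_defs of_real_def power2_eq_square)

lemma pure_anticommute: "qre u = 0 \<Longrightarrow> qre v = 0 \<Longrightarrow> u * v + v * u = of_real (2 * qre (u * v))"
  by (simp add: quat_defs of_real_def)

text \<open>By the double cross product formula (\<open>rec\<close>), \<open>w\<close> is recovered
  from \<open>u\<close>, \<open>qre (u * w)\<close> and the commutator \<open>m\<close>. So it
  suffices to move \<open>m\<close> to \<open>m'\<close> by an element commuting with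
  \<open>u\<close>. Both anticommute with \<open>u\<close>, hence
  \<open>of_real (qnorm2 m) - m' * m\<close> does this; it vanishes only for
  \<open>m' = - m\<close>, and then the half turn \<open>u\<close> works.\<close>

lemma conj_pair_pure:
  assumes u: "qre u = 0" and w: "qre w = 0" "qre w' = 0" "qnorm2 w' = qnorm2 w" "qre (u * w') = qre
    (u * w)"
  shows "\<exists>g\<in>uq. cj g u = u \<and> cj g w = w'"
proof (cases "u = 0")
  case True
  then show ?thesis using conj_same_re[of w w'] w by auto
next
  case False
  define m where "m = u * w - w * u"
  define m' where "m' = u * w' - w' * u"
  have um: "u * m = - (m * u)" "u * m' = - (m' * u)" if "qre u = 0"
    using pure_mult_self[OF u] by (simp_all add: m_def m'_def algebra_simps) (simp_all add:
      mult.assoc[symmetric] of_real_quat_commute)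
  have nm: "qnorm2 m' = qnorm2 m" unfolding m_def m'_def qnorm2_commutator using w u by simp
  have pm: "qre m = 0" "qre m' = 0" by (simp_all add: m_def m'_def qre_mult_commute)
  have rec: "v = v'" if "u * (u * v - v * u) = u * (u * v' - v' * u)" "qre v = 0" "qre v' = 0" "qre
    (u * v) = qre (u * v')" for v v'
  proof -
    have 1: "u * (u * v - v * u) = of_real (- 2 * qnorm2 u) * v - of_real (2 * qre (u * v)) * u"
      if "qre v = 0" for v
    proof -
      have "v * u = of_real (2 * qre (u * v)) - u * v"
        using pure_anticommute[OF u that] by (simp add: algebra_simps)
      then have "u * (u * v - v * u) = (u * u) * v + (u * u) * v - u * of_real (2 * qre (u * v))"
        by (simp add: right_diff_distrib mult.assoc)
      then have "u * (u * v - v * u) = - (qnorm2 u *\<^sub>R v) - qnorm2 u *\<^sub>R v - (2 * qre (u * v)) *\<^sub>R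
        u"
        unfolding pure_mult_self[OF u] of_real_quat_commute[symmetric] by (simp add: of_real_def)
      moreover have "(- 2 * qnorm2 u) *\<^sub>R v = - (qnorm2 u *\<^sub>R v) - qnorm2 u *\<^sub>R v"
        by (simp add: quat_defs)
      ultimately show ?thesis by (simp add: of_real_def)
    qed
    have "of_real (- 2 * qnorm2 u) * v = of_real (- 2 * qnorm2 u) * v'"
      using that 1[of v] 1[of v'] by simp
    then show "v = v'" using False by simp
  qed
  have "\<exists>g. g \<noteq> 0 \<and> g * u = u * g \<and> g * m = m' * g"
  proof (cases "m' = - m")
    case True
    then show ?thesis using False um[OF u] by (intro exI[of _ u]) simp
  next
    case F: False
    let ?g = "of_real (qnorm2 m) - m' * m"
    have "?g \<noteq> 0"
    proof
      assume "?g = 0"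
      then have "of_real (qnorm2 m) * m = m' * (m * m)" by (simp add: mult.assoc[symmetric])
      then have "of_real (qnorm2 m) * m = of_real (qnorm2 m) * (- m')"
        using pure_mult_self[OF pm(1)] by (simp add: of_real_quat_commute)
      then have "m = 0 \<or> m = - m'" by (auto simp: mult_cancel_left simp del: mult_minus_right)
      then show False using F nm by auto
    qed
    moreover have "m' * m * u = u * (m' * m)"
      using um[OF u] by (metis mult.assoc minus_mult_left minus_mult_right minus_minus)
    then have "?g * u = u * ?g" by (simp add: algebra_simps of_real_quat_commute)
    moreover have "?g * m = m' * ?g"
    proof -
      have "?g * m = of_real (qnorm2 m) * m - m' * (m * m)" by (simp add: algebra_simps)
      also have "\<dots> = of_real (qnorm2 m) * m + of_real (qnorm2 m) * m'" 
        unfolding pure_mult_self[OF pm(1)] by (simp add: of_real_quat_commute)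
      also have "\<dots> = m' * of_real (qnorm2 m) - (m' * m') * m"
        unfolding pure_mult_self[OF pm(2)] nm by (simp add: of_real_quat_commute)
      finally show ?thesis by (simp add: algebra_simps)
    qed
    ultimately show ?thesis by blast
  qed
  then obtain g where g: "g \<noteq> 0" "g * u = u * g" "g * m = m' * g" by blast
  obtain h where h: "qnorm2 h = 1" "\<And>x y. g * x = y * g \<Longrightarrow> cj h x = y"
    by (rule scale_to_uq[OF g(1)]) blast
  note h = h(1) h(2)[OF g(2)] h(2)[OF g(3)]
  have h0: "h \<noteq> 0" using h by auto
  have "u * cj h w - cj h w * u = cj h u * cj h w - cj h w * cj h u"
    unfolding h(2) ..
  also have "\<dots> = cj h m"
    unfolding cj_mult[OF h0, symmetric] m_def by (simp only: right_diff_distrib left_diff_distrib)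
  finally have e: "u * cj h w - cj h w * u = u * w' - w' * u"
    unfolding h(3) m'_def .
  have "qre (u * cj h w) = qre (cj h (u * w))"
    unfolding cj_mult[OF h0] h(2) ..
  then have "qre (u * cj h w) = qre (u * w')"
    unfolding qre_cj[OF h0] w(4) .
  moreover have "qre (cj h w) = 0" unfolding qre_cj[OF h0] by (rule w)
  moreover have "u * (u * cj h w - cj h w * u) = u * (u * w' - w' * u)" by (simp only: e)
  ultimately have "cj h w = w'" using w(2) by (metis rec)
  then show ?thesis using h(1,2) by (intro bexI[of _ h]) simp_all
qed

text \<open>The real parts of \<open>a\<close>, \<open>b\<close> and \<open>a * b\<close> encode the
  lengths and the scalar product of the imaginary parts, so this is the transitivity of the
  rotations of three-space on pairs of vectors with a given Gram matrix.\<close>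

lemma conj_pair:
  assumes "qnorm2 a = 1" "qnorm2 b = 1" "qnorm2 a' = 1" "qnorm2 b' = 1"
    and "qre a = qre a'" "qre b = qre b'" "qre (a * b) = qre (a' * b')"
  shows "\<exists>g\<in>uq. cj g a = a' \<and> cj g b = b'"
proof -
  obtain g where g: "qnorm2 g = 1" "cj g a = a'" using conj_same_re[of a a'] assms by auto
  have g0: "g \<noteq> 0" using g by auto
  define b1 where "b1 = cj g b"
  have b1: "qnorm2 b1 = 1" "qre b1 = qre b'" "qre (a' * b1) = qre (a' * b')"
  proof -
    show "qnorm2 b1 = 1" "qre b1 = qre b'"
      using assms g unfolding b1_def by (simp_all only: qnorm2_cj qre_cj[OF g0])
    show "qre (a' * b1) = qre (a' * b')"
      unfolding b1_def g(2)[symmetric] cj_mult[OF g0, symmetric] qre_cj[OF g0]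
      unfolding g(2) by (rule assms)
  qed
  let ?im = "\<lambda>x. x - of_real (qre x)"
  have nim: "qnorm2 (?im x) = qnorm2 x - (qre x)\<^sup>2" for x
    by (simp add: qnorm2_def of_real_def quat_defs)
  have pim: "qre (?im x * ?im y) = qre (x * y) - qre x * qre y" for x y
    by (simp add: of_real_def quat_defs)
  have "qnorm2 (?im b') = qnorm2 (?im b1)" "qre (?im a' * ?im b') = qre (?im a' * ?im b1)"
    unfolding nim pim by (simp_all add: b1 assms)
  then obtain h where h: "qnorm2 h = 1" "cj h (?im a') = ?im a'" "cj h (?im b1) = ?im b'"
    using conj_pair_pure[of "?im a'" "?im b1" "?im b'"] by auto
  have h0: "h \<noteq> 0" using h by auto
  have im: "cj h (?im x) = cj h x - of_real (qre x)" for x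
  proof -
    have "cj h (?im x) = cj h x - of_real (qre x) * (h * inverse h)"
      by (simp only: right_diff_distrib left_diff_distrib mult.assoc of_real_quat_commute)
    then show ?thesis using h0 by simp
  qed
  have "cj h a' = a'" "cj h b1 = b'" using h(2,3) b1(2) unfolding im by simp_all
  then have "cj (h * g) a = a'" "cj (h * g) b = b'"
    unfolding cj_cj[symmetric] g(2) b1_def by simp_all
  then show ?thesis
    using g h by (intro bexI[of _ "h * g"]) auto
qed

text \<open>Both are roots of the real quadratic with roots \<open>x\<close> and
  \<open>inverse x\<close>, and its factorisation survives evaluation at an element commuting with
  \<open>x\<close>.\<close>

lemma commuting_same_re:
  assumes "qnorm2 x = 1" "qnorm2 y = 1" "x * y = y * x" "qre x = qre y"
  shows "y = x \<or> y = inverse x"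
proof -
  have "(y - x) * (y - inverse x) = y * y - y * (x + inverse x) + (y * x - x * y) + (y * inverse x -
    y * inverse x) + (x * inverse x) 
     + (x * y - y * x)"
    using assms(3) by (simp add: algebra_simps)
  also have "\<dots> = 0"
    using assms uq_quadratic[of y] by (simp add: uq_add_inverse)
  finally show ?thesis by simp
qed

lemma braid_formula:
  assumes "qnorm2 a = 1" "qnorm2 b = 1"
  shows "a * b * a = (2 * qre (a * b)) *\<^sub>R a - inverse b"
proof -
  have "b * a + inverse (b * a) = (2 * qre (a * b)) *\<^sub>R 1"
    using uq_add_inverse[of "b * a"] assms by (simp add: qre_mult_commute)
  then have "a * (b * a + inverse a * inverse b) = (2 * qre (a * b)) *\<^sub>R a"
    using assms by (simp add: nonzero_inverse_mult_distrib uq_nonzero)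
  then have "a * b * a + inverse b = (2 * qre (a * b)) *\<^sub>R a"
    using assms by (simp add: distrib_left uq_nonzero mult.assoc)
  then show ?thesis by (simp add: eq_diff_eq)
qed

text \<open>The difference of the two sides is \<open>2 * qre (a * b) - 1\<close> times
  \<open>a - b\<close>. This is the origin of the value 1/2 for the generators of the polyhedral
  groups.\<close>

lemma braid_iff:
  assumes "qnorm2 a = 1" "qnorm2 b = 1" "qre a = qre b"
  shows "a * b * a = b * a * b \<longleftrightarrow> a = b \<or> qre (a * b) = 1 / 2"
proof -
  have "a * b * a - b * a * b = (2 * qre (a * b)) *\<^sub>R (a - b) - (inverse b - inverse a)"
    unfolding braid_formula[OF assms(1,2)] braid_formula[OF assms(2,1)] qre_mult_commute[of b a]
    by (simp add: algebra_simps)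
  also have "inverse b - inverse a = a - b"
  proof -
    have "inverse x = (2 * qre b) *\<^sub>R 1 - x" if "x = a \<or> x = b" for x
      using uq_add_inverse[of x] assms that by (auto simp: eq_diff_eq add.commute)
    then show ?thesis by simp
  qed
  finally have "a * b * a - b * a * b = (2 * qre (a * b) - 1) *\<^sub>R (a - b)"
    by (simp add: scaleR_left_diff_distrib)
  then have "a * b * a - b * a * b = 0 \<longleftrightarrow> a = b \<or> qre (a * b) = 1 / 2" by auto
  then show ?thesis by simp
qed

text \<open>This is how lifts are transported later: a lift of \<open>a\<close>, conjugated by a
  lift of \<open>a * b\<close>, is a lift of \<open>b\<close>.\<close>

lemma braid_conj:
  assumes "qnorm2 a = 1" "qnorm2 b = 1" "a * b * a = b * a * b"
  shows "cj (a * b) a = b"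
proof -
  have "a * b \<noteq> 0" using assms(1,2) by auto
  moreover have "a * b * a = b * (a * b)" unfolding assms(3) by (simp only: mult.assoc)
  ultimately show ?thesis by (subst cj_eq_iff)
qed

section \<open>Finite subgroups of the unit quaternions\<close>

text \<open>In a finite set of units closed under multiplication the inverses are positive powers,
  so that a finite submonoid of \<open>uq\<close> is a subgroup.\<close>

definition fin_subgroup :: "quat set \<Rightarrow> bool" where
  "fin_subgroup F \<longleftrightarrow> finite F \<and> 1 \<in> F \<and> F \<subseteq> uq \<and> (\<forall>x\<in>F. \<forall>y\<in>F. x * y \<in> F)"

lemma fin_subgroupD:
  assumes "fin_subgroup F"
  shows "finite F" "1 \<in> F" "x \<in> F \<Longrightarrow> qnorm2 x = 1" "x \<in> F \<Longrightarrow> y \<in> F \<Longrightarrow> x * y \<in> F"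
  using assms unfolding fin_subgroup_def by blast+

lemma fin_subgroup_power:
  assumes "fin_subgroup F" "x \<in> F" shows "x ^ n \<in> F"
  using assms(2) by (induction n) (simp_all add: fin_subgroupD(2,4)[OF assms(1)])

lemma fin_subgroup_inverse:
  assumes F: "fin_subgroup F" and x: "x \<in> F" shows "inverse x \<in> F"
proof -
  have "\<not> inj_on (\<lambda>n. x ^ n) (UNIV :: nat set)"
    using fin_subgroupD(1)[OF F] fin_subgroup_power[OF F x] finite_imageD infinite_UNIV_nat
    by (metis finite_subset image_subsetI)
  then obtain i j :: nat where "i < j" "x ^ i = x ^ j"
    unfolding inj_on_def by (metis linorder_neqE_nat)
  then have "x ^ i * 1 = x ^ i * (x * x ^ (j - i - 1))"
    by (metis power_Suc power_add Suc_pred' add_diff_inverse_nat less_imp_le_nat mult.right_neutral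
        not_less zero_less_diff diff_diff_add plus_1_eq_Suc add.commute)
  moreover have "x \<noteq> 0" using fin_subgroupD(3)[OF F x] by auto
  ultimately have "x * x ^ (j - i - 1) = 1" by simp
  then have "inverse x = x ^ (j - i - 1)" using inverse_unique by blast
  then show ?thesis using fin_subgroup_power[OF F x] by simp
qed

lemma fin_subgroup_cj:
  assumes F: "fin_subgroup F" and "x \<in> F" "y \<in> F" shows "cj x y \<in> F"
  by (intro fin_subgroupD(4)[OF F] fin_subgroup_inverse[OF F] assms(2,3))

section \<open>Commutative subgroups and their smallest angle\<close>

lemma noncentral_bound:
  assumes "qnorm2 x = 1" "x \<noteq> 1" "x \<noteq> - 1" shows "qre x < 1" "- 1 < qre x" "(qre x)\<^sup>2 < 1"
proof -
  show 1: "qre x < 1" "- 1 < qre x"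
    using qre_uq_bound[of x] qre_eq_one[of x] qre_eq_minus_one[of x] assms
      by (auto simp: abs_le_iff less_le)
  then show "(qre x)\<^sup>2 < 1" by (simp add: abs_square_less_1)
qed

text \<open>For an imaginary unit \<open>u\<close> this is the exponential of \<open>t\<close> times
  \<open>u\<close>; it parametrises the centralizer of \<open>u\<close> in the unit
  quaternions.\<close>

definition cisq :: "quat \<Rightarrow> real \<Rightarrow> quat" where
  "cisq u t = cos t *\<^sub>R 1 + sin t *\<^sub>R u"

lemma cisq_add: "u * u = - 1 \<Longrightarrow> cisq u (s + t) = cisq u s * cisq u t"
  by (simp add: cisq_def cos_add sin_add algebra_simps)

lemma cisq_0 [simp]: "cisq u 0 = 1"
  by (simp add: cisq_def)

lemma cisq_mult_nat: "u * u = - 1 \<Longrightarrow> cisq u (real k * t) = cisq u t ^ k"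
  by (induction k) (auto simp: distrib_right cisq_add)

lemma qre_cisq [simp]: "qre u = 0 \<Longrightarrow> qre (cisq u t) = cos t"
  by (simp add: cisq_def)

lemma axis_exists:
  assumes "qnorm2 a = 1" "a \<noteq> 1" "a \<noteq> - 1"
  obtains u s where "qre u = 0" "qnorm2 u = 1" "u * u = - 1" "a = qre a *\<^sub>R 1 + s *\<^sub>R u" "s > 0"
    "s\<^sup>2 = 1 - (qre a)\<^sup>2"
proof -
  define s where "s = sqrt (1 - (qre a)\<^sup>2)"
  have s: "s > 0" "s\<^sup>2 = 1 - (qre a)\<^sup>2" using noncentral_bound[OF assms] by (simp_all add: s_def)
  define u where "u = (1 / s) *\<^sub>R (a - qre a *\<^sub>R 1)"
  have u0: "qre u = 0" by (simp add: u_def)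
  have "qnorm2 (a - qre a *\<^sub>R 1) = qnorm2 a - (qre a)\<^sup>2" by (simp add: qnorm2_def quat_defs)
  then have "qnorm2 u = 1" using s noncentral_bound(3)[OF assms] assms(1)
    by (simp add: u_def qnorm2_scaleR power_divide)
  moreover from this have "u * u = - 1" using pure_mult_self[OF u0] by simp
  moreover have "a = qre a *\<^sub>R 1 + s *\<^sub>R u" using s(1) by (simp add: u_def)
  ultimately show thesis using that u0 s by blast
qed

lemma commute_axis:
  assumes u: "qre u = 0" "u * u = - 1" and x: "x * u = u * x"
  shows "\<exists>r. x = qre x *\<^sub>R 1 + r *\<^sub>R u"
proof -
  let ?v = "x - qre x *\<^sub>R 1"
  have "u * ?v = ?v * u" using x by (simp add: algebra_simps)
  then have "2 *\<^sub>R (u * ?v) = of_real (2 * qre (u * ?v))"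
    using pure_anticommute[OF u(1), of ?v] by (simp add: scaleR_2)
  then have e: "u * ?v = qre (u * ?v) *\<^sub>R 1"
    unfolding of_real_def by (metis scaleR_scaleR scaleR_cancel_left zero_neq_numeral)
  have "- ?v = u * (u * ?v)" using u(2) by (simp add: mult.assoc[symmetric])
  also have "\<dots> = qre (u * ?v) *\<^sub>R u" by (subst e) simp
  finally have "x = qre x *\<^sub>R 1 + (- qre (u * ?v)) *\<^sub>R u" by (simp add: algebra_simps)
  then show ?thesis by blast
qed

lemma axis_commute_iff:
  assumes "a = r *\<^sub>R 1 + s *\<^sub>R u" "s \<noteq> (0::real)"
  shows "x * a = a * x \<longleftrightarrow> x * u = u * (x::quat)"
  using assms(2) unfolding assms(1) by (simp add: distrib_left distrib_right)

text \<open>The centralizer of a noncentral element is the plane spanned by 1 and its axis, which is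
  commutative.\<close>

lemma commute_trans:
  assumes "qnorm2 x = 1" "x \<noteq> 1" "x \<noteq> - 1" "y * x = x * y" "z * x = x * z"
  shows "y * z = z * y"
proof -
  obtain u s where u: "qre u = 0" "u * u = - 1" "x = qre x *\<^sub>R 1 + s *\<^sub>R u" "s > 0"
    using axis_exists[OF assms(1-3)] by metis
  have "y * u = u * y" "z * u = u * z"
    using assms(4,5) axis_commute_iff[OF u(3), of y] axis_commute_iff[OF u(3), of z] u(4) by auto
  then obtain r t where r: "y = qre y *\<^sub>R 1 + r *\<^sub>R u" "z = qre z *\<^sub>R 1 + t *\<^sub>R u"
    using commute_axis[OF u(1,2)] by blast
  show ?thesis by (subst (1 2) r(1), subst (1 2) r(2)) (simp add: algebra_simps)
qed

text \<open>An element of largest real part has the smallest angle \<open>\<theta>\<close>. Division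
  with remainder by \<open>\<theta>\<close> turns any element into one of angle in the interval from
  0 to \<open>\<theta>\<close>, the right end excluded, and by maximality this is 1. Applied to -1,
  of angle pi, the division shows that \<open>\<theta>\<close> is pi/n.\<close>

lemma cyclic_angle:
  assumes A: "fin_subgroup A" and comm: "\<And>x y. x \<in> A \<Longrightarrow> y \<in> A \<Longrightarrow> x * y = y * x"
    and a: "a \<in> A" "a \<noteq> 1" and max: "\<And>x. x \<in> A \<Longrightarrow> x \<noteq> 1 \<Longrightarrow> qre x \<le> qre a"
  shows "(\<forall>x\<in>A. \<exists>k. x = a ^ k) \<and> (- 1 \<in> A \<longrightarrow> (\<exists>n>0. qre a = cos (pi / real n)))"
proof (cases "a = - 1")
  case True
  then have "x = 1 \<or> x = - 1" if "x \<in> A" for x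
    using max[OF that] noncentral_bound(2)[OF fin_subgroupD(3)[OF A that]] by fastforce
  then have "\<exists>k. x = a ^ k" if "x \<in> A" for x
    using True that by (metis power_0 power_one_right)
  moreover have "qre a = cos (pi / real 1)" using True by simp
  ultimately show ?thesis by (metis zero_less_one)
next
  case False
  obtain u s where u: "qre u = 0" "u * u = - 1" "a = qre a *\<^sub>R 1 + s *\<^sub>R u" "s > 0" "s\<^sup>2 = 1 - (qre
    a)\<^sup>2" "qnorm2 u = 1"
    using axis_exists[OF fin_subgroupD(3)[OF A a(1)] a(2) False] by metis
  define \<theta> where "\<theta> = arccos (qre a)"
  have b: "- 1 < qre a" "qre a < 1"
    using noncentral_bound[OF fin_subgroupD(3)[OF A a(1)] a(2) False] by auto
  have th: "0 < \<theta>" "\<theta> < pi" "cos \<theta> = qre a"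
    using b arccos_lt_bounded[of "qre a"] by (auto simp: \<theta>_def)
  have "sin \<theta> = s" using u(4,5) b by (simp add: \<theta>_def sin_arccos flip: u(5))
  then have ath: "a = cisq u \<theta>" using u(3) th by (simp add: cisq_def)
  have step: "\<exists>k. t = real k * \<theta>" if t: "t \<ge> 0" "cisq u t \<in> A" for t
  proof -
    define k where "k = nat \<lfloor>t / \<theta>\<rfloor>"
    define d where "d = t - real k * \<theta>"
    have k: "real k = of_int \<lfloor>t / \<theta>\<rfloor>" using t th by (simp add: k_def)
    have d: "0 \<le> d" "d < \<theta>"
      using th floor_divide_lower[of \<theta> t] floor_divide_upper[of \<theta> t]
        by (simp_all add: d_def k algebra_simps)
    have "cisq u t = cisq u d * a ^ k"
      unfolding ath cisq_mult_nat[OF u(2), symmetric] cisq_add[OF u(2), symmetric]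
        by (simp add: d_def)
    then have "cisq u d = cisq u t * inverse (a ^ k)"
      using fin_subgroupD(3)[OF A fin_subgroup_power[OF A a(1)], of k] by (simp add: mult.assoc)
    then have dA: "cisq u d \<in> A"
      using t fin_subgroup_inverse[OF A fin_subgroup_power[OF A a(1)]] fin_subgroupD(4)[OF A]
        by auto
    have "d = 0"
    proof (rule ccontr)
      assume "d \<noteq> 0"
      then have "cos \<theta> < cos d" "cos d < cos 0"
        using cos_monotone_0_pi[of d \<theta>] cos_monotone_0_pi[of 0 d] d th(1,2) by simp_all
      then show False
        using max[OF dA] th(3) qre_cisq[OF u(1), of d] by (cases "cisq u d = 1") auto
    qed
    then show ?thesis by (auto simp: d_def)
  qed
  have polar: "\<exists>t\<ge>0. x = cisq u t" if x: "x \<in> A" for x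
  proof -
    have "x * u = u * x" using comm[OF x a(1)] axis_commute_iff[OF u(3), of x] u(4) by simp
    then obtain r where r: "x = qre x *\<^sub>R 1 + r *\<^sub>R u" using commute_axis[OF u(1,2)] by blast
    have "qnorm2 (p *\<^sub>R 1 + q *\<^sub>R u) = p\<^sup>2 + q\<^sup>2 * qnorm2 u" for p q
      using u(1) by (simp add: qnorm2_def quat_defs power_mult_distrib algebra_simps)
    then have "(qre x)\<^sup>2 + r\<^sup>2 = 1"
      using fin_subgroupD(3)[OF A x] r u(6) by (metis mult.right_neutral)
    then obtain t where "0 \<le> t" "qre x = cos t" "r = sin t" using sincos_total_2pi by metis
    then show ?thesis using r by (auto simp: cisq_def)
  qed
  have "\<exists>k. x = a ^ k" if "x \<in> A" for x
    using polar[OF that] step that unfolding ath by (metis cisq_mult_nat[OF u(2)])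
  moreover have "\<exists>n>0. qre a = cos (pi / real n)" if m1: "- 1 \<in> A"
  proof -
    have "cisq u pi = - 1" by (simp add: cisq_def)
    then obtain k where k: "pi = real k * \<theta>" using step[of pi] m1 by auto
    then have "k > 0" using pi_gt_zero by (cases k) auto
    then show ?thesis using th(3) by (intro exI[of _ k]) (simp add: k)
  qed
  ultimately show ?thesis by blast
qed

lemma fin_subgroup_centralizer: "fin_subgroup F \<Longrightarrow> fin_subgroup {y \<in> F. y * x = x * y}"
proof -
  have "y * z * x = x * (y * z)" if "y * x = x * y" "z * x = x * z" for y z
    unfolding mult.assoc that(2) unfolding mult.assoc[symmetric] that(1) ..
  then show "fin_subgroup F \<Longrightarrow> ?thesis" unfolding fin_subgroup_def by auto
qed

lemma fin_subgroup_Max: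
  assumes "fin_subgroup F" "b \<in> F" "P b"
  obtains a where "a \<in> F" "P a" "\<And>y. y \<in> F \<Longrightarrow> P y \<Longrightarrow> qre y \<le> qre a"
proof -
  have fin: "finite (qre ` {y \<in> F. P y})" using fin_subgroupD(1)[OF assms(1)] by simp
  then have "Max (qre ` {y \<in> F. P y}) \<in> qre ` {y \<in> F. P y}" using assms by (intro Max_in) auto
  then obtain a where a: "a \<in> F" "P a" "qre a = Max (qre ` {y \<in> F. P y})" by auto
  show thesis using a(1,2) Max_ge[OF fin] unfolding a(3)[symmetric] by (auto intro: that)
qed

text \<open>The centralizer of \<open>x\<close> is commutative by \<open>commute_trans\<close>, so
  \<open>cyclic_angle\<close> applies to it.\<close>

lemma maximal_cyclic:
  assumes F: "fin_subgroup F" "- 1 \<in> F" and x: "x \<in> F" "x \<noteq> 1" "x \<noteq> - 1"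
  obtains a n k where "a \<in> F" "a \<noteq> 1" "a \<noteq> - 1" "n > 0" "qre a = cos (pi / real n)" "x = a ^ k"
    "\<And>y. y \<in> F \<Longrightarrow> y * x = x * y \<Longrightarrow> \<exists>k. y = a ^ k"
    "\<And>y. y \<in> F \<Longrightarrow> y * x = x * y \<Longrightarrow> y \<noteq> 1 \<Longrightarrow> qre y \<le> qre a" "a * x = x * a"
proof -
  let ?A = "{y \<in> F. y * x = x * y}"
  have A: "fin_subgroup ?A" by (rule fin_subgroup_centralizer[OF F(1)])
  obtain a where a: "a \<in> ?A" "a \<noteq> 1" "\<And>y. y \<in> ?A \<Longrightarrow> y \<noteq> 1 \<Longrightarrow> qre y \<le> qre a"
    using fin_subgroup_Max[OF A, of x "\<lambda>x. x \<noteq> 1"] x by auto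
  have "a \<noteq> - 1"
    using a(3)[of x] x noncentral_bound[OF fin_subgroupD(3)[OF F(1) x(1)] x(2,3)] by auto
  have comm: "y * z = z * y" if "y \<in> ?A" "z \<in> ?A" for y z
    using commute_trans[OF fin_subgroupD(3)[OF F(1) x(1)] x(2,3)] that by auto
  have 1: "\<And>y. y \<in> ?A \<Longrightarrow> \<exists>k. y = a ^ k" "\<exists>n>0. qre a = cos (pi / real n)"
    using cyclic_angle[OF A comm a(1,2,3)] F(2) by auto
  obtain n k where "n > 0" "qre a = cos (pi / real n)" "x = a ^ k"
    using 1(2) 1(1)[of x] x by auto
  moreover have "a \<in> F" "a * x = x * a" using a(1) by auto
  ultimately show thesis
    using 1(1) a(2,3) \<open>a \<noteq> - 1\<close> by (intro that[of a n k]) auto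
qed

text \<open>Three times pi/5 is pi minus twice pi/5. The formulas for double and triple angles turn
  this into a cubic equation, which splits off the root -1.\<close>

lemma cos_pi_5: "cos (pi / 5) = (1 + sqrt 5) / 4"
proof -
  define c where "c = cos (pi / 5)"
  have "cos (3 * (pi / 5)) = - cos (2 * (pi / 5))"
    by (subst cos_minus_pi[symmetric]) (simp add: field_simps)
  then have "4 * c ^ 3 - 3 * c = - (2 * c\<^sup>2 - 1)"
    unfolding c_def cos_double_cos cos_treble_cos .
  then have "(c + 1) * ((4 * c - 1)\<^sup>2 - 5) = 0"
    by algebra
  moreover have c: "c > 0" unfolding c_def by (rule cos_gt_zero_pi) (auto intro: less_trans[of _ 0])
  moreover have "c > 1 / 2"
    unfolding c_def cos_60[symmetric] by (intro cos_monotone_0_pi) auto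
  ultimately have "(4 * c - 1)\<^sup>2 = 5" by auto
  then have "4 * c - 1 = sqrt 5" using \<open>c > 1 / 2\<close> by (simp add: real_sqrt_unique)
  then show ?thesis by (simp add: c_def)
qed

text \<open>The cosines of \<open>\<pi> / 3\<close>, \<open>\<pi> / 4\<close> and \<open>\<pi> / 5\<close>.\<close>

abbreviation (input) "c3 \<equiv> 1 / 2 :: real"
abbreviation (input) "c4 \<equiv> sqrt 2 / 2 :: real"
abbreviation (input) "c5 \<equiv> (1 + sqrt 5) / 4 :: real"

section \<open>Real parts of powers and pairs of elements of smallest angle\<close>

lemma qre_power_Suc_Suc:
  assumes "qnorm2 a = 1" shows "qre (a ^ Suc (Suc k)) = 2 * qre a * qre (a ^ Suc k) - qre (a ^ k)"
proof -
  have "a ^ Suc (Suc k) = (2 * qre a) *\<^sub>R (a * a ^ k) - a ^ k"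
    using uq_quadratic[OF assms] by (simp add: mult.assoc[symmetric] left_diff_distrib)
  then show ?thesis by simp
qed

text \<open>Consecutive real parts obey the Chebyshev recurrence, so they are confined to any set of
  pairs that contains the first pair and is stable under the recurrence.\<close>

lemma qre_power_invariant:
  assumes a: "qnorm2 a = 1" and V: "(1, qre a) \<in> V" "\<forall>v\<in>V. (snd v, 2 * qre a * snd v - fst v) \<in> V"
  shows "qre (a ^ k) \<in> fst ` V"
proof -
  have "(qre (a ^ k), qre (a ^ Suc k)) \<in> V"
  proof (induction k)
    case 0 then show ?case using V(1) by simp
  next
    case (Suc k) then show ?case using bspec[OF V(2) Suc.IH] qre_power_Suc_Suc[OF a, of k] by simp
  qed
  then show ?thesis by force
qed

text \<open>Each set of pairs is the orbit of the first pair. For pi/4 and pi/5 the computation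
  rests on the quadratic equation of the cosine \<open>r\<close>, namely
  \<open>2 * r * r = 1\<close> and \<open>2 * r * r = r + c3\<close>.\<close>

lemma qre_power_values:
  assumes a: "qnorm2 a = 1" and k: "x = a ^ k"
  shows "qre a = 0 \<Longrightarrow> qre x \<in> {0, 1, - 1}"
    "qre a = c3 \<Longrightarrow> qre x \<in> {1, - 1, c3, - c3}"
    "qre a = c4 \<Longrightarrow> qre x \<in> {0, 1, - 1, c4, - c4}"
    "qre a = c5 \<Longrightarrow> qre x \<in> {1, - 1, c5, - c5, c5 - c3, c3 - c5}"
proof -
  note inv = qre_power_invariant[OF a, of _ k, folded k]
  show "qre a = 0 \<Longrightarrow> qre x \<in> {0, 1, - 1}"
    using inv[of "{(1, 0), (0, - 1), (- 1, 0), (0, 1)}"] by auto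
  show "qre a = c3 \<Longrightarrow> qre x \<in> {1, - 1, c3, - c3}"
    using inv[of "{(1, c3), (c3, - c3), (- c3, - 1), (- 1, - c3), (- c3, c3), (c3, 1)}"] by auto
  have "qre x \<in> {0, 1, - 1, r, - r}" if r: "qre a = r" "2 * r * r = 1" for r
    using inv[of "{(1, r), (r, 0), (0, - r), (- r, - 1), (- 1, - r), (- r, 0), (0, r), (r, 1)}"]
    by (simp add: r(1)) (use r(2) in auto)
  from this[of c4] show "qre a = c4 \<Longrightarrow> qre x \<in> {0, 1, - 1, c4, - c4}" by simp
  have "qre x \<in> {1, - 1, r, - r, r - c3, c3 - r}" if r: "qre a = r" "2 * r * r = r + c3" for r
    using inv[of "{(1, r), (r, r - c3), (r - c3, c3 - r), (c3 - r, - r), (- r, - 1), (- 1, - r),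
      (- r, c3 - r), (c3 - r, r - c3), (r - c3, r), (r, 1)}"]
    by (simp add: r(1)) (use r(2) in \<open>auto simp: algebra_simps\<close>)
  from this[of c5] show "qre a = c5 \<Longrightarrow> qre x \<in> {1, - 1, c5, - c5, c5 - c3, c3 - c5}"
    by (simp add: field_simps)
qed

lemma qnorm2_diff_unit:
  assumes "qnorm2 x = 1" "qnorm2 y = 1" shows "qnorm2 (x - y) = 2 - 2 * qre (x * inverse y)"
proof -
  have 1: "qnorm2 (z - 1) = qnorm2 z + 1 - 2 * qre z" for z
    by (simp add: qnorm2_def quat_defs power2_eq_square algebra_simps)
  have "x - y = (x * inverse y - 1) * y" using assms by (simp add: left_diff_distrib mult.assoc)
  then have "qnorm2 (x - y) = qnorm2 (x * inverse y - 1) * qnorm2 y" by (simp only: qnorm2_mult)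
  then show ?thesis using assms unfolding 1 by simp
qed

lemma qre_mult_inverse:
  assumes "qnorm2 y = 1" shows "qre (x * y) + qre (x * inverse y) = 2 * qre x * qre y"
proof -
  have "qre (x * (y + inverse y)) = 2 * qre x * qre y" unfolding uq_add_inverse[OF assms] by simp
  then show ?thesis by (simp add: distrib_left)
qed

lemma noncommuting_noncentral:
  assumes "x * y \<noteq> y * (x::quat)" shows "x \<noteq> 1" "x \<noteq> - 1" "y \<noteq> 1" "y \<noteq> - 1" "x * y \<noteq> 1" "x * y \<noteq> -
    1"
proof -
  show "x \<noteq> 1" "x \<noteq> - 1" "y \<noteq> 1" "y \<noteq> - 1" using assms by auto
  show "x * y \<noteq> 1"
  proof
    assume "x * y = 1" then show False
      using assms inverse_unique[of x y] by (metis left_inverse mult_zero_left zero_neq_one)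
  qed
  show "x * y \<noteq> - 1"
  proof
    assume "x * y = - 1" then have "(- x) * y = 1" by simp
    then have "y * (- x) = 1" using inverse_unique[of "- x" y]
      by (metis left_inverse mult_zero_left zero_neq_one)
    then show False using assms \<open>x * y = - 1\<close> by (simp add: minus_equation_iff)
  qed
qed

definition maxre :: "quat set \<Rightarrow> real \<Rightarrow> bool" where
  "maxre F c \<longleftrightarrow> (\<forall>x\<in>F. x \<noteq> 1 \<longrightarrow> x \<noteq> - 1 \<longrightarrow> qre x \<le> c)"

lemma maxreD: "maxre F c \<Longrightarrow> x \<in> F \<Longrightarrow> x \<noteq> 1 \<Longrightarrow> x \<noteq> - 1 \<Longrightarrow> qre x \<le> c"
  by (auto simp: maxre_def)

text \<open>If the angle of \<open>a\<close> and \<open>b\<close> is small, their commutator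
  \<open>k\<close> has an even smaller one: the squared norm of \<open>a * b - b * a\<close> is
  \<open>2 - 2 * qre k\<close> and at most \<open>4 * (1 - c\<^sup>2)\<^sup>2\<close>, while
  maximality of \<open>c\<close> asks for \<open>qre k \<le> c\<close>. Here \<open>k\<close> is not
  -1, as conjugation cannot negate an element of positive real part. The bound 3/4 is the squared
  cosine of pi/6.\<close>

lemma min_angle_bound:
  assumes F: "fin_subgroup F" and max: "maxre F c"
    and a: "a \<in> F" "qre a = c" and b: "b \<in> F" "qre b = c" and ab: "a * b \<noteq> b * a" and c: "0 < c"
  shows "c\<^sup>2 < 3 / 4"
proof (rule ccontr)
  assume *: "\<not> c\<^sup>2 < 3 / 4"
  note u = fin_subgroupD(3)[OF F a(1)] fin_subgroupD(3)[OF F b(1)]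
  define k where "k = a * b * inverse (b * a)"
  have kF: "k \<in> F" unfolding k_def by (intro fin_subgroupD(4)[OF F] fin_subgroup_inverse[OF F] a b)
  have nz: "b * a \<noteq> 0" using u by auto
  have kba: "k * (b * a) = a * b" using nz by (simp add: k_def mult.assoc)
  have "k \<noteq> 1" using kba ab by auto
  moreover have "k \<noteq> - 1"
  proof
    assume "k = - 1"
    then have "a * b = - (b * a)" using kba by simp
    then have "a * b = (- b) * a" by simp
    then have "cj a b = - b" by (subst cj_eq_iff) (use u in auto)
    moreover have "qre (cj a b) = qre b" by (rule qre_cj) (use u in auto)
    ultimately show False using b c by simp
  qed
  ultimately have "qre k \<le> c" using maxreD[OF max kF] by simp
  moreover have "qnorm2 (a * b - b * a) = 2 - 2 * qre k"
    unfolding k_def by (rule qnorm2_diff_unit) (use u in auto)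
  moreover have "qnorm2 (a * b - b * a) \<le> 4 * (1 - c\<^sup>2)\<^sup>2"
    unfolding qnorm2_commutator u a(2) b(2) by (simp add: power2_eq_square)
  ultimately have "1 - c \<le> 2 * (1 - c\<^sup>2)\<^sup>2" by simp
  also have "\<dots> = (1 - c) * (2 * (1 + c) * (1 - c\<^sup>2))" by algebra
  finally have 1: "(1 - c) * 1 \<le> (1 - c) * (2 * (1 + c) * (1 - c\<^sup>2))" by simp
  have "c < 1" using noncentral_bound(1)[OF u(1)] noncommuting_noncentral[OF ab] a by simp
  then have "1 \<le> 2 * (1 + c) * (1 - c\<^sup>2)" using 1 by simp
  also have "\<dots> \<le> 2 * (1 + c) * (1 / 4)" by (rule mult_left_mono) (use * c in auto)
  finally show False using \<open>c < 1\<close> by simp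
qed

lemma cos_ge_sqrt3_2:
  assumes "n \<ge> 6" shows "3 / 4 \<le> (cos (pi / real n))\<^sup>2" "0 < cos (pi / real n)"
proof -
  have "cos (pi / 6) \<le> cos (pi / real n)"
    using assms by (intro cos_monotone_0_pi_le) (auto simp: field_simps)
  then have "sqrt 3 / 2 \<le> cos (pi / real n)" unfolding cos_30 .
  then show "3 / 4 \<le> (cos (pi / real n))\<^sup>2" "0 < cos (pi / real n)"
    using power_mono[of "sqrt 3 / 2" "cos (pi / real n)" 2]
      by (auto simp: power_divide intro: less_le_trans[of 0 "sqrt 3 / 2"])
qed

text \<open>The angles of the maximal cyclic subgroups are pi/n. The bound on \<open>c\<close>
  excludes n at least 6, and n = 1 would give the central element -1.\<close>

lemma maximal_cyclic_small:
  assumes F: "fin_subgroup F" "- 1 \<in> F" and max: "maxre F c" and c: "0 \<le> c" "c\<^sup>2 < 3 / 4"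
    and x: "x \<in> F" "x \<noteq> 1" "x \<noteq> - 1"
  obtains a k where "a \<in> F" "a \<noteq> 1" "a \<noteq> - 1" "qre a \<in> {0, c3, c4, c5}" "x = a ^ k" "qre x \<le> qre a"
    "qre a \<le> c" "a * x = x * a"
proof -
  obtain a n k where a: "a \<in> F" "a \<noteq> 1" "a \<noteq> - 1" "n > 0" "qre a = cos (pi / real n)" "x = a ^ k"
    "\<And>y. y \<in> F \<Longrightarrow> y * x = x * y \<Longrightarrow> y \<noteq> 1 \<Longrightarrow> qre y \<le> qre a" "a * x = x * a"
    using maximal_cyclic[OF F x] by metis
  have "qre a \<le> c" by (rule maxreD[OF max a(1-3)])
  have "n < 6"
  proof (rule ccontr)
    assume "\<not> n < 6"
    then have "3 / 4 \<le> (qre a)\<^sup>2" "0 < qre a" using cos_ge_sqrt3_2[of n] a(5) by auto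
    moreover have "(qre a)\<^sup>2 \<le> c\<^sup>2" using \<open>qre a \<le> c\<close> calculation(2) by (intro power_mono) auto
    ultimately show False using c by linarith
  qed
  moreover have "n \<noteq> 1" using a(3,5) qre_eq_minus_one[OF fin_subgroupD(3)[OF F(1) a(1)]] by auto
  ultimately have "n = 2 \<or> n = 3 \<or> n = 4 \<or> n = 5" using a(4) by auto
  then have "qre a \<in> {0, c3, c4, c5}" using a(5) cos_45 cos_60 cos_pi_5 by auto
  then show thesis using a x \<open>qre a \<le> c\<close> by (intro that[of a k]) auto
qed

lemma sqrt_bounds: "141 / 100 < sqrt (2::real)" "sqrt (2::real) < 142 / 100" "223 / 100 < sqrt
  (5::real)" "sqrt (5::real) < 224 / 100"
  by (rule real_less_rsqrt real_less_lsqrt; simp add: power2_eq_square)+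

text \<open>The real parts of \<open>a * b\<close> and \<open>a * inverse b\<close> add up to
  \<open>2 * c * c\<close>, and both belong to the short list of real parts of powers. In the three
  cases the sum is 1/2, 1 and \<open>c5 + 1 / 2\<close>, and every way to write it with two listed
  values involves 1/2.\<close>

lemma braid_pair_exists:
  assumes F: "fin_subgroup F" "- 1 \<in> F" and max: "maxre F c"
    and a: "a \<in> F" "qre a = c" and b: "b \<in> F" "qre b = c" and ab: "a * b \<noteq> b * a" and c: "0 < c"
  shows "c \<in> {c3, c4, c5}" "qre (a * b) = 1 / 2 \<or> qre (a * inverse b) = 1 / 2"
proof -
  note u = fin_subgroupD(3)[OF F(1) a(1)] fin_subgroupD(3)[OF F(1) b(1)]
  note nc = noncommuting_noncentral[OF ab]
  note small = maximal_cyclic_small[OF F max less_imp_le[OF c] min_angle_bound[OF F(1) max a b ab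
    c]]
  show cv: "c \<in> {c3, c4, c5}"
  proof -
    obtain a' where "qre a' \<in> {0, c3, c4, c5}" "qre a \<le> qre a'" "qre a' \<le> c"
      by (rule small[OF a(1) nc(1,2)])
    then show ?thesis using a(2) c by auto
  qed
  have val: "qre x \<le> c \<and> (qre x \<in> {0, c3, - c3} \<or> c4 \<le> c \<and> qre x \<in> {c4, - c4} \<or> c5 \<le> c
    \<and> qre x \<in> {c5, - c5, c5 - c3, c3 - c5})"
    if x: "x \<in> F" "x \<noteq> 1" "x \<noteq> - 1" for x
  proof -
    obtain a' k where a': "a' \<in> F" "qre a' \<in> {0, c3, c4, c5}" "x = a' ^ k" "qre a' \<le> c"
      by (rule small[OF x])
    have "qre x \<noteq> 1" "qre x \<noteq> - 1" using x qre_eq_one qre_eq_minus_one fin_subgroupD(3)[OF F(1)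
      x(1)] by auto
    then show ?thesis
      using qre_power_values[OF fin_subgroupD(3)[OF F(1) a'(1)] a'(3)] a'(2,4) maxreD[OF max x]
        by auto
  qed
  have ab': "a * inverse b \<noteq> inverse b * a"
  proof
    assume "a * inverse b = inverse b * a"
    then have "b * (a * inverse b) * b = b * (inverse b * a) * b" by simp
    then show False using ab u by (auto simp: mult.assoc uq_nonzero)
  qed
  have v1: "a * b \<in> F" "a * inverse b \<in> F"
    using fin_subgroupD(4)[OF F(1)] fin_subgroup_inverse[OF F(1)] a b by auto
  have sum: "qre (a * b) + qre (a * inverse b) = 2 * c * c"
    using qre_mult_inverse[OF u(2), of a] a b by simp
  define x y where "x = qre (a * b)" and "y = qre (a * inverse b)"
  have X: "x \<le> c \<and> (x \<in> {0, c3, - c3} \<or> c4 \<le> c \<and> x \<in> {c4, - c4} \<or> c5 \<le> c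
    \<and> x \<in> {c5, - c5, c5 - c3, c3 - c5})"
    unfolding x_def by (rule val) (use v1 nc in auto)
  have Y: "y \<le> c \<and> (y \<in> {0, c3, - c3} \<or> c4 \<le> c \<and> y \<in> {c4, - c4} \<or> c5 \<le> c
    \<and> y \<in> {c5, - c5, c5 - c3, c3 - c5})"
    unfolding y_def by (rule val) (use v1 noncommuting_noncentral[OF ab'] in auto)
  note sq = sqrt_bounds
  have "x = 1 / 2 \<or> y = 1 / 2" if "c = c3"
  proof -
    have "x + y = 1 / 2" using sum that by (simp add: x_def y_def)
    moreover have "\<not> c4 \<le> c" "\<not> c5 \<le> c" using that sq by auto
    ultimately show ?thesis using X Y that by auto
  qed
  moreover have "x = 1 / 2 \<or> y = 1 / 2" if "c = c4"
  proof -
    have "x + y = 1" using sum that by (simp add: x_def y_def)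
    moreover have "\<not> c5 \<le> c" using that sq by auto
    ultimately show ?thesis using X Y that sq by auto
  qed
  moreover have "x = 1 / 2 \<or> y = 1 / 2" if "c = c5"
  proof -
    have e: "x + y = (3 + sqrt 5) / 4" using sum that by (simp add: x_def y_def field_simps)
    have lim: "x \<le> c5" "y \<le> c5" using X Y that by auto
    \<comment> \<open>Neither summand exceeds \<open>c5\<close>, so both exceed 0.4; this discards
      0, the negative values and \<open>c5 - c3\<close>.\<close>
    then have lo: "x > 4 / 10" "y > 4 / 10" using e by (simp_all add: field_simps)
    have "z = c3 \<or> z = c4 \<or> z = c5"
      if "z \<le> c \<and> (z \<in> {0, c3, - c3} \<or> c4 \<le> c \<and> z \<in> {c4, - c4} \<or> c5 \<le> c
        \<and> z \<in> {c5, - c5, c5 - c3, c3 - c5})"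
        "z > 4 / 10" for z
      using that sq unfolding insert_iff empty_iff
      by (elim disjE conjE FalseE) (blast | (rule FalseE, linarith) | (rule FalseE, auto simp:
        field_simps))+
    from this[OF X lo(1)] this[OF Y lo(2)] show ?thesis
      using e sq by (elim disjE) (blast | (rule FalseE, linarith) | (rule FalseE, auto simp:
        field_simps))+
  qed
  ultimately show "qre (a * b) = 1 / 2 \<or> qre (a * inverse b) = 1 / 2"
    using cv unfolding x_def[symmetric] y_def[symmetric] by blast
qed

text \<open>Inside a finite group the generated monoid is the generated subgroup. Adding one
  generator on the left at a time gives the induction by which lifts of generators are extended to
  lifts of all elements.\<close>

inductive_set mgen :: "'a::monoid_mult set \<Rightarrow> 'a set" for A where
  mgen_one: "1 \<in> mgen A"
| mgen_mult: "x \<in> A \<Longrightarrow> y \<in> mgen A \<Longrightarrow> x * y \<in> mgen A"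

lemma mgen_base: "x \<in> A \<Longrightarrow> x \<in> mgen A"
  using mgen_mult[OF _ mgen_one, of x A] by simp

lemma mgen_closed: "x \<in> mgen A \<Longrightarrow> y \<in> mgen A \<Longrightarrow> x * y \<in> mgen A"
  by (induction rule: mgen.induct) (auto simp: mult.assoc intro: mgen.intros)

lemma mgen_subset: "fin_subgroup F \<Longrightarrow> A \<subseteq> F \<Longrightarrow> mgen A \<subseteq> F"
proof
  fix x assume F: "fin_subgroup F" "A \<subseteq> F" and "x \<in> mgen A"
  from this(3) show "x \<in> F" by induction (use fin_subgroupD[OF F(1)] F(2) in blast)+
qed

lemma fin_subgroup_mgen:
  assumes F: "fin_subgroup F" and A: "A \<subseteq> F" shows "fin_subgroup (mgen A)"
  using mgen_subset[OF assms] fin_subgroupD[OF F] unfolding fin_subgroup_def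
  by (blast intro: mgen_one mgen_closed finite_subset)

lemma mgen_cj:
  assumes "g \<noteq> 0" shows "cj g ` mgen A = mgen (cj g ` A)"
proof
  show "cj g ` mgen A \<subseteq> mgen (cj g ` A)"
  proof clarify
    fix x assume "x \<in> mgen A"
    then show "cj g x \<in> mgen (cj g ` A)"
      by induction (auto simp: assms cj_mult simp del: mult.assoc intro: mgen.intros)
  qed
  show "mgen (cj g ` A) \<subseteq> cj g ` mgen A"
  proof
    fix x assume "x \<in> mgen (cj g ` A)"
    then show "x \<in> cj g ` mgen A"
    proof induction
      case mgen_one
      show ?case by (rule image_eqI[of _ _ 1]) (auto simp: assms intro: mgen.intros)
    next
      case (mgen_mult x y)
      then obtain x' y' where "x' \<in> A" "y' \<in> mgen A" "x = cj g x'" "y = cj g y'" by blast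
      then show ?case
        using cj_mult[OF assms, of x' y']
          by (intro image_eqI[of _ _ "x' * y'"]) (auto intro: mgen.intros)
    qed
  qed
qed

section \<open>Averaging over rotations, and generation by a braid pair\<close>

lemma geometric_sum_zero:
  fixes r :: "'a::division_ring"
  assumes "r \<noteq> 1" "r ^ n = 1" shows "(\<Sum>k<n. r ^ k) = 0"
proof -
  have "(\<Sum>k<m. r ^ k) * (r - 1) = r ^ m - 1" for m
    by (induction m) (simp_all add: algebra_simps power_commutes)
  from this[of n] show ?thesis using assms by simp
qed

lemma qre_sum: "qre (sum f A) = (\<Sum>x\<in>A. qre (f x))"
  by (induction A rule: infinite_finite_induct) auto

lemma qre_square: "(qre x)\<^sup>2 = (qnorm2 x + qre (x * x)) / 2"
  by (simp add: qnorm2_def quat_defs power2_eq_square)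

lemma power_square: "(x * x) ^ k = x ^ k * (x ^ k :: 'a::monoid_mult)"
  by (simp add: power2_eq_square[symmetric] power_mult[symmetric] mult.commute)

lemma power_intertwine: "u * a = b * u \<Longrightarrow> u * a ^ k = b ^ k * (u :: 'a::monoid_mult)"
proof (induction k)
  case (Suc k)
  have "u * a ^ Suc k = (u * a) * a ^ k" by (simp add: mult.assoc)
  also have "\<dots> = b * (u * a ^ k)" unfolding Suc.prems by (simp add: mult.assoc)
  finally show ?case unfolding Suc.IH[OF Suc.prems] by (simp add: mult.assoc)
qed simp

lemma cj_power_swap:
  assumes "qnorm2 a = 1" "u * a = inverse a * u"
  shows "inverse (a ^ k) * u * a ^ k = (inverse a * inverse a) ^ k * u"
  unfolding mult.assoc power_intertwine[OF assms(2)] power_square by (simp add: power_inverse)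

text \<open>Averaging over the rotations about the axis \<open>p\<close> of \<open>a\<close>; the second term is where the
  rotation needs order at least three.\<close>

lemma rotation_average:
  assumes p: "qre p = 0" "qnorm2 p = 1" and a: "a = c *\<^sub>R 1 + s *\<^sub>R p" "qnorm2 a = 1" "a * a \<noteq> 1" "a
    * a \<noteq> - 1" "a ^ n = 1"
    and q: "qre q = 0" and v: "qre v = 0"
  shows "(\<Sum>k<n. (qre (cj (a ^ k) q * v))\<^sup>2) =
    real n * ((qre (p * v) * qre (p * q))\<^sup>2 + (qnorm2 v - (qre (p * v))\<^sup>2) * (qnorm2 q - (qre (p *
      q))\<^sup>2) / 2)"
proof -
  \<comment> \<open>\<open>\<alpha>\<close> and \<open>\<delta>\<close> are minus the scalar
    products with the axis \<open>p\<close>, so \<open>u\<close> and \<open>q'\<close> are the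
    components of \<open>v\<close> and \<open>q\<close> orthogonal to \<open>p\<close>.\<close>
  define \<alpha> where "\<alpha> = qre (p * v)"
  define \<delta> where "\<delta> = qre (p * q)"
  define u where "u = v + \<alpha> *\<^sub>R p"
  define q' where "q' = q + \<delta> *\<^sub>R p"
  have pp: "p * p = - 1" using pure_mult_self[OF p(1)] p(2) by simp
  have u: "qre u = 0" "p * u = - (u * p)" and q': "qre q' = 0" "p * q' = - (q' * p)"
  proof -
    show r: "qre u = 0" "qre q' = 0" using v q p by (simp_all add: u_def q'_def)
    have "qre (p * u) = 0" "qre (p * q') = 0"
      by (simp_all add: u_def q'_def distrib_left pp \<alpha>_def \<delta>_def)
    then show "p * u = - (u * p)" "p * q' = - (q' * p)"
      using pure_anticommute[OF p(1) r(1)] pure_anticommute[OF p(1) r(2)]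
        by (simp_all add: eq_neg_iff_add_eq_0)
  qed
  have nqs: "qnorm2 (w + qre (p * w) *\<^sub>R p) = qnorm2 w - (qre (p * w))\<^sup>2" if "qre w = 0" for w
  proof -
    have "qnorm2 (w + r *\<^sub>R p) = qnorm2 w - 2 * r * qre (p * w) + r\<^sup>2 * qnorm2 p" for r
      using that p(1) by (simp add: qnorm2_def quat_defs power2_eq_square algebra_simps)
    then show ?thesis by (simp add: p(2) power2_eq_square)
  qed
  define ia where "ia = inverse a"
  have ia: "ia = c *\<^sub>R 1 - s *\<^sub>R p"
  proof -
    have "qcnj p = - p" using p(1) by (simp add: quat_defs)
    then show ?thesis unfolding ia_def uq_inverse[OF a(2)] unfolding a(1) by (simp)
  qed
  have ua: "u * a = ia * u" unfolding ia a(1) using u(2) by (simp add: algebra_simps)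
  have az: "a \<noteq> 0" using a(2) by auto
  define \<rho> where "\<rho> = ia * ia"
  define z where "z = u * q'"
  have pz: "p * z = z * p" 
    unfolding z_def by (simp add: mult.assoc[symmetric] u(2)) (simp add: mult.assoc q'(2))
  have cm: "x * y = y * x" if "\<exists>r t. x = r *\<^sub>R 1 + t *\<^sub>R p" "p * y = y * p" for x y
    using that by (auto simp: algebra_simps)
  have rp: "\<exists>r t. \<rho> ^ k = r *\<^sub>R 1 + t *\<^sub>R p" for k
  proof (induction k)
    case 0 show ?case by (rule exI[of _ 1], rule exI[of _ 0]) simp
  next
    case (Suc k)
    then obtain r t where "\<rho> ^ k = r *\<^sub>R 1 + t *\<^sub>R p" by blast
    then have "\<rho> ^ Suc k = (c *\<^sub>R 1 - s *\<^sub>R p) * ((c *\<^sub>R 1 - s *\<^sub>R p) * (r *\<^sub>R 1 + t *\<^sub>R p))"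
      by (simp add: \<rho>_def ia mult.assoc)
    moreover have "(r1 *\<^sub>R 1 + t1 *\<^sub>R p) * (r2 *\<^sub>R 1 + t2 *\<^sub>R p) = (r1 * r2 - t1 * t2) *\<^sub>R 1 + (r1 *
      t2 + t1 * r2) *\<^sub>R p"
      for r1 t1 r2 t2 using pp by (simp add: algebra_simps)
    from this[of c "- s"] have "(c *\<^sub>R 1 - s *\<^sub>R p) * (r2 *\<^sub>R 1 + t2 *\<^sub>R p) = (c * r2 + s * t2) *\<^sub>R
      1 + (c * t2 - s * r2) *\<^sub>R p"
      for r2 t2 by simp
    ultimately show ?case by metis
  qed
  have summand: "qre (cj (a ^ k) q * v) = - \<alpha> * \<delta> + qre (\<rho> ^ k * z)" for k
  proof -
    have "qre (cj (a ^ k) q * v) = qre (q * (inverse (a ^ k) * v * a ^ k))"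
      using qre_mult_commute[of "a ^ k" "q * (inverse (a ^ k) * v)"] by (simp only: mult.assoc)
    also have "inverse (a ^ k) * v * a ^ k = inverse (a ^ k) * u * a ^ k - \<alpha> *\<^sub>R (inverse (a ^ k) *
      p * a ^ k)"
      unfolding u_def by (simp add: algebra_simps)
    also have "inverse (a ^ k) * p * a ^ k = p"
    proof -
      have "p * a = a * p" unfolding a(1) by (simp add: algebra_simps)
      then have "p * a ^ k = a ^ k * p" by (simp add: power_commuting_commutes)
      then show ?thesis using az by (simp add: mult.assoc)
    qed
    also have "inverse (a ^ k) * u * a ^ k = \<rho> ^ k * u"
      unfolding \<rho>_def ia_def by (rule cj_power_swap[OF a(2)]) (use ua in \<open>simp add: ia_def\<close>)
    also have "qre (q * (\<rho> ^ k * u - \<alpha> *\<^sub>R p)) = qre (q * (\<rho> ^ k * u)) - \<alpha> * \<delta>"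
      using qre_mult_commute[of q p] by (simp add: right_diff_distrib \<delta>_def)
    also have "qre (q * (\<rho> ^ k * u)) = qre (\<rho> ^ k * z) - \<delta> * qre (p * (\<rho> ^ k * u))"
    proof -
      have "q = q' - \<delta> *\<^sub>R p" by (simp add: q'_def)
      moreover have "qre (q' * (\<rho> ^ k * u)) = qre (\<rho> ^ k * z)"
        unfolding z_def using qre_mult_commute[of q' "\<rho> ^ k * u"] by (simp only: mult.assoc)
      ultimately show ?thesis by (simp add: left_diff_distrib)
    qed
    also have "qre (p * (\<rho> ^ k * u)) = 0"
    proof -
      obtain r t where "\<rho> ^ k = r *\<^sub>R 1 + t *\<^sub>R p" using rp by blast
      then have e: "p * (\<rho> ^ k * u) = r *\<^sub>R (p * u) - t *\<^sub>R u"
        using pp by (simp add: distrib_left distrib_right mult.assoc[symmetric])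
      have "qre (p * u) = 0" using u(2) qre_mult_commute[of p u] by simp
      then show ?thesis unfolding e using u(1) by simp
    qed
    finally show ?thesis by simp
  qed
  have iaa: "ia * ia \<noteq> 1" "ia * ia \<noteq> - 1"
  proof -
    have "inverse (ia * ia) = a * a" using az by (simp add: ia_def nonzero_inverse_mult_distrib)
    then show "ia * ia \<noteq> 1" "ia * ia \<noteq> - 1" using a(3,4) by auto
  qed
  have rn: "\<rho> ^ n = 1"
  proof -
    have "ia ^ n = 1" using a(5) by (simp add: ia_def power_inverse)
    then show ?thesis by (simp add: \<rho>_def power_square)
  qed
  \<comment> \<open>Two geometric sums vanish: this one because \<open>\<rho>\<close> is not 1, the
    one in \<open>s2\<close> because its square is not 1 either. As \<open>\<rho>\<close> is the
    inverse of \<open>a * a\<close>, these are the two conditions on \<open>a * a\<close>.\<close>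
  have s1: "(\<Sum>k<n. qre (\<rho> ^ k * z)) = 0"
    using geometric_sum_zero[OF _ rn] iaa(1)
      by (simp add: \<rho>_def qre_sum[symmetric] sum_distrib_right[symmetric])
  have s2: "(\<Sum>k<n. qre ((\<rho> * \<rho>) ^ k * (z * z))) = 0"
  proof -
    have "\<rho> * \<rho> \<noteq> 1"
    proof
      assume "\<rho> * \<rho> = 1"
      then have "(\<rho> - 1) * (\<rho> + 1) = 0" by (simp add: algebra_simps)
      then show False using iaa by (auto simp: \<rho>_def eq_neg_iff_add_eq_0)
    qed
    moreover have "(\<rho> * \<rho>) ^ n = 1" using rn by (simp add: power_square)
    ultimately show ?thesis
      using geometric_sum_zero[of "\<rho> * \<rho>" n]
        by (simp add: qre_sum[symmetric] sum_distrib_right[symmetric])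
  qed
  have nr: "qnorm2 (\<rho> ^ k) = 1" for k using a(2) by (simp add: \<rho>_def ia_def)
  have "(qre (\<rho> ^ k * z))\<^sup>2 = qnorm2 z / 2 + qre ((\<rho> * \<rho>) ^ k * (z * z)) / 2" for k
  proof -
    have "\<rho> ^ k * z = z * \<rho> ^ k" by (rule cm[OF rp pz])
    then have "\<rho> ^ k * (z * \<rho> ^ k) * z = \<rho> ^ k * (\<rho> ^ k * z) * z" by (simp only:)
    then have "\<rho> ^ k * z * (\<rho> ^ k * z) = \<rho> ^ k * (\<rho> ^ k * z) * z" by (simp only: mult.assoc)
    also have "\<dots> = (\<rho> * \<rho>) ^ k * (z * z)" unfolding power_square by (simp only: mult.assoc)
    finally show ?thesis unfolding qre_square qnorm2_mult nr by simp
  qed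
  then have s3: "(\<Sum>k<n. (qre (\<rho> ^ k * z))\<^sup>2) = real n * qnorm2 z / 2"
    using s2 by (simp add: sum.distrib sum_divide_distrib[symmetric])
  have "(\<Sum>k<n. (qre (cj (a ^ k) q * v))\<^sup>2)
      = (\<Sum>k<n. (\<alpha> * \<delta>)\<^sup>2 - 2 * \<alpha> * \<delta> * qre (\<rho> ^ k * z) + (qre (\<rho> ^ k * z))\<^sup>2)"
    unfolding summand by (rule sum.cong) (auto simp: power2_eq_square algebra_simps)
  also have "\<dots> = real n * (\<alpha> * \<delta>)\<^sup>2 + real n * qnorm2 z / 2"
    by (simp add: sum.distrib sum_subtractf sum_distrib_left[symmetric] s1 s3)
  also have "qnorm2 z = (qnorm2 v - \<alpha>\<^sup>2) * (qnorm2 q - \<delta>\<^sup>2)"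
    unfolding z_def qnorm2_mult u_def q'_def \<alpha>_def \<delta>_def nqs[OF v] nqs[OF q] ..
  finally show ?thesis unfolding \<alpha>_def \<delta>_def by (simp add: algebra_simps)
qed

lemma fin_subgroup_torsion:
  assumes F: "fin_subgroup F" and x: "x \<in> F" shows "\<exists>n>0. x ^ n = 1"
proof -
  have "x ^ i = x ^ j \<Longrightarrow> i < j \<Longrightarrow> x ^ (j - i) = 1" for i j
  proof -
    assume *: "x ^ i = x ^ j" "i < j"
    have "x ^ j = x ^ i * x ^ (j - i)" using *(2) by (simp add: power_add[symmetric] del: power_add)
    then have "x ^ i * x ^ (j - i) = x ^ i * 1" using *(1) by simp
    moreover have "x \<noteq> 0" using fin_subgroupD(3)[OF F x] by auto
    ultimately show ?thesis by simp
  qed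
  moreover obtain i j :: nat where "i < j" "x ^ i = x ^ j"
  proof -
    have "range (\<lambda>n. x ^ n) \<subseteq> F" using fin_subgroup_power[OF F x] by auto
    then have "finite (range (\<lambda>n. x ^ n))" using fin_subgroupD(1)[OF F] finite_subset by blast
    then have "\<not> inj (\<lambda>n. x ^ n)" using finite_imageD infinite_UNIV_nat by blast
    then show thesis using that unfolding inj_on_def by (metis linorder_neqE_nat)
  qed
  ultimately show ?thesis by (metis zero_less_diff)
qed

lemma re_scaled_sum:
  assumes "x = c *\<^sub>R 1 + s *\<^sub>R p" "qre p = 0" "y = w *\<^sub>R 1 + v" "qre v = 0"
  shows "qre (x * y) = c * w + s * qre (p * v)"
  using assms by (simp add: algebra_simps)

text \<open>An element \<open>y\<close> of maximal real part in a coset of \<open>H\<close> has small scalar product with the axes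
  of all conjugates of \<open>a\<close>; averaging over the rotations about one axis then forces \<open>y = 1\<close>.\<close>

lemma braid_generation:
  assumes F: "fin_subgroup F" and max: "maxre F c" and a: "a \<in> F" "qre a = c"
    and b: "b \<in> F" "qre b = c"
    and ab: "a * b \<noteq> b * a" and c: "0 < c"
    and H: "fin_subgroup H" "H \<subseteq> F" "a \<in> H" "b \<in> H" "- 1 \<in> H"
  shows "F \<subseteq> H"
proof
  fix y0 assume y0: "y0 \<in> F"
  note nc = noncommuting_noncentral[OF ab]
  obtain p s where p: "qre p = 0" "qnorm2 p = 1" "p * p = - 1" "a = c *\<^sub>R 1 + s *\<^sub>R p" "s > 0" "s\<^sup>2
    = 1 - c\<^sup>2"
    using axis_exists[OF fin_subgroupD(3)[OF F a(1)] nc(1,2)] a(2) by metis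
  obtain q s' where q: "qre q = 0" "qnorm2 q = 1" "q * q = - 1" "b = c *\<^sub>R 1 + s' *\<^sub>R q" "s' > 0"
    "s'\<^sup>2 = 1 - c\<^sup>2"
    using axis_exists[OF fin_subgroupD(3)[OF F b(1)] nc(3,4)] b(2) by metis
  have ss: "s' = s" using p(5,6) q(5,6) by (metis power2_eq_imp_eq less_imp_le)
  have c1: "c < 1" using noncentral_bound(1)[OF fin_subgroupD(3)[OF F a(1)] nc(1,2)] a(2) by simp
  define S where "S = (\<lambda>h. h * y0) ` H"
  have "finite (qre ` S)" "qre ` S \<noteq> {}" using fin_subgroupD(1,2)[OF H(1)] by (auto simp: S_def)
  then have "Max (qre ` S) \<in> qre ` S" by (rule Max_in)
  then obtain h where h: "h \<in> H" "qre (h * y0) = Max (qre ` S)"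
    unfolding S_def image_image by force
  define y where "y = h * y0"
  define w where "w = qre y"
  define v where "v = y - w *\<^sub>R 1"
  have yF: "y \<in> F" unfolding y_def using fin_subgroupD(4)[OF F] h(1) H(2) y0 by blast
  have ny: "qnorm2 y = 1" by (rule fin_subgroupD(3)[OF F yF])
  have v0: "qre v = 0" and yv: "y = w *\<^sub>R 1 + v" by (simp_all add: v_def w_def)
  have nv: "qnorm2 v = 1 - w\<^sup>2"
  proof -
    have "qnorm2 (y - qre y *\<^sub>R 1) = qnorm2 y - (qre y)\<^sup>2" by (simp add: qnorm2_def quat_defs)
    then show ?thesis by (simp add: v_def w_def ny)
  qed
  have best: "qre (g * y) \<le> w" if "g \<in> H" for g
  proof -
    have "g * y \<in> S" unfolding S_def y_def
      using fin_subgroupD(4)[OF H(1) that h(1)] by (auto simp: mult.assoc[symmetric])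
    then show ?thesis using \<open>finite (qre ` S)\<close> h(2) unfolding w_def y_def by (simp add: Max_ge)
  qed
  have "y = 1"
  proof (rule ccontr)
    assume "y \<noteq> 1"
    \<comment> \<open>The real parts of \<open>g * y\<close> and \<open>inverse g * y\<close> are
      \<open>c * w\<close> plus and minus \<open>s * qre (r * v)\<close>, and neither may exceed
      \<open>w\<close>.\<close>
    have axis: "s * \<bar>qre (r * v)\<bar> \<le> w * (1 - c)" if g: "g \<in> H" "g = c *\<^sub>R 1 + s *\<^sub>R r" "qre r = 0"
      for g r
    proof -
      have "inverse g = c *\<^sub>R 1 + (- s) *\<^sub>R r"
      proof -
        have "qcnj r = - r" using g(3) by (simp add: quat_defs)
        then show ?thesis using uq_inverse[OF fin_subgroupD(3)[OF H(1) g(1)]] unfolding g(2) by simp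
      qed
      from re_scaled_sum[OF this g(3) yv v0] best[OF fin_subgroup_inverse[OF H(1) g(1)]]
      have "c * w - s * qre (r * v) \<le> w" by simp
      moreover from re_scaled_sum[OF g(2,3) yv v0] best[OF g(1)]
      have "c * w + s * qre (r * v) \<le> w" by simp
      ultimately have "\<bar>s * qre (r * v)\<bar> \<le> w * (1 - c)" by (simp add: algebra_simps abs_le_iff)
      then show ?thesis using p(5) by (simp add: abs_mult)
    qed
    have w0: "0 \<le> w"
    proof -
      have "0 \<le> s * \<bar>qre (p * v)\<bar>" using p(5) by simp
      also have "\<dots> \<le> w * (1 - c)" by (rule axis[OF H(3) p(4,1)])
      finally show ?thesis using c1 by (simp add: zero_le_mult_iff)
    qed
    have "y \<noteq> - 1" using w0 by (auto simp: w_def)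
    then have wc: "w \<le> c" unfolding w_def using maxreD[OF max yF] \<open>y \<noteq> 1\<close> by simp
    \<comment> \<open>Since \<open>s\<^sup>2 = (1 - c) * (1 + c)\<close>, the bound of
      \<open>axis\<close> with \<open>w \<le> c\<close> makes every squared scalar product at most
      \<open>D * s\<^sup>2\<close>. From \<open>c < 1\<close> follows
      \<open>D < 1 / 4\<close>.\<close>
    define D where "D = (c / (1 + c))\<^sup>2"
    have D: "0 \<le> D" "D < 1 / 4"
    proof -
      have "c / (1 + c) < 1 / 2" using c c1 by (simp add: field_simps)
      then have "(c / (1 + c))\<^sup>2 < (1 / 2)\<^sup>2" using c by (intro power_strict_mono) auto
      then show "0 \<le> D" "D < 1 / 4" by (simp_all add: D_def power2_eq_square)
    qed
    have s2: "s\<^sup>2 = (1 - c) * (1 + c)" using p(6) by algebra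
    have sp: "0 < s\<^sup>2" using p(5) by simp
    have small: "x\<^sup>2 \<le> D * s\<^sup>2" if "s * \<bar>x\<bar> \<le> w * (1 - c)" for x
    proof -
      have "s * \<bar>x\<bar> \<le> c * (1 - c)" using that wc c1
        by (meson mult_right_mono order.trans diff_ge_0_iff_ge less_imp_le)
      then have "(s * \<bar>x\<bar>)\<^sup>2 \<le> (c * (1 - c))\<^sup>2" using p(5) by (intro power_mono) auto
      then have "s\<^sup>2 * x\<^sup>2 \<le> (c * (1 - c))\<^sup>2" by (simp add: power_mult_distrib)
      also have "(c * (1 - c))\<^sup>2 = s\<^sup>2 * (D * s\<^sup>2)"
      proof -
        have "c * (1 - c) = c / (1 + c) * s\<^sup>2" unfolding s2 using c by simp
        then show ?thesis by (simp only: power_mult_distrib D_def power2_eq_square mult_ac)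
      qed
      finally show ?thesis using sp by simp
    qed
    define \<alpha> where "\<alpha> = qre (p * v)"
    define \<delta> where "\<delta> = qre (p * q)"
    have al: "\<alpha>\<^sup>2 \<le> D * s\<^sup>2" unfolding \<alpha>_def by (rule small[OF axis[OF H(3) p(4,1)]])
    have de: "\<delta>\<^sup>2 \<le> D"
    proof -
      have "qre (a * b) \<le> c" by (rule maxreD[OF max fin_subgroupD(4)[OF F a(1) b(1)] nc(5,6)])
      moreover have "qre (a * inverse b) \<le> c"
      proof (rule maxreD[OF max fin_subgroupD(4)[OF F a(1) fin_subgroup_inverse[OF F b(1)]]])
        have "a * inverse b * b = a" using fin_subgroupD(3)[OF F b(1)] by (simp add: mult.assoc)
        then show "a * inverse b \<noteq> 1" "a * inverse b \<noteq> - 1" using ab by auto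
      qed
      moreover have "qre (a * b) = c * c + s * (s * \<delta>)"
        unfolding p(4) q(4) ss \<delta>_def using p(1) q(1) by (simp add: algebra_simps)
      moreover have "qre (a * b) + qre (a * inverse b) = 2 * c * c"
        using qre_mult_inverse[OF fin_subgroupD(3)[OF F b(1)], of a] a(2) b(2) by simp
      ultimately have "s * (s * \<delta>) \<le> c - c * c" "- (s * (s * \<delta>)) \<le> c - c * c" by linarith+
      then have "\<bar>s * s * \<delta>\<bar> \<le> c - c * c" by (simp add: abs_le_iff mult.assoc)
      then have "s * s * \<bar>\<delta>\<bar> \<le> c - c * c" by (simp add: abs_mult)
      then have "(1 - c) * ((1 + c) * \<bar>\<delta>\<bar>) \<le> (1 - c) * c"
      proof -
        have "s * s = (1 - c) * (1 + c)" using s2 by (simp add: power2_eq_square)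
        moreover have "c - c * c = (1 - c) * c" by (simp add: algebra_simps)
        ultimately show ?thesis using \<open>s * s * \<bar>\<delta>\<bar> \<le> c - c * c\<close> by (simp only: mult.assoc)
      qed
      then have "(1 + c) * \<bar>\<delta>\<bar> \<le> c" using c1 by simp
      then have "\<bar>\<delta>\<bar> \<le> c / (1 + c)" using c by (simp add: field_simps)
      then have "\<bar>\<delta>\<bar>\<^sup>2 \<le> (c / (1 + c))\<^sup>2" by (intro power_mono) auto
      then show ?thesis by (simp add: D_def)
    qed
    obtain n where n: "n > 0" "a ^ n = 1" using fin_subgroup_torsion[OF F a(1)] by blast
    have aa: "a * a \<noteq> 1" "a * a \<noteq> - 1"
    proof -
      have "a * a = (2 * c) *\<^sub>R a - 1"
        using uq_quadratic[OF fin_subgroupD(3)[OF F a(1)]] a(2) by simp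
      moreover have "(2 * c) *\<^sub>R a \<noteq> 0" using c fin_subgroupD(3)[OF F a(1)] by auto
      moreover have "(2 * c) *\<^sub>R a \<noteq> 2"
      proof
        assume "(2 * c) *\<^sub>R a = 2"
        then have "qre ((2 * c) *\<^sub>R a) = qre (of_real 2)" by simp
        then have "c * c = 1" using a(2) unfolding qre_of_real by simp
        moreover have "c * c < 1" using c c1 mult_strict_mono[of c 1 c 1] by simp
        ultimately show False by simp
      qed
      ultimately show "a * a \<noteq> 1" "a * a \<noteq> - 1" by (simp_all add: diff_eq_eq)
    qed
    \<comment> \<open>The mean of these squares is at most \<open>D * s\<^sup>2\<close>, but by
      \<open>rotation_average\<close> at least \<open>(1 - D)\<^sup>2 * s\<^sup>2 / 2\<close>,
      because \<open>v\<close> has squared norm at least \<open>s\<^sup>2\<close>. For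
      \<open>D < 1 / 4\<close> this fails: 9/16 exceeds 1/2.\<close>
    have "(\<Sum>k<n. (qre (cj (a ^ k) q * v))\<^sup>2) \<le> (\<Sum>k<n. D * s\<^sup>2)"
    proof (rule sum_mono, rule small)
      fix k
      have gk: "cj (a ^ k) b \<in> H" by (rule fin_subgroup_cj[OF H(1) fin_subgroup_power[OF H(1,3)]
        H(4)])
      have az: "a ^ k \<noteq> 0" using fin_subgroupD(3)[OF F a(1)] by (auto simp: uq_nonzero)
      show "s * \<bar>qre (cj (a ^ k) q * v)\<bar> \<le> w * (1 - c)"
      proof (rule axis[OF gk])
        show "cj (a ^ k) b = c *\<^sub>R 1 + s *\<^sub>R cj (a ^ k) q"
          unfolding q(4) ss using az by (simp add: distrib_left distrib_right)
        show "qre (cj (a ^ k) q) = 0" unfolding qre_cj[OF az] by (rule q(1))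
      qed
    qed
    then have "(\<alpha> * \<delta>)\<^sup>2 + (qnorm2 v - \<alpha>\<^sup>2) * (1 - \<delta>\<^sup>2) / 2 \<le> D * s\<^sup>2"
      using rotation_average[OF p(1,2,4) fin_subgroupD(3)[OF F a(1)] aa n(2) q(1) v0] n(1) q(2)
      by (simp add: \<alpha>_def \<delta>_def)
    then have 1: "(qnorm2 v - \<alpha>\<^sup>2) * (1 - \<delta>\<^sup>2) / 2 \<le> D * s\<^sup>2"
      using zero_le_power2[of "\<alpha> * \<delta>"] by linarith
    have 2: "s\<^sup>2 \<le> qnorm2 v" unfolding nv p(6) using w0 wc by (simp add: power_mono)
    have "(1 - D) * s\<^sup>2 \<le> qnorm2 v - \<alpha>\<^sup>2" using 2 al by (simp add: algebra_simps)
    then have "(1 - D) * s\<^sup>2 * (1 - D) \<le> (qnorm2 v - \<alpha>\<^sup>2) * (1 - \<delta>\<^sup>2)"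
    proof (rule mult_mono)
      have "0 \<le> (1 - D) * s\<^sup>2" using D sp by simp
      then show "0 \<le> qnorm2 v - \<alpha>\<^sup>2" using \<open>(1 - D) * s\<^sup>2 \<le> qnorm2 v - \<alpha>\<^sup>2\<close> by linarith
    qed (use de D in auto)
    then have "((1 - D) * (1 - D)) * s\<^sup>2 \<le> (2 * D) * s\<^sup>2" using 1 by (simp add: algebra_simps)
    then have "(1 - D) * (1 - D) \<le> 2 * D" using sp by simp
    moreover have "(3 / 4) * (3 / 4) \<le> (1 - D) * (1 - D)" using D by (intro mult_mono) auto
    ultimately show False using D by simp
  qed
  then have "y0 = inverse h" using y_def inverse_unique by metis
  then show "y0 \<in> H" using fin_subgroup_inverse[OF H(1) h(1)] by simp
qed

section \<open>Classification of the finite subgroups\<close>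

definition cyclic :: "quat set \<Rightarrow> quat \<Rightarrow> bool" where
  "cyclic F a \<longleftrightarrow> a \<in> F \<and> (\<forall>x\<in>F. \<exists>k. x = a ^ k)"

text \<open>The binary dihedral groups. For \<open>qre a = 0\<close> this is the quaternion group, whose axis is not
  unique.\<close>

definition dihedral :: "quat set \<Rightarrow> quat \<Rightarrow> quat \<Rightarrow> bool" where
  "dihedral F a b \<longleftrightarrow> a \<in> F \<and> b \<in> F \<and> a \<noteq> 1 \<and> a \<noteq> - 1 \<and> b * a = inverse a * b \<and> b * b = - 1
    \<and> 0 \<le> qre a \<and>
     maxre F (qre a) \<and> (\<forall>x\<in>F. (\<exists>k. x = a ^ k) \<or> (\<exists>k. x = b * a ^ k))"

text \<open>The binary polyhedral groups: if \<open>qre a = qre b\<close>, then \<open>qre (a * b) = 1 / 2\<close> is the braid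
  relation \<open>a b a = b a b\<close>.\<close>

definition polyhedral :: "quat set \<Rightarrow> real \<Rightarrow> quat \<Rightarrow> quat \<Rightarrow> bool" where
  "polyhedral F c a b \<longleftrightarrow> a \<in> F \<and> b \<in> F \<and> a * b \<noteq> b * a \<and> qre a = c \<and> qre b = c
    \<and> qre (a * b) = 1 / 2 \<and>
     c \<in> {c3, c4, c5} \<and> - 1 \<in> F \<and> maxre F c \<and> F = mgen {a, b}"

lemma square_eq_one:
  assumes "b * b = (1 :: 'a::division_ring)" shows "b = 1 \<or> b = - 1"
proof -
  have "(b - 1) * (b + 1) = 0" using assms by (simp add: algebra_simps)
  then show ?thesis by (auto simp: eq_neg_iff_add_eq_0)
qed

text \<open>The generator of the centralizer of \<open>a\<close> has the largest real part in it,
  which is \<open>c\<close> again; so it is \<open>a\<close> or \<open>inverse a\<close>.\<close>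

lemma maxre_generator_power:
  assumes F: "fin_subgroup F" "- 1 \<in> F" and max: "maxre F c"
    and a: "a \<in> F" "qre a = c" "a \<noteq> 1" "a \<noteq> - 1"
    and y: "y \<in> F" "y * a = a * y"
  shows "\<exists>k. y = a ^ k"
proof -
  obtain a' where a': "a' \<in> F" "a' \<noteq> 1" "a' \<noteq> - 1" "\<And>y. y \<in> F \<Longrightarrow> y * a = a * y \<Longrightarrow> \<exists>k. y = a' ^ k"
    "\<And>y. y \<in> F \<Longrightarrow> y * a = a * y \<Longrightarrow> y \<noteq> 1 \<Longrightarrow> qre y \<le> qre a'" "a' * a = a * a'"
    using maximal_cyclic[OF F a(1,3,4)] by metis
  have "qre a' = qre a" using a'(5)[OF a(1) refl a(3)] maxreD[OF max a'(1-3)] a(2) by simp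
  then have "a = a' \<or> a = inverse a'"
    using commuting_same_re[OF fin_subgroupD(3)[OF F(1) a'(1)] fin_subgroupD(3)[OF F(1) a(1)] a'(6)]
      by simp
  then show ?thesis
  proof
    assume "a = a'" then show ?thesis using a'(4)[OF y] by simp
  next
    assume i: "a = inverse a'"
    have "inverse y * a = a * inverse y"
    proof -
      have y0: "y \<noteq> 0" using fin_subgroupD(3)[OF F(1) y(1)] by auto
      have "inverse y * (y * a) * inverse y = inverse y * (a * y) * inverse y" using y(2) by simp
      then show ?thesis using y0 by (simp add: mult.assoc)
    qed
    then obtain k where "inverse y = a' ^ k"
      using a'(4)[OF fin_subgroup_inverse[OF F(1) y(1)]] by blast
    then have "y = a ^ k" unfolding i by (metis inverse_inverse_eq power_inverse)
    then show ?thesis ..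
  qed
qed

lemma pure_maxre_0:
  assumes F: "fin_subgroup F" "- 1 \<in> F" and max: "maxre F 0" and x: "x \<in> F"
  shows "x = 1 \<or> x = - 1 \<or> qre x = 0"
proof -
  have "- x \<in> F" using fin_subgroupD(4)[OF F(1) F(2) x] by simp
  then show ?thesis
    using maxreD[OF max x] maxreD[OF max, of "- x"]
      by (cases "x = - 1"; cases "x = 1") (auto simp: minus_equation_iff[of x])
qed

text \<open>All noncentral elements are imaginary, and if a product of imaginary elements is
  imaginary, they anticommute. Hence every noncommuting pair serves as a pair of generators, which
  is exploited whenever the axis of this group may be chosen.\<close>

lemma quaternion_group:
  assumes F: "fin_subgroup F" "- 1 \<in> F" and max: "maxre F 0" and ab: "a \<in> F" "b \<in> F" "a * b \<noteq> b * a"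
  shows "dihedral F a b"
proof -
  note na = fin_subgroupD(3)[OF F(1) ab(1)] and nb = fin_subgroupD(3)[OF F(1) ab(2)]
  note nc = noncommuting_noncentral[OF ab(3)]
  note pure = pure_maxre_0[OF F max]
  have ra: "qre a = 0" "qre b = 0" using pure ab nc by auto
  have aa: "a * a = - 1" "b * b = - 1"
    using uq_quadratic[OF na] uq_quadratic[OF nb] ra by simp_all
  have ia: "inverse a = - a" using aa(1) by (metis inverse_unique minus_mult_right minus_minus)
  have ib: "inverse b = - b" using aa(2) by (metis inverse_unique minus_mult_right minus_minus)
  have b0: "b \<noteq> 0" using nb by auto
  have anti: "x * a = inverse a * x" if x: "x \<in> F" "x * a \<noteq> a * x" for x
  proof -
    have "qre (x * a) = 0" "qre x = 0"
      using pure[OF fin_subgroupD(4)[OF F(1) x(1) ab(1)]] pure[OF x(1)] noncommuting_noncentral[OF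
        x(2)] by auto
    then show ?thesis
      using pure_anticommute[of x a] ra by (simp add: ia eq_neg_iff_add_eq_0)
  qed
  have pow: "\<exists>k. y = a ^ k" if "y \<in> F" "y * a = a * y" for y
    by (rule maxre_generator_power[OF F max ab(1) ra(1) nc(1,2) that])
  have "(\<exists>k. x = a ^ k) \<or> (\<exists>k. x = b * a ^ k)" if x: "x \<in> F" for x
  proof (cases "x * a = a * x")
    case True then show ?thesis using pow[OF x] by blast
  next
    case False
    have "inverse b * x * a = (b * a) * x"
      unfolding ib mult.assoc anti[OF x False] ia by simp
    also have "b * a = - (a * b)" using anti[OF ab(2) ab(3)[symmetric]] ia by simp
    finally have "inverse b * x * a = a * (inverse b * x)" by (simp add: ib mult.assoc)
    then obtain k where "inverse b * x = a ^ k"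
      using pow[OF fin_subgroupD(4)[OF F(1) fin_subgroup_inverse[OF F(1) ab(2)] x]] by blast
    then have "x = b * a ^ k" using b0 by (metis inverse_cancel(2))
    then show ?thesis by blast
  qed
  then show ?thesis unfolding dihedral_def
    using ab nc anti[OF ab(2) ab(3)[symmetric]] aa max ra by auto
qed

text \<open>\<open>b * b\<close> commutes with both \<open>a\<close> and \<open>b\<close>, so if it
  were noncentral, these would commute. It is not 1, since then \<open>b\<close> would be
  central.\<close>

lemma invert_square:
  assumes "qnorm2 b = 1" "a \<noteq> 0" "b * a = inverse a * b" "b * a \<noteq> a * b"
  shows "b * b = - (1 :: quat)" "qre b = 0"
proof -
  have bb: "b * b * a = a * (b * b)"
  proof -
    have "b * (b * a) = b * inverse a * b" unfolding assms(3) by (simp only: mult.assoc)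
    also have "b * inverse a = a * b"
    proof -
      have "a * (b * a) * inverse a = a * (inverse a * b) * inverse a" unfolding assms(3) ..
      then show ?thesis using assms(2) by (simp add: mult.assoc)
    qed
    finally show ?thesis by (simp only: mult.assoc)
  qed
  show 1: "b * b = - 1"
  proof (rule ccontr)
    assume n: "b * b \<noteq> - 1"
    have "b * b \<noteq> 1"
    proof
      assume "b * b = 1"
      then have "b = 1 \<or> b = - 1" by (rule square_eq_one)
      then show False using assms(4) by auto
    qed
    then have "a * b = b * a"
      using commute_trans[of "b * b" a b] n assms(1) bb by (simp add: mult.assoc)
    then show False using assms(4) by simp
  qed
  have "(2 * qre b) *\<^sub>R b = 0" using uq_quadratic[OF assms(1)] 1 by simp
  then show "qre b = 0" using assms(1) by auto
qed

text \<open>Let \<open>a\<close> have the largest real part \<open>c\<close> among the noncentral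
  elements. If every element of real part \<open>c\<close> commutes with \<open>a\<close>, then the
  conjugates of \<open>a\<close> are \<open>a\<close> and \<open>inverse a\<close>, so the group is
  cyclic or dihedral. Otherwise a second axis of the smallest angle exists, which gives the
  quaternion group for \<open>c = 0\<close> and a generating braid pair for
  \<open>c > 0\<close>.\<close>

lemma finite_subgroup_cases:
  assumes F: "fin_subgroup F" "- 1 \<in> F"
  shows "(\<exists>a. cyclic F a) \<or> (\<exists>a b. dihedral F a b) \<or> (\<exists>c a b. polyhedral F c a b)"
proof (cases "\<exists>x\<in>F. x \<noteq> 1 \<and> x \<noteq> - 1")
  case False
  then have "cyclic F (- 1)" using F(2) unfolding cyclic_def by (metis power_0 power_one_right)
  then show ?thesis by blast
next
  case True
  then obtain a where a: "a \<in> F" "a \<noteq> 1" "a \<noteq> - 1" "\<And>y. y \<in> F \<Longrightarrow> y \<noteq> 1 \<and> y \<noteq> - 1 \<Longrightarrow> qre y \<le> qre a"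
    using fin_subgroup_Max[OF F(1), of _ "\<lambda>y. y \<noteq> 1 \<and> y \<noteq> - 1"] by metis
  note na = fin_subgroupD(3)[OF F(1) a(1)]
  define c where "c = qre a"
  have max: "maxre F c" using a(4) by (auto simp: maxre_def c_def)
  have neg: "- x \<in> F" if "x \<in> F" for x using fin_subgroupD(4)[OF F(1) F(2) that] by simp
  have c0: "0 \<le> c"
    using maxreD[OF max neg[OF a(1)]] a(2,3) by (simp add: c_def minus_equation_iff)
  have pow: "\<exists>k. y = a ^ k" if "y \<in> F" "y * a = a * y" for y
    by (rule maxre_generator_power[OF F max a(1) c_def[symmetric] a(2,3) that])
  show ?thesis
  proof (cases "\<exists>b\<in>F. qre b = c \<and> a * b \<noteq> b * a")
    case False
    show ?thesis
    proof (cases "\<forall>b\<in>F. b * a = a * b")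
      case True
      then have "cyclic F a" using pow a(1) by (auto simp: cyclic_def)
      then show ?thesis by blast
    next
      case nonab: False
      then obtain b where b: "b \<in> F" "b * a \<noteq> a * b" by blast
      have inv: "g * a = inverse a * g" if g: "g \<in> F" "g * a \<noteq> a * g" for g
      proof -
        have g0: "g \<noteq> 0" using g fin_subgroupD(3)[OF F(1)] by auto
        have gF: "cj g a \<in> F" by (rule fin_subgroup_cj[OF F(1) g(1) a(1)])
        have gq: "qre (cj g a) = c" unfolding qre_cj[OF g0] c_def ..
        have "a * cj g a = cj g a * a" using False gF gq by blast
        then have "cj g a = a \<or> cj g a = inverse a"
          using commuting_same_re[OF na fin_subgroupD(3)[OF F(1) gF]] gq by (simp add: c_def)
        then show ?thesis using g cj_eq_iff[OF g0] by blast
      qed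
      note ba = inv[OF b]
      have nb: "qnorm2 b = 1" by (rule fin_subgroupD(3)[OF F(1) b(1)])
      have az: "a \<noteq> 0" "b \<noteq> 0" using na nb by auto
      have "b * b = - 1" by (rule invert_square(1)[OF nb az(1) ba b(2)])
      moreover have "(\<exists>k. x = a ^ k) \<or> (\<exists>k. x = b * a ^ k)" if x: "x \<in> F" for x
      proof (cases "x * a = a * x")
        case True then show ?thesis using pow[OF x] by blast
      next
        case False
        have "inverse b * x * a = inverse b * inverse a * x"
          using inv[OF x False] by (simp add: mult.assoc)
        also have "inverse b * inverse a = a * inverse b"
        proof -
          have "inverse b * (b * a) * inverse b = inverse b * (inverse a * b) * inverse b"
            unfolding ba ..
          then show ?thesis using az by (simp add: mult.assoc)
        qed
        finally have "inverse b * x * a = a * (inverse b * x)" by (simp only: mult.assoc)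
        then obtain k where "inverse b * x = a ^ k"
          using pow[OF fin_subgroupD(4)[OF F(1) fin_subgroup_inverse[OF F(1) b(1)] x]] by blast
        then have "x = b * a ^ k" using az by (metis inverse_cancel(2))
        then show ?thesis by blast
      qed
      ultimately have "dihedral F a b" unfolding dihedral_def
        using a b ba max c0 by (auto simp: c_def)
      then show ?thesis by blast
    qed
  next
    case True
    then obtain b where b: "b \<in> F" "qre b = c" "a * b \<noteq> b * a" by blast
    note nb = fin_subgroupD(3)[OF F(1) b(1)]
    note nc = noncommuting_noncentral[OF b(3)]
    show ?thesis
    proof (cases "c = 0")
      case True
      then show ?thesis using quaternion_group[OF F _ a(1) b(1,3)] max by auto
    next
      case False
      then have c: "0 < c" using c0 by simp
      note ex = braid_pair_exists[OF F max a(1) c_def[symmetric] b c]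
      \<comment> \<open>The real part 1/2 is attained by \<open>a * b\<close> or by
        \<open>a * inverse b\<close>, and \<open>inverse b\<close> has the same real part as
        \<open>b\<close>.\<close>
      define b' where "b' = (if qre (a * b) = 1 / 2 then b else inverse b)"
      have b': "b' \<in> F" "qre b' = c" "qre (a * b') = 1 / 2"
        using b fin_subgroup_inverse[OF F(1) b(1)] ex(2) nb by (auto simp: b'_def)
      have ab': "a * b' \<noteq> b' * a"
      proof
        assume *: "a * b' = b' * a"
        then have "a * inverse b = inverse b * a" using b(3) by (auto simp: b'_def split: if_splits)
        then have "b * (a * inverse b) * b = b * (inverse b * a) * b" by (simp only:)
        then have "b * a = a * b" using uq_nonzero[OF nb] by (simp add: mult.assoc)
        then show False using b(3) by simp
      qed
      have sub: "{a, b'} \<subseteq> F" using a b' by auto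
      obtain k where k: "- 1 = a ^ k" using pow[OF F(2)] by auto
      have "a ^ k \<in> mgen {a, b'}" by (rule fin_subgroup_power[OF fin_subgroup_mgen[OF F(1) sub]])
        (simp add: mgen_base)
      then have "F \<subseteq> mgen {a, b'}"
        using braid_generation[OF F(1) max a(1) c_def[symmetric] b'(1,2) ab' c fin_subgroup_mgen[OF
          F(1) sub] mgen_subset[OF F(1) sub]] k
        by (simp add: mgen_base)
      then have "polyhedral F c a b'"
        unfolding polyhedral_def using mgen_subset[OF F(1) sub] a b' ab' ex(1) F(2) max
          by (auto simp: c_def)
      then show ?thesis by blast
    qed
  qed
qed

lemma fin_subgroup_card_image_eq:
  assumes "fin_subgroup F'" "fin_subgroup F" "card F = card F'" "qnorm2 g = 1" "cj g ` F \<subseteq> F'"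
  shows "cj g ` F = F'"
proof (rule card_subset_eq[OF fin_subgroupD(1)[OF assms(1)] assms(5)])
  show "card (cj g ` F) = card F'" using assms(3,4) by (simp add: card_image[OF inj_cj] uq_nonzero)
qed

lemma fin_subgroup_cj_image: "fin_subgroup F \<Longrightarrow> qnorm2 g = 1 \<Longrightarrow> fin_subgroup (cj g ` F)"
  unfolding fin_subgroup_def
proof (elim conjE, intro conjI ballI)
  assume *: "qnorm2 g = 1" "finite F" "1 \<in> F" "F \<subseteq> uq" "\<forall>x\<in>F. \<forall>y\<in>F. x * y \<in> F"
  have g0: "g \<noteq> 0" using *(1) by auto
  show "finite (cj g ` F)" using * by simp
  show "1 \<in> cj g ` F" by (rule image_eqI[of _ _ 1]) (use g0 * in auto)
  show "cj g ` F \<subseteq> uq" using *(1,4) by auto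
  fix x y assume "x \<in> cj g ` F" "y \<in> cj g ` F"
  then obtain x' y' where "x' \<in> F" "y' \<in> F" "x = cj g x'" "y = cj g y'" by auto
  then show "x * y \<in> cj g ` F" using *(5) cj_mult[OF g0, of x' y']
    by (intro image_eqI[of _ _ "x' * y'"]) auto
qed

lemma cyclic_commutes: "cyclic F a \<Longrightarrow> x \<in> F \<Longrightarrow> y \<in> F \<Longrightarrow> x * y = y * x"
  unfolding cyclic_def by (metis power_add add.commute)

lemma commutative_cyclic:
  assumes F: "fin_subgroup F" and comm: "\<And>x y. x \<in> F \<Longrightarrow> y \<in> F \<Longrightarrow> x * y = y * x"
  shows "\<exists>a. cyclic F a"
proof (cases "F = {1}")
  case True then have "cyclic F 1" by (auto simp: cyclic_def intro: exI[of _ 0]) then show ?thesis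
    by blast
next
  case False
  then obtain b where "b \<in> F" "b \<noteq> 1" using fin_subgroupD(2)[OF F] by blast
  then obtain a where a: "a \<in> F" "a \<noteq> 1" "\<And>y. y \<in> F \<Longrightarrow> y \<noteq> 1 \<Longrightarrow> qre y \<le> qre a"
    using fin_subgroup_Max[OF F, of b "\<lambda>x. x \<noteq> 1"] by metis
  have "cyclic F a" using cyclic_angle[OF F comm a] a(1) by (auto simp: cyclic_def)
  then show ?thesis by blast
qed

lemma polyhedral_has_square_root:
  assumes F: "fin_subgroup F" and p: "polyhedral F c a b"
  shows "qre (a * a * b) = 0"
proof -
  have na: "qnorm2 a = 1" using p fin_subgroupD(3)[OF F] by (auto simp: polyhedral_def)
  have "a * a * b = (2 * qre a) *\<^sub>R (a * b) - b"
    unfolding uq_quadratic[OF na] by (simp add: algebra_simps)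
  then show ?thesis using p by (simp add: polyhedral_def)
qed

text \<open>If -1 is missing, adjoin it. The enlarged group \<open>E\<close> contains no square root
  of -1, because its square would already lie in \<open>F\<close>. Dihedral and polyhedral groups do
  contain one, in the latter case \<open>a * a * b\<close>; so \<open>E\<close> is cyclic and
  \<open>F\<close> is commutative.\<close>

lemma fin_subgroup_cases:
  assumes F: "fin_subgroup F"
  obtains (cyclic) a where "cyclic F a" | (dihedral) a b where "dihedral F a b" | (polyhedral) c a b
    where "polyhedral F c a b"
proof (cases "- 1 \<in> F")
  case True
  then show thesis using finite_subgroup_cases[OF F] cyclic dihedral polyhedral by blast
next
  case False
  define E where "E = F \<union> uminus ` F"
  have E: "fin_subgroup E"
    using F unfolding fin_subgroup_def E_def by (auto simp: image_iff) 
  have m1: "- 1 \<in> E" using fin_subgroupD(2)[OF F] by (auto simp: E_def)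
  have sq: "x * x \<noteq> - 1" if "x \<in> E" for x
  proof
    assume *: "x * x = - 1"
    obtain y where "y \<in> F" "x = y \<or> x = - y" using \<open>x \<in> E\<close> by (auto simp: E_def)
    then have "x * x \<in> F" using fin_subgroupD(4)[OF F] by auto
    then show False using * False by simp
  qed
  consider a where "cyclic E a" | a b where "dihedral E a b" | c a b where "polyhedral E c a b"
    using finite_subgroup_cases[OF E m1] by blast
  then show thesis
  proof cases
    case 1
    have "F \<subseteq> E" by (auto simp: E_def)
    then show thesis using commutative_cyclic[OF F] cyclic_commutes[OF 1] cyclic by blast
  next
    case 2
    then show thesis using sq[of b] by (auto simp: dihedral_def)
  next
    case (3 c a b)
    have "a * a * b \<in> E" using 3 fin_subgroupD(4)[OF E] by (auto simp: polyhedral_def)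
    moreover from this have "a * a * b * (a * a * b) = - 1"
      using polyhedral_has_square_root[OF E 3] uq_quadratic[OF fin_subgroupD(3)[OF E]] by fastforce
    ultimately show thesis using sq by blast
  qed
qed

section \<open>Distribution of real parts\<close>

text \<open>Unit quaternions are conjugate iff their real parts agree, so almost conjugate subgroups
  have the same distribution of real parts.\<close>

definition re_dist :: "quat set \<Rightarrow> quat set \<Rightarrow> bool" where
  "re_dist F F' \<longleftrightarrow> (\<forall>t. card {x \<in> F. qre x = t} = card {x \<in> F'. qre x = t})"

lemma re_dist_sym: "re_dist F F' \<Longrightarrow> re_dist F' F"
  by (auto simp: re_dist_def)

lemma re_dist_ex:
  assumes "re_dist F F'" "finite F" "x \<in> F" shows "\<exists>y\<in>F'. qre y = qre x"
proof -
  have "card {z \<in> F. qre z = qre x} \<noteq> 0" using assms by auto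
  then have "card {z \<in> F'. qre z = qre x} \<noteq> 0" using assms(1) by (simp add: re_dist_def)
  then have "{z \<in> F'. qre z = qre x} \<noteq> {}" by (metis card.empty)
  then show ?thesis by auto
qed

lemma card_by_re:
  assumes "finite F" "finite T" "qre ` F \<subseteq> T" shows "card F = (\<Sum>t\<in>T. card {x \<in> F. qre x = t})"
proof -
  have "F = (\<Union>t\<in>T. {x \<in> F. qre x = t})" using assms(3) by auto
  then have "card F = card (\<Union>t\<in>T. {x \<in> F. qre x = t})" by simp
  also have "\<dots> = (\<Sum>t\<in>T. card {x \<in> F. qre x = t})"
    by (rule card_UN_disjoint) (use assms in auto)
  finally show ?thesis .
qed

lemma re_dist_card:
  assumes "re_dist F F'" "finite F" "finite F'" shows "card F = card F'"
  using card_by_re[of F "qre ` F \<union> qre ` F'"] card_by_re[of F' "qre ` F \<union> qre ` F'"] assms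
  by (simp add: re_dist_def)

lemma re_dist_cj:
  assumes "qnorm2 g = 1" shows "re_dist (cj g ` F) F"
proof -
  have g0: "g \<noteq> 0" using assms by auto
  have "{x \<in> cj g ` F. qre x = t} = cj g ` {x \<in> F. qre x = t}" for t
    using qre_cj[OF g0] by auto
  then show ?thesis by (simp add: re_dist_def card_image[OF inj_cj[OF g0]])
qed

lemma re_dist_trans: "re_dist A B \<Longrightarrow> re_dist B C \<Longrightarrow> re_dist A C"
  by (simp add: re_dist_def)

lemma re_dist_bij:
  assumes "bij_betw \<phi> F F'" "\<And>x. x \<in> F \<Longrightarrow> qre (\<phi> x) = qre x" shows "re_dist F F'"
  unfolding re_dist_def
proof
  fix t
  have "bij_betw \<phi> {x \<in> F. qre x = t} {x \<in> F'. qre x = t}"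
    using assms unfolding bij_betw_def inj_on_def by (auto simp: image_iff)
  then show "card {x \<in> F. qre x = t} = card {x \<in> F'. qre x = t}" by (rule bij_betw_same_card)
qed

lemma re_dist_maxre:
  assumes "re_dist F F'" "fin_subgroup F" "fin_subgroup F'" and c: "maxre F c" shows "maxre F' c"
  unfolding maxre_def
proof (intro ballI impI)
  fix x assume x: "x \<in> F'" "x \<noteq> 1" "x \<noteq> - 1"
  obtain y where y: "y \<in> F" "qre y = qre x"
    using re_dist_ex[OF re_dist_sym[OF assms(1)] fin_subgroupD(1)[OF assms(3)] x(1)] by blast
  have "y \<noteq> 1" "y \<noteq> - 1"
    using x y qre_eq_one[OF fin_subgroupD(3)[OF assms(3) x(1)]] qre_eq_minus_one[OF
      fin_subgroupD(3)[OF assms(3) x(1)]] by auto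
  then show "qre x \<le> c" using maxreD[OF c y(1)] y(2) by simp
qed

lemma re_dist_max_attained:
  assumes "re_dist F F'" "fin_subgroup F" "fin_subgroup F'"
    and a: "maxre F (qre a)" "a \<in> F" "a \<noteq> 1" "a \<noteq> - 1" and a': "maxre F' (qre a')" "a' \<in> F'" "a' \<noteq>
      1" "a' \<noteq> - 1"
  shows "qre a = qre a'"
  using maxreD[OF re_dist_maxre[OF assms(1-3) a(1)] a'(2-4)]
    maxreD[OF re_dist_maxre[OF re_dist_sym[OF assms(1)] assms(3,2) a'(1)] a(2-4)] by simp

lemma cj_power: "g \<noteq> 0 \<Longrightarrow> cj g (x ^ k) = cj g x ^ k"
proof (induction k)
  case (Suc k) then show ?case using cj_mult[of g x "x ^ k"] by simp
qed simp

section \<open>Subgroups with equal distributions of real parts are conjugate\<close>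

lemma dihedralD:
  assumes F: "fin_subgroup F" and d: "dihedral F a b"
  shows "a \<in> F" "b \<in> F" "qnorm2 a = 1" "qnorm2 b = 1" "a \<noteq> 1" "a \<noteq> - 1" "b * a = inverse a * b" "a *
    b \<noteq> b * a" "qre b = 0"
    "qre (a * b) = 0" "maxre F (qre a)" "- 1 \<in> F" "\<And>k. qre (b * a ^ k) = 0" "\<And>x. x \<in> F
      \<Longrightarrow> (\<exists>k. x = a ^ k) \<or> (\<exists>k. x = b * a ^ k)"
    "\<And>k. b * a ^ k * (b * a ^ k) = - 1" "0 \<le> qre a"
proof -
  show 1: "a \<in> F" "b \<in> F" "a \<noteq> 1" "a \<noteq> - 1" "b * a = inverse a * b" "maxre F (qre a)" "0 \<le> qre a"
    and
    2: "\<And>x. x \<in> F \<Longrightarrow> (\<exists>k. x = a ^ k) \<or> (\<exists>k. x = b * a ^ k)"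
    using d by (auto simp: dihedral_def)
  have bb: "b * b = - 1" using d by (simp add: dihedral_def)
  then show "- 1 \<in> F" using fin_subgroupD(4)[OF F 1(2,2)] by simp
  show n: "qnorm2 a = 1" "qnorm2 b = 1" using 1 fin_subgroupD(3)[OF F] by auto
  then have a0: "a \<noteq> 0" "b \<noteq> 0" by auto
  show "a * b \<noteq> b * a"
  proof
    assume "a * b = b * a"
    then have "a * b = inverse a * b" using 1 by simp
    then have "a = inverse a" using a0 by simp
    then have "a * a = 1" using a0 by (metis right_inverse)
    then show False using square_eq_one 1 by blast
  qed
  show rb: "qre b = 0" using uq_quadratic[OF n(2)] bb a0 by simp
  have sq: "b * a ^ k * (b * a ^ k) = - 1" for k
  proof -
    have "b * a ^ k = inverse a ^ k * b" by (rule power_intertwine) (rule 1(5))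
    then have "b * a ^ k * (b * a ^ k) = inverse a ^ k * b * (b * a ^ k)" by simp
    also have "\<dots> = inverse a ^ k * (b * b) * a ^ k" by (simp only: mult.assoc)
    also have "\<dots> = - 1" using a0 by (simp add: bb power_inverse)
    finally show ?thesis .
  qed
  then show "b * a ^ k * (b * a ^ k) = - 1" for k .
  have "x * x = - 1 \<Longrightarrow> qnorm2 x = 1 \<Longrightarrow> qre x = 0" for x using uq_quadratic[of x] by auto
  then show p: "qre (b * a ^ k) = 0" for k using sq n by simp
  show "qre (a * b) = 0" using p[of 1] qre_mult_commute[of a b] by simp
qed

lemma dihedral_image_subset:
  assumes d: "dihedral F a b" and F: "fin_subgroup F" and g: "qnorm2 g = 1" "cj g a \<in> F'" "cj g b \<in>
    F'" and F': "fin_subgroup F'"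
  shows "cj g ` F \<subseteq> F'"
proof clarify
  fix x assume "x \<in> F"
  have g0: "g \<noteq> 0" using g by auto
  consider k where "x = a ^ k" | k where "x = b * a ^ k"
    using dihedralD(14)[OF F d \<open>x \<in> F\<close>] by blast
  then show "cj g x \<in> F'"
  proof cases
    case 1 show ?thesis unfolding 1 cj_power[OF g0] by (rule fin_subgroup_power[OF F' g(2)])
  next
    case 2 show ?thesis unfolding 2 cj_mult[OF g0] cj_power[OF g0]
      by (rule fin_subgroupD(4)[OF F' g(3) fin_subgroup_power[OF F' g(2)]])
  qed
qed

text \<open>The elements \<open>b * a ^ k\<close> are imaginary, so \<open>x\<close> is a power of
  \<open>a\<close> and commutes with it.\<close>

lemma dihedral_re_eq:
  assumes F: "fin_subgroup F" and d: "dihedral F a b" and x: "x \<in> F" "qre x = qre a"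
    and p: "0 < qre a"
  shows "x = a \<or> x = inverse a"
proof -
  obtain k where "x = a ^ k" using dihedralD(13,14)[OF F d] x p by (metis less_irrefl)
  then have "a * x = x * a" by (simp add: power_commutes)
  then show ?thesis using commuting_same_re[OF dihedralD(3)[OF F d] fin_subgroupD(3)[OF F x(1)]]
    x(2) by simp
qed

text \<open>Count the elements of the largest noncentral real part: a dihedral group has at most two
  of them, whereas \<open>a'\<close>, \<open>b'\<close> and \<open>inverse a'\<close> are three in a
  polyhedral group.\<close>

lemma dihedral_not_polyhedral:
  assumes F: "fin_subgroup F" "fin_subgroup F'" and s: "re_dist F F'" and d: "dihedral F a b"
    and p: "polyhedral F' c a' b'"
  shows False
proof -
  have p': "a' \<in> F'" "b' \<in> F'" "a' * b' \<noteq> b' * a'" "qre a' = c" "qre b' = c" "maxre F' c" "c > 0"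
    using p sqrt_bounds by (auto simp: polyhedral_def)
  note nc = noncommuting_noncentral[OF p'(3)]
  have c: "qre a = c" using re_dist_max_attained[OF s F dihedralD(11,1,5,6)[OF F(1) d], of a'] p' nc
    by auto
  have n: "qnorm2 a' = 1" using fin_subgroupD(3)[OF F(2) p'(1)] .
  have "{x \<in> F. qre x = c} \<subseteq> {a, inverse a}" using dihedral_re_eq[OF F(1) d] c p' by auto
  then have "card {x \<in> F. qre x = c} \<le> card {a, inverse a}" by (intro card_mono) auto
  also have "\<dots> \<le> 2" by (rule card_insert_le_m1) auto
  finally have 1: "card {x \<in> F. qre x = c} \<le> 2" .
  have i: "inverse a' \<in> F'" by (rule fin_subgroup_inverse[OF F(2) p'(1)])
  have "a' \<noteq> b'" "b' \<noteq> inverse a'" using p'(3) n by auto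
  moreover have "a' \<noteq> inverse a'"
  proof
    assume "a' = inverse a'"
    then have "a' * a' = 1" using n by (metis uq_right_inverse)
    then show False using square_eq_one nc by blast
  qed
  ultimately have "card {a', b', inverse a'} = 3" by auto
  moreover have "{a', b', inverse a'} \<subseteq> {x \<in> F'. qre x = c}" using p' i n by auto
  then have "card {a', b', inverse a'} \<le> card {x \<in> F'. qre x = c}"
    by (intro card_mono) (use fin_subgroupD(1)[OF F(2)] in auto)
  moreover have "card {x \<in> F. qre x = c} = card {x \<in> F'. qre x = c}"
    using s by (simp add: re_dist_def)
  ultimately show False using 1 by simp
qed

lemma cyclic_conj:
  assumes F: "fin_subgroup F" "fin_subgroup F'" and s: "re_dist F F'" and a: "cyclic F a"
  shows "\<exists>g\<in>uq. cj g ` F = F'"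
proof -
  obtain a' where a': "a' \<in> F'" "qre a' = qre a"
    using re_dist_ex[OF s fin_subgroupD(1)[OF F(1)]] a by (auto simp: cyclic_def)
  obtain g where g: "qnorm2 g = 1" "cj g a = a'"
    using conj_same_re[of a a'] fin_subgroupD(3)[OF F(2) a'(1)] fin_subgroupD(3)[OF F(1)] a a'(2)
      by (auto simp: cyclic_def)
  have g0: "g \<noteq> 0" using g by auto
  have "cj g ` F \<subseteq> F'"
  proof clarify
    fix x assume "x \<in> F"
    then obtain k where "x = a ^ k" using a by (auto simp: cyclic_def)
    then show "cj g x \<in> F'" using cj_power[OF g0] g(2) fin_subgroup_power[OF F(2) a'(1)] by simp
  qed
  then show ?thesis
    using fin_subgroup_card_image_eq[OF F(2,1) re_dist_card[OF s fin_subgroupD(1)[OF F(1)]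
      fin_subgroupD(1)[OF F(2)]] g(1)] g(1) by blast
qed

lemma conj_sym:
  assumes "qnorm2 g = 1" "cj g ` F = F'" shows "qnorm2 (inverse g) = 1" "cj (inverse g) ` F' = F"
proof -
  have g0: "g \<noteq> 0" using assms by auto
  show "qnorm2 (inverse g) = 1" using assms by simp
  show "cj (inverse g) ` F' = F" unfolding assms(2)[symmetric] image_image cj_cancel(1)[OF g0]
    by simp
qed

text \<open>The distribution fixes the largest noncentral real part, and with it the real parts of
  the generators and of their product: \<open>qre a\<close>, 0, 0 in the dihedral case and
  \<open>c\<close>, \<open>c\<close>, 1/2 in the polyhedral one. So \<open>conj_pair\<close> matches
  the generators. If one of the groups is cyclic, matching one generator and comparing orders is
  enough.\<close>

theorem re_dist_conj:
  assumes F: "fin_subgroup F" "fin_subgroup F'" and s: "re_dist F F'"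
  shows "\<exists>g\<in>uq. cj g ` F = F'"
proof -
  note crd = re_dist_card[OF s fin_subgroupD(1)[OF F(1)] fin_subgroupD(1)[OF F(2)]]
  show ?thesis
  proof (cases rule: fin_subgroup_cases[OF F(1)])
    case (1 a) then show ?thesis by (rule cyclic_conj[OF F s])
  next
    case dihedral: (2 a b)
    show ?thesis
    proof (cases rule: fin_subgroup_cases[OF F(2)])
      case (1 a')
      obtain g where "qnorm2 g = 1" "cj g ` F' = F"
        using cyclic_conj[OF F(2,1) re_dist_sym[OF s] 1] by blast
      from conj_sym[OF this] show ?thesis by blast
    next
      case (2 a' b')
      note d = dihedralD[OF F(1) dihedral] and d' = dihedralD[OF F(2) 2]
      have c: "qre a = qre a'" by (rule re_dist_max_attained[OF s F d(11,1,5,6) d'(11,1,5,6)])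
      obtain g where g: "qnorm2 g = 1" "cj g a = a'" "cj g b = b'"
        using conj_pair[OF d(3,4) d'(3,4) c] d d' by auto
      then have "cj g ` F \<subseteq> F'" using dihedral_image_subset[OF dihedral F(1) g(1) _ _ F(2)] d'(1,2)
        by auto
      then show ?thesis using fin_subgroup_card_image_eq[OF F(2,1) crd g(1)] g(1) by blast
    next
      case (3 c a' b') then show ?thesis using dihedral_not_polyhedral[OF F s dihedral] by blast
    qed
  next
    case polyhedral: (3 c a b)
    show ?thesis
    proof (cases rule: fin_subgroup_cases[OF F(2)])
      case (1 a')
      obtain g where "qnorm2 g = 1" "cj g ` F' = F"
        using cyclic_conj[OF F(2,1) re_dist_sym[OF s] 1] by blast
      from conj_sym[OF this] show ?thesis by blast
    next
      case (2 a' b') then show ?thesis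
        using dihedral_not_polyhedral[OF F(2,1) re_dist_sym[OF s]] polyhedral by blast
    next
      case (3 c' a' b')
      have c: "qre a = qre a'"
        by (rule re_dist_max_attained[OF s F]) (use polyhedral 3 noncommuting_noncentral in \<open>auto
          simp: polyhedral_def\<close>)
      have n: "qnorm2 a = 1" "qnorm2 b = 1" "qnorm2 a' = 1" "qnorm2 b' = 1"
        using polyhedral 3 fin_subgroupD(3)[OF F(1)] fin_subgroupD(3)[OF F(2)]
        by (auto simp: polyhedral_def)
      obtain g where g: "qnorm2 g = 1" "cj g a = a'" "cj g b = b'"
        using conj_pair[OF n c] c polyhedral 3 by (auto simp: polyhedral_def)
      have "F = mgen {a, b}" "F' = mgen {a', b'}"
        using polyhedral 3 unfolding polyhedral_def by blast+
      then have "cj g ` F = F'" using mgen_cj[of g "{a, b}"] g(2,3) uq_nonzero[OF g(1)] by simp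
      then show ?thesis using g(1) by blast
    qed
  qed
qed

section \<open>Normal subgroups\<close>

definition normal_sub :: "quat set \<Rightarrow> quat set \<Rightarrow> bool" where
  "normal_sub N F \<longleftrightarrow> fin_subgroup N \<and> N \<subseteq> F \<and> (\<forall>f\<in>F. \<forall>x\<in>N. cj f x \<in> N)"

text \<open>For a subgroup \<open>N\<close> this says that there is at most one coset besides
  \<open>N\<close>; the case of \<open>N\<close> equal to \<open>F\<close> is included.\<close>

definition index_le_2 :: "quat set \<Rightarrow> quat set \<Rightarrow> bool" where
  "index_le_2 F N \<longleftrightarrow> (\<forall>x\<in>F. \<forall>y\<in>F. x \<notin> N \<longrightarrow> y \<notin> N \<longrightarrow> x * y \<in> N)"

text \<open>Conjugation moves \<open>e1\<close>, \<open>e2\<close> to i, j, where 1,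
  \<open>e1\<close>, \<open>e2\<close>, \<open>e1 * e2\<close> become the standard orthonormal
  basis.\<close>

lemma quat_basis_parseval:
  assumes "qnorm2 e1 = 1" "qnorm2 e2 = 1" "qre e1 = 0" "qre e2 = 0" "qre (e1 * e2) = 0"
  shows "qnorm2 x = (qre x)\<^sup>2 + (qre (x * e1))\<^sup>2 + (qre (x * e2))\<^sup>2 + (qre (x * (e1 * e2)))\<^sup>2"
proof -
  let ?i = "Quat 0 1 0 0" and ?j = "Quat 0 0 1 0"
  have ij: "qnorm2 ?i = 1" "qnorm2 ?j = 1" by (simp_all add: qnorm2_def)
  obtain g where g: "qnorm2 g = 1" "cj g e1 = ?i" "cj g e2 = ?j"
    using conj_pair[OF assms(1,2) ij] assms by (auto simp: times_quat_def)
  have g0: "g \<noteq> 0" using g by auto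
  have r: "qre (x * e) = qre (cj g x * cj g e)" for e
    unfolding cj_mult[OF g0, symmetric] qre_cj[OF g0] ..
  have w: "qnorm2 w = (qre w)\<^sup>2 + (qre (w * ?i))\<^sup>2 + (qre (w * ?j))\<^sup>2 + (qre (w * (?i * ?j)))\<^sup>2" for
    w
    by (simp add: qnorm2_def times_quat_def)
  have "qnorm2 x = qnorm2 (cj g x)" using g by simp
  also have "\<dots> = (qre (cj g x))\<^sup>2 + (qre (cj g x * ?i))\<^sup>2 + (qre (cj g x * ?j))\<^sup>2 + (qre (cj g x *
    (?i * ?j)))\<^sup>2"
    by (rule w)
  finally show ?thesis unfolding r[of e1] r[of e2] r[of "e1 * e2"] cj_mult[OF g0, of e1 e2] g(2,3)
    qre_cj[OF g0] .
qed

section \<open>The quaternion group of order 8\<close>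

lemma unit_square_m1: "qnorm2 x = 1 \<Longrightarrow> qre x = 0 \<Longrightarrow> x * x = - 1"
  using uq_quadratic[of x] by simp

definition q8 :: "quat \<Rightarrow> quat \<Rightarrow> quat set" where
  "q8 e1 e2 = {1, - 1, e1, - e1, e2, - e2, e1 * e2, - (e1 * e2)}"

lemma q8_mult:
  assumes "e1 * e1 = - 1" "e2 * e2 = - 1" "e2 * e1 = - (e1 * e2)" "x \<in> q8 e1 e2" "y \<in> q8 e1 e2"
  shows "x * y \<in> q8 e1 e2"
proof -
  have r: "e1 * (e1 * z) = - z" "e2 * (e2 * z) = - z" "e2 * (e1 * z) = - (e1 * (e2 * z))" for z
    using assms(1-3) by (simp_all add: mult.assoc[symmetric])
  show ?thesis using assms(4,5) unfolding q8_def
    by (auto simp: mult.assoc r assms(1-3))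
qed

lemma q8_memI:
  assumes e: "qnorm2 e1 = 1" "qnorm2 e2 = 1" "qre e1 = 0" "qre e2 = 0" "qre (e1 * e2) = 0"
    and x: "qnorm2 x = 1"
    and "\<bar>qre x\<bar> = 1 \<or> \<bar>qre (x * e1)\<bar> = 1 \<or> \<bar>qre (x * e2)\<bar> = 1 \<or> \<bar>qre (x * (e1 * e2))\<bar> = 1"
  shows "x \<in> q8 e1 e2"
proof -
  have k: "x = 1 \<or> x = - 1" if "\<bar>qre x\<bar> = 1" "qnorm2 x = 1" for x
    using that qre_eq_one[of x] qre_eq_minus_one[of x] by (auto simp: abs_if split: if_splits)
  have h: "x = f \<or> x = - f" if "\<bar>qre (x * f)\<bar> = 1" "qnorm2 f = 1" "qre f = 0" for f
  proof -
    have "x * f = 1 \<or> x * f = - 1" using k[OF that(1)] x that(2) by simp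
    then have "x * f * f = f \<or> x * f * f = - f" by auto
    then show ?thesis using unit_square_m1[OF that(2,3)]
      by (auto simp: mult.assoc minus_equation_iff)
  qed
  show ?thesis using assms(7) k[OF _ x] h[of e1] h[of e2] h[of "e1 * e2"] e unfolding q8_def by auto
qed

section \<open>Normal subgroups of the polyhedral groups\<close>

lemma polyhedralD:
  assumes F: "fin_subgroup F" and p: "polyhedral F c a b"
  shows "a \<in> F" "b \<in> F" "qnorm2 a = 1" "qnorm2 b = 1" "a * b \<noteq> b * a" "qre a = c" "qre b = c" "qre
    (a * b) = 1 / 2"
    "c = c3 \<or> c = c4 \<or> c = c5" "- 1 \<in> F" "maxre F c" "F = mgen {a, b}" "0 < c" "c\<^sup>2 < 3 / 4"
    "a * b * a = b * a * b" "cj (a * b) a = b" "a \<noteq> 1" "a \<noteq> - 1"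
proof -
  show 1: "a \<in> F" "b \<in> F" "a * b \<noteq> b * a" "qre a = c" "qre b = c" "qre (a * b) = 1 / 2"
    "c = c3 \<or> c = c4 \<or> c = c5" "- 1 \<in> F" "maxre F c" "F = mgen {a, b}"
    using p unfolding polyhedral_def by blast+
  show 2: "0 < c" using 1(7) sqrt_bounds by auto
  show n: "qnorm2 a = 1" "qnorm2 b = 1" using 1 fin_subgroupD(3)[OF F] by auto
  show "c\<^sup>2 < 3 / 4" by (rule min_angle_bound[OF F 1(9,1,4,2,5,3) 2])
  show br: "a * b * a = b * a * b" using braid_iff[OF n] 1 by simp
  show "cj (a * b) a = b" by (rule braid_conj[OF n br])
  show "a \<noteq> 1" "a \<noteq> - 1" using noncommuting_noncentral[OF 1(3)] by auto
qed

lemma polyhedral_values: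
  assumes F: "fin_subgroup F" and p: "polyhedral F c a b" and x: "x \<in> F"
  shows "c = c3 \<Longrightarrow> qre x \<in> {0, 1, - 1, c3, - c3}"
    "c = c4 \<Longrightarrow> qre x \<in> {0, 1, - 1, c3, - c3, c4, - c4}"
    "c = c5 \<Longrightarrow> qre x \<in> {0, 1, - 1, c3, - c3, c4, - c4, c5, - c5, c5 - c3, c3 - c5}"
proof -
  note P = polyhedralD[OF F p]
  have "(c = c3 \<longrightarrow> qre x \<in> {0, 1, - 1, c3, - c3}) \<and> (c = c4
    \<longrightarrow> qre x \<in> {0, 1, - 1, c3, - c3, c4, - c4}) \<and>
    (c = c5 \<longrightarrow> qre x \<in> {0, 1, - 1, c3, - c3, c4, - c4, c5, - c5, c5 - c3, c3 - c5})"
  proof (cases "x = 1 \<or> x = - 1")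
    case True then show ?thesis by auto
  next
    case False
    then obtain a' k where a': "a' \<in> F" "qre a' \<in> {0, c3, c4, c5}" "x = a' ^ k" "qre a' \<le> c"
      using maximal_cyclic_small[OF F P(10,11) less_imp_le[OF P(13)] P(14) x] by metis
    have lt: "c3 < c4" "c4 < c5" "c3 < c5" using sqrt_bounds by (simp_all add: field_simps)
    have gen: "(c = u \<longrightarrow> z \<in> {0, 1, - 1, u, - u}) \<and> (c = v \<longrightarrow> z \<in> {0, 1, - 1, u, - u, v, - v}) \<and>
        (c = w \<longrightarrow> z \<in> {0, 1, - 1, u, - u, v, - v, w, - w, w - u, u - w})"
      if "u < v" "v < w" "y = 0 \<or> y = u \<or> y = v \<or> y = w" "y \<le> c"
        "y = 0 \<Longrightarrow> z \<in> {0, 1, - 1}" "y = u \<Longrightarrow> z \<in> {1, - 1, u, - u}" "y = v \<Longrightarrow> z \<in> {0, 1, - 1, v, - v}"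
        "y = w \<Longrightarrow> z \<in> {1, - 1, w, - w, w - u, u - w}" for u v w y z :: real
      using that(3) by (elim disjE) (use that in auto)
    show ?thesis
      by (rule gen[OF lt(1,2) _ a'(4)]) (use qre_power_values[OF fin_subgroupD(3)[OF F a'(1)] a'(3)]
        a'(2) in blast)+
  qed
  then show "c = c3 \<Longrightarrow> qre x \<in> {0, 1, - 1, c3, - c3}"
    "c = c4 \<Longrightarrow> qre x \<in> {0, 1, - 1, c3, - c3, c4, - c4}"
    "c = c5 \<Longrightarrow> qre x \<in> {0, 1, - 1, c3, - c3, c4, - c4, c5, - c5, c5 - c3, c3 - c5}" by blast+
qed

text \<open>The binary icosahedral group has no element of order 8: the real parts of
  \<open>x * a\<close> and \<open>x * inverse a\<close> would add up to twice
  \<open>c4 * c5\<close>, about 1.144. Both are at most \<open>c5\<close>, hence both exceed 0.32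
  and belong to 1/2, \<open>c4\<close>, \<open>c5\<close>, no two of which have this sum.\<close>

lemma polyhedral_no_c4:
  assumes F: "fin_subgroup F" and p: "polyhedral F c a b" and c: "c = c5"
    and x: "x \<in> F" "qre x = c4"
  shows False
proof -
  note P = polyhedralD[OF F p]
  note sq = sqrt_bounds
  have nx: "qnorm2 x = 1" by (rule fin_subgroupD(3)[OF F x(1)])
  have ne: "x \<noteq> a" "x \<noteq> - a" "x \<noteq> inverse a" "x \<noteq> - inverse a" using P(3,6) c x(2) sq by auto
  have a0: "a \<noteq> 0" using P(3) by auto
  have xa: "x * a \<in> F" "x * inverse a \<in> F"
    using fin_subgroupD(4)[OF F] fin_subgroup_inverse[OF F] x P(1) by auto
  have nc: "x * a \<noteq> 1" "x * a \<noteq> - 1" "x * inverse a \<noteq> 1" "x * inverse a \<noteq> - 1"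
  proof -
    have "x = x * a * inverse a" "x = x * inverse a * a" using a0 by (simp_all add: mult.assoc)
    then show "x * a \<noteq> 1" "x * a \<noteq> - 1" "x * inverse a \<noteq> 1" "x * inverse a \<noteq> - 1" using ne by auto
  qed
  define u v where "u = qre (x * a)" and "v = qre (x * inverse a)"
  have "u + v = 2 * (sqrt 2 / 2) * ((1 + sqrt 5) / 4)"
    using qre_mult_inverse[OF P(3), of x] P(6) c x(2) by (simp add: u_def v_def)
  then have sum: "u + v = (sqrt 2 + sqrt 2 * sqrt 5) / 4" by (simp add: algebra_simps)
  have lo: "(141 / 100) * (223 / 100) \<le> sqrt 2 * sqrt (5::real)"
    and hi: "sqrt 2 * sqrt (5::real) \<le> (142 / 100) * (224 / 100)"
    using sq by (intro mult_mono; simp)+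
  have le: "u \<le> c5" "v \<le> c5" using maxreD[OF P(11)] xa nc c by (auto simp: u_def v_def)
  then have "u > 32 / 100" "v > 32 / 100" using sum lo sq by simp_all
  moreover have "z \<le> 31 / 100 \<or> z = c3 \<or> z = c4 \<or> 8 / 10 \<le> z" if "z = qre y" "y \<in> F" for z y
    using polyhedral_values(3)[OF F p that(2) c] sq
      unfolding that(1)[symmetric] insert_iff empty_iff
    by (elim disjE FalseE) (simp_all add: field_simps)
  from this[OF u_def xa(1)] this[OF v_def xa(2)]
  have "u \<le> 31 / 100 \<or> u = c3 \<or> u = c4 \<or> u \<ge> 8 / 10" "v \<le> 31 / 100 \<or> v = c3 \<or> v = c4 \<or> v \<ge> 8 / 10" .
  ultimately show False using sum lo hi sq by (elim disjE) (simp_all add: field_simps)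
qed

text \<open>Elements of equal real part that satisfy the braid relation are conjugate inside the
  group by their product. If \<open>x\<close> does not commute with \<open>a\<close>, then
  \<open>x\<close> or \<open>inverse x\<close> forms such a pair with \<open>a\<close>.\<close>

lemma polyhedral_conj_generator:
  assumes F: "fin_subgroup F" and p: "polyhedral F c a b" and x: "x \<in> F" "qre x = c"
  shows "\<exists>h\<in>F. cj h x = a \<or> cj h x = inverse a"
proof (cases "a * x = x * a")
  case True
  note P = polyhedralD[OF F p]
  have "x = a \<or> x = inverse a" using commuting_same_re[OF P(3) fin_subgroupD(3)[OF F x(1)] True] x P
    by simp
  then show ?thesis using fin_subgroupD(2)[OF F] by (intro bexI[of _ 1]) auto
next
  case False
  note P = polyhedralD[OF F p]
  have nx: "qnorm2 x = 1" by (rule fin_subgroupD(3)[OF F x(1)])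
  have conj: "\<exists>h\<in>F. cj h z = a" if z: "z \<in> F" "qre z = c" "qre (a * z) = 1 / 2" for z
  proof -
    have nz: "qnorm2 z = 1" by (rule fin_subgroupD(3)[OF F z(1)])
    have "a * z * a = z * a * z" using braid_iff[OF P(3) nz] P z by simp
    then have e: "cj (a * z) a = z" by (rule braid_conj[OF P(3) nz])
    have az: "a * z \<noteq> 0" using P(3) nz by auto
    have "cj (inverse (a * z)) z = a" using cj_cancel(1)[OF az, of a] unfolding e .
    moreover have "inverse (a * z) \<in> F"
      by (intro fin_subgroup_inverse[OF F] fin_subgroupD(4)[OF F] P z)
    ultimately show ?thesis by blast
  qed
  from braid_pair_exists(2)[OF F P(10,11,1,6) x False P(13)] show ?thesis
  proof
    assume "qre (a * x) = 1 / 2" then show ?thesis using conj[OF x] by blast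
  next
    assume "qre (a * inverse x) = 1 / 2"
    then obtain h where h: "h \<in> F" "cj h (inverse x) = a"
      using conj[of "inverse x"] fin_subgroup_inverse[OF F x(1)] nx x by auto
    have "h \<noteq> 0" using fin_subgroupD(3)[OF F h(1)] by auto
    then have "cj h x = inverse a" using h(2) cj_inverse[of h x] by (metis inverse_inverse_eq)
    then show ?thesis using h by blast
  qed
qed

text \<open>By conjugation \<open>N\<close> contains \<open>a\<close>, and with it \<open>b\<close>,
  which is a conjugate of \<open>a\<close>.\<close>

lemma polyhedral_normal_full:
  assumes F: "fin_subgroup F" and p: "polyhedral F c a b" and N: "normal_sub N F"
    and x: "x \<in> N" "qre x = c"
  shows "N = F"
proof -
  note P = polyhedralD[OF F p]
  have N': "fin_subgroup N" "N \<subseteq> F" "\<And>f x. f \<in> F \<Longrightarrow> x \<in> N \<Longrightarrow> cj f x \<in> N"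
    using N by (auto simp: normal_sub_def)
  obtain h where h: "h \<in> F" "cj h x = a \<or> cj h x = inverse a"
    using polyhedral_conj_generator[OF F p _ x(2)] x N'(2) by blast
  have "a \<in> N" using h(2) N'(3)[OF h(1) x(1)] fin_subgroup_inverse[OF N'(1), of "inverse a"] by auto
  moreover from this have "b \<in> N" using N'(3)[OF fin_subgroupD(4)[OF F P(1,2)]] P(16) by metis
  ultimately have "mgen {a, b} \<subseteq> N" by (intro mgen_subset[OF N'(1)]) auto
  then show ?thesis using P(12) N'(2) by auto
qed

text \<open>An element that inverts \<open>x\<close> without commuting with it is imaginary. The
  generators have positive real part, so they would both commute with \<open>x\<close> and hence
  with each other.\<close>

lemma polyhedral_no_inverted:
  assumes F: "fin_subgroup F" and p: "polyhedral F c a b" and x: "qnorm2 x = 1" "x \<noteq> 1" "x \<noteq> - 1"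
    and i: "\<And>f. f \<in> F \<Longrightarrow> cj f x = x \<or> cj f x = inverse x"
  shows False
proof -
  note P = polyhedralD[OF F p]
  have x0: "x \<noteq> 0" using x by auto
  have cm: "f * x = x * f" if f: "f \<in> F" "qre f = c" for f
  proof (rule ccontr)
    assume n: "f * x \<noteq> x * f"
    have nf: "qnorm2 f = 1" by (rule fin_subgroupD(3)[OF F f(1)])
    have f0: "f \<noteq> 0" using nf by auto
    have "f * x = inverse x * f" using i[OF f(1)] n cj_eq_iff[OF f0] by blast
    then have "qre f = 0" using invert_square(2)[OF nf x0] n by blast
    then show False using f(2) P(13) by simp
  qed
  have "a * b = b * a" using commute_trans[OF x cm cm] P by blast
  then show False using P(5) by simp
qed

lemma qre_commutator:
  assumes "qnorm2 a = 1" "qnorm2 e = 1"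
  shows "qre (cj a e * inverse e) = 1 - 2 * ((1 - (qre a)\<^sup>2) * (1 - (qre e)\<^sup>2) - (qre a * qre e -
    qre (a * e))\<^sup>2)"
proof -
  have "cj a e * inverse e = a * e * inverse (e * a)"
    using assms by (simp add: nonzero_inverse_mult_distrib uq_nonzero mult.assoc)
  then have "qnorm2 (a * e - e * a) = 2 - 2 * qre (cj a e * inverse e)"
    using qnorm2_diff_unit[of "a * e" "e * a"] assms by simp
  then show ?thesis unfolding qnorm2_commutator assms by simp
qed

lemma commute_if_re:
  assumes "qnorm2 a = 1" "qnorm2 e = 1" "(qre a * qre e - qre (a * e))\<^sup>2 = (1 - (qre a)\<^sup>2) * (1 -
    (qre e)\<^sup>2)"
  shows "a * e = e * a"
  using qnorm2_commutator[of a e] assms by simp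

text \<open>For imaginary \<open>e\<close> in \<open>K\<close> the commutator of \<open>f\<close>
  and \<open>e\<close> lies in \<open>K\<close>, so its real part, a function of \<open>c\<close>
  and \<open>qre (f * e)\<close>, is 0, 1 or -1. For \<open>c5\<close> it is positive, hence 1, and
  \<open>f\<close> would commute with all of \<open>K\<close>. For \<open>c4\<close> Parseval's
  identity yields an \<open>e\<close> commuting with \<open>f\<close>, and the imaginary element
  \<open>f * f\<close> is then \<open>e\<close> or its inverse.\<close>

lemma polyhedral_over_normal_q8:
  assumes F: "fin_subgroup F" and p: "polyhedral F c a b" and K: "normal_sub K F"
    and d: "dihedral K e1 e2" "qre e1 = 0"
    and f: "f \<in> F" "qre f = c"
  shows "c \<noteq> c5" "c = c4 \<Longrightarrow> f * f \<in> K"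
proof -
  note P = polyhedralD[OF F p]
  have K': "fin_subgroup K" "K \<subseteq> F" "\<And>f x. f \<in> F \<Longrightarrow> x \<in> K \<Longrightarrow> cj f x \<in> K"
    using K by (auto simp: normal_sub_def)
  note D = dihedralD[OF K'(1) d(1)]
  have nf: "qnorm2 f = 1" by (rule fin_subgroupD(3)[OF F f(1)])
  have val: "1 - 2 * ((1 - c\<^sup>2) - (qre (f * e))\<^sup>2) \<in> {0, 1, - 1}" if e: "e \<in> K" "qre e = 0" for e
  proof -
    have "cj f e * inverse e \<in> K" by (intro fin_subgroupD(4)[OF K'(1)] fin_subgroup_inverse[OF
      K'(1)] K'(3) f e)
    then have "qre (cj f e * inverse e) \<in> {0, 1, - 1}"
      using pure_maxre_0[OF K'(1) D(12), of "cj f e * inverse e"] D(11) d(2) by auto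
    then show ?thesis using qre_commutator[OF nf fin_subgroupD(3)[OF K'(1) e(1)]] f(2) e(2) by simp
  qed
  have cm: "f * e = e * f" if e: "e \<in> K" "qre e = 0" "(qre (f * e))\<^sup>2 = 1 - c\<^sup>2" for e
    by (rule commute_if_re[OF nf fin_subgroupD(3)[OF K'(1) e(1)]]) (use e f in simp)
  show "c \<noteq> c5"
  proof
    assume c: "c = c5"
    have cc: "1 - c\<^sup>2 = (5 - sqrt 5) / 8" unfolding c by (simp add: power2_eq_square field_simps)
    have fe: "f * e = e * f" if e: "e \<in> K" "qre e = 0" for e
    proof (rule cm[OF e])
      have "1 - 2 * ((5 - sqrt 5) / 8 - r) > 0" if "r \<ge> 0" for r
        using that sqrt_bounds by (simp add: field_simps)
      from this[of "(qre (f * e))\<^sup>2"] have "1 - 2 * ((1 - c\<^sup>2) - (qre (f * e))\<^sup>2) > 0"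
        unfolding cc by simp
      then show "(qre (f * e))\<^sup>2 = 1 - c\<^sup>2" using val[OF e] by auto
    qed
    have "e1 * e2 = e2 * e1"
    proof (rule commute_trans[OF nf])
      have "(qre f)\<^sup>2 \<noteq> 1" using f(2) P(14) by simp
      then show "f \<noteq> 1" "f \<noteq> - 1" by auto
      show "e1 * f = f * e1" "e2 * f = f * e2" using fe D(1,2,9) d(2) by simp_all
    qed
    then show False using D(8) by simp
  qed
  assume c: "c = c4"
  have cc: "c\<^sup>2 = 1 / 2" by (simp add: c power_divide)
  have ff: "qre (f * f) = 0" using uq_quadratic[OF nf] f(2) cc by (simp add: power2_eq_square)
  have el: "e1 * e2 \<in> K" by (rule fin_subgroupD(4)[OF K'(1) D(1,2)])
  have "\<exists>e\<in>K. qre e = 0 \<and> (qre (f * e))\<^sup>2 = 1 / 2"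
  proof (rule ccontr)
    assume *: "\<not> ?thesis"
    have "qre (f * e) = 0" if e: "e \<in> K" "qre e = 0" for e
    proof -
      have "2 * (qre (f * e))\<^sup>2 \<in> {0, 1, - 1}" using val[OF e] cc by simp
      moreover have "2 * (qre (f * e))\<^sup>2 \<noteq> - 1" using zero_le_power2[of "qre (f * e)"] by linarith
      ultimately show ?thesis using * e by auto
    qed
    then have "qnorm2 f = c\<^sup>2"
      using quat_basis_parseval[OF D(3,4) d(2) D(9,10), of f] D(1,2,9,10) d(2) el f(2) by simp
    then show False using nf cc by simp
  qed
  then obtain e where e: "e \<in> K" "qre e = 0" "(qre (f * e))\<^sup>2 = 1 / 2" by blast
  then have "f * e = e * f" using cm cc by simp
  then have "e * f * f = f * (e * f)" "f * (e * f) = f * (f * e)"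
    by (simp_all only: mult.assoc[symmetric])
  then have eff: "e * (f * f) = f * f * e" by (simp only: mult.assoc)
  have "f * f = e \<or> f * f = inverse e"
    by (rule commuting_same_re[OF fin_subgroupD(3)[OF K'(1) e(1)] _ eff]) (use nf ff e in auto)
  then show "f * f \<in> K" using e(1) fin_subgroup_inverse[OF K'(1) e(1)] by auto
qed

lemma q8_re: "qre e1 = 0 \<Longrightarrow> qre e2 = 0 \<Longrightarrow> qre (e1 * e2) = 0 \<Longrightarrow> x \<in> q8 e1 e2 \<Longrightarrow> qre x \<in> {0, 1, - 1}"
  by (auto simp: q8_def)

text \<open>All real parts are 0, 1, -1, 1/2 or -1/2. For imaginary \<open>x\<close> in
  \<open>F\<close> the squares of the other three coordinates add up to 1, each being 0, 1/4 or 1,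
  and three quarters are too little; so one coordinate is 1 or -1 and \<open>x\<close> is a basis
  element up to sign.\<close>

lemma pol3_q8:
  assumes F: "fin_subgroup F" and p: "polyhedral F c3 a b"
  defines "e1 \<equiv> a * inverse b" and "e2 \<equiv> cj a (a * inverse b)"
    and "K \<equiv> {x \<in> F. qre x \<in> {0, 1, - 1}}"
  shows "fin_subgroup K" "dihedral K e1 e2" "qre e1 = 0"
proof -
  note P = polyhedralD[OF F p]
  have ab0: "a \<noteq> 0" "b \<noteq> 0" using P by auto
  have eF: "e1 \<in> F" "e2 \<in> F" unfolding e1_def e2_def
    by (intro fin_subgroup_cj[OF F] fin_subgroupD(4)[OF F] fin_subgroup_inverse[OF F] P)+
  have n: "qnorm2 e1 = 1" "qnorm2 e2 = 1" using eF fin_subgroupD(3)[OF F] by auto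
  have iab: "qre (a * inverse b) = 0" using qre_mult_inverse[OF P(4), of a] P by simp
  then show r1: "qre e1 = 0" by (simp add: e1_def)
  have r2: "qre e2 = 0" unfolding e2_def qre_cj[OF ab0(1)] by (rule iab)
  have r12: "qre (e1 * e2) = 0"
  proof -
    have "e1 * e2 = cj a (inverse b * (a * a) * inverse b)"
      unfolding e1_def e2_def using ab0 by (simp add: mult.assoc)
    then have "qre (e1 * e2) = qre (inverse b * (a * a) * inverse b)"
      by (simp only: qre_cj[OF ab0(1)])
    also have "\<dots> = qre (a * a * (inverse b * inverse b))"
      using qre_mult_commute[of "inverse b" "a * a * inverse b"] by (simp only: mult.assoc)
    also have "a * a = a - 1" using uq_quadratic[OF P(3)] P by simp
    also have "inverse b * inverse b = inverse b - 1" using uq_quadratic[of "inverse b"] P by simp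
    also have "qre ((a - 1) * (inverse b - 1)) = 0"
      using iab P by (simp add: algebra_simps)
    finally show ?thesis .
  qed
  have sq: "e1 * e1 = - 1" "e2 * e2 = - 1" using unit_square_m1 n r1 r2 by auto
  have anti: "e2 * e1 = - (e1 * e2)"
    using pure_anticommute[OF r1 r2] r12 by (simp add: eq_neg_iff_add_eq_0 add.commute)
  have sub: "x \<in> q8 e1 e2" if x: "x \<in> K" for x
  proof (cases "\<bar>qre x\<bar> = 1")
    case True then show ?thesis using q8_memI[OF n r1 r2 r12] x fin_subgroupD(3)[OF F]
      by (auto simp: K_def)
  next
    case False
    then have rx: "qre x = 0" and xF: "x \<in> F" using x by (auto simp: K_def)
    have nx: "qnorm2 x = 1" by (rule fin_subgroupD(3)[OF F xF])
    have v: "qre (x * e) \<in> {0, 1, - 1, c3, - c3}" if "e \<in> F" for e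
      using polyhedral_values(1)[OF F p fin_subgroupD(4)[OF F xF that]] by simp
    have "1 = (qre (x * e1))\<^sup>2 + (qre (x * e2))\<^sup>2 + (qre (x * (e1 * e2)))\<^sup>2"
      using quat_basis_parseval[OF n r1 r2 r12, of x] nx rx by simp
    moreover have "z\<^sup>2 = 0 \<or> z\<^sup>2 = 1 / 4 \<or> \<bar>z\<bar> = 1" if "z \<in> {0, 1, - 1, c3, - c3}" for z :: real
      using that by (elim insertE emptyE) (simp_all only: power2_eq_square, simp_all)
    note this[OF v]
    from this[OF eF(1)] this[OF eF(2)] this[OF fin_subgroupD(4)[OF F eF]]
    have "(qre (x * e1))\<^sup>2 = 0 \<or> (qre (x * e1))\<^sup>2 = 1 / 4 \<or> \<bar>qre (x * e1)\<bar> = 1"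
      "(qre (x * e2))\<^sup>2 = 0 \<or> (qre (x * e2))\<^sup>2 = 1 / 4 \<or> \<bar>qre (x * e2)\<bar> = 1"
      "(qre (x * (e1 * e2)))\<^sup>2 = 0 \<or> (qre (x * (e1 * e2)))\<^sup>2 = 1 / 4 \<or> \<bar>qre (x * (e1 * e2))\<bar> = 1" .
    ultimately have "\<bar>qre (x * e1)\<bar> = 1 \<or> \<bar>qre (x * e2)\<bar> = 1 \<or> \<bar>qre (x * (e1 * e2))\<bar> = 1" by auto
    then show ?thesis using q8_memI[OF n r1 r2 r12 nx] by blast
  qed
  have q8F: "q8 e1 e2 \<subseteq> F"
  proof -
    have "e1 * e2 \<in> F" by (rule fin_subgroupD(4)[OF F eF])
    moreover have "- x \<in> F" if "x \<in> F" for x using fin_subgroupD(4)[OF F P(10) that] by simp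
    ultimately show ?thesis using eF fin_subgroupD(2)[OF F] by (auto simp: q8_def)
  qed
  have K: "K = q8 e1 e2"
    using sub q8F q8_re[OF r1 r2 r12] by (auto simp: K_def)
  show fK: "fin_subgroup K"
    unfolding fin_subgroup_def
  proof (intro conjI ballI)
    show "finite K" "1 \<in> K" by (simp_all add: K q8_def)
    show "K \<subseteq> uq" using fin_subgroupD(3)[OF F] by (auto simp: K_def)
    show "x * y \<in> K" if "x \<in> K" "y \<in> K" for x y using q8_mult[OF sq anti] that unfolding K .
  qed
  have "e1 * e2 \<noteq> e2 * e1"
  proof
    assume *: "e1 * e2 = e2 * e1"
    have "e1 * e2 + e2 * e1 = 0" unfolding anti by simp
    then have "e1 * e2 + e1 * e2 = 0" unfolding *[symmetric] .
    then have "e1 * e2 = 0" by (simp flip: scaleR_2)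
    then show False using n by auto
  qed
  moreover have "maxre K 0" using qre_eq_one fin_subgroupD(3)[OF fK]
    unfolding maxre_def K_def by auto
  moreover have "- 1 \<in> K" "e1 \<in> K" "e2 \<in> K" by (simp_all add: K q8_def)
  ultimately show "dihedral K e1 e2" using quaternion_group[OF fK] by blast
qed

lemma normal_subD: "normal_sub N F \<Longrightarrow> fin_subgroup N" "normal_sub N F \<Longrightarrow> x \<in> N
  \<Longrightarrow> x \<in> F" "normal_sub N F \<Longrightarrow> f \<in> F \<Longrightarrow> x \<in> N \<Longrightarrow> cj f x \<in> N"
  by (auto simp: normal_sub_def)

lemma normal_sub_factor:
  assumes F: "fin_subgroup F" and N: "normal_sub N F" and "f \<in> F" "x \<in> N"
    shows "inverse f * x * f \<in> N"
  using normal_subD(3)[OF N fin_subgroup_inverse[OF F assms(3)] assms(4)] by simp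

text \<open>Modulo a normal subgroup containing the squares of the generators, a group generated by a
  braid pair has at most the six elements of the symmetric group.\<close>

lemma braid_words:
  assumes F: "fin_subgroup F" and p: "polyhedral F c a b"
    and K: "normal_sub K F" "a * a \<in> K" "b * b \<in> K" and x: "x \<in> F"
  shows "\<exists>k\<in>K. x \<in> {k, k * a, k * b, k * (a * b), k * (b * a), k * (a * b * a)}"
proof -
  note P = polyhedralD[OF F p]
  have "x \<in> mgen {a, b}" using P(12) x by simp
  then show ?thesis
  proof induction
    case mgen_one show ?case using fin_subgroupD(2)[OF normal_subD(1)[OF K(1)]]
      by (intro bexI[of _ 1]) auto
  next
    case (mgen_mult s y)
    obtain k where k: "k \<in> K" "y \<in> {k, k * a, k * b, k * (a * b), k * (b * a), k * (a * b * a)}"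
      using mgen_mult.IH by blast
    have sF: "s \<in> F" using mgen_mult.hyps(1) P by auto
    then have s0: "s \<noteq> 0" using fin_subgroupD(3)[OF F sF] by auto
    define k' where "k' = cj s k"
    have k': "k' \<in> K" "\<And>w. s * (k * w) = k' * (s * w)" "s * k = k' * s"
      using normal_subD(3)[OF K(1) sF k(1)] s0 by (auto simp: k'_def mult.assoc)
    have kk: "k' * (a * a) \<in> K" "k' * (b * b) \<in> K"
      using fin_subgroupD(4)[OF normal_subD(1)[OF K(1)] k'(1)] K(2,3) by auto
    have br: "b * (a * b) = a * (b * a)" "b * (a * (b * z)) = a * (b * (a * z))" for z
      using P(15) by (simp_all only: mult.assoc[symmetric])
    show ?case
    proof (cases "s = a")
      case True
      note k'' = k'(2,3)[unfolded True]
      have "s * y \<in> {k' * a, k' * (a * a), k' * (a * b), k' * (a * a) * b, k' * (a * b * a), k' * (a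
        * a) * (b * a)}"
        unfolding True using k(2) by (elim insertE emptyE) (simp_all add: k'' mult.assoc)
      then show ?thesis using k'(1) kk by blast
    next
      case False
      then have s: "s = b" using mgen_mult.hyps(1) by simp
      note k'' = k'(2,3)[unfolded s]
      have "s * y \<in> {k' * b, k' * (b * a), k' * (b * b), k' * (a * b * a), k' * (b * b) * a, k' * (b
        * b) * (a * b)}"
        unfolding s using k(2) by (elim insertE emptyE) (simp_all add: k'' mult.assoc br)
      then show ?thesis using k'(1) kk by blast
    qed
  qed
qed

text \<open>Modulo \<open>N\<close> the class of \<open>a\<close> is its own inverse and the class
  of \<open>b\<close> is its inverse, so that one class of order at most 2 generates the
  quotient.\<close>

lemma polyhedral_index_le_2:
  assumes F: "fin_subgroup F" and p: "polyhedral F c a b"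
    and N: "normal_sub N F" "a * a \<in> N" "a * b \<in> N"
  shows "index_le_2 F N"
proof -
  note P = polyhedralD[OF F p]
  note fN = normal_subD(1)[OF N(1)]
  have a0: "a \<noteq> 0" using P by auto
  have ab: "inverse a * b \<in> N"
  proof -
    have "inverse (a * a) * (a * b) \<in> N"
      by (intro fin_subgroupD(4)[OF fN] fin_subgroup_inverse[OF fN] N)
    then show ?thesis using a0 by (simp add: nonzero_inverse_mult_distrib mult.assoc)
  qed
  have ba: "b * a \<in> N" using normal_sub_factor[OF F N(1) P(1) N(3)] a0 by (simp add: mult.assoc)
  have "x \<in> N \<or> inverse a * x \<in> N" if "x \<in> F" for x
  proof -
    have "x \<in> mgen {a, b}" using P(12) that by simp
    then show ?thesis
    proof induction
      case mgen_one show ?case using fin_subgroupD(2)[OF fN] by simp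
    next
      case (mgen_mult s y)
      show ?case
      proof (cases "y \<in> N")
        case True
        then have "inverse a * (s * y) \<in> N"
          using mgen_mult.hyps(1) fin_subgroupD(4)[OF fN ab True] a0 by (auto simp: mult.assoc)
        then show ?thesis ..
      next
        case False
        then have y: "inverse a * y \<in> N" using mgen_mult.IH by blast
        have "s * y = (s * a) * (inverse a * y)" using a0 by (simp add: mult.assoc)
        moreover have "s * a \<in> N" using mgen_mult.hyps(1) N(2) ba by auto
        ultimately show ?thesis using fin_subgroupD(4)[OF fN _ y] by simp
      qed
    qed
  qed
  then have *: "inverse a * x \<in> N" if "x \<in> F" "x \<notin> N" for x using that by blast
  show ?thesis unfolding index_le_2_def
  proof (intro ballI impI)
    fix x y assume x: "x \<in> F" "x \<notin> N" and y: "y \<in> F" "y \<notin> N"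
    have "x * y = a * a * (inverse a * (inverse a * x) * a) * (inverse a * y)"
      using a0 by (simp add: mult.assoc)
    moreover have "inverse a * (inverse a * x) * a \<in> N"
      by (rule normal_sub_factor[OF F N(1) P(1) *[OF x]])
    ultimately show "x * y \<in> N" using fin_subgroupD(4)[OF fN] N(2) *[OF y] by simp
  qed
qed

text \<open>The normal quaternion group of order 8 in the binary tetrahedral and octahedral groups.\<close>

definition quaternion_core :: "quat set \<Rightarrow> real \<Rightarrow> quat \<Rightarrow> quat \<Rightarrow> quat set" where
  "quaternion_core F c a b = (if c = c3 then {x \<in> F. qre x \<in> {0, 1, - 1}}
     else {x. \<exists>k. x = (a * a) ^ k \<or> x = b * b * (a * a) ^ k})"

text \<open>For \<open>c3\<close> the group \<open>N\<close> is cut out by real parts, for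
  \<open>c4\<close> it is generated by the squares of \<open>a\<close> and \<open>b\<close>. Either
  description determines \<open>N\<close> and is carried along by a conjugation that matches
  generators.\<close>

lemma polyhedral_normal_q8:
  assumes F: "fin_subgroup F" and p: "polyhedral F c a b" and N: "normal_sub N F"
    and d: "dihedral N e1 e2" "qre e1 = 0"
  shows "N = quaternion_core F c a b" "c = c3 \<or> (c = c4
    \<and> dihedral N (a * a) (b * b))" "\<forall>x\<in>N. qre x \<in> {0, 1, - 1}"
proof -
  note P = polyhedralD[OF F p]
  note fN = normal_subD(1)[OF N]
  note D = dihedralD[OF fN d(1)]
  show re: "\<forall>x\<in>N. qre x \<in> {0, 1, - 1}"
    using pure_maxre_0[OF fN D(12)] D(11) d(2) by fastforce
  have "c \<noteq> c5" by (rule polyhedral_over_normal_q8(1)[OF F p N d P(1,6)])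
  then have c34: "c = c3 \<or> c = c4" using P(9) by blast
  have neq: "c4 \<noteq> c3" using sqrt_bounds by auto
  have 4: "dihedral N (a * a) (b * b)" if c: "c = c4"
  proof -
    have sq: "a * a \<in> N" "b * b \<in> N" using polyhedral_over_normal_q8(2)[OF F p N d _ _ c] P by auto
    have cc: "c\<^sup>2 = 1 / 2" by (simp add: c power_divide)
    have z: "qre (a * a) = 0" "qre (b * b) = 0"
      using uq_quadratic[OF P(3)] uq_quadratic[OF P(4)] P(6,7) cc
        by (simp_all add: power2_eq_square)
    have nc: "a * a \<noteq> 1" "a * a \<noteq> - 1" "b * b \<noteq> 1" "b * b \<noteq> - 1" using z by auto
    have "a * a * (b * b) \<noteq> b * b * (a * a)"
    proof
      assume e: "a * a * (b * b) = b * b * (a * a)"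
      have "b * b * a = a * (b * b)"
        using commute_trans[of "a * a" "b * b" a] nc P(3) e by (simp add: mult.assoc)
      then have "a * b = b * a"
        using commute_trans[of "b * b" a b] nc P(4) by (simp add: mult.assoc)
      then show False using P(5) by simp
    qed
    then show ?thesis using quaternion_group[OF fN D(12) _ sq] D(11) d(2) by simp
  qed
  then show "c = c3 \<or> (c = c4 \<and> dihedral N (a * a) (b * b))" using c34 by blast
  show "N = quaternion_core F c a b"
  proof (cases "c = c3")
    case True
    have "x \<in> N" if x: "x \<in> F" "qre x \<in> {0, 1, - 1}" for x
    proof -
      have fK: "fin_subgroup {x \<in> F. qre x \<in> {0, 1, - 1}}" using pol3_q8(1)[OF F] p True by simp
      have m: "maxre {x \<in> F. qre x \<in> {0, 1, - 1}} 0"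
        using qre_eq_one fin_subgroupD(3)[OF F] unfolding maxre_def by auto
      have m1: "- 1 \<in> {x \<in> F. qre x \<in> {0, 1, - 1}}" using P(10) by simp
      have sub: "N \<subseteq> {x \<in> F. qre x \<in> {0, 1, - 1}}" using re normal_subD(2)[OF N] by auto
      have "dihedral {x \<in> F. qre x \<in> {0, 1, - 1}} e1 e2"
        using quaternion_group[OF fK m1 m _ _ D(8)] sub D(1,2) by blast
      then have "(\<exists>k. x = e1 ^ k) \<or> (\<exists>k. x = e2 * e1 ^ k)" using dihedralD(14)[OF fK] x by blast
      then show ?thesis using fin_subgroup_power[OF fN D(1)] fin_subgroupD(4)[OF fN D(2)] by blast
    qed
    then show ?thesis using True re normal_subD(2)[OF N] by (auto simp: quaternion_core_def)
  next
    case False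
    then have d4: "dihedral N (a * a) (b * b)" using 4 c34 by blast
    note D4 = dihedralD[OF fN d4]
    show ?thesis
      using False D4(14) fin_subgroup_power[OF fN D4(1)] fin_subgroupD(4)[OF fN D4(2)]
        unfolding quaternion_core_def by auto
  qed
qed

text \<open>If \<open>N\<close> is cyclic, or dihedral with a unique axis, a noncentral element of
  \<open>N\<close> is sent to itself or its inverse by all of \<open>F\<close>, which
  \<open>polyhedral_no_inverted\<close> excludes. If \<open>N\<close> is polyhedral with the same
  \<open>c\<close>, it is everything. Otherwise it is tetrahedral in an octahedral group, and a
  nontrivial word in the quotient of \<open>F\<close> by the quaternion group lies in
  \<open>N\<close>.\<close>

lemma polyhedral_normal_cases:
  assumes F: "fin_subgroup F" and p: "polyhedral F c a b" and N: "normal_sub N F"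
    and x: "x \<in> N" "x \<noteq> 1" "x \<noteq> - 1"
  shows "index_le_2 F N \<or> (\<exists>e1 e2. dihedral N e1 e2 \<and> qre e1 = 0)"
proof (cases rule: fin_subgroup_cases[OF normal_subD(1)[OF N]])
  case (1 n)
  note fN = normal_subD(1)[OF N]
  have "cj f x = x \<or> cj f x = inverse x" if f: "f \<in> F" for f
  proof -
    have f0: "f \<noteq> 0" using fin_subgroupD(3)[OF F f] by auto
    have fx: "cj f x \<in> N" by (rule normal_subD(3)[OF N f x(1)])
    show ?thesis
      by (rule commuting_same_re[OF fin_subgroupD(3)[OF fN x(1)] fin_subgroupD(3)[OF fN fx]
        cyclic_commutes[OF 1 x(1) fx]]) (simp only: qre_cj[OF f0])
  qed
  then show ?thesis using polyhedral_no_inverted[OF F p fin_subgroupD(3)[OF fN x(1)] x(2,3)]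
    by blast
next
  case (2 n1 n2)
  note fN = normal_subD(1)[OF N]
  note D = dihedralD[OF fN 2]
  show ?thesis
  proof (cases "qre n1 = 0")
    case True then show ?thesis using 2 by blast
  next
    case False
    then have pos: "0 < qre n1" using D(16) by simp
    have "cj f n1 = n1 \<or> cj f n1 = inverse n1" if f: "f \<in> F" for f
    proof -
      have f0: "f \<noteq> 0" using fin_subgroupD(3)[OF F f] by auto
      show ?thesis
        by (rule dihedral_re_eq[OF fN 2 normal_subD(3)[OF N f D(1)] _ pos]) (simp only: qre_cj[OF
          f0])
    qed
    then show ?thesis using polyhedral_no_inverted[OF F p D(3,5,6)] by blast
  qed
next
  case (3 c' a' b')
  note fN = normal_subD(1)[OF N]
  note P = polyhedralD[OF F p] and P' = polyhedralD[OF fN 3]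
  show ?thesis
  proof (cases "c' = c")
    case True
    then have "N = F" using polyhedral_normal_full[OF F p N P'(1)] P'(6) by simp
    then show ?thesis by (simp add: index_le_2_def)
  next
    case False
    have aF: "a' \<in> F" by (rule normal_subD(2)[OF N P'(1)])
    have "c' \<le> c" using maxreD[OF P(11) aF] P'(6,17,18) by simp
    then have "(c' = c3 \<and> c = c4) \<or> (c' = c3 \<and> c = c5) \<or> (c' = c4 \<and> c = c5)"
      using P(9) P'(9) False sqrt_bounds by (elim disjE) (simp_all add: field_simps)
    moreover have "\<not> (c' = c4 \<and> c = c5)" using polyhedral_no_c4[OF F p _ aF] P'(6) by blast
    ultimately have c': "c' = c3" and c: "c = c4 \<or> c = c5" by blast+
    define K where "K = {x \<in> N. qre x \<in> {0, 1, - 1}}"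
    define e1 e2 where "e1 = a' * inverse b'" and "e2 = cj a' (a' * inverse b')"
    have K: "fin_subgroup K" "dihedral K e1 e2" "qre e1 = 0"
      using pol3_q8[OF fN] 3 c' unfolding K_def e1_def e2_def by auto
    have nK: "normal_sub K F" unfolding normal_sub_def
    proof (intro conjI ballI)
      show "fin_subgroup K" by (rule K)
      show "K \<subseteq> F" using normal_subD(2)[OF N] by (auto simp: K_def)
      fix f x assume f: "f \<in> F" "x \<in> K"
      have f0: "f \<noteq> 0" using fin_subgroupD(3)[OF F f(1)] by auto
      show "cj f x \<in> K" using f normal_subD(3)[OF N f(1), of x] qre_cj[OF f0, of x]
        unfolding K_def by simp
    qed
    \<comment> \<open>The quaternion group \<open>K\<close> of \<open>N\<close> is normal in
      \<open>F\<close>, since it is described by real parts; so \<open>F\<close> cannot have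
      \<open>c = c5\<close>.\<close>
    have c4: "c = c4" using polyhedral_over_normal_q8(1)[OF F p nK K(2,3) P(1,6)] c by blast
    have sq: "a * a \<in> K" "b * b \<in> K"
      using polyhedral_over_normal_q8(2)[OF F p nK K(2,3) _ _ c4] P by auto
    have KN: "K \<subseteq> N" by (auto simp: K_def)
    \<comment> \<open>\<open>w\<close> represents the class of \<open>a'\<close> modulo
      \<open>K\<close>. As \<open>a'\<close> has real part 1/2, it is outside \<open>K\<close>, so
      \<open>w\<close> is one of the five nontrivial representatives, and it lies in
      \<open>N\<close>.\<close>
    obtain k w where kw: "k \<in> K" "a' = k * w" "w \<in> {1, a, b, a * b, b * a, a * b * a}"
      using braid_words[OF F p nK sq aF] by force
    have wN: "w \<in> N"
    proof -
      have "k \<noteq> 0" using fin_subgroupD(3)[OF K(1) kw(1)] by auto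
      then have "w = inverse k * a'" using kw(2) by simp
      then show ?thesis using fin_subgroupD(4)[OF fN fin_subgroup_inverse[OF fN, of k] P'(1)] kw(1)
        KN by auto
    qed
    have gN: "index_le_2 F N" if "a \<in> N \<or> b \<in> N"
    proof -
      have "N = F" using polyhedral_normal_full[OF F p N] that P(6,7) by blast
      then show ?thesis by (simp add: index_le_2_def)
    qed
    have a0: "a \<noteq> 0" using P by auto
    have "a' \<notin> K" using P'(6) c' by (auto simp: K_def)
    then have "w \<noteq> 1" using kw by auto
    then consider "a \<in> N \<or> b \<in> N" | "a * b \<in> N" | "b * a \<in> N" | "a * b * a \<in> N"
      using kw(3) wN by blast
    then show ?thesis
    proof cases
      case 1 then show ?thesis using gN by blast
    next
      case 2 then show ?thesis using polyhedral_index_le_2[OF F p N _ 2] sq KN by blast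
    next
      case 3
      have "a * b \<in> N" using normal_subD(3)[OF N P(1) 3] a0 by (simp add: mult.assoc)
      then show ?thesis using polyhedral_index_le_2[OF F p N] sq KN by blast
    next
      case 4
      have "a * b * a * inverse (a * a) \<in> N"
        using fin_subgroupD(4)[OF fN 4 fin_subgroup_inverse[OF fN]] sq KN by blast
      then have "cj a b \<in> N" using a0 by (simp add: nonzero_inverse_mult_distrib mult.assoc)
      from normal_sub_factor[OF F N P(1) this] have "b \<in> N" using a0 by (simp add: mult.assoc)
      then show ?thesis using gN by blast
    qed
  qed
qed

section \<open>Conjugating a group together with a normal subgroup\<close>

lemma inverse_is_power:
  assumes F: "fin_subgroup F" and x: "x \<in> F" shows "\<exists>m. inverse x = x ^ m"
proof -
  obtain n where n: "n > 0" "x ^ n = 1" using fin_subgroup_torsion[OF F x] by blast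
  then have "x * x ^ (n - 1) = 1" by (cases n) auto
  then have "inverse x = x ^ (n - 1)" by (rule inverse_unique)
  then show ?thesis ..
qed

lemma same_re_comm_mem:
  assumes "fin_subgroup N" "y \<in> N" "qnorm2 x = 1" "qre y = qre x" "x * y = y * x" shows "x \<in> N"
  using commuting_same_re[OF assms(3) fin_subgroupD(3)[OF assms(1,2)] assms(5)] assms(2,4)
    fin_subgroup_inverse[OF assms(1,2)] by auto

lemma re_dist_subset_eq:
  assumes "fin_subgroup N" "fin_subgroup N'" "re_dist N N'" "N \<subseteq> N'" shows "N = N'"
  by (rule card_subset_eq[OF fin_subgroupD(1)[OF assms(2)] assms(4)]) (rule re_dist_card[OF assms(3)
    fin_subgroupD(1)[OF assms(1)] fin_subgroupD(1)[OF assms(2)]])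

lemma normal_pair_trivial: "N = N' \<Longrightarrow> \<exists>g\<in>uq. cj g ` F = F \<and> cj g ` N = N'"
  by (rule bexI[of _ 1]) auto

lemma dihedral_power_mem:
  assumes N: "fin_subgroup N" "a * a \<in> N" "a \<notin> N" "a ^ j \<in> N"
  shows "\<exists>m. a ^ j = (a * a) ^ m"
proof (cases "even j")
  case True
  then obtain m where "j = 2 * m" by (elim evenE)
  then have "a ^ j = (a * a) ^ m" by (simp add: power_mult power2_eq_square)
  then show ?thesis by blast
next
  case False
  then obtain m where "j = 2 * m + 1" by (elim oddE)
  then have "a ^ j = a ^ (2 * m) * a" by (simp only: power_add power_one_right)
  then have e: "a ^ j = (a * a) ^ m * a" by (simp only: power_mult power2_eq_square)
  have m: "(a * a) ^ m \<in> N" by (rule fin_subgroup_power[OF N(1,2)])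
  have "inverse ((a * a) ^ m) * a ^ j = a"
    unfolding e by (rule inverse_cancel(1)) (use fin_subgroupD(3)[OF N(1) m] uq_nonzero in blast)
  then have "a \<in> N" using fin_subgroupD(4)[OF N(1) fin_subgroup_inverse[OF N(1) m] N(4)] by simp
  then show ?thesis using N(3) by simp
qed

lemma dihedral_reflection:
  assumes F: "fin_subgroup F" and d: "dihedral F a b"
  shows "b * a ^ k * a = inverse a * (b * a ^ k)" "qre (a * (b * a ^ k)) = 0" "b * a ^ k \<in> F"
    "qnorm2 (b * a ^ k) = 1"
proof -
  note D = dihedralD[OF F d]
  have "b * a ^ k * a = b * a * a ^ k" by (simp add: mult.assoc power_commutes)
  then show 1: "b * a ^ k * a = inverse a * (b * a ^ k)" unfolding D(7) by (simp add: mult.assoc)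
  have "qre (a * (b * a ^ k)) = qre (b * a ^ Suc k)"
    using qre_mult_commute[of a "b * a ^ k"] by (simp add: mult.assoc power_commutes)
  then show "qre (a * (b * a ^ k)) = 0" unfolding D(13) .
  show "b * a ^ k \<in> F" by (rule fin_subgroupD(4)[OF F D(2) fin_subgroup_power[OF F D(1)]])
  then show "qnorm2 (b * a ^ k) = 1" by (rule fin_subgroupD(3)[OF F])
qed

text \<open>The commutator of \<open>a\<close> with an element \<open>b * a ^ k\<close> is
  \<open>a * a\<close>.\<close>

lemma dihedral_normal_square:
  assumes F: "fin_subgroup F" and d: "dihedral F a b" and N: "normal_sub N F" and k: "b * a ^ k \<in> N"
  shows "a * a \<in> N"
proof -
  note D = dihedralD[OF F d]
  define r where "r = b * a ^ k"
  have a0: "a \<noteq> 0" and r0: "r \<noteq> 0" using D(3) dihedral_reflection(4)[OF F d, of k]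
    by (auto simp: r_def)
  have "a * (r * a) * inverse a = a * (inverse a * r) * inverse a"
    unfolding dihedral_reflection(1)[OF F d, of k, folded r_def] ..
  then have "r * inverse a = a * r" using a0 by (simp add: mult.assoc)
  then have "cj a r = a * (a * r)" by (simp only: mult.assoc)
  then have "cj a r * inverse r = a * a * (r * inverse r)" by (simp only: mult.assoc)
  then have "cj a r * inverse r = a * a" using r0 by simp
  then show ?thesis
    using fin_subgroupD(4)[OF normal_subD(1)[OF N] normal_subD(3)[OF N D(1) k]
      fin_subgroup_inverse[OF normal_subD(1)[OF N] k]] by (simp add: r_def)
qed

text \<open>The subgroups that have to be moved are those containing some \<open>b * a ^ k\<close>
  but not \<open>a\<close>: they come in two versions, with even and with odd \<open>k\<close>. An
  element \<open>g\<close> commuting with \<open>a\<close>, possibly outside \<open>F\<close>,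
  carries one reflection to the other and preserves \<open>F\<close>. All other normal subgroups are
  determined by their distribution.\<close>

lemma dihedral_normal_pair:
  assumes F: "fin_subgroup F" and d: "dihedral F a b" and pos: "0 < qre a"
    and N: "normal_sub N F" "normal_sub N' F" and s: "re_dist N N'"
  shows "\<exists>g\<in>uq. cj g ` F = F \<and> cj g ` N = N'"
proof -
  note D = dihedralD[OF F d]
  note fN = normal_subD(1)[OF N(1)] normal_subD(1)[OF N(2)]
  have a0: "a \<noteq> 0" using D by auto
  have aiff: "a \<in> M'" if M: "normal_sub M F" "normal_sub M' F" "re_dist M M'" "a \<in> M" for M M'
  proof -
    obtain y where y: "y \<in> M'" "qre y = qre a"
      using re_dist_ex[OF M(3) fin_subgroupD(1)[OF normal_subD(1)[OF M(1)]] M(4)] by blast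
    then have "y = a \<or> y = inverse a"
      using dihedral_re_eq[OF F d normal_subD(2)[OF M(2)] _ pos] by blast
    then show ?thesis using y fin_subgroup_inverse[OF normal_subD(1)[OF M(2)] y(1)] by auto
  qed
  have pw: "\<exists>k. x = a ^ k" if "normal_sub M F" "x \<in> M" "\<not> (\<exists>k. b * a ^ k \<in> M)" for x M
    using D(14)[OF normal_subD(2)[OF that(1,2)]] that(2,3) by blast
  show ?thesis
  proof (cases "a \<in> N")
    case True
    then have aN': "a \<in> N'" using aiff[OF N s] by blast
    have full: "M = F" if M: "normal_sub M F" "a \<in> M" "b * a ^ k \<in> M" for M k
    proof -
      note fM = normal_subD(1)[OF M(1)]
      have "b * a ^ k * inverse (a ^ k) \<in> M"
        by (intro fin_subgroupD(4)[OF fM] fin_subgroup_inverse[OF fM] fin_subgroup_power[OF fM] M)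
      then have bM: "b \<in> M" using a0 by (simp add: mult.assoc)
      have "x \<in> M" if "x \<in> F" for x
        using D(14)[OF that] fin_subgroup_power[OF fM M(2)] fin_subgroupD(4)[OF fM bM] by blast
      then show ?thesis using normal_subD(2)[OF M(1)] by blast
    qed
    have "N = N'"
    proof (cases "(\<exists>k. b * a ^ k \<in> N) \<or> (\<exists>k. b * a ^ k \<in> N')")
      case True
      then have "N = F \<or> N' = F" using full N \<open>a \<in> N\<close> aN' by blast
      then show ?thesis
        using re_dist_subset_eq[OF fN s] re_dist_subset_eq[OF fN(2,1) re_dist_sym[OF s]]
          normal_subD(2)[OF N(1)] normal_subD(2)[OF N(2)] by blast
    next
      case False
      then show ?thesis
        using pw[OF N(1)] pw[OF N(2)] fin_subgroup_power[OF fN(1) \<open>a \<in> N\<close>] fin_subgroup_power[OF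
          fN(2) aN'] by blast
    qed
    then show ?thesis by (rule normal_pair_trivial)
  next
    case aN: False
    then have aN': "a \<notin> N'" using aiff[OF N(2,1) re_dist_sym[OF s]] by blast
    \<comment> \<open>If \<open>M'\<close> had no reflection, it would be commutative, and so would
      its conjugate \<open>M\<close>. But \<open>M\<close> contains a reflection and
      \<open>a * a\<close>, which commute only if the fourth power of \<open>a\<close> is 1,
      contrary to a positive real part.\<close>
    have mixed: "\<exists>k. b * a ^ k \<in> M'" if M: "normal_sub M F" "normal_sub M' F" "re_dist M M'"
      and k: "b * a ^ k \<in> M" for M M' k
    proof (rule ccontr)
      assume n: "\<nexists>k. b * a ^ k \<in> M'"
      have comm': "x * y = y * x" if "x \<in> M'" "y \<in> M'" for x y
        using pw[OF M(2) _ n] that by (metis power_add add.commute)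
      obtain h where h: "qnorm2 h = 1" "cj h ` M = M'"
        using re_dist_conj[OF normal_subD(1)[OF M(1)] normal_subD(1)[OF M(2)] M(3)] by blast
      have h0: "h \<noteq> 0" using h by auto
      let ?r = "b * a ^ k"
      have aa: "a * a \<in> M" by (rule dihedral_normal_square[OF F d M(1) k])
      have "cj h (a * a * ?r) = cj h (?r * (a * a))"
        unfolding cj_mult[OF h0, of "a * a" ?r] cj_mult[OF h0, of ?r "a * a"]
          by (rule comm') (use h aa k in blast)+
      then have "a * a * ?r = ?r * (a * a)" by (rule inj_cj[OF h0, of UNIV, THEN injD])
      also have "\<dots> = ?r * a * a" by (simp only: mult.assoc)
      also have "\<dots> = inverse a * ?r * a" unfolding dihedral_reflection(1)[OF F d] ..
      also have "\<dots> = inverse a * (?r * a)" by (simp only: mult.assoc)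
      also have "\<dots> = inverse a * (inverse a * ?r)" unfolding dihedral_reflection(1)[OF F d] ..
      also have "\<dots> = inverse a * inverse a * ?r" by (simp only: mult.assoc)
      finally have "a * a = inverse a * inverse a"
        using dihedral_reflection(4)[OF F d, of k] by (auto simp: mult_right_cancel)
      from arg_cong[OF this, of "\<lambda>x. x * (a * a)"]
      have "a * a * (a * a) = inverse a * inverse a * (a * a)" .
      also have "\<dots> = 1" using a0 by (simp add: mult.assoc)
      finally have "a * a * (a * a) = 1" .
      then have "a * a = 1 \<or> a * a = - 1" by (rule square_eq_one)
      then have "a * a = - 1" using square_eq_one D(5,6) by blast
      then have "(2 * qre a) *\<^sub>R a = 0" using uq_quadratic[OF D(3)] by simp
      then show False using pos a0 by simp
    qed
    show ?thesis
    proof (cases "\<exists>k. b * a ^ k \<in> N")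
      case False
      then have False': "\<nexists>k. b * a ^ k \<in> N'" using mixed[OF N(2,1) re_dist_sym[OF s]] by blast
      have "N \<subseteq> N'"
      proof
        fix x assume x: "x \<in> N"
        obtain y where y: "y \<in> N'" "qre y = qre x"
          using re_dist_ex[OF s fin_subgroupD(1)[OF fN(1)] x] by blast
        obtain i j where "x = a ^ i" "y = a ^ j"
          using pw[OF N(1) x False] pw[OF N(2) y(1) False'] by blast
        then have "x * y = y * x" by (metis power_add add.commute)
        then show "x \<in> N'" using same_re_comm_mem[OF fN(2) y(1) fin_subgroupD(3)[OF fN(1) x] y(2)]
          by blast
      qed
      then show ?thesis using re_dist_subset_eq[OF fN s] normal_pair_trivial by blast
    next
      case True
      then obtain k where k: "b * a ^ k \<in> N" by blast
      obtain l where l: "b * a ^ l \<in> N'" using mixed[OF N s k] by blast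
      define r where "r = b * a ^ k"
      define r' where "r' = b * a ^ l"
      note R = dihedral_reflection[OF F d, of k, folded r_def]
        and R' = dihedral_reflection[OF F d, of l, folded r'_def]
      have re: "qre r = 0" "qre r' = 0" unfolding r_def r'_def D(13) by simp_all
      obtain g where g: "qnorm2 g = 1" "cj g a = a" "cj g r = r'"
        using conj_pair[OF D(3) R(4) D(3) R'(4)] R(2) R'(2) re by auto
      have g0: "g \<noteq> 0" using g by auto
      have b: "b = r * inverse (a ^ k)" unfolding r_def using a0 by (simp add: mult.assoc)
      have gb: "cj g b = r' * inverse (a ^ k)"
        unfolding b cj_mult[OF g0] cj_inverse[OF g0] cj_power[OF g0] g(2,3) ..
      have "cj g ` F \<subseteq> F"
        by (rule dihedral_image_subset[OF d F g(1) _ _ F])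
          (unfold gb g(2), rule D(1), intro fin_subgroupD(4)[OF F] fin_subgroup_inverse[OF F]
            fin_subgroup_power[OF F] D(1) R'(3))
      then have gF: "cj g ` F = F" using fin_subgroup_card_image_eq[OF F F refl g(1)] by blast
      have aa: "a * a \<in> N" "a * a \<in> N'"
        using dihedral_normal_square[OF F d N(1) k] dihedral_normal_square[OF F d N(2) l] by auto
      have "cj g ` N \<subseteq> N'"
      proof clarify
        fix x assume x: "x \<in> N"
        have pow: "cj g y \<in> N'" if y: "y \<in> N" "y = a ^ j" for y j
        proof -
          obtain m where "y = (a * a) ^ m" using dihedral_power_mem[OF fN(1) aa(1) aN] y by blast
          then have "cj g y = (a * a) ^ m" by (simp only: cj_power[OF g0] cj_mult[OF g0] g(2))
          then show ?thesis using fin_subgroup_power[OF fN(2) aa(2)] by simp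
        qed
        consider j where "x = a ^ j" | j where "x = b * a ^ j"
          using D(14)[OF normal_subD(2)[OF N(1) x]] by blast
        then show "cj g x \<in> N'"
        proof cases
          case 1 then show ?thesis using pow x by blast
        next
          case 2
          obtain m where m: "inverse (a ^ k) = (a ^ k) ^ m"
            using inverse_is_power[OF F fin_subgroup_power[OF F D(1)]] by blast
          define y where "y = inverse r * x"
          have r0: "r \<noteq> 0" using R(4) by auto
          have "y = inverse (a ^ k) * a ^ j"
            unfolding y_def r_def 2
              using a0 uq_nonzero[OF D(4)] by (simp add: nonzero_inverse_mult_distrib mult.assoc)
          then have "y = a ^ (k * m + j)" unfolding m by (simp add: power_mult power_add)
          moreover have "y \<in> N" unfolding y_def
            using fin_subgroupD(4)[OF fN(1) fin_subgroup_inverse[OF fN(1)] x] k r_def by simp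
          ultimately have "cj g y \<in> N'" using pow by blast
          moreover have "x = r * y" using r0 by (simp add: y_def)
          then have "cj g x = r' * cj g y" by (simp only: cj_mult[OF g0] g(3))
          ultimately show ?thesis using fin_subgroupD(4)[OF fN(2)] l r'_def by simp
        qed
      qed
      then have "cj g ` N = N'"
        using fin_subgroup_card_image_eq[OF fN(2,1) re_dist_card[OF s fin_subgroupD(1)[OF fN(1)]
          fin_subgroupD(1)[OF fN(2)]] g(1)] by blast
      then show ?thesis using gF g(1) by blast
    qed
  qed
qed

lemma central_re_dist_eq:
  assumes fN: "fin_subgroup N" "fin_subgroup N'" and s: "re_dist N N'" and c: "N \<subseteq> {1, - 1}"
    shows "N = N'"
proof (rule re_dist_subset_eq[OF fN s])
  show "N \<subseteq> N'"
  proof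
    fix x assume x: "x \<in> N"
    obtain y where y: "y \<in> N'" "qre y = qre x"
      using re_dist_ex[OF s fin_subgroupD(1)[OF fN(1)] x] by blast
    have "x * y = y * x" using c x by auto
    then show "x \<in> N'" using same_re_comm_mem[OF fN(2) y(1) fin_subgroupD(3)[OF fN(1) x] y(2)]
      by blast
  qed
qed

lemma cyclic_normal_pair:
  assumes a: "cyclic F a" and N: "normal_sub N F" "normal_sub N' F" and s: "re_dist N N'"
  shows "N = N'"
proof (rule re_dist_subset_eq[OF normal_subD(1)[OF N(1)] normal_subD(1)[OF N(2)] s])
  show "N \<subseteq> N'"
  proof
    fix x assume x: "x \<in> N"
    obtain y where y: "y \<in> N'" "qre y = qre x"
      using re_dist_ex[OF s fin_subgroupD(1)[OF normal_subD(1)[OF N(1)]] x] by blast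
    have "x * y = y * x" using cyclic_commutes[OF a normal_subD(2)[OF N(1) x] normal_subD(2)[OF N(2)
      y(1)]] .
    then show "x \<in> N'" using same_re_comm_mem[OF normal_subD(1)[OF N(2)] y(1) fin_subgroupD(3)[OF
      normal_subD(1)[OF N(1)] x] y(2)] by blast
  qed
qed

lemma noncentral_not_central:
  assumes F: "fin_subgroup F" and c: "a \<in> F" "b \<in> F" "a * b \<noteq> b * a"
    and x: "qnorm2 x = 1" "x \<noteq> 1" "x \<noteq> - 1"
  shows "\<exists>v\<in>F. x * v \<noteq> v * x"
proof (rule ccontr)
  assume "\<not> ?thesis"
  then have "a * x = x * a" "b * x = x * b" using c by auto
  then show False using commute_trans[OF x] c(3) by blast
qed

text \<open>The three cyclic subgroups of order 4 are normal, so conjugation inside \<open>F\<close>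
  does not permute them. Any two noncommuting pairs have the same real parts, however, and a
  conjugation between them preserves \<open>F\<close>.\<close>

lemma q8_normal_pair:
  assumes F: "fin_subgroup F" and d: "dihedral F a b" and z: "qre a = 0"
    and N: "normal_sub N F" "normal_sub N' F" and s: "re_dist N N'"
  shows "\<exists>g\<in>uq. cj g ` F = F \<and> cj g ` N = N'"
proof -
  note D = dihedralD[OF F d]
  note fN = normal_subD(1)[OF N(1)] normal_subD(1)[OF N(2)]
  have mx: "maxre F 0" using D(11) z by simp
  note pure = pure_maxre_0[OF F D(12) mx]
  show ?thesis
  proof (cases "N \<subseteq> {1, - 1}")
    case True then show ?thesis using central_re_dist_eq[OF fN s] normal_pair_trivial by blast
  next
    case False
    then obtain u where u: "u \<in> N" "u \<noteq> 1" "u \<noteq> - 1" by blast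
    have uF: "u \<in> F" by (rule normal_subD(2)[OF N(1) u(1)])
    have ru: "qre u = 0" using pure[OF uF] u by blast
    show ?thesis
    proof (cases "\<exists>v\<in>N. u * v \<noteq> v * u")
      case True
      then obtain v where v: "v \<in> N" "u * v \<noteq> v * u" by blast
      have "dihedral F u v" by (rule quaternion_group[OF F D(12) mx uF normal_subD(2)[OF N(1) v(1)]
        v(2)])
      then have "x \<in> N" if "x \<in> F" for x
        using dihedralD(14)[OF F _ that] fin_subgroup_power[OF fN(1) u(1)] fin_subgroupD(4)[OF fN(1)
          v(1)] by blast
      then have "N = N'" using re_dist_subset_eq[OF fN(2,1) re_dist_sym[OF s]] normal_subD(2)[OF
        N(2)] by blast
      then show ?thesis by (rule normal_pair_trivial)
    next
      case comm: False
      obtain u' where u': "u' \<in> N'" "qre u' = qre u"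
        using re_dist_ex[OF s fin_subgroupD(1)[OF fN(1)] u(1)] by blast
      have uF': "u' \<in> F" by (rule normal_subD(2)[OF N(2) u'(1)])
      have nc': "u' \<noteq> 1" "u' \<noteq> - 1" using u'(2) ru by auto
      have n: "qnorm2 u = 1" "qnorm2 u' = 1" using fin_subgroupD(3)[OF F] uF uF' by auto
      obtain v where v: "v \<in> F" "u * v \<noteq> v * u"
        using noncentral_not_central[OF F D(1,2,8) n(1) u(2,3)] by blast
      obtain v' where v': "v' \<in> F" "u' * v' \<noteq> v' * u'"
        using noncentral_not_central[OF F D(1,2,8) n(2) nc'] by blast
      note nv = noncommuting_noncentral[OF v(2)] noncommuting_noncentral[OF v'(2)]
      have r: "qre v = 0" "qre v' = 0" "qre (u * v) = 0" "qre (u' * v') = 0"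
        using pure[OF v(1)] pure[OF v'(1)] pure[OF fin_subgroupD(4)[OF F uF v(1)]] pure[OF
          fin_subgroupD(4)[OF F uF' v'(1)]] nv by blast+
      obtain g where g: "qnorm2 g = 1" "cj g u = u'" "cj g v = v'"
        using conj_pair[OF n(1) fin_subgroupD(3)[OF F v(1)] n(2) fin_subgroupD(3)[OF F v'(1)]] u'(2)
          r by auto
      have g0: "g \<noteq> 0" using g by auto
      have d': "dihedral F u v" by (rule quaternion_group[OF F D(12) mx uF v])
      have "cj g ` F \<subseteq> F" by (rule dihedral_image_subset[OF d' F g(1) _ _ F]) (simp_all only: g uF'
        v'(1))
      then have gF: "cj g ` F = F" using fin_subgroup_card_image_eq[OF F F refl g(1)] by blast
      have "cj g ` N \<subseteq> N'"
      proof clarify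
        fix x assume x: "x \<in> N"
        have "x * u = u * x" using comm x by auto
        then obtain k where "x = u ^ k"
          using maxre_generator_power[OF F D(12) mx uF ru u(2,3) normal_subD(2)[OF N(1) x]] by blast
        then show "cj g x \<in> N'" using fin_subgroup_power[OF fN(2) u'(1)] cj_power[OF g0] g(2)
          by simp
      qed
      then have "cj g ` N = N'"
        using fin_subgroup_card_image_eq[OF fN(2,1) re_dist_card[OF s fin_subgroupD(1)[OF fN(1)]
          fin_subgroupD(1)[OF fN(2)]] g(1)] by blast
      then show ?thesis using gF g(1) by blast
    qed
  qed
qed

lemma index_le_2_contains_ab:
  assumes F: "fin_subgroup F" and p: "polyhedral F c a b" and N: "normal_sub N F" "index_le_2 F N"
  shows "a * b \<in> N" "a \<in> N \<Longrightarrow> N = F" "b \<in> N \<longleftrightarrow> a \<in> N"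
proof -
  note P = polyhedralD[OF F p]
  show 1: "a \<in> N \<Longrightarrow> N = F" using polyhedral_normal_full[OF F p N(1)] P(6) by blast
  moreover have "b \<in> N \<Longrightarrow> N = F" using polyhedral_normal_full[OF F p N(1)] P(7) by blast
  ultimately show "a * b \<in> N" "b \<in> N \<longleftrightarrow> a \<in> N"
    using N(2) P(1,2) fin_subgroupD(4)[OF F P(1,2)] unfolding index_le_2_def by blast+
qed

text \<open>If \<open>a\<close>, and hence \<open>b\<close>, is outside \<open>N\<close>, each
  generator switches between \<open>N\<close> and its complement. Membership is then the parity of
  the length of a word, the same for \<open>N\<close> and \<open>N'\<close>.\<close>

lemma index_le_2_unique:
  assumes F: "fin_subgroup F" and p: "polyhedral F c a b" and N: "normal_sub N F" "index_le_2 F N"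
    and N': "normal_sub N' F" "index_le_2 F N'" and s: "re_dist N N'"
  shows "N = N'"
proof (cases "a \<in> N \<or> a \<in> N'")
  case True
  then have "N = F \<or> N' = F" using index_le_2_contains_ab(2)[OF F p N] index_le_2_contains_ab(2)[OF
    F p N'] by blast
  then show ?thesis
    using re_dist_subset_eq[OF normal_subD(1)[OF N(1)] normal_subD(1)[OF N'(1)] s]
      re_dist_subset_eq[OF normal_subD(1)[OF N'(1)] normal_subD(1)[OF N(1)] re_dist_sym[OF s]]
      normal_subD(2)[OF N(1)] normal_subD(2)[OF N'(1)] by blast
next
  case False
  note P = polyhedralD[OF F p]
  have ab: "s \<notin> N" "s \<notin> N'" "s \<in> F" if "s \<in> {a, b}" for s
    using False index_le_2_contains_ab(3)[OF F p N] index_le_2_contains_ab(3)[OF F p N'] P(1,2) that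
      by auto
  have step: "s * y \<in> M \<longleftrightarrow> y \<notin> M" if M: "normal_sub M F" "index_le_2 F M" and s: "s \<notin> M" "s \<in> F"
    and y: "y \<in> F" for M s y
  proof
    assume sy: "s * y \<in> M"
    show "y \<notin> M"
    proof
      assume y: "y \<in> M"
      have "s * y * inverse y \<in> M" by (rule fin_subgroupD(4)[OF normal_subD(1)[OF M(1)] sy
        fin_subgroup_inverse[OF normal_subD(1)[OF M(1)] y]])
      then show False using s(1) fin_subgroupD(3)[OF normal_subD(1)[OF M(1)] y]
        by (simp add: mult.assoc)
    qed
  next
    assume "y \<notin> M" then show "s * y \<in> M" using M(2) s y unfolding index_le_2_def by blast
  qed
  have "x \<in> F \<and> (x \<in> N \<longleftrightarrow> x \<in> N')" if "x \<in> mgen {a, b}" for x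
    using that
  proof induction
    case mgen_one then show ?case using fin_subgroupD(2)[OF F] fin_subgroupD(2)[OF normal_subD(1)[OF
      N(1)]] fin_subgroupD(2)[OF normal_subD(1)[OF N'(1)]] by blast
  next
    case (mgen_mult s y)
    then show ?case
      using step[OF N ab(1,3), of s y] step[OF N' ab(2,3), of s y] ab(3)[of s] fin_subgroupD(4)[OF
        F, of s y] by blast
  qed
  then show ?thesis using normal_subD(2)[OF N(1)] normal_subD(2)[OF N'(1)] P(12) by blast
qed

text \<open>Normal subgroups are central, of index at most 2, or the quaternion group. The last two
  kinds are told apart by the real part 1/2 of \<open>a * b\<close>, which belongs to every normal
  subgroup of index at most 2.\<close>

lemma polyhedral_normal_unique:
  assumes F: "fin_subgroup F" and p: "polyhedral F c a b" and N: "normal_sub N F" "normal_sub N' F"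
    and s: "re_dist N N'"
  shows "N = N'"
proof -
  note P = polyhedralD[OF F p]
  note fN = normal_subD(1)[OF N(1)] normal_subD(1)[OF N(2)]
  have mixed: False if M: "normal_sub M F" "normal_sub M' F" "re_dist M M'" and i: "index_le_2 F M"
    and d: "dihedral M' e1 e2" "qre e1 = 0" for M M' e1 e2
  proof -
    obtain y where "y \<in> M'" "qre y = 1 / 2"
      using re_dist_ex[OF M(3) fin_subgroupD(1)[OF normal_subD(1)[OF M(1)]]
        index_le_2_contains_ab(1)[OF F p M(1) i]] P(8) by auto
    then show False using polyhedral_normal_q8(3)[OF F p M(2) d] by fastforce
  qed
  show ?thesis
  proof (cases "N \<subseteq> {1, - 1} \<or> N' \<subseteq> {1, - 1}")
    case True then show ?thesis using central_re_dist_eq[OF fN s] central_re_dist_eq[OF fN(2,1)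
      re_dist_sym[OF s]] by blast
  next
    case False
    then obtain x y where "x \<in> N" "x \<noteq> 1" "x \<noteq> - 1" "y \<in> N'" "y \<noteq> 1" "y \<noteq> - 1" by blast
    then have "index_le_2 F N \<or> (\<exists>e1 e2. dihedral N e1 e2 \<and> qre e1 = 0)" "index_le_2 F N'
      \<or> (\<exists>e1 e2. dihedral N' e1 e2 \<and> qre e1 = 0)"
      using polyhedral_normal_cases[OF F p N(1)] polyhedral_normal_cases[OF F p N(2)] by blast+
    then show ?thesis
      using index_le_2_unique[OF F p N(1) _ N(2) _ s] mixed[OF N s] mixed[OF N(2,1) re_dist_sym[OF
        s]]
        polyhedral_normal_q8(1)[OF F p N(1)] polyhedral_normal_q8(1)[OF F p N(2)] by blast
  qed
qed

lemma normal_pair_same: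
  assumes F: "fin_subgroup F" and N: "normal_sub N F" "normal_sub N' F" and s: "re_dist N N'"
  shows "\<exists>g\<in>uq. cj g ` F = F \<and> cj g ` N = N'"
proof (cases rule: fin_subgroup_cases[OF F])
  case (1 a)
  show ?thesis by (rule normal_pair_trivial[OF cyclic_normal_pair[OF 1 N s]])
next
  case (2 a b)
  show ?thesis
  proof (cases "qre a = 0")
    case True
    show ?thesis by (rule q8_normal_pair[OF F 2 True N s])
  next
    case False
    have "0 < qre a" using dihedralD(16)[OF F 2] False by (rule order_le_neq_trans[OF _ not_sym])
    show ?thesis by (rule dihedral_normal_pair[OF F 2 \<open>0 < qre a\<close> N s])
  qed
next
  case (3 c a b)
  show ?thesis by (rule normal_pair_trivial[OF polyhedral_normal_unique[OF F 3 N s]])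
qed

lemma normal_sub_cj:
  assumes N: "normal_sub N F" and g: "qnorm2 g = 1" shows "normal_sub (cj g ` N) (cj g ` F)"
  unfolding normal_sub_def
proof (intro conjI ballI)
  have g0: "g \<noteq> 0" using g by auto
  show "fin_subgroup (cj g ` N)" by (rule fin_subgroup_cj_image[OF normal_subD(1)[OF N] g])
  show "cj g ` N \<subseteq> cj g ` F" using normal_subD(2)[OF N] by blast
  fix f x assume "f \<in> cj g ` F" "x \<in> cj g ` N"
  then obtain f' x' where *: "f' \<in> F" "f = cj g f'" "x' \<in> N" "x = cj g x'" by blast
  have "cj f x = cj g (cj f' x')" unfolding *(2,4) cj_mult[OF g0] cj_inverse[OF g0] ..
  then show "cj f x \<in> cj g ` N" using normal_subD(3)[OF N *(1,3)] by blast
qed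

text \<open>The groups are matched by one conjugation; a second one, which preserves
  \<open>F'\<close>, corrects the normal subgroup. Applied on both sides of a product it makes
  projections and kernels coincide simultaneously.\<close>

theorem normal_pair:
  assumes F: "fin_subgroup F" "fin_subgroup F'" and N: "normal_sub N F" "normal_sub N' F'"
    and s: "re_dist F F'" "re_dist N N'"
  shows "\<exists>g\<in>uq. cj g ` F = F' \<and> cj g ` N = N'"
proof -
  obtain g where g: "qnorm2 g = 1" "cj g ` F = F'" using re_dist_conj[OF F s(1)] by blast
  have "normal_sub (cj g ` N) F'" using normal_sub_cj[OF N(1) g(1)] g(2) by simp
  moreover have "re_dist (cj g ` N) N'" using re_dist_trans[OF re_dist_cj[OF g(1)] s(2)] .
  ultimately obtain h where h: "qnorm2 h = 1" "cj h ` F' = F'" "cj h ` cj g ` N = N'"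
    using normal_pair_same[OF F(2) _ N(2)] by blast
  have "cj (h * g) ` A = cj h ` cj g ` A" for A unfolding image_image cj_cj ..
  then show ?thesis using g h by (intro bexI[of _ "h * g"]) auto
qed

section \<open>Finite subgroups of pairs of unit quaternions\<close>

definition fin_subgroup2 :: "(quat \<times> quat) set \<Rightarrow> bool" where
  "fin_subgroup2 G \<longleftrightarrow> finite G \<and> (1, 1) \<in> G \<and> (\<forall>l r. (l, r) \<in> G \<longrightarrow> qnorm2 l = 1 \<and> qnorm2 r = 1) \<and>
     (\<forall>l r l' r'. (l, r) \<in> G \<longrightarrow> (l', r') \<in> G \<longrightarrow> (l * l', r * r') \<in> G)"

lemma fin_subgroup2D:
  assumes "fin_subgroup2 G"
  shows "finite G" "(1, 1) \<in> G" "(l, r) \<in> G \<Longrightarrow> qnorm2 l = 1" "(l, r) \<in> G \<Longrightarrow> qnorm2 r = 1"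
    "(l, r) \<in> G \<Longrightarrow> (l', r') \<in> G \<Longrightarrow> (l * l', r * r') \<in> G"
  using assms unfolding fin_subgroup2_def by blast+

text \<open>Goursat: a subgroup of a product is determined by its projections \<open>L\<close>, \<open>R\<close>, the kernels \<open>M\<close>,
  \<open>N\<close> and an isomorphism from \<open>L / M\<close> to \<open>R / N\<close>.\<close>

abbreviation lft :: "(quat \<times> quat) set \<Rightarrow> quat set" where "lft G \<equiv> fst ` G"
abbreviation rgt :: "(quat \<times> quat) set \<Rightarrow> quat set" where "rgt G \<equiv> snd ` G"
definition kl :: "(quat \<times> quat) set \<Rightarrow> quat set" where "kl G = {l. (l, 1) \<in> G}"
definition kr :: "(quat \<times> quat) set \<Rightarrow> quat set" where "kr G = {r. (1, r) \<in> G}"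

lemma lftE: "l \<in> lft G \<Longrightarrow> (\<And>r. (l, r) \<in> G \<Longrightarrow> thesis) \<Longrightarrow> thesis"
  and rgtE: "r \<in> rgt G \<Longrightarrow> (\<And>l. (l, r) \<in> G \<Longrightarrow> thesis) \<Longrightarrow> thesis"
  and lftI: "(l, r) \<in> G \<Longrightarrow> l \<in> lft G" and rgtI: "(l, r) \<in> G \<Longrightarrow> r \<in> rgt G"
  by force+

lemma fin_subgroup2_swap: "fin_subgroup2 G \<Longrightarrow> fin_subgroup2 (prod.swap ` G)"
  unfolding fin_subgroup2_def by auto

lemma swap_simps: "lft (prod.swap ` G) = rgt G" "rgt (prod.swap ` G) = lft G" "kl (prod.swap ` G) =
  kr G"
  "kr (prod.swap ` G) = kl G"
  by (auto simp: kl_def kr_def image_image)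

lemma fin_subgroup2_power: "fin_subgroup2 G \<Longrightarrow> (l, r) \<in> G \<Longrightarrow> (l ^ n, r ^ n) \<in> G"
  by (induction n) (auto simp: fin_subgroup2D(2,5))

lemma fin_subgroup_lft:
  assumes G: "fin_subgroup2 G" shows "fin_subgroup (lft G)"
  unfolding fin_subgroup_def
proof (intro conjI ballI)
  show "finite (lft G)" using fin_subgroup2D(1)[OF G] by simp
  show "1 \<in> lft G" by (rule lftI[OF fin_subgroup2D(2)[OF G]])
  show "lft G \<subseteq> uq" using fin_subgroup2D(3)[OF G] by auto
  fix x y assume "x \<in> lft G" "y \<in> lft G"
  then show "x * y \<in> lft G" by (elim lftE) (rule lftI[OF fin_subgroup2D(5)[OF G]])
qed

lemma fin_subgroup_rgt: "fin_subgroup2 G \<Longrightarrow> fin_subgroup (rgt G)"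
  using fin_subgroup_lft[OF fin_subgroup2_swap] by (simp add: swap_simps)

lemma fin_subgroup2_inverse:
  assumes G: "fin_subgroup2 G" and p: "(l, r) \<in> G" shows "(inverse l, inverse r) \<in> G"
proof -
  obtain m where m: "m > 0" "l ^ m = 1"
    using fin_subgroup_torsion[OF fin_subgroup_lft[OF G] lftI[OF p]] by blast
  obtain n where n: "n > 0" "r ^ n = 1"
    using fin_subgroup_torsion[OF fin_subgroup_rgt[OF G] rgtI[OF p]] by blast
  define k where "k = m * n - 1"
  have k: "Suc k = m * n" using m n by (simp add: k_def)
  have "l ^ Suc k = 1" unfolding k power_mult m(2) by simp
  moreover have "r ^ Suc k = 1" unfolding k mult.commute[of m] power_mult n(2) by simp
  ultimately have "inverse l = l ^ k" "inverse r = r ^ k" using inverse_unique by simp_all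
  then show ?thesis using fin_subgroup2_power[OF G p] by simp
qed

lemma fin_subgroup2_cj: "fin_subgroup2 G \<Longrightarrow> (f, w) \<in> G \<Longrightarrow> (l, r) \<in> G \<Longrightarrow> (cj f l, cj w r) \<in> G"
  by (intro fin_subgroup2D(5) fin_subgroup2_inverse)

lemma normal_sub_kl:
  assumes G: "fin_subgroup2 G" shows "normal_sub (kl G) (lft G)"
  unfolding normal_sub_def
proof (intro conjI ballI)
  show "fin_subgroup (kl G)" unfolding fin_subgroup_def
  proof (intro conjI ballI)
    have "kl G \<subseteq> lft G" by (auto simp: kl_def intro: lftI)
    then show "finite (kl G)" using fin_subgroup2D(1)[OF G] finite_subset by blast
    show "1 \<in> kl G" using fin_subgroup2D(2)[OF G] by (simp add: kl_def)
    show "kl G \<subseteq> uq" using fin_subgroup2D(3)[OF G] by (auto simp: kl_def)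
    show "x * y \<in> kl G" if "x \<in> kl G" "y \<in> kl G" for x y
      using fin_subgroup2D(5)[OF G, of x 1 y 1] that by (simp add: kl_def)
  qed
  show "kl G \<subseteq> lft G" by (auto simp: kl_def intro: lftI)
  fix f x assume f: "f \<in> lft G" and x: "x \<in> kl G"
  obtain w where w: "(f, w) \<in> G" using f by (rule lftE)
  have "(cj f x, cj w 1) \<in> G" by (rule fin_subgroup2_cj[OF G w]) (use x in \<open>simp add: kl_def\<close>)
  moreover have "cj w 1 = 1" using fin_subgroup2D(4)[OF G w] by simp
  ultimately show "cj f x \<in> kl G" by (simp add: kl_def)
qed

lemma normal_sub_kr: "fin_subgroup2 G \<Longrightarrow> normal_sub (kr G) (rgt G)"
  using normal_sub_kl[OF fin_subgroup2_swap] by (simp add: swap_simps)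

lemma fiber_diff:
  assumes G: "fin_subgroup2 G" and p: "(l, r) \<in> G" "(l, r') \<in> G" shows "inverse r * r' \<in> kr G"
  using fin_subgroup2D(5)[OF G fin_subgroup2_inverse[OF G p(1)] p(2)] fin_subgroup2D(3)[OF G p(1)]
    by (simp add: kr_def)

lemma fiber_mult: "fin_subgroup2 G \<Longrightarrow> (l, r) \<in> G \<Longrightarrow> n \<in> kr G \<Longrightarrow> (l, r * n) \<in> G"
  using fin_subgroup2D(5)[of G l r 1 n] by (simp add: kr_def)

lemma fiber_eq:
  assumes G: "fin_subgroup2 G" and p: "(l, r) \<in> G" and d: "inverse r * r' \<in> kr G"
    shows "(l, r') \<in> G"
proof -
  have "r \<noteq> 0" using fin_subgroup2D(4)[OF G p] by auto
  then show ?thesis using fiber_mult[OF G p d] by simp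
qed

section \<open>Pairs of real parts, and reduction to equal projections and kernels\<close>

definition re_dist2 :: "(quat \<times> quat) set \<Rightarrow> (quat \<times> quat) set \<Rightarrow> bool" where
  "re_dist2 G H \<longleftrightarrow> (\<forall>s t. card {p \<in> G. qre (fst p) = s \<and> qre (snd p) = t} = card {p \<in> H. qre (fst p)
    = s \<and> qre (snd p) = t})"

lemma re_dist2_sym: "re_dist2 G H \<Longrightarrow> re_dist2 H G"
  by (simp add: re_dist2_def)

lemma re_dist2_ex:
  assumes "re_dist2 G H" "fin_subgroup2 G" "(l, r) \<in> G" shows "\<exists>l' r'. (l', r') \<in> H \<and> qre l' = qre l
    \<and> qre r' = qre r"
proof -
  have "card {p \<in> G. qre (fst p) = qre l \<and> qre (snd p) = qre r} \<noteq> 0"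
    using assms(3) fin_subgroup2D(1)[OF assms(2)] by auto
  then have "card {p \<in> H. qre (fst p) = qre l \<and> qre (snd p) = qre r} \<noteq> 0"
    using assms(1) by (simp add: re_dist2_def)
  then have "{p \<in> H. qre (fst p) = qre l \<and> qre (snd p) = qre r} \<noteq> {}" by (metis card.empty)
  then show ?thesis by auto
qed

lemma re_dist2_swap:
  assumes "re_dist2 G H" shows "re_dist2 (prod.swap ` G) (prod.swap ` H)"
proof -
  have "{p \<in> prod.swap ` G. qre (fst p) = s \<and> qre (snd p) = t} = prod.swap ` {p \<in> G. qre (fst p) = t
    \<and> qre (snd p) = s}" for G s t
    by auto
  then show ?thesis using assms by (simp add: re_dist2_def card_image)
qed

lemma re_dist2_kr:
  assumes "re_dist2 G H" "fin_subgroup2 G" "fin_subgroup2 H" shows "re_dist (kr G) (kr H)"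
proof -
  have "card {r \<in> kr G. qre r = t} = card {p \<in> G. qre (fst p) = 1 \<and> qre (snd p) = t}"
    if G: "fin_subgroup2 G" for G t
  proof -
    have "{p \<in> G. qre (fst p) = 1 \<and> qre (snd p) = t} = Pair 1 ` {r \<in> kr G. qre r = t}"
      using fin_subgroup2D(3)[OF G] qre_eq_one by (auto simp: kr_def)
    then show ?thesis by (simp add: card_image inj_on_def)
  qed
  then show ?thesis using assms by (simp add: re_dist2_def re_dist_def)
qed

text \<open>The fibres of the left projection are cosets of \<open>kr G\<close>, all of the same
  size. Dividing by it passes the distribution from the group on to its projection.\<close>

lemma card_lft_fibers:
  assumes G: "fin_subgroup2 G" shows "card {p \<in> G. qre (fst p) = s} = card (kr G) * card {l \<in> lft G.
    qre l = s}"
proof -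
  have fin: "finite {l \<in> lft G. qre l = s}" using fin_subgroup2D(1)[OF G] by simp
  have f: "card {p \<in> G. fst p = l} = card (kr G)" if l: "l \<in> lft G" for l
  proof -
    obtain r where r: "(l, r) \<in> G" using l by (rule lftE)
    have r0: "r \<noteq> 0" using fin_subgroup2D(4)[OF G r] by auto
    have "{p \<in> G. fst p = l} = (\<lambda>n. (l, r * n)) ` kr G"
    proof
      show "{p \<in> G. fst p = l} \<subseteq> (\<lambda>n. (l, r * n)) ` kr G"
      proof
        fix p assume "p \<in> {p \<in> G. fst p = l}"
        then obtain y where y: "p = (l, y)" "(l, y) \<in> G" by (cases p) auto
        then have "inverse r * y \<in> kr G" using fiber_diff[OF G r] by simp
        then show "p \<in> (\<lambda>n. (l, r * n)) ` kr G"
          using r0 y(1) by (intro image_eqI[of _ _ "inverse r * y"]) simp_all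
      qed
      show "(\<lambda>n. (l, r * n)) ` kr G \<subseteq> {p \<in> G. fst p = l}" using fiber_mult[OF G r] by auto
    qed
    moreover have "inj_on (\<lambda>n. (l, r * n)) (kr G)" using r0 by (auto simp: inj_on_def)
    ultimately show ?thesis by (simp add: card_image)
  qed
  have "{p \<in> G. qre (fst p) = s} = (\<Union>l\<in>{l \<in> lft G. qre l = s}. {p \<in> G. fst p = l})" by auto
  then have "card {p \<in> G. qre (fst p) = s} = (\<Sum>l\<in>{l \<in> lft G. qre l = s}. card {p \<in> G. fst p = l})"
    using fin fin_subgroup2D(1)[OF G] by (simp only:) (rule card_UN_disjoint, auto)
  also have "\<dots> = (\<Sum>l\<in>{l \<in> lft G. qre l = s}. card (kr G))" by (rule sum.cong) (auto simp: f)
  finally show ?thesis by simp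
qed

lemma re_dist2_fst:
  assumes j: "re_dist2 G H" and f: "finite G" "finite H"
  shows "card {p \<in> G. qre (fst p) = s} = card {p \<in> H. qre (fst p) = s}"
proof -
  let ?T = "qre ` snd ` G \<union> qre ` snd ` H"
  have "card {p \<in> K. qre (fst p) = s} = (\<Sum>t\<in>?T. card {p \<in> K. qre (fst p) = s \<and> qre (snd p) = t})"
    if K: "K = G \<or> K = H" for K
  proof -
    have "{p \<in> K. qre (fst p) = s} = (\<Union>t\<in>?T. {p \<in> K. qre (fst p) = s \<and> qre (snd p) = t})"
      using K by auto
    then show ?thesis using f K by (simp only:) (rule card_UN_disjoint, auto)
  qed
  then show ?thesis using j by (simp add: re_dist2_def)
qed

lemma re_dist2_lft:
  assumes j: "re_dist2 G H" and G: "fin_subgroup2 G" and H: "fin_subgroup2 H"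
    shows "re_dist (lft G) (lft H)"
  unfolding re_dist_def
proof
  fix s
  have "card (kr G) = card (kr H)"
    using re_dist_card[OF re_dist2_kr[OF j G H] fin_subgroupD(1) fin_subgroupD(1)] normal_subD(1)[OF
      normal_sub_kr] G H by blast
  moreover have "card (kr G) > 0" using fin_subgroupD(1,2)[OF normal_subD(1)[OF normal_sub_kr[OF
    G]]] by (auto simp: card_gt_0_iff)
  ultimately show "card {x \<in> lft G. qre x = s} = card {x \<in> lft H. qre x = s}"
    using re_dist2_fst[OF j fin_subgroup2D(1)[OF G] fin_subgroup2D(1)[OF H], of s]
      card_lft_fibers[OF G, of s] card_lft_fibers[OF H, of s] by simp
qed

lemma re_dist2_rgt: "re_dist2 G H \<Longrightarrow> fin_subgroup2 G \<Longrightarrow> fin_subgroup2 H \<Longrightarrow> re_dist (rgt G) (rgt H)"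
  and re_dist2_kl: "re_dist2 G H \<Longrightarrow> fin_subgroup2 G \<Longrightarrow> fin_subgroup2 H \<Longrightarrow> re_dist (kl G) (kl H)"
  using re_dist2_lft[OF re_dist2_swap fin_subgroup2_swap fin_subgroup2_swap] re_dist2_kr[OF
    re_dist2_swap fin_subgroup2_swap fin_subgroup2_swap] by (simp_all add: swap_simps)

abbreviation cj2 :: "quat \<Rightarrow> quat \<Rightarrow> quat \<times> quat \<Rightarrow> quat \<times> quat" where
  "cj2 g h \<equiv> \<lambda>p. (cj g (fst p), cj h (snd p))"

definition conj_equiv :: "(quat \<times> quat) set \<Rightarrow> (quat \<times> quat) set \<Rightarrow> bool" where
  "conj_equiv G H \<longleftrightarrow> (\<exists>g\<in>uq. \<exists>h\<in>uq. cj2 g h ` G = H)"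

lemma conj_equiv_refl: "conj_equiv G G"
  unfolding conj_equiv_def by (intro bexI[of _ 1]) auto

lemma conj_equiv_trans:
  assumes "conj_equiv G H" "conj_equiv H K" shows "conj_equiv G K"
proof -
  obtain g h where 1: "qnorm2 g = 1" "qnorm2 h = 1" "cj2 g h ` G = H"
    using assms(1) by (auto simp: conj_equiv_def)
  obtain g' h' where 2: "qnorm2 g' = 1" "qnorm2 h' = 1" "cj2 g' h' ` H = K"
    using assms(2) by (auto simp: conj_equiv_def)
  have "cj2 (g' * g) (h' * h) ` G = cj2 g' h' ` cj2 g h ` G"
    unfolding image_image by (simp only: cj_cj fst_conv snd_conv)
  then show ?thesis unfolding conj_equiv_def
    using 1 2 by (intro bexI[of _ "g' * g"] bexI[of _ "h' * h"]) auto
qed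

lemma conj_equiv_swap:
  assumes "conj_equiv (prod.swap ` G) (prod.swap ` H)" shows "conj_equiv G H"
proof -
  obtain g h where 1: "qnorm2 g = 1" "qnorm2 h = 1" "cj2 g h ` prod.swap ` G = prod.swap ` H"
    using assms by (auto simp: conj_equiv_def)
  have "H = prod.swap ` prod.swap ` H" by (simp add: image_image)
  also have "\<dots> = cj2 h g ` G" unfolding 1(3)[symmetric] image_image by simp
  finally show ?thesis unfolding conj_equiv_def using 1 by (intro bexI[of _ h] bexI[of _ g]) auto
qed

lemma fin_subgroup2_cj2:
  assumes G: "fin_subgroup2 G" and g: "qnorm2 g = 1" "qnorm2 h = 1"
    shows "fin_subgroup2 (cj2 g h ` G)"
  unfolding fin_subgroup2_def
proof (intro conjI allI impI)
  have 0: "g \<noteq> 0" "h \<noteq> 0" using g by auto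
  show "finite (cj2 g h ` G)" using fin_subgroup2D(1)[OF G] by simp
  show "(1, 1) \<in> cj2 g h ` G" by (rule image_eqI[OF _ fin_subgroup2D(2)[OF G]]) (use 0 in simp)
  fix l r assume p: "(l, r) \<in> cj2 g h ` G"
  then obtain l0 r0 where p0: "(l0, r0) \<in> G" "l = cj g l0" "r = cj h r0" by auto
  show "qnorm2 l = 1" "qnorm2 r = 1" unfolding p0 qnorm2_cj[OF g(1)] qnorm2_cj[OF g(2)]
    using fin_subgroup2D(3,4)[OF G p0(1)] by auto
  fix l' r' assume "(l', r') \<in> cj2 g h ` G"
  then obtain l1 r1 where p1: "(l1, r1) \<in> G" "l' = cj g l1" "r' = cj h r1" by auto
  have "(l * l', r * r') = cj2 g h (l0 * l1, r0 * r1)"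
    unfolding p0 p1 fst_conv snd_conv cj_mult[OF 0(1)] cj_mult[OF 0(2)] ..
  then show "(l * l', r * r') \<in> cj2 g h ` G" using fin_subgroup2D(5)[OF G p0(1) p1(1)] by blast
qed

lemma cj2_parts:
  assumes g: "qnorm2 g = 1" "qnorm2 h = 1"
  shows "lft (cj2 g h ` G) = cj g ` lft G" "rgt (cj2 g h ` G) = cj h ` rgt G"
    "kl (cj2 g h ` G) = cj g ` kl G" "kr (cj2 g h ` G) = cj h ` kr G"
proof -
  have 0: "g \<noteq> 0" "h \<noteq> 0" using g by auto
  have one: "x = 1" if "cj k x = 1" "k \<noteq> 0" for k x
    using that(1) unfolding cj_eq_iff[OF that(2)] using that(2) by simp
  show "lft (cj2 g h ` G) = cj g ` lft G" "rgt (cj2 g h ` G) = cj h ` rgt G"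
    by (simp_all add: image_image)
  show "kl (cj2 g h ` G) = cj g ` kl G"
  proof (intro Set.set_eqI iffI)
    fix l assume "l \<in> kl (cj2 g h ` G)"
    then obtain x y where p: "(x, y) \<in> G" "l = cj g x" "cj h y = 1" by (auto simp: kl_def)
    have "x \<in> kl G" using p(1) unfolding one[OF p(3) 0(2)] by (simp add: kl_def)
    then show "l \<in> cj g ` kl G" using p(2) by blast
  next
    fix l assume "l \<in> cj g ` kl G"
    then obtain x where "(x, 1) \<in> G" "l = cj g x" by (auto simp: kl_def)
    then show "l \<in> kl (cj2 g h ` G)" unfolding kl_def
      using 0(2) by (intro CollectI image_eqI[of _ _ "(x, 1)"]) simp_all
  qed
  show "kr (cj2 g h ` G) = cj h ` kr G"
  proof (intro Set.set_eqI iffI)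
    fix r assume "r \<in> kr (cj2 g h ` G)"
    then obtain x y where p: "(x, y) \<in> G" "r = cj h y" "cj g x = 1" by (auto simp: kr_def)
    have "y \<in> kr G" using p(1) unfolding one[OF p(3) 0(1)] by (simp add: kr_def)
    then show "r \<in> cj h ` kr G" using p(2) by blast
  next
    fix r assume "r \<in> cj h ` kr G"
    then obtain x where "(1, x) \<in> G" "r = cj h x" by (auto simp: kr_def)
    then show "r \<in> kr (cj2 g h ` G)" unfolding kr_def
      using 0(1) by (intro CollectI image_eqI[of _ _ "(1, x)"]) simp_all
  qed
qed

lemma re_dist2_cj2:
  assumes g: "qnorm2 g = 1" "qnorm2 h = 1" shows "re_dist2 (cj2 g h ` G) G"
proof -
  have 0: "g \<noteq> 0" "h \<noteq> 0" using g by auto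
  have inj: "inj_on (cj2 g h) A" for A
  proof (rule inj_onI)
    fix p q :: "quat \<times> quat" assume "cj2 g h p = cj2 g h q"
    then have "cj g (fst p) = cj g (fst q)" "cj h (snd p) = cj h (snd q)"
      by (simp_all only: prod.inject)
    then show "p = q" using injD[OF inj_cj[OF 0(1)]] injD[OF inj_cj[OF 0(2)]]
      by (blast intro: prod_eqI)
  qed
  have "{p \<in> cj2 g h ` G. qre (fst p) = s \<and> qre (snd p) = t} = cj2 g h ` {p \<in> G. qre (fst p) = s
    \<and> qre (snd p) = t}" for s t
    unfolding image_def using qre_cj[OF 0(1)] qre_cj[OF 0(2)] by fastforce
  then show ?thesis by (simp add: re_dist2_def card_image[OF inj])
qed

lemma re_dist2_card:
  assumes "re_dist2 G H" "fin_subgroup2 G" "fin_subgroup2 H" shows "card G = card H"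
proof -
  note f = fin_subgroup2D(1)[OF assms(2)] fin_subgroup2D(1)[OF assms(3)]
  let ?T = "qre ` fst ` G \<union> qre ` fst ` H"
  have "card K = (\<Sum>s\<in>?T. card {p \<in> K. qre (fst p) = s})" if K: "K = G \<or> K = H" for K
  proof -
    have "K = (\<Union>s\<in>?T. {p \<in> K. qre (fst p) = s})" using K by auto
    then have "card K = card (\<Union>s\<in>?T. {p \<in> K. qre (fst p) = s})" by simp
    also have "\<dots> = (\<Sum>s\<in>?T. card {p \<in> K. qre (fst p) = s})"
      by (rule card_UN_disjoint) (use f K in auto)
    finally show ?thesis .
  qed
  then show ?thesis using re_dist2_fst[OF assms(1) f] by simp
qed

definition twins :: "(quat \<times> quat) set \<Rightarrow> (quat \<times> quat) set \<Rightarrow> quat set \<Rightarrow> quat set \<Rightarrow> quat set \<Rightarrow> quat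
  set \<Rightarrow> bool" where
  "twins G H L M R N \<longleftrightarrow> fin_subgroup2 G \<and> fin_subgroup2 H \<and> re_dist2 G H \<and> lft G = L \<and> lft H = L
    \<and> kl G = M \<and> kl H = M \<and>
     rgt G = R \<and> rgt H = R \<and> kr G = N \<and> kr H = N"

lemma twinsD:
  assumes "twins G H L M R N"
  shows "fin_subgroup2 G" "fin_subgroup2 H" "re_dist2 G H" "lft G = L" "lft H = L" "kl G = M" "kl H
    = M" "rgt G = R" "rgt H = R" "kr G = N" "kr H = N"
    "fin_subgroup L" "fin_subgroup R" "normal_sub M L" "normal_sub N R" "fin_subgroup M"
      "fin_subgroup N"
proof -
  show *: "fin_subgroup2 G" "fin_subgroup2 H" "re_dist2 G H" "lft G = L" "lft H = L" "kl G = M" "kl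
    H = M" "rgt G = R" "rgt H = R" "kr G = N" "kr H = N"
    using assms unfolding twins_def by blast+
  show "fin_subgroup L" "fin_subgroup R" "normal_sub M L" "normal_sub N R"
    using fin_subgroup_lft[OF *(1)] fin_subgroup_rgt[OF *(1)] normal_sub_kl[OF *(1)]
      normal_sub_kr[OF *(1)] unfolding * .
  then show "fin_subgroup M" "fin_subgroup N" using normal_subD(1) by blast+
qed

lemma twins_sym: "twins G H L M R N \<Longrightarrow> twins H G L M R N"
  by (simp add: twins_def re_dist2_sym)

lemma twins_swap: "twins G H L M R N \<Longrightarrow> twins (prod.swap ` G) (prod.swap ` H) R N L M"
  by (simp add: twins_def re_dist2_swap fin_subgroup2_swap swap_simps)

lemma twins_exist:
  assumes G: "fin_subgroup2 G" "fin_subgroup2 H" and j: "re_dist2 G H"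
  shows "\<exists>G'. conj_equiv G G' \<and> twins G' H (lft H) (kl H) (rgt H) (kr H)"
proof -
  obtain g where g: "qnorm2 g = 1" "cj g ` lft G = lft H" "cj g ` kl G = kl H"
    using normal_pair[OF fin_subgroup_lft[OF G(1)] fin_subgroup_lft[OF G(2)] normal_sub_kl[OF G(1)]
      normal_sub_kl[OF G(2)] re_dist2_lft[OF j G] re_dist2_kl[OF j G]] by blast
  obtain h where h: "qnorm2 h = 1" "cj h ` rgt G = rgt H" "cj h ` kr G = kr H"
    using normal_pair[OF fin_subgroup_rgt[OF G(1)] fin_subgroup_rgt[OF G(2)] normal_sub_kr[OF G(1)]
      normal_sub_kr[OF G(2)] re_dist2_rgt[OF j G] re_dist2_kr[OF j G]] by blast
  let ?G = "cj2 g h ` G"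
  have "conj_equiv G ?G" unfolding conj_equiv_def using g h by blast
  moreover have "re_dist2 ?G H" using re_dist2_cj2[OF g(1) h(1), of G] j by (simp add: re_dist2_def)
  then have "twins ?G H (lft H) (kl H) (rgt H) (kr H)"
    unfolding twins_def cj2_parts[OF g(1) h(1)] g(2,3) h(2,3)
      using fin_subgroup2_cj2[OF G(1) g(1) h(1)] G(2) by simp
  ultimately show ?thesis by blast
qed

lemma twins_index_le_2:
  assumes t: "twins G H L M R N" and i: "index_le_2 L M" shows "G \<subseteq> H"
proof clarify
  note T = twinsD[OF t]
  fix l r assume p: "(l, r) \<in> G"
  have n0: "qnorm2 l = 1" "qnorm2 r = 1" using fin_subgroup2D(3,4)[OF T(1) p] by auto
  have lk: "l' \<in> M \<longleftrightarrow> r' \<in> N" if K: "fin_subgroup2 K" "kl K = M" "kr K = N" "(l', r') \<in> K" for K l'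
    r'
  proof
    assume "l' \<in> M"
    then have "(l', 1) \<in> K" using K(2) by (auto simp: kl_def)
    then show "r' \<in> N" using fiber_diff[OF K(1) _ K(4)] K(3) by fastforce
  next
    assume "r' \<in> N"
    then have "inverse r' \<in> kr K" using K(3) fin_subgroup_inverse[OF T(17)] by simp
    from fiber_mult[OF K(1,4) this] have "(l', 1) \<in> K" using fin_subgroup2D(4)[OF K(1,4)] by simp
    then show "l' \<in> M" using K(2) by (auto simp: kl_def)
  qed
  have "l \<in> L" "r \<in> R" using p T(4,8) lftI rgtI by blast+
  show "(l, r) \<in> H"
  proof (cases "l \<in> M")
    case True
    then have "r \<in> N" using lk[OF T(1,6,10) p] by simp
    moreover have "(l, 1) \<in> H" using True T(7) by (auto simp: kl_def)
    ultimately show ?thesis using fiber_mult[OF T(2), of l 1 r] T(11) by simp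
  next
    case False
    \<comment> \<open>\<open>H\<close> contains \<open>(l, r2)\<close> and \<open>(l3, r)\<close>.
      Neither left component is in \<open>M\<close>, so \<open>inverse l3 * l\<close> is, and
      \<open>r2\<close> agrees with \<open>r\<close> modulo \<open>N\<close>.\<close>
    obtain r2 where r2: "(l, r2) \<in> H" using \<open>l \<in> L\<close> T(5) lftE by metis
    obtain l3 where l3: "(l3, r) \<in> H" using \<open>r \<in> R\<close> T(9) rgtE by metis
    have "l3 \<notin> M" using False lk[OF T(1,6,10) p] lk[OF T(2,7,11) l3] by simp
    then have "inverse l3 \<notin> M" using fin_subgroup_inverse[OF T(16), of "inverse l3"] by auto
    moreover have "inverse l3 \<in> L" using fin_subgroup_inverse[OF T(12)] lftI[OF l3] T(5) by simp
    ultimately have "inverse l3 * l \<in> M" using i False \<open>l \<in> L\<close> unfolding index_le_2_def by blast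
    then have "inverse r * r2 \<in> N" using lk[OF T(2,7,11) fin_subgroup2D(5)[OF T(2)
      fin_subgroup2_inverse[OF T(2) l3] r2]] by simp
    then have "inverse (inverse r * r2) \<in> N" by (rule fin_subgroup_inverse[OF T(17)])
    moreover have "r \<noteq> 0" "r2 \<noteq> 0" using n0 fin_subgroup2D(4)[OF T(2) r2] by auto
    then have "inverse (inverse r * r2) = inverse r2 * r"
      by (simp add: nonzero_inverse_mult_distrib)
    ultimately show ?thesis using fiber_eq[OF T(2) r2] T(11) by simp
  qed
qed

lemma twins_index_le_2_conj_equiv:
  assumes t: "twins G H L M R N" and i: "index_le_2 L M \<or> index_le_2 R N" shows "conj_equiv G H"
proof -
  have *: "G = H" if "twins G H L M R N" "index_le_2 L M" for G H L M R N
    using twins_index_le_2[OF that] twins_index_le_2[OF twins_sym[OF that(1)] that(2)] by blast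
  show ?thesis
    using i *[OF t] *[OF twins_swap[OF t]] conj_equiv_refl conj_equiv_swap by metis
qed

text \<open>The conjugate of \<open>G\<close> and \<open>H\<close> both have right kernel
  \<open>N\<close>, so a common lift of each generator gives common lifts over all of
  \<open>L\<close>, and then full fibres. Equal orders turn the inclusion into equality.\<close>

lemma conj_equiv_lifts:
  assumes t: "twins G H L M R N" and L: "L = mgen A" and g: "qnorm2 g = 1"
    and h: "qnorm2 h = 1" "cj h ` N = N"
    and lifts: "\<And>s. s \<in> A \<Longrightarrow> \<exists>y z. (s, y) \<in> G \<and> (cj g s, z) \<in> H \<and> inverse z * cj h y \<in> N"
  shows "conj_equiv G H"
proof -
  note T = twinsD[OF t]
  have 0: "g \<noteq> 0" "h \<noteq> 0" using g h by auto
  let ?G = "cj2 g h ` G"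
  have fG: "fin_subgroup2 ?G" by (rule fin_subgroup2_cj2[OF T(1) g h(1)])
  have kG: "kr ?G = N" unfolding cj2_parts[OF g h(1)] T(10) by (rule h(2))
  have common: "\<exists>r. (cj g l, r) \<in> ?G \<and> (cj g l, r) \<in> H" if "l \<in> mgen A" for l
    using that
  proof induction
    case mgen_one
    show ?case using fin_subgroup2D(2)[OF fG] fin_subgroup2D(2)[OF T(2)] 0 by auto
  next
    case (mgen_mult s l)
    obtain y z where yz: "(s, y) \<in> G" "(cj g s, z) \<in> H" "inverse z * cj h y \<in> N"
      using lifts[OF mgen_mult.hyps(1)] by blast
    have 1: "(cj g s, cj h y) \<in> ?G" by (rule image_eqI[OF _ yz(1)]) simp
    have 2: "(cj g s, cj h y) \<in> H" by (rule fiber_eq[OF T(2) yz(2)]) (use yz(3) T(11) in simp)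
    obtain r where r: "(cj g l, r) \<in> ?G" "(cj g l, r) \<in> H" using mgen_mult.IH by blast
    show ?case
      using fin_subgroup2D(5)[OF fG 1 r(1)] fin_subgroup2D(5)[OF T(2) 2 r(2)]
        unfolding cj_mult[OF 0(1), symmetric] by blast
  qed
  have "?G \<subseteq> H"
  proof clarify
    fix l r assume p: "(l, r) \<in> G"
    then have "l \<in> mgen A" using lftI[OF p] T(4) L by simp
    then obtain r0 where r0: "(cj g l, r0) \<in> ?G" "(cj g l, r0) \<in> H" using common by blast
    have "(cj g l, cj h r) \<in> ?G" by (rule image_eqI[OF _ p]) simp
    then have "inverse r0 * cj h r \<in> N" using fiber_diff[OF fG r0(1)] kG by blast
    then have "(cj g l, cj h r) \<in> H" using fiber_eq[OF T(2) r0(2)] T(11) by simp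
    then show "(cj g (fst (l, r)), cj h (snd (l, r))) \<in> H" by simp
  qed
  moreover have "card ?G = card H"
    using re_dist2_card[OF _ fG T(2)] re_dist2_cj2[OF g h(1), of G] T(3) by (simp add: re_dist2_def)
  ultimately have "?G = H" using card_subset_eq[OF fin_subgroup2D(1)[OF T(2)]] by blast
  then show ?thesis unfolding conj_equiv_def using g h(1) by blast
qed

section \<open>Lifts of generators\<close>

lemma cj_image_self: "fin_subgroup N \<Longrightarrow> qnorm2 h = 1 \<Longrightarrow> cj h ` N \<subseteq> N \<Longrightarrow> cj h ` N = N"
  by (rule fin_subgroup_card_image_eq) auto

lemma conj_equiv_two_lifts:
  assumes t: "twins G H L M R N" and L: "L = mgen {a, b}" and g: "qnorm2 g = 1"
    and h: "qnorm2 h = 1" "cj h ` N = N"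
    and "(a, y1) \<in> G" "(b, z1) \<in> G" "(cj g a, y2) \<in> H" "(cj g b, z2) \<in> H"
    and "inverse y2 * cj h y1 \<in> N" "inverse z2 * cj h z1 \<in> N"
  shows "conj_equiv G H"
proof (rule conj_equiv_lifts[OF t L g h])
  fix s assume "s \<in> {a, b}"
  then consider "s = a" | "s = b" by blast
  then show "\<exists>y z. (s, y) \<in> G \<and> (cj g s, z) \<in> H \<and> inverse z * cj h y \<in> N"
    using assms(6-11) by cases blast+
qed

lemma conj_equiv_equal_lifts:
  assumes t: "twins G H L M R N" and L: "L = mgen {a, b}" and h: "qnorm2 h = 1" "cj h ` N = N"
    and p: "(a, y1) \<in> G" "(b, z1) \<in> G" "(a, y2) \<in> H" "(b, z2) \<in> H"
      and e: "cj h y1 = y2" "cj h z1 = z2"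
  shows "conj_equiv G H"
proof (rule conj_equiv_two_lifts[OF t L _ h p(1,2), of 1 y2 z2])
  note T = twinsD[OF t]
  show "qnorm2 1 = 1" by simp
  show "(cj 1 a, y2) \<in> H" "(cj 1 b, z2) \<in> H" using p by simp_all
  show "inverse y2 * cj h y1 \<in> N" "inverse z2 * cj h z1 \<in> N"
    unfolding e using fin_subgroup2D(4)[OF T(2) p(3)] fin_subgroup2D(4)[OF T(2) p(4)]
      fin_subgroupD(2)[OF T(17)] by simp_all
qed

lemma kernel_iff:
  assumes G: "fin_subgroup2 G" and p: "(l, r) \<in> G" shows "l \<in> kl G \<longleftrightarrow> r \<in> kr G"
proof
  assume "l \<in> kl G"
  then have "(l, 1) \<in> G" by (simp add: kl_def)
  then show "r \<in> kr G" using fiber_diff[OF G _ p, of 1] by simp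
next
  assume "r \<in> kr G"
  then have "inverse r \<in> kr G" by (rule fin_subgroup_inverse[OF normal_subD(1)[OF normal_sub_kr[OF
    G]]])
  from fiber_mult[OF G p this] show "l \<in> kl G" using fin_subgroup2D(4)[OF G p] by (simp add: kl_def)
qed

text \<open>Serves to show that unsuitable lifts would make the right projection too small, for
  instance commutative.\<close>

lemma rgt_span:
  assumes G: "fin_subgroup2 G" and L: "lft G = mgen A" and U: "1 \<in> U" "\<And>u n. u \<in> U \<Longrightarrow> n \<in> kr G
    \<Longrightarrow> u * n \<in> U"
    and lifts: "\<And>s. s \<in> A \<Longrightarrow> \<exists>y. (s, y) \<in> G \<and> (\<forall>u\<in>U. y * u \<in> U)"
  shows "rgt G \<subseteq> U"
proof
  fix r assume "r \<in> rgt G"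
  then obtain l where l: "(l, r) \<in> G" by (rule rgtE)
  have "\<exists>u\<in>U. (l, u) \<in> G" if "l \<in> mgen A" for l
    using that
  proof induction
    case mgen_one then show ?case using U(1) fin_subgroup2D(2)[OF G] by blast
  next
    case (mgen_mult s l)
    obtain y where y: "(s, y) \<in> G" "\<forall>u\<in>U. y * u \<in> U" using lifts[OF mgen_mult.hyps(1)] by blast
    obtain u where "u \<in> U" "(l, u) \<in> G" using mgen_mult.IH by blast
    then show ?case using y fin_subgroup2D(5)[OF G y(1)] by blast
  qed
  then obtain u where u: "u \<in> U" "(l, u) \<in> G" using lftI[OF l] L by blast
  have "u * (inverse u * r) \<in> U" by (rule U(2)[OF u(1) fiber_diff[OF G u(2) l]])
  then show "r \<in> U" using fin_subgroup2D(4)[OF G u(2)] uq_nonzero by simp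
qed

section \<open>Matching lifts when a projection is cyclic\<close>

lemma cyclic_mgen: assumes F: "fin_subgroup F" and c: "cyclic F a" shows "F = mgen {a}"
proof
  have aF: "a \<in> F" using c by (simp add: cyclic_def)
  show "mgen {a} \<subseteq> F" by (rule mgen_subset[OF F]) (use aF in simp)
  have "a ^ k \<in> mgen {a}" for k by (induction k) (auto intro: mgen.intros)
  then show "F \<subseteq> mgen {a}" using c by (auto simp: cyclic_def)
qed

text \<open>The distribution gives a pair in \<open>H\<close> with the same two real parts. Its left
  component is \<open>a\<close> or \<open>inverse a\<close>; in the second case the pair is
  inverted, which keeps both real parts.\<close>

lemma match_lift:
  assumes t: "twins G H L M R N" and p: "(a, y) \<in> G" and u: "\<And>x. x \<in> L \<Longrightarrow> qre x = qre a \<Longrightarrow> x = a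
    \<or> x = inverse a"
  shows "\<exists>y'. (a, y') \<in> H \<and> qre y' = qre y"
proof -
  note T = twinsD[OF t]
  obtain a' y' where q: "(a', y') \<in> H" "qre a' = qre a" "qre y' = qre y"
    using re_dist2_ex[OF T(3,1) p] by blast
  have "a' = a \<or> a' = inverse a" using u lftI[OF q(1)] T(5) q(2) by blast
  then show ?thesis
  proof
    assume "a' = a" then show ?thesis using q by blast
  next
    assume i: "a' = inverse a"
    have "(a, inverse y') \<in> H" using fin_subgroup2_inverse[OF T(2) q(1)] i by simp
    moreover have "qre (inverse y') = qre y" using q(3) fin_subgroup2D(4)[OF T(2) q(1)] by simp
    ultimately show ?thesis by blast
  qed
qed

lemma cyclic_re_eq:
  assumes F: "fin_subgroup F" and c: "cyclic F a" and x: "x \<in> F" "y \<in> F" "qre x = qre y"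
    shows "x = y \<or> x = inverse y"
  using commuting_same_re[OF fin_subgroupD(3)[OF F x(2)] fin_subgroupD(3)[OF F x(1)]
    cyclic_commutes[OF c x(2,1)] x(3)[symmetric]] .

text \<open>A conjugation that inverts the generator \<open>\<rho>\<close> inverts all of
  \<open>R\<close>, and so preserves each of its subgroups.\<close>

lemma cyclic_match_conj:
  assumes R: "fin_subgroup R" and c: "cyclic R \<rho>" and y: "y1 \<in> R" "y2 \<in> R" "qre y2 = qre y1"
  shows "\<exists>h\<in>uq. cj h y1 = y2 \<and> (\<forall>N. fin_subgroup N \<longrightarrow> N \<subseteq> R \<longrightarrow> cj h ` N = N)"
proof -
  consider "y2 = y1" | "y2 = inverse y1" using cyclic_re_eq[OF R c y(2,1,3)] by blast
  then show ?thesis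
  proof cases
    case 1 then show ?thesis by (intro bexI[of _ 1]) auto
  next
    case 2
    have r: "\<rho> \<in> R" "qnorm2 \<rho> = 1" using c fin_subgroupD(3)[OF R] by (auto simp: cyclic_def)
    obtain h where h: "qnorm2 h = 1" "cj h \<rho> = inverse \<rho>"
      using conj_same_re[of \<rho> "inverse \<rho>"] r by auto
    have h0: "h \<noteq> 0" using h by auto
    have inv: "cj h x = inverse x" if xR: "x \<in> R" for x
    proof -
      obtain k where "x = \<rho> ^ k" using c xR by (auto simp: cyclic_def)
      then show ?thesis by (simp only: cj_power[OF h0] h(2) power_inverse)
    qed
    have "cj h ` N = N" if N: "fin_subgroup N" "N \<subseteq> R" for N
    proof (rule cj_image_self[OF N(1) h(1)])
      show "cj h ` N \<subseteq> N"
      proof clarify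
        fix x assume "x \<in> N"
        then show "cj h x \<in> N" using inv[of x] N(2) fin_subgroup_inverse[OF N(1)] by auto
      qed
    qed
    then show ?thesis using h(1) inv[OF y(1)] 2 by blast
  qed
qed

lemma conj_equiv_cyclic_cyclic:
  assumes t: "twins G H L M R N" and L: "cyclic L a" and R: "cyclic R \<rho>" shows "conj_equiv G H"
proof -
  note T = twinsD[OF t]
  have aL: "a \<in> L" using L by (simp add: cyclic_def)
  obtain y1 where y1: "(a, y1) \<in> G" using aL T(4) lftE by metis
  obtain y2 where y2: "(a, y2) \<in> H" "qre y2 = qre y1"
    using match_lift[OF t y1 cyclic_re_eq[OF T(12) L _ aL]] by blast
  obtain h where h: "qnorm2 h = 1" "cj h y1 = y2" "cj h ` N = N"
    using cyclic_match_conj[OF T(13) R _ _ y2(2)] rgtI[OF y1] rgtI[OF y2(1)] T(8,9,15,17)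
      by (auto simp: normal_sub_def)
  have "L = mgen {a, a}" using cyclic_mgen[OF T(12) L] by simp
  then show ?thesis by (rule conj_equiv_equal_lifts[OF t _ h(1,3) y1 y1 y2(1) y2(1) h(2) h(2)])
qed

section \<open>Rotations and reflections: elements of a dihedral group that do, respectively do not,
  commute with \<open>a\<close>\<close>

lemma dihedral_rotation:
  assumes F: "fin_subgroup F" and d: "dihedral F a b" and x: "x \<in> F" "x * a = a * x"
    shows "\<exists>k. x = a ^ k"
  by (rule maxre_generator_power[OF F dihedralD(12)[OF F d] dihedralD(11)[OF F d] dihedralD(1)[OF F
    d] refl dihedralD(5,6)[OF F d] x])

lemma dihedral_reflect:
  assumes F: "fin_subgroup F" and d: "dihedral F a b" and x: "x \<in> F" "x * a \<noteq> a * x"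
  shows "x * a = inverse a * x" "x * x = - 1" "qre x = 0" "qre (a * x) = 0" "qnorm2 x = 1"
proof -
  have "\<exists>k. x = b * a ^ k" using dihedralD(14)[OF F d x(1)] x(2) by (auto simp: power_commutes)
  then obtain k where k: "x = b * a ^ k" ..
  show "x * a = inverse a * x" "x * x = - 1" "qre x = 0" "qre (a * x) = 0" "qnorm2 x = 1"
    unfolding k by (rule dihedral_reflection[OF F d] dihedralD[OF F d])+
qed

lemma reflect_rotation:
  assumes F: "fin_subgroup F" and d: "dihedral F a b" and y: "y \<in> F" "y * a \<noteq> a * y"
    and x: "x \<in> F" "x * a = a * x"
  shows "y * x = inverse x * y" "x * y = y * inverse x" "y * x * inverse y = inverse x"
proof -
  obtain k where k: "x = a ^ k" using dihedral_rotation[OF F d x] by blast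
  have y0: "y \<noteq> 0" and x0: "x \<noteq> 0" using fin_subgroupD(3)[OF F] y x uq_nonzero by blast+
  show 1: "y * x = inverse x * y"
    unfolding k power_intertwine[OF dihedral_reflect(1)[OF F d y]] by (simp add: power_inverse)
  show "y * x * inverse y = inverse x" unfolding 1 using y0 by (simp add: mult.assoc)
  have "x * (y * x) * inverse x = x * (inverse x * y) * inverse x" unfolding 1 ..
  then show "x * y = y * inverse x" using x0 by (simp add: mult.assoc)
qed

lemma reflect_mult:
  assumes F: "fin_subgroup F" and d: "dihedral F a b" and x: "x \<in> F" "x * a \<noteq> a * x"
    and y: "y \<in> F" "y * a \<noteq> a * y"
  shows "x * y * a = a * (x * y)"
proof -
  note D = dihedralD[OF F d]
  have "x * y * a = x * inverse a * y"
    using dihedral_reflect(1)[OF F d y] by (simp only: mult.assoc)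
  also have "x * inverse a = a * x" using reflect_rotation(2)[OF F d x D(1) refl] by simp
  finally show ?thesis by (simp only: mult.assoc)
qed

lemma dihedral_change_reflection:
  assumes F: "fin_subgroup F" and d: "dihedral F a b" and r: "r \<in> F" "r * a \<noteq> a * r"
    shows "dihedral F a r"
proof -
  note D = dihedralD[OF F d]
  have r0: "r \<noteq> 0" using fin_subgroupD(3)[OF F r(1)] by auto
  have "(\<exists>k. x = a ^ k) \<or> (\<exists>k. x = r * a ^ k)" if x: "x \<in> F" for x
  proof (cases "x * a = a * x")
    case True then show ?thesis using dihedral_rotation[OF F d x] by blast
  next
    case False
    have ir: "inverse r = - r" using dihedral_reflect(2)[OF F d r]
      by (metis inverse_unique minus_mult_right minus_minus)
    have "r * x * a = a * (r * x)" by (rule reflect_mult[OF F d r x False])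
    then have "inverse r * x * a = a * (inverse r * x)" unfolding ir by simp
    then obtain k where "inverse r * x = a ^ k"
      using dihedral_rotation[OF F d fin_subgroupD(4)[OF F fin_subgroup_inverse[OF F r(1)] x]]
      by blast
    then have "x = r * a ^ k" using inverse_cancel(2)[OF r0, of x] by simp
    then show ?thesis by blast
  qed
  then show ?thesis unfolding dihedral_def
    using D(1,5,6,11,16) r(1) dihedral_reflect(1,2)[OF F d r] by blast
qed

lemma dihedral_mgen:
  assumes F: "fin_subgroup F" and d: "dihedral F a b" shows "F = mgen {a, b}"
proof
  note D = dihedralD[OF F d]
  show "mgen {a, b} \<subseteq> F" by (rule mgen_subset[OF F]) (use D(1,2) in simp)
  have a: "a ^ k \<in> mgen {a, b}" for k by (induction k) (auto intro: mgen.intros)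
  then have "b * a ^ k \<in> mgen {a, b}" for k by (intro mgen_mult) auto
  then show "F \<subseteq> mgen {a, b}" using a D(14) by blast
qed

lemma index_le_2I:
  assumes F: "fin_subgroup F" and N: "normal_sub N F" and s: "s \<in> F" "s * s \<in> N" and c: "\<And>x. x \<in> F
    \<Longrightarrow> x \<in> N \<or> inverse s * x \<in> N"
  shows "index_le_2 F N"
  unfolding index_le_2_def
proof (intro ballI impI)
  note fN = normal_subD(1)[OF N]
  have s0: "s \<noteq> 0" using fin_subgroupD(3)[OF F s(1)] by auto
  fix x y assume x: "x \<in> F" "x \<notin> N" and y: "y \<in> F" "y \<notin> N"
  have "x * y = s * s * (inverse s * (inverse s * x) * s) * (inverse s * y)"
    using s0 by (simp add: mult.assoc)
  moreover have "inverse s * (inverse s * x) * s \<in> N"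
    by (rule normal_sub_factor[OF F N s(1)]) (use c x in blast)
  ultimately show "x * y \<in> N" using fin_subgroupD(4)[OF fN] s(2) c y by metis
qed

text \<open>A reflection \<open>n\<close> in \<open>N\<close> may replace \<open>b\<close> as a
  generator. As \<open>a * a\<close> is then in \<open>N\<close> as well, every element is in
  \<open>N\<close> or in the coset of \<open>a\<close>.\<close>

lemma dihedral_normal_rotations:
  assumes F: "fin_subgroup F" and d: "dihedral F a b" and N: "normal_sub N F"
    and i: "\<not> index_le_2 F N" and n: "n \<in> N"
  shows "n * a = a * n"
proof (rule ccontr)
  assume r: "n * a \<noteq> a * n"
  note D = dihedralD[OF F d] and fN = normal_subD(1)[OF N]
  have nF: "n \<in> F" by (rule normal_subD(2)[OF N n])
  have d': "dihedral F a n" by (rule dihedral_change_reflection[OF F d nF r])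
  note D' = dihedralD[OF F d']
  have aa: "a * a \<in> N" using dihedral_normal_square[OF F d' N, of 0] n by simp
  have a0: "a \<noteq> 0" using D by auto
  have pw: "a ^ j \<in> N \<or> inverse a * a ^ j \<in> N" for j
  proof (cases "even j")
    case True
    then obtain m where "j = 2 * m" by (elim evenE)
    then have "a ^ j = (a * a) ^ m" by (simp only: power_mult power2_eq_square)
    then show ?thesis using fin_subgroup_power[OF fN aa] by simp
  next
    case False
    then obtain m where "j = Suc (2 * m)" by (elim oddE) simp
    then have "inverse a * a ^ j = a ^ (2 * m)" using a0 by simp
    then have "inverse a * a ^ j = (a * a) ^ m" by (simp only: power_mult power2_eq_square)
    then show ?thesis using fin_subgroup_power[OF fN aa] by simp
  qed
  have "x \<in> N \<or> inverse a * x \<in> N" if x: "x \<in> F" for x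
  proof -
    consider k where "x = a ^ k" | k where "x = n * a ^ k" using D'(14)[OF x] by blast
    then show ?thesis
    proof cases
      case 1 then show ?thesis using pw by blast
    next
      case 2
      show ?thesis
      proof (cases "a ^ k \<in> N")
        case True then show ?thesis using 2 fin_subgroupD(4)[OF fN n] by simp
      next
        case False
        then have "inverse a * a ^ k \<in> N" using pw by blast
        moreover have "inverse a * n * a \<in> N" by (rule normal_sub_factor[OF F N D(1) n])
        moreover have "inverse a * x = inverse a * n * a * (inverse a * a ^ k)" unfolding 2
          using a0 by (simp add: mult.assoc)
        ultimately show ?thesis using fin_subgroupD(4)[OF fN] by simp
      qed
    qed
  qed
  then have "index_le_2 F N" by (rule index_le_2I[OF F N D(1) aa])
  then show False using i by blast
qed

lemma rotation_fix:
  assumes F: "fin_subgroup F" and d: "dihedral F a b" and h: "qnorm2 h = 1" "cj h a = a"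
    and x: "x \<in> F" "x * a = a * x"
  shows "cj h x = x"
proof -
  obtain k where k: "x = a ^ k" using dihedral_rotation[OF F d x] by blast
  show ?thesis unfolding k cj_power[OF uq_nonzero[OF h(1)]] h(2) ..
qed

lemma reflect_conj:
  assumes F: "fin_subgroup F" and d: "dihedral F a b" and x: "x \<in> F" "x * a \<noteq> a * x"
    and y: "y \<in> F" "y * a \<noteq> a * y"
  shows "\<exists>h\<in>uq. cj h a = a \<and> cj h x = y"
  using conj_pair[OF dihedralD(3)[OF F d] dihedral_reflect(5)[OF F d x] dihedralD(3)[OF F d]
    dihedral_reflect(5)[OF F d y]]
    dihedral_reflect(3,4)[OF F d x] dihedral_reflect(3,4)[OF F d y] by simp

lemma not_all_rotations:
  assumes G: "fin_subgroup2 G" and d: "dihedral (rgt G) \<alpha> \<beta>" and N: "\<And>n. n \<in> kr G \<Longrightarrow> n * \<alpha> = \<alpha> * n"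
    and L: "lft G = mgen A"
    and lifts: "\<And>s. s \<in> A \<Longrightarrow> \<exists>y. (s, y) \<in> G \<and> y * \<alpha> = \<alpha> * y"
  shows False
proof -
  have "rgt G \<subseteq> {u. u * \<alpha> = \<alpha> * u}"
  proof (rule rgt_span[OF G L])
    have c: "x * y * \<alpha> = \<alpha> * (x * y)" if "x * \<alpha> = \<alpha> * x" "y * \<alpha> = \<alpha> * y" for x y
    proof -
      have "x * y * \<alpha> = x * \<alpha> * y" unfolding mult.assoc that(2) ..
      then show ?thesis unfolding that(1) by (simp only: mult.assoc)
    qed
    show "1 \<in> {u. u * \<alpha> = \<alpha> * u}" by simp
    show "u * n \<in> {u. u * \<alpha> = \<alpha> * u}" if "u \<in> {u. u * \<alpha> = \<alpha> * u}" "n \<in> kr G" for u n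
      using c[of u n] that N by simp
    show "\<exists>y. (s, y) \<in> G \<and> (\<forall>u\<in>{u. u * \<alpha> = \<alpha> * u}. y * u \<in> {u. u * \<alpha> = \<alpha> * u})" if "s \<in> A" for s
      using lifts[OF that] c by blast
  qed
  then show False using dihedralD(2,8)[OF fin_subgroup_rgt[OF G] d] by auto
qed

text \<open>The lift of the generator \<open>a\<close> is a reflection, since otherwise all of
  \<open>R\<close> would consist of rotations. Two reflections are matched by an element commuting
  with \<open>\<alpha>\<close>, and this fixes \<open>N\<close>, which consists of
  rotations.\<close>

lemma conj_equiv_cyclic_dihedral:
  assumes t: "twins G H L M R N" and L: "cyclic L a" and R: "dihedral R \<alpha> \<beta>"
    and i: "\<not> index_le_2 R N" shows "conj_equiv G H"
proof -
  note T = twinsD[OF t]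
  have aL: "a \<in> L" using L by (simp add: cyclic_def)
  obtain y1 where y1: "(a, y1) \<in> G" using aL T(4) lftE by metis
  obtain y2 where y2: "(a, y2) \<in> H" using aL T(5) lftE by metis
  note rot = dihedral_normal_rotations[OF T(13) R T(15) i]
  have Lm: "L = mgen {a}" by (rule cyclic_mgen[OF T(12) L])
  have n1: "y1 * \<alpha> \<noteq> \<alpha> * y1" using not_all_rotations[of G \<alpha> \<beta> "{a}"] T(1,4,8,10) R rot Lm y1 by auto
  have n2: "y2 * \<alpha> \<noteq> \<alpha> * y2" using not_all_rotations[of H \<alpha> \<beta> "{a}"] T(2,5,9,11) R rot Lm y2 by auto
  have yR: "y1 \<in> R" "y2 \<in> R" using rgtI[OF y1] rgtI[OF y2] T(8,9) by auto
  obtain h where h: "qnorm2 h = 1" "cj h \<alpha> = \<alpha>" "cj h y1 = y2"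
    using reflect_conj[OF T(13) R yR(1) n1 yR(2) n2] by blast
  have "cj h n = n" if "n \<in> N" for n
    using rotation_fix[OF T(13) R h(1,2) normal_subD(2)[OF T(15) that] rot[OF that]] .
  then have hN: "cj h ` N = N" by simp
  have "L = mgen {a, a}" using Lm by simp
  then show ?thesis by (rule conj_equiv_equal_lifts[OF t _ h(1) hN y1 y1 y2 y2 h(3) h(3)])
qed

text \<open>An element of \<open>L\<close> with the real part of \<open>a\<close> is conjugate in
  \<open>L\<close> to \<open>a\<close> or \<open>inverse a\<close>. Conjugation by a lift of the
  conjugating element keeps the real part on the right.\<close>

lemma polyhedral_match:
  assumes t: "twins G H L M R N" and p: "polyhedral L c a b" and y: "(a, y) \<in> G"
  shows "\<exists>y'. (a, y') \<in> H \<and> qre y' = qre y"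
proof -
  note T = twinsD[OF t] and P = polyhedralD[OF twinsD(12)[OF t] p]
  obtain a' y' where q: "(a', y') \<in> H" "qre a' = qre a" "qre y' = qre y"
    using re_dist2_ex[OF T(3,1) y] by blast
  have "a' \<in> L" using lftI[OF q(1)] T(5) by simp
  then obtain f where f: "f \<in> L" "cj f a' = a \<or> cj f a' = inverse a"
    using polyhedral_conj_generator[OF T(12) p] q(2) P(6) by metis
  obtain w where w: "(f, w) \<in> H" using f(1) T(5) lftE by metis
  have n: "qnorm2 w = 1" "qnorm2 y' = 1" using fin_subgroup2D(4)[OF T(2)] w q(1) by auto
  have e: "(cj f a', cj w y') \<in> H" by (rule fin_subgroup2_cj[OF T(2) w q(1)])
  have re: "qre (cj w y') = qre y" unfolding qre_cj[OF uq_nonzero[OF n(1)]] by (rule q(3))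
  from f(2) show ?thesis
  proof
    assume "cj f a' = a" then show ?thesis using e re by metis
  next
    assume "cj f a' = inverse a"
    then have "(a, inverse (cj w y')) \<in> H" using fin_subgroup2_inverse[OF T(2) e] by simp
    moreover have "qnorm2 (cj w y') = 1" unfolding qnorm2_cj[OF n(1)] by (rule n(2))
    then have "qre (inverse (cj w y')) = qre y" using re by (simp only: qre_inverse)
    ultimately show ?thesis by blast
  qed
qed

text \<open>Conjugate \<open>(a, y)\<close> by a lift of \<open>a * b\<close>, which sends
  \<open>a\<close> to \<open>b\<close>.\<close>

lemma polyhedral_lift:
  assumes G: "fin_subgroup2 G" and p: "polyhedral (lft G) c a b" and y: "(a, y) \<in> G"
  shows "\<exists>v\<in>rgt G. (b, cj v y) \<in> G \<and> qre (cj v y) = qre y"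
proof -
  note P = polyhedralD[OF fin_subgroup_lft[OF G] p]
  obtain v where v: "(a * b, v) \<in> G"
    using fin_subgroupD(4)[OF fin_subgroup_lft[OF G] P(1,2)] lftE by metis
  have "(cj (a * b) a, cj v y) \<in> G" by (rule fin_subgroup2_cj[OF G v y])
  then have "(b, cj v y) \<in> G" unfolding P(16) .
  moreover have "qre (cj v y) = qre y" by (rule qre_cj[OF uq_nonzero[OF fin_subgroup2D(4)[OF G v]]])
  ultimately show ?thesis using rgtI[OF v] by blast
qed

text \<open>As \<open>R\<close> is commutative, conjugation by lifts is trivial on the right, so a
  lift of \<open>a\<close> is also a lift of \<open>b\<close>.\<close>

lemma conj_equiv_polyhedral_cyclic:
  assumes t: "twins G H L M R N" and L: "polyhedral L c a b" and R: "cyclic R \<rho>"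
    shows "conj_equiv G H"
proof -
  note T = twinsD[OF t] and P = polyhedralD[OF twinsD(12)[OF t] L]
  obtain y1 where y1: "(a, y1) \<in> G" using P(1) T(4) lftE by metis
  obtain y2 where y2: "(a, y2) \<in> H" "qre y2 = qre y1" using polyhedral_match[OF t L y1] by blast
  have b: "(b, y) \<in> K" if K: "fin_subgroup2 K" "lft K = L" "rgt K = R" "(a, y) \<in> K" for K y
  proof -
    obtain v where v: "v \<in> rgt K" "(b, cj v y) \<in> K"
      using polyhedral_lift[OF K(1) _ K(4)] L K(2) by blast
    have "v * y = y * v" using cyclic_commutes[OF R] v(1) rgtI[OF K(4)] K(3) by simp
    then have "cj v y = y" using fin_subgroupD(3)[OF fin_subgroup_rgt[OF K(1)] v(1)]
      by (simp add: mult.assoc)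
    then show ?thesis using v(2) by (simp only:)
  qed
  obtain h where h: "qnorm2 h = 1" "cj h y1 = y2" "cj h ` N = N"
    using cyclic_match_conj[OF T(13) R _ _ y2(2)] rgtI[OF y1] rgtI[OF y2(1)] T(8,9,15,17)
      by (auto simp: normal_sub_def)
  show ?thesis
    by (rule conj_equiv_equal_lifts[OF t P(12) h(1,3) y1 b[OF T(1,4,8) y1] y2(1) b[OF T(2,5,9)
      y2(1)] h(2) h(2)])
qed

text \<open>With a central kernel the braid relation of \<open>a\<close> and \<open>b\<close> lifts
  up to sign. The two sides are of different degree in \<open>z0\<close>, so if the sign is -1,
  replacing \<open>z0\<close> by \<open>- z0\<close> removes it; in that case -1 lies in the kernel
  and \<open>- z0\<close> is again a lift.\<close>

lemma polyhedral_central_lift: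
  assumes G: "fin_subgroup2 G" and p: "polyhedral (lft G) c a b" and N: "kr G \<subseteq> {1, - 1}"
    and y: "(a, y) \<in> G"
  shows "\<exists>z. (b, z) \<in> G \<and> qre z = qre y \<and> (y = z \<or> qre (y * z) = 1 / 2)"
proof -
  note P = polyhedralD[OF fin_subgroup_lft[OF G] p]
  have ny: "qnorm2 y = 1" by (rule fin_subgroup2D(4)[OF G y])
  obtain v where v: "(b, cj v y) \<in> G" using polyhedral_lift[OF G p y] by blast
  define z0 where "z0 = cj v y"
  have z0: "(b, z0) \<in> G" "qnorm2 z0 = 1" using v fin_subgroup2D(4)[OF G v] by (simp_all add: z0_def)
  have l: "(a * b * a, y * z0 * y) \<in> G" "(a * b * a, z0 * y * z0) \<in> G"
    using fin_subgroup2D(5)[OF G fin_subgroup2D(5)[OF G y z0(1)] y] fin_subgroup2D(5)[OF G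
      fin_subgroup2D(5)[OF G z0(1) y] z0(1)] P(15) by simp_all
  have zz: "z0 * y * z0 \<noteq> 0" using ny z0 by auto
  note V = inverse_cancel(2)[OF zz, of "y * z0 * y"]
  have "inverse (z0 * y * z0) * (y * z0 * y) = 1 \<or> inverse (z0 * y * z0) * (y * z0 * y) = - 1"
    using fiber_diff[OF G l(2,1)] N by blast
  then have br: "y * z0 * y = z0 * y * z0 \<or> y * z0 * y = - (z0 * y * z0)"
  proof
    assume e: "inverse (z0 * y * z0) * (y * z0 * y) = 1"
    show ?thesis using V unfolding e by simp
  next
    assume e: "inverse (z0 * y * z0) * (y * z0 * y) = - 1"
    show ?thesis using V unfolding e by simp
  qed
  obtain z where z: "(b, z) \<in> G" "qnorm2 z = 1" "y * z * y = z * y * z"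
  proof (cases "y * z0 * y = z0 * y * z0")
    case True then show thesis using that z0 by blast
  next
    case False
    then have e: "y * z0 * y = - (z0 * y * z0)" using br by blast
    have "inverse (z0 * y * z0) * (y * z0 * y) = - 1" unfolding e using zz by simp
    then have "- 1 \<in> kr G" using fiber_diff[OF G l(2,1)] by simp
    from fiber_mult[OF G z0(1) this] have "(b, - z0) \<in> G" by simp
    moreover have "y * (- z0) * y = (- z0) * y * (- z0)" using e by simp
    ultimately show thesis using that z0(2) by simp
  qed
  have cz: "cj (y * z) y = z" by (rule braid_conj[OF ny z(2,3)])
  have "qre (cj (y * z) y) = qre y" by (rule qre_cj) (use ny z in auto)
  then have "qre z = qre y" unfolding cz .
  then show ?thesis using z braid_iff[OF ny z(2)] by auto
qed

lemma comm_if_single_lift: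
  assumes G: "fin_subgroup2 G" and L: "lft G = mgen {a, b}" and N: "kr G \<subseteq> {1, - 1}"
    and y: "(a, y) \<in> G" "(b, y) \<in> G"
    and u: "u \<in> rgt G" "v \<in> rgt G"
  shows "u * v = v * u"
proof -
  let ?U = "{x. \<exists>k. x = y ^ k \<or> x = - (y ^ k)}"
  have "rgt G \<subseteq> ?U"
  proof (rule rgt_span[OF G L])
    show "1 \<in> ?U" by (auto intro: exI[of _ 0])
    show "x * n \<in> ?U" if "x \<in> ?U" "n \<in> kr G" for x n
    proof -
      have "n = 1 \<or> n = - 1" using that(2) N by blast
      then show ?thesis using that(1) by auto
    qed
    have "y * x \<in> ?U" if x: "x \<in> ?U" for x
    proof -
      obtain k where "x = y ^ k \<or> x = - (y ^ k)" using x by blast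
      then have "y * x = y ^ Suc k \<or> y * x = - (y ^ Suc k)" by auto
      then show ?thesis by blast
    qed
    then show "\<exists>z. (s, z) \<in> G \<and> (\<forall>x\<in>?U. z * x \<in> ?U)" if "s \<in> {a, b}" for s using that y by blast
  qed
  then obtain i j where "u = y ^ i \<or> u = - (y ^ i)" "v = y ^ j \<or> v = - (y ^ j)" using u by blast
  moreover have "y ^ i * y ^ j = y ^ j * y ^ i" by (simp flip: power_add add: add.commute)
  ultimately show ?thesis by auto
qed

text \<open>The lifts \<open>y\<close>, \<open>z\<close> have equal real parts and either coincide
  or satisfy \<open>qre (y * z) = 1 / 2\<close>. Coincidence makes \<open>R\<close> commutative and
  so forces coincidence in the other group too. Hence the three real parts agree and
  \<open>conj_pair\<close> applies.\<close>

lemma conj_equiv_polyhedral_central: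
  assumes t: "twins G H L M R N" and L: "polyhedral L c a b" and N: "N \<subseteq> {1, - 1}"
    shows "conj_equiv G H"
proof -
  note T = twinsD[OF t] and P = polyhedralD[OF twinsD(12)[OF t] L]
  obtain y1 where y1: "(a, y1) \<in> G" using P(1) T(4) lftE by metis
  obtain y2 where y2: "(a, y2) \<in> H" "qre y2 = qre y1" using polyhedral_match[OF t L y1] by blast
  obtain z1 where z1: "(b, z1) \<in> G" "qre z1 = qre y1" "y1 = z1 \<or> qre (y1 * z1) = 1 / 2"
    using polyhedral_central_lift[OF T(1) _ _ y1] L N T(4,10) by blast
  obtain z2 where z2: "(b, z2) \<in> H" "qre z2 = qre y2" "y2 = z2 \<or> qre (y2 * z2) = 1 / 2"
    using polyhedral_central_lift[OF T(2) _ _ y2(1)] L N T(5,11) by blast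
  have n: "qnorm2 y1 = 1" "qnorm2 z1 = 1" "qnorm2 y2 = 1" "qnorm2 z2 = 1"
    using fin_subgroup2D(4)[OF T(1) y1] fin_subgroup2D(4)[OF T(1) z1(1)] fin_subgroup2D(4)[OF T(2)
      y2(1)] fin_subgroup2D(4)[OF T(2) z2(1)] .
  have R: "y1 \<in> R" "z1 \<in> R" "y2 \<in> R" "z2 \<in> R"
    using rgtI[OF y1] rgtI[OF z1(1)] rgtI[OF y2(1)] rgtI[OF z2(1)] T(8,9) by auto
  have cm: "u * v = v * u" if e: "y1 = z1 \<or> y2 = z2" and u: "u \<in> R" "v \<in> R" for u v
    using e
  proof
    assume "y1 = z1"
    then show ?thesis
      using comm_if_single_lift[OF T(1), of a b y1 u v] T(4,8,10) P(12) N y1 z1(1) u by simp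
  next
    assume "y2 = z2"
    then show ?thesis
      using comm_if_single_lift[OF T(2), of a b y2 u v] T(5,9,11) P(12) N y2(1) z2(1) u by simp
  qed
  have same: "y = z" if "y * z = z * y" "qnorm2 y = 1" "qnorm2 z = 1" "qre z = qre y" "y = z
    \<or> qre (y * z) = 1 / 2" for y z
  proof -
    have "z = y \<or> z = inverse y" using commuting_same_re[OF that(2,3,1)] that(4) by simp
    moreover have "z = inverse y \<Longrightarrow> qre (y * z) = 1" using that(2) by simp
    ultimately show ?thesis using that(5) by auto
  qed
  have "qre (y1 * z1) = qre (y2 * z2)"
  proof (cases "y1 = z1 \<or> y2 = z2")
    case True
    then have "y1 = z1" "y2 = z2" using same[OF cm[OF True R(1,2)] n(1,2) z1(2,3)] same[OF cm[OF
      True R(3,4)] n(3,4) z2(2,3)] by auto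
    then show ?thesis using uq_quadratic[OF n(1)] uq_quadratic[OF n(3)] y2(2) by simp
  next
    case False then show ?thesis using z1(3) z2(3) by simp
  qed
  then obtain h where h: "qnorm2 h = 1" "cj h y1 = y2" "cj h z1 = z2"
    using conj_pair[OF n(1,2,3,4)] y2(2) z1(2) z2(2) by auto
  have h0: "h \<noteq> 0" using h by auto
  have "cj h n = n" if "n \<in> N" for n using that N h0 by auto
  then have hN: "cj h ` N = N" by simp
  show ?thesis by (rule conj_equiv_equal_lifts[OF t P(12) h(1) hN y1 z1(1) y2(1) z2(1) h(2,3)])
qed

section \<open>Elements of order 3 and generators of order dividing 4 in cyclic quotients\<close>

lemma power_mem_dvd:
  assumes F: "fin_subgroup F" "\<alpha> \<in> F" and N: "fin_subgroup N"
  shows "\<exists>d. \<forall>k. \<alpha> ^ k \<in> N \<longleftrightarrow> d dvd k"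
proof -
  obtain n where n: "n > 0" "\<alpha> ^ n = 1" using fin_subgroup_torsion[OF F] by blast
  define d where "d = (LEAST d. d > 0 \<and> \<alpha> ^ d \<in> N)"
  have "n > 0 \<and> \<alpha> ^ n \<in> N" using n fin_subgroupD(2)[OF N] by simp
  then have d: "d > 0" "\<alpha> ^ d \<in> N" using LeastI[of "\<lambda>d. d > 0 \<and> \<alpha> ^ d \<in> N" n]
    unfolding d_def by blast+
  have least: "\<not> (m > 0 \<and> \<alpha> ^ m \<in> N)" if "m < d" for m
    using not_less_Least[of m] that unfolding d_def by blast
  have "\<alpha> ^ k \<in> N \<longleftrightarrow> d dvd k" for k
  proof
    assume k: "\<alpha> ^ k \<in> N"
    have e: "\<alpha> ^ k = (\<alpha> ^ d) ^ (k div d) * \<alpha> ^ (k mod d)"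
      unfolding power_mult[symmetric] power_add[symmetric] by simp
    have m: "(\<alpha> ^ d) ^ (k div d) \<in> N" by (rule fin_subgroup_power[OF N d(2)])
    have "inverse ((\<alpha> ^ d) ^ (k div d)) * \<alpha> ^ k = \<alpha> ^ (k mod d)"
      unfolding e by (rule inverse_cancel(1)) (use fin_subgroupD(3)[OF N m] uq_nonzero in blast)
    then have "\<alpha> ^ (k mod d) \<in> N" using fin_subgroupD(4)[OF N fin_subgroup_inverse[OF N m] k]
      by simp
    then have "k mod d = 0" using least[of "k mod d"] d(1) by auto
    then show "d dvd k" by auto
  next
    assume "d dvd k"
    then obtain m where "k = d * m" ..
    then have "\<alpha> ^ k = (\<alpha> ^ d) ^ m" by (simp only: power_mult)
    then show "\<alpha> ^ k \<in> N" using fin_subgroup_power[OF N d(2)] by simp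
  qed
  then show ?thesis by blast
qed

text \<open>Both numbers have order 3 modulo \<open>d\<close>, so they are opposite or equal.
  Equality is written as \<open>d dvd i + 2 * j\<close>, since \<open>3 * j\<close> vanishes modulo
  \<open>d\<close>.\<close>

lemma dvd_order_3:
  fixes d i j :: nat
  assumes "d dvd 3 * i" "d dvd 3 * j" "\<not> d dvd i" "\<not> d dvd j"
  shows "d dvd i + j \<or> d dvd i + 2 * j"
proof -
  have "3 dvd d"
  proof (rule ccontr)
    assume "\<not> 3 dvd d"
    moreover have g: "gcd 3 d dvd 3" "gcd 3 d dvd d" by simp_all
    moreover have "gcd 3 d \<le> 3" using g(1) by (rule dvd_imp_le) simp
    then consider "gcd 3 d = 0" | "gcd 3 d = 1" | "gcd 3 d = 2" | "gcd 3 d = 3" by linarith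
    then have "gcd 3 d = 1 \<or> gcd 3 d = 3" using g(1) by cases auto
    ultimately have "coprime 3 d" unfolding coprime_iff_gcd_eq_1 by metis
    then have "d dvd i" using assms(1) by (simp add: coprime_dvd_mult_right_iff coprime_commute)
    then show False using assms(3) by simp
  qed
  then obtain e where e: "d = 3 * e" ..
  then have "e dvd i" "e dvd j" using assms(1,2) by simp_all
  then obtain i' j' where ij: "i = e * i'" "j = e * j'" by (auto elim!: dvdE)
  have "\<not> 3 dvd i'" "\<not> 3 dvd j'" using assms(3,4)
    unfolding e ij by (auto simp: mult.commute[of 3] intro: mult_dvd_mono)
  then have "3 dvd i' + j' \<or> 3 dvd i' + 2 * j'" by presburger
  then have "e * 3 dvd e * (i' + j') \<or> e * 3 dvd e * (i' + 2 * j')" by auto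
  then show ?thesis unfolding e ij by (simp add: algebra_simps)
qed

text \<open>Here \<open>d\<close> divides 4, and the units modulo 4 are 1 and -1. Equality of
  \<open>i\<close> and \<open>j\<close> is written as \<open>d dvd i + 3 * j\<close>, since
  \<open>4 * j\<close> vanishes modulo \<open>d\<close>.\<close>

lemma dvd_order_4:
  fixes d i j :: nat
  assumes "d dvd 4 * i" "coprime i d" "coprime j d"
  shows "d dvd i + j \<or> d dvd i + 3 * j"
proof -
  have "d dvd 4" using assms(1,2) by (simp add: coprime_dvd_mult_left_iff coprime_commute)
  then have "d \<le> 4" by (rule dvd_imp_le) simp
  then consider "d = 0" | "d = 1" | "d = 2" | "d = 3" | "d = 4" by linarith
  moreover have odd: "odd k" if "coprime k d" "even d" for k
    using coprime_common_divisor[OF that(1) _ that(2)] by auto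
  ultimately show ?thesis
  proof cases
    case 3
    then show ?thesis using odd[OF assms(2)] odd[OF assms(3)] unfolding 3 by simp
  next
    case 5
    then show ?thesis using odd[OF assms(2)] odd[OF assms(3)] unfolding 5 by presburger
  qed (use \<open>d dvd 4\<close> in auto)
qed

lemma cyclic_order_3:
  assumes F: "fin_subgroup F" "\<alpha> \<in> F" and N: "fin_subgroup N" and x: "x1 = \<alpha> ^ i" "x2 = \<alpha> ^ j"
    and o3: "x1 * x1 * x1 \<in> N" "x2 * x2 * x2 \<in> N" and n: "x1 \<notin> N" "x2 \<notin> N"
  shows "inverse x2 * x1 \<in> N \<or> x1 * x2 \<in> N"
proof -
  obtain d where d: "\<And>k. \<alpha> ^ k \<in> N \<longleftrightarrow> d dvd k" using power_mem_dvd[OF F N] by blast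
  have cube: "\<alpha> ^ k * \<alpha> ^ k * \<alpha> ^ k = \<alpha> ^ (3 * k)" for k
  proof -
    have "k + k + k = 3 * k" by simp
    then show ?thesis by (simp only: power_add[symmetric])
  qed
  have "d dvd 3 * i" "d dvd 3 * j" "\<not> d dvd i" "\<not> d dvd j" using o3 n unfolding x cube d by blast+
  then have "d dvd i + j \<or> d dvd i + 2 * j" by (rule dvd_order_3)
  then show ?thesis
  proof
    assume "d dvd i + j"
    then show ?thesis unfolding d[symmetric] x power_add by blast
  next
    assume "d dvd i + 2 * j"
    then have 1: "\<alpha> ^ (i + 2 * j) \<in> N" unfolding d .
    have x20: "x2 \<noteq> 0" "x2 * x2 * x2 \<noteq> 0"
      using uq_nonzero[OF fin_subgroupD(3)[OF F]] unfolding x by simp_all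
    have "i + 2 * j = j + j + i" by simp
    then have "\<alpha> ^ (i + 2 * j) = \<alpha> ^ (j + j) * \<alpha> ^ i" by (simp only: power_add)
    then have "\<alpha> ^ (i + 2 * j) = x2 * x2 * x1" unfolding x by (simp add: power_add)
    then have "inverse (x2 * x2 * x2) * \<alpha> ^ (i + 2 * j) = inverse x2 * x1"
      using x20(1) by (simp add: nonzero_inverse_mult_distrib mult.assoc)
    then show ?thesis using fin_subgroupD(4)[OF N fin_subgroup_inverse[OF N o3(2)] 1] by simp
  qed
qed

lemma cyclic_order_4:
  assumes F: "fin_subgroup F" "\<alpha> \<in> F" and N: "fin_subgroup N" and x: "x1 = \<alpha> ^ i" "x2 = \<alpha> ^ j"
    and o4: "x1 ^ 4 \<in> N" "x2 ^ 4 \<in> N" and g: "inverse (x1 ^ k) * \<alpha> \<in> N" "inverse (x2 ^ l) * \<alpha> \<in> N"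
  shows "inverse x2 * x1 \<in> N \<or> x1 * x2 \<in> N"
proof -
  obtain d where d: "\<And>k. \<alpha> ^ k \<in> N \<longleftrightarrow> d dvd k" using power_mem_dvd[OF F N] by blast
  \<comment> \<open>Modulo \<open>N\<close> the generator \<open>\<alpha>\<close> is a power of its
    own power with exponent \<open>i\<close>, so \<open>i\<close> is invertible modulo
    \<open>d\<close>.\<close>
  have cop: "coprime i d" if "inverse ((\<alpha> ^ i) ^ k) * \<alpha> \<in> N" for i k
  proof (rule coprimeI)
    fix e assume e: "e dvd i" "e dvd d"
    have aF: "\<alpha> ^ (i * k) \<in> F" by (rule fin_subgroup_power[OF F])
    obtain m where m: "inverse (\<alpha> ^ (i * k)) = (\<alpha> ^ (i * k)) ^ m"
      using inverse_is_power[OF F(1) aF] by blast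
    have "\<alpha> ^ (i * k) * inverse (\<alpha> ^ (i * k)) = 1" using fin_subgroupD(3)[OF F(1) aF] by simp
    then have "\<alpha> ^ (i * k + i * k * m) = 1" unfolding m by (simp add: power_add power_mult)
    have "(\<alpha> ^ (i * k)) ^ m * \<alpha> \<in> N"
      using that unfolding power_mult[symmetric] m[unfolded power_mult[symmetric]] .
    then have "\<alpha> ^ (i * k * m + 1) \<in> N" by (simp only: power_mult power_add power_one_right)
    then have "d dvd i * k * m + 1" unfolding d .
    then have "e dvd i * k * m + 1" using e(2) dvd_trans by blast
    moreover have "e dvd i * k * m" using e(1) by simp
    ultimately show "is_unit e" using dvd_add_right_iff by blast
  qed
  have "coprime i d" "coprime j d" using cop[of i k] cop[of j l] g unfolding x by blast+
  moreover have "d dvd 4 * i" using o4(1)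
    unfolding x power_mult[symmetric] d by (simp add: mult.commute)
  ultimately have "d dvd i + j \<or> d dvd i + 3 * j" using dvd_order_4 by blast
  then show ?thesis
  proof
    assume "d dvd i + j"
    then show ?thesis unfolding d[symmetric] x power_add by blast
  next
    assume "d dvd i + 3 * j"
    then have 1: "\<alpha> ^ (i + 3 * j) \<in> N" unfolding d .
    have x20: "x2 \<noteq> 0" using uq_nonzero[OF fin_subgroupD(3)[OF F]] unfolding x by simp_all
    have "i + 3 * j = j + j + j + i" by simp
    then have "\<alpha> ^ (i + 3 * j) = \<alpha> ^ (j + j + j) * \<alpha> ^ i" by (simp only: power_add)
    then have "\<alpha> ^ (i + 3 * j) = x2 * x2 * x2 * x1" unfolding x by (simp add: power_add)
    moreover have "x2 ^ 4 = x2 * x2 * x2 * x2" by (simp add: numeral_eq_Suc mult.assoc)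
    ultimately have "inverse (x2 ^ 4) * \<alpha> ^ (i + 3 * j) = inverse x2 * x1"
      using x20 by (simp add: nonzero_inverse_mult_distrib mult.assoc)
    then show ?thesis using fin_subgroupD(4)[OF N fin_subgroup_inverse[OF N o4(2)] 1] by simp
  qed
qed

lemma rotation_cj:
  assumes F: "fin_subgroup F" and d: "dihedral F a b" and v: "v \<in> F" and x: "x \<in> F" "x * a = a * x"
  shows "cj v x = x \<or> cj v x = inverse x"
proof (cases "v * a = a * v")
  case True
  have "v * x = x * v"
    using commute_trans[OF dihedralD(3,5,6)[OF F d] True x(2)] .
  then have "cj v x = x" using fin_subgroupD(3)[OF F v] by (simp add: mult.assoc)
  then show ?thesis ..
next
  case False then show ?thesis using reflect_rotation(3)[OF F d v False x] by simp
qed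

text \<open>Lifts of \<open>a\<close> and \<open>b\<close> are conjugate in \<open>R\<close>, so
  both are rotations or both are reflections, and the former would make \<open>R\<close> consist of
  rotations. Writing the lift of \<open>b\<close> as \<open>y * x\<close> with a rotation
  \<open>x\<close>, the braid relation says precisely that \<open>x\<close> has trivial cube modulo
  the kernel.\<close>

lemma polyhedral_dihedral_lift:
  assumes G: "fin_subgroup2 G" and p: "polyhedral (lft G) c a b" and d: "dihedral (rgt G) \<alpha> \<beta>"
    and N: "\<And>n. n \<in> kr G \<Longrightarrow> n * \<alpha> = \<alpha> * n"
    and y: "(a, y) \<in> G"
  shows "y * \<alpha> \<noteq> \<alpha> * y" "\<exists>x\<in>rgt G. (b, y * x) \<in> G \<and> x * \<alpha> = \<alpha> * x \<and> x * x * x \<in> kr G"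
proof -
  note R = fin_subgroup_rgt[OF G] and P = polyhedralD[OF fin_subgroup_lft[OF G] p]
    and D = dihedralD[OF fin_subgroup_rgt[OF G] d]
  have yR: "y \<in> rgt G" by (rule rgtI[OF y])
  obtain v where v: "v \<in> rgt G" "(b, cj v y) \<in> G" using polyhedral_lift[OF G p y] by blast
  define z where "z = cj v y"
  have z: "(b, z) \<in> G" "z \<in> rgt G" using v(2) rgtI by (auto simp: z_def)
  have v0: "v \<noteq> 0" using fin_subgroupD(3)[OF R v(1)] by auto
  have inv_comm: "x * a = a * x" if "inverse x * a = a * inverse x" "x \<noteq> 0" for x a :: quat
  proof -
    have "x * (inverse x * a) * x = x * (a * inverse x) * x" using that(1) by simp
    then show ?thesis using that(2) by (simp add: mult.assoc)
  qed
  show ref: "y * \<alpha> \<noteq> \<alpha> * y"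
  proof
    assume r: "y * \<alpha> = \<alpha> * y"
    have "cj v y * \<alpha> = \<alpha> * cj v y"
      using rotation_cj[OF R d v(1) yR r]
    proof
      assume "cj v y = y" then show ?thesis using r by (simp only:)
    next
      assume e: "cj v y = inverse y"
      have "qnorm2 y = 1" by (rule fin_subgroupD(3)[OF R yR])
      then show ?thesis unfolding e using inv_comm[of "inverse y" \<alpha>] r uq_nonzero[of y] by simp
    qed
    then show False
      using not_all_rotations[OF G d N P(12)] y v(2) r by blast
  qed
  have zref: "z * \<alpha> \<noteq> \<alpha> * z"
  proof
    assume r: "z * \<alpha> = \<alpha> * z"
    have iv: "inverse v \<in> rgt G" by (rule fin_subgroup_inverse[OF R v(1)])
    have e: "cj (inverse v) z = y" unfolding z_def by (rule cj_cancel(1)[OF v0])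
    from rotation_cj[OF R d iv z(2) r] have "y = z \<or> y = inverse z" unfolding e .
    then have "y * \<alpha> = \<alpha> * y"
    proof
      assume "y = z" then show ?thesis using r by simp
    next
      assume e: "y = inverse z"
      have "qnorm2 z = 1" by (rule fin_subgroupD(3)[OF R z(2)])
      then show ?thesis unfolding e using inv_comm[of "inverse z" \<alpha>] r uq_nonzero[of z] by simp
    qed
    then show False using ref by simp
  qed
  have yy: "y * y = - 1" by (rule dihedral_reflect(2)[OF R d yR ref])
  have iy: "inverse y = - y" using yy by (metis inverse_unique minus_mult_right minus_minus)
  have ny: "qnorm2 y = 1" by (rule fin_subgroupD(3)[OF R yR])
  have y0: "y \<noteq> 0" using ny by auto
  define x where "x = inverse y * z"
  have xR: "x \<in> rgt G" unfolding x_def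
    by (rule fin_subgroupD(4)[OF R fin_subgroup_inverse[OF R yR] z(2)])
  have zx: "z = y * x" using y0 by (simp add: x_def)
  have xr: "x * \<alpha> = \<alpha> * x" using reflect_mult[OF R d yR ref z(2) zref] by (simp add: x_def iy)
  have nx: "qnorm2 x = 1" by (rule fin_subgroupD(3)[OF R xR])
  have x0: "x \<noteq> 0" using nx by auto
  have xy: "x * y = y * inverse x" by (rule reflect_rotation(2)[OF R d yR ref xR xr])
  have "(a * b * a, y * z * y) \<in> G" "(a * b * a, z * y * z) \<in> G"
    using fin_subgroup2D(5)[OF G fin_subgroup2D(5)[OF G y z(1)] y] fin_subgroup2D(5)[OF G
      fin_subgroup2D(5)[OF G z(1) y] z(1)] P(15) by simp_all
  then have 1: "inverse (z * y * z) * (y * z * y) \<in> kr G" using fiber_diff[OF G] by blast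
  have A: "y * z * y = - (y * inverse x)"
  proof -
    have "y * z * y = (y * y) * (x * y)" unfolding zx by (simp only: mult.assoc)
    then show ?thesis unfolding yy xy by simp
  qed
  have B: "z * y * z = - (y * x * x)"
  proof -
    have "z * y * z = y * (x * y) * (y * x)" unfolding zx by (simp only: mult.assoc)
    also have "\<dots> = y * (y * inverse x) * (y * x)" unfolding xy ..
    also have "\<dots> = (y * y) * (inverse x * y) * x" by (simp only: mult.assoc)
    also have "inverse x * y = y * x" using reflect_rotation(1)[OF R d yR ref xR xr] by simp
    also have "(y * y) * (y * x) * x = - (y * x * x)" unfolding yy by (simp add: mult.assoc)
    finally show ?thesis .
  qed
  have "inverse (z * y * z) * (y * z * y) = inverse (x * x * x)"
    unfolding A B using x0 y0 by (simp add: nonzero_inverse_mult_distrib mult.assoc)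
  then have "inverse (x * x * x) \<in> kr G" using 1 by simp
  then have "x * x * x \<in> kr G" using fin_subgroup_inverse[OF normal_subD(1)[OF normal_sub_kr[OF G]],
    of "inverse (x * x * x)"] by simp
  then show "\<exists>x\<in>rgt G. (b, y * x) \<in> G \<and> x * \<alpha> = \<alpha> * x \<and> x * x * x \<in> kr G"
    using xR z(1) zx xr by blast
qed

text \<open>Modulo \<open>N\<close> the rotations \<open>x1\<close> and \<open>x2\<close> are both
  trivial or both of order 3 in a cyclic group, so they are equal or inverse to each other. Of the
  two conjugations \<open>h\<close> and \<open>y2 * h\<close>, which both send \<open>y1\<close> to
  \<open>y2\<close>, one fixes and one inverts the rotations.\<close>

lemma conj_equiv_polyhedral_dihedral:
  assumes t: "twins G H L M R N" and L: "polyhedral L c a b" and R: "dihedral R \<alpha> \<beta>"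
    and i: "\<not> index_le_2 R N" shows "conj_equiv G H"
proof -
  note T = twinsD[OF t] and P = polyhedralD[OF twinsD(12)[OF t] L]
    and D = dihedralD[OF twinsD(13)[OF t] R]
  note rot = dihedral_normal_rotations[OF T(13) R T(15) i]
  obtain y1 where y1: "(a, y1) \<in> G" using P(1) T(4) lftE by metis
  obtain y2 where y2: "(a, y2) \<in> H" using P(1) T(5) lftE by metis
  have r1: "y1 * \<alpha> \<noteq> \<alpha> * y1" "\<exists>x\<in>R. (b, y1 * x) \<in> G \<and> x * \<alpha> = \<alpha> * x \<and> x * x * x \<in> N"
    using polyhedral_dihedral_lift[OF T(1) _ _ _ y1, of c b \<alpha> \<beta>] L R rot T(4,8,10) by auto
  have r2: "y2 * \<alpha> \<noteq> \<alpha> * y2" "\<exists>x\<in>R. (b, y2 * x) \<in> H \<and> x * \<alpha> = \<alpha> * x \<and> x * x * x \<in> N"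
    using polyhedral_dihedral_lift[OF T(2) _ _ _ y2, of c b \<alpha> \<beta>] L R rot T(5,9,11) by auto
  obtain x1 where x1: "x1 \<in> R" "(b, y1 * x1) \<in> G" "x1 * \<alpha> = \<alpha> * x1" "x1 * x1 * x1 \<in> N"
    using r1(2) by blast
  obtain x2 where x2: "x2 \<in> R" "(b, y2 * x2) \<in> H" "x2 * \<alpha> = \<alpha> * x2" "x2 * x2 * x2 \<in> N"
    using r2(2) by blast
  have yR: "y1 \<in> R" "y2 \<in> R" using rgtI[OF y1] rgtI[OF y2] T(8,9) by auto
  have n0: "a \<noteq> 0" "y1 \<noteq> 0" "y2 \<noteq> 0" "x1 \<noteq> 0" "x2 \<noteq> 0"
    using P(3) fin_subgroupD(3)[OF T(13)] yR x1(1) x2(1) uq_nonzero by blast+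
  \<comment> \<open>\<open>x1\<close> in \<open>G\<close> and \<open>x2\<close> in \<open>H\<close>
    are lifts of the same element \<open>inverse a * b\<close>, so each is in \<open>N\<close>
    exactly when this is in \<open>M\<close>.\<close>
  have ker: "x1 \<in> N \<longleftrightarrow> x2 \<in> N"
  proof -
    have "(inverse a * b, inverse y1 * (y1 * x1)) \<in> G" "(inverse a * b, inverse y2 * (y2 * x2)) \<in> H"
      using fin_subgroup2D(5)[OF T(1) fin_subgroup2_inverse[OF T(1) y1] x1(2)] fin_subgroup2D(5)[OF
        T(2) fin_subgroup2_inverse[OF T(2) y2] x2(2)] .
    then have "(inverse a * b, x1) \<in> G" "(inverse a * b, x2) \<in> H" using n0 by simp_all
    then show ?thesis using kernel_iff[OF T(1)] kernel_iff[OF T(2)] T(6,7,10,11) by blast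
  qed
  obtain h where h: "qnorm2 h = 1" "cj h \<alpha> = \<alpha>" "cj h y1 = y2"
    using reflect_conj[OF T(13) R yR(1) r1(1) yR(2) r2(1)] by blast
  have h0: "h \<noteq> 0" using h by auto
  have fixr: "cj h x = x" if "x \<in> R" "x * \<alpha> = \<alpha> * x" for x
    by (rule rotation_fix[OF T(13) R h(1,2) that])
  have "cj h n = n" if "n \<in> N" for n by (rule fixr[OF normal_subD(2)[OF T(15) that] rot[OF that]])
  then have hN: "cj h ` N = N" by simp
  have hx: "cj h (y1 * x1) = y2 * x1" unfolding cj_mult[OF h0] h(3) fixr[OF x1(1,3)] ..
  have "inverse x2 * x1 \<in> N \<or> x1 * x2 \<in> N"
  proof (cases "x1 \<in> N")
    case True then show ?thesis using ker fin_subgroupD(4)[OF T(17)] by blast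
  next
    case False
    obtain i j where "x1 = \<alpha> ^ i" "x2 = \<alpha> ^ j"
      using dihedral_rotation[OF T(13) R x1(1,3)] dihedral_rotation[OF T(13) R x2(1,3)] by blast
    then show ?thesis using cyclic_order_3[OF T(13) D(1) T(17) _ _ x1(4) x2(4)] False ker by blast
  qed
  then show ?thesis
  proof
    assume e: "inverse x2 * x1 \<in> N"
    show ?thesis
    proof (rule conj_equiv_two_lifts[OF t P(12) _ h(1) hN y1 x1(2), of 1 y2 "y2 * x2"])
      show "qnorm2 1 = 1" "(cj 1 a, y2) \<in> H" "(cj 1 b, y2 * x2) \<in> H" using y2 x2 by simp_all
      show "inverse y2 * cj h y1 \<in> N" unfolding h(3) using n0 fin_subgroupD(2)[OF T(17)] by simp
      show "inverse (y2 * x2) * cj h (y1 * x1) \<in> N" unfolding hx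
        using n0 e by (simp add: nonzero_inverse_mult_distrib mult.assoc)
    qed
  next
    assume e: "x1 * x2 \<in> N"
    \<comment> \<open>Conjugation by the reflection \<open>y2\<close> fixes \<open>y2\<close> and
      inverts all rotations.\<close>
    define k where "k = y2 * h"
    have k: "qnorm2 k = 1" using h(1) fin_subgroupD(3)[OF T(13) yR(2)] by (simp add: k_def)
    have kc: "cj k x = cj y2 (cj h x)" for x unfolding k_def cj_cj ..
    have flip: "cj y2 x = inverse x" if "x \<in> R" "x * \<alpha> = \<alpha> * x" for x
      by (rule reflect_rotation(3)[OF T(13) R yR(2) r2(1) that])
    have ky: "cj k y1 = y2" unfolding kc h(3) using n0 by (simp add: mult.assoc)
    have kx: "cj k (y1 * x1) = y2 * inverse x1"
      unfolding kc hx cj_mult[OF n0(3)] flip[OF x1(1,3)] using n0 by (simp add: mult.assoc)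
    have "cj k n \<in> N" if "n \<in> N" for n
      unfolding kc fixr[OF normal_subD(2)[OF T(15) that] rot[OF that]] flip[OF normal_subD(2)[OF
        T(15) that] rot[OF that]]
      by (rule fin_subgroup_inverse[OF T(17) that])
    then have kN: "cj k ` N = N" by (intro cj_image_self[OF T(17) k]) blast
    show ?thesis
    proof (rule conj_equiv_two_lifts[OF t P(12) _ k kN y1 x1(2), of 1 y2 "y2 * x2"])
      show "qnorm2 1 = 1" "(cj 1 a, y2) \<in> H" "(cj 1 b, y2 * x2) \<in> H" using y2 x2 by simp_all
      show "inverse y2 * cj k y1 \<in> N" unfolding ky using n0 fin_subgroupD(2)[OF T(17)] by simp
      have "inverse (x1 * x2) \<in> N" by (rule fin_subgroup_inverse[OF T(17) e])
      then show "inverse (y2 * x2) * cj k (y1 * x1) \<in> N" unfolding kx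
        using n0 by (simp add: nonzero_inverse_mult_distrib mult.assoc)
    qed
  qed
qed

section \<open>Two polyhedral projections\<close>

lemma polyhedral_change_generators:
  assumes F: "fin_subgroup F" and p: "polyhedral F c a b" and y: "y \<in> F" "qre y = c"
    and z: "z \<in> F" "qre z = c" and yz: "qre (y * z) = 1 / 2" "y * z \<noteq> z * y"
  shows "polyhedral F c y z"
proof -
  note P = polyhedralD[OF F p] and nc = noncommuting_noncentral[OF yz(2)]
  have sub: "{y, z} \<subseteq> F" using y z by simp
  obtain k where k: "- 1 = y ^ k" using maxre_generator_power[OF F P(10,11) y nc(1,2) P(10)] by auto
  have "y ^ k \<in> mgen {y, z}" by (rule fin_subgroup_power[OF fin_subgroup_mgen[OF F sub]]) (simp add:
    mgen_base)
  then have "F \<subseteq> mgen {y, z}"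
    using braid_generation[OF F P(11) y z yz(2) P(13) fin_subgroup_mgen[OF F sub] mgen_subset[OF F
      sub]] k by (simp add: mgen_base)
  then have "F = mgen {y, z}" using mgen_subset[OF F sub] by blast
  then show ?thesis unfolding polyhedral_def using y z yz P(9,10,11) by blast
qed

text \<open>Inside \<open>F\<close> only \<open>a\<close> or \<open>inverse a\<close> can be
  reached. The triple of real parts of \<open>inverse a\<close>, \<open>inverse b\<close> is that of
  \<open>a\<close>, \<open>b\<close>, so some unit quaternion inverts both generators, and it
  preserves \<open>F\<close>.\<close>

lemma polyhedral_conj_to_generator:
  assumes F: "fin_subgroup F" and p: "polyhedral F c a b" and y: "y \<in> F" "qre y = c"
  shows "\<exists>h\<in>uq. cj h y = a \<and> cj h ` F = F"
proof -
  note P = polyhedralD[OF F p]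
  obtain f where f: "f \<in> F" "cj f y = a \<or> cj f y = inverse a"
    using polyhedral_conj_generator[OF F p y] by blast
  have nf: "qnorm2 f = 1" by (rule fin_subgroupD(3)[OF F f(1)])
  have "cj f ` F \<subseteq> F" using fin_subgroup_cj[OF F f(1)] by blast
  then have fF: "cj f ` F = F" by (rule cj_image_self[OF F nf])
  from f(2) show ?thesis
  proof
    assume "cj f y = a" then show ?thesis using nf fF by blast
  next
    assume e: "cj f y = inverse a"
    have ab: "qre (inverse a * inverse b) = qre (a * b)"
    proof -
      have "inverse a * inverse b = inverse (b * a)"
        using uq_nonzero[OF P(3)] uq_nonzero[OF P(4)] by (simp add: nonzero_inverse_mult_distrib)
      then show ?thesis using P(3,4) qre_mult_commute[of b a] by simp
    qed
    obtain k where k: "qnorm2 k = 1" "cj k (inverse a) = a" "cj k (inverse b) = b"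
      using conj_pair[of "inverse a" "inverse b" a b] P(3,4) ab by auto
    have k0: "k \<noteq> 0" using k by auto
    have ka: "cj k a = inverse a" "cj k b = inverse b"
      using k(2,3) cj_inverse[OF k0, of a] cj_inverse[OF k0, of b] by (metis inverse_inverse_eq)+
    have "cj k ` F = mgen (cj k ` {a, b})" using mgen_cj[OF k0, of "{a, b}"] P(12) by simp
    also have "\<dots> = mgen {inverse a, inverse b}" using ka by simp
    also have "\<dots> \<subseteq> F" by (rule mgen_subset[OF F]) (use P(1,2) fin_subgroup_inverse[OF F] in simp)
    finally have kF: "cj k ` F = F" by (rule cj_image_self[OF F k(1)])
    have "cj (k * f) y = a" unfolding cj_cj[symmetric] e by (rule k(2))
    moreover have "cj (k * f) ` F = cj k ` cj f ` F" unfolding image_image cj_cj ..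
    then have "cj (k * f) ` F = F" unfolding fF kF .
    ultimately show ?thesis using k(1) nf by (intro bexI[of _ "k * f"]) auto
  qed
qed

text \<open>The products \<open>y * n\<close> lie outside \<open>N\<close> and have squares in
  \<open>N\<close>, so these squares are -1 or imaginary and \<open>qre (y * n)\<close> has square 0
  or 1/2. By Parseval's identity not all of them vanish, and the sign is adjusted by -1 in
  \<open>N\<close>.\<close>

lemma coset_re_c4:
  assumes R: "fin_subgroup R" and N: "normal_sub N R" and d: "dihedral N e1 e2" "qre e1 = 0"
    and y: "y \<in> R" "y \<notin> N" "y * y \<in> N"
  shows "\<exists>n\<in>N. qre (y * n) = c4"
proof -
  note fN = normal_subD(1)[OF N] and D = dihedralD[OF normal_subD(1)[OF N] d(1)]
  have m0: "maxre N 0" using D(11) d(2) by simp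
  have ny: "qnorm2 y = 1" by (rule fin_subgroupD(3)[OF R y(1)])
  have v: "(qre (y * n))\<^sup>2 = 0 \<or> (qre (y * n))\<^sup>2 = 1 / 2" if n: "n \<in> N" for n
  proof -
    have nn: "qnorm2 n = 1" by (rule fin_subgroupD(3)[OF fN n])
    have ynN: "y * n \<notin> N"
    proof
      assume "y * n \<in> N"
      then have "y * n * inverse n \<in> N"
        by (rule fin_subgroupD(4)[OF fN _ fin_subgroup_inverse[OF fN n]])
      then show False using y(2) nn by (simp add: mult.assoc)
    qed
    have "inverse y * n * y \<in> N" by (rule normal_sub_factor[OF R N y(1) n])
    then have "y * y * (inverse y * n * y) * n \<in> N" using fin_subgroupD(4)[OF fN] y(3) n by blast
    moreover have "y * n * (y * n) = y * y * (inverse y * n * y) * n"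
      using ny by (simp add: mult.assoc uq_nonzero)
    ultimately have "y * n * (y * n) \<in> N" by simp
    then consider "y * n * (y * n) = 1" | "y * n * (y * n) = - 1" | "qre (y * n * (y * n)) = 0"
      using pure_maxre_0[OF fN D(12) m0] by blast
    moreover have "qre (y * n * (y * n)) = 2 * (qre (y * n))\<^sup>2 - 1"
      using uq_quadratic[of "y * n"] ny nn by (simp add: power2_eq_square)
    moreover have "y * n * (y * n) \<noteq> 1"
    proof
      assume "y * n * (y * n) = 1"
      then have "y * n = 1 \<or> y * n = - 1" by (rule square_eq_one)
      then show False using ynN fin_subgroupD(2)[OF fN] D(12) by auto
    qed
    ultimately show ?thesis by cases auto
  qed
  have "\<exists>n\<in>N. (qre (y * n))\<^sup>2 = 1 / 2"
  proof (rule ccontr)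
    assume "\<not> ?thesis"
    then have z: "qre (y * n) = 0" if "n \<in> N" for n using v[OF that] that by auto
    have "qnorm2 y = 0"
      using quat_basis_parseval[OF D(3,4) d(2) D(9,10), of y] z[OF fin_subgroupD(2)[OF fN]] z[OF
        D(1)] z[OF D(2)] z[OF fin_subgroupD(4)[OF fN D(1,2)]] by simp
    then show False using ny by simp
  qed
  then obtain n where n: "n \<in> N" "(qre (y * n))\<^sup>2 = 1 / 2" by blast
  have "(c4)\<^sup>2 = 1 / 2" by (simp add: power_divide)
  then have "(qre (y * n))\<^sup>2 = c4\<^sup>2" using n(2) by simp
  then have "qre (y * n) = c4 \<or> qre (y * n) = - c4" by (rule power2_eq_iff[THEN iffD1])
  moreover have "- n \<in> N" using fin_subgroupD(4)[OF fN D(12) n(1)] by simp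
  ultimately show ?thesis using n(1) by (metis mult_minus_right quat_sel(5) minus_minus)
qed

text \<open>Modulo the kernels \<open>a\<close> and \<open>b\<close> have order 2. So their lifts
  can be chosen of real part \<open>c4\<close>, and \<open>inverse z0\<close> is a lift of
  \<open>b\<close> as well as \<open>z0\<close>; one of the two forms a braid pair with
  \<open>y\<close>. They do not commute with \<open>y\<close>, as otherwise \<open>a * b\<close>
  would lie in the left kernel.\<close>

lemma polyhedral_polyhedral_c4_lift:
  assumes G: "fin_subgroup2 G" and p: "polyhedral (lft G) c4 a b" and q: "polyhedral (rgt G) c4 \<alpha> \<beta>"
    and dM: "dihedral (kl G) m1 m2" "qre m1 = 0" and dN: "dihedral (kr G) n1 n2" "qre n1 = 0"
  shows "\<exists>y z. (a, y) \<in> G \<and> (b, z) \<in> G \<and> polyhedral (rgt G) c4 y z"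
proof -
  note L = fin_subgroup_lft[OF G] and R = fin_subgroup_rgt[OF G]
  note P = polyhedralD[OF L p] and Q = polyhedralD[OF R q]
  note M = normal_sub_kl[OF G] and N = normal_sub_kr[OF G]
  note fM = normal_subD(1)[OF M] and fN = normal_subD(1)[OF N]
  have sq: "a * a \<in> kl G" "b * b \<in> kl G"
    using polyhedral_over_normal_q8(2)[OF L p M dM P(1,6) refl] polyhedral_over_normal_q8(2)[OF L p
      M dM P(2,7) refl] .
  have re4: "x \<notin> kl G" if "x \<in> lft G" "qre x = c4" for x
  proof
    assume "x \<in> kl G"
    then show False using polyhedral_normal_q8(3)[OF L p M dM] that(2) sqrt_bounds by fastforce
  qed
  have lift: "\<exists>w. (s, w) \<in> G \<and> qre w = c4" if s: "s \<in> lft G" "qre s = c4" "s * s \<in> kl G" for s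
  proof -
    obtain w where w: "(s, w) \<in> G" using s(1) by (rule lftE)
    have "w \<notin> kr G" using re4[OF s(1,2)] kernel_iff[OF G w] by simp
    moreover have "w * w \<in> kr G" using kernel_iff[OF G fin_subgroup2D(5)[OF G w w]] s(3) by simp
    ultimately obtain n where "n \<in> kr G" "qre (w * n) = c4"
      using coset_re_c4[OF R N dN rgtI[OF w]] by blast
    then show ?thesis using fiber_mult[OF G w] by blast
  qed
  obtain y where y: "(a, y) \<in> G" "qre y = c4" using lift[OF P(1,6) sq(1)] by blast
  obtain z0 where z0: "(b, z0) \<in> G" "qre z0 = c4" using lift[OF P(2,7) sq(2)] by blast
  have n: "qnorm2 y = 1" "qnorm2 z0 = 1"
    using fin_subgroup2D(4)[OF G y(1)] fin_subgroup2D(4)[OF G z0(1)] .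
  have z0': "(b, inverse z0) \<in> G"
  proof -
    have "inverse (b * b) \<in> kl G" by (rule fin_subgroup_inverse[OF fM sq(2)])
    have zz: "z0 * z0 \<in> kr G" using kernel_iff[OF G fin_subgroup2D(5)[OF G z0(1) z0(1)]] sq(2)
      by simp
    have "(b, z0 * inverse (z0 * z0)) \<in> G"
      by (rule fiber_mult[OF G z0(1) fin_subgroup_inverse[OF fN zz]])
    moreover have "z0 * inverse (z0 * z0) = inverse z0"
      using n by (simp add: nonzero_inverse_mult_distrib uq_nonzero)
    ultimately show ?thesis by simp
  qed
  have nab: "a * b \<notin> kl G"
  proof
    assume "a * b \<in> kl G"
    then show False using polyhedral_normal_q8(3)[OF L p M dM] P(8) by fastforce
  qed
  have noncomm: "y * z \<noteq> z * y" if z: "(b, z) \<in> G" "qre z = c4" for z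
  proof
    assume "y * z = z * y"
    then have "z = y \<or> z = inverse y"
      using commuting_same_re[OF n(1) fin_subgroup2D(4)[OF G z(1)]] y(2) z(2) by simp
    moreover have "y * y \<in> kr G" using kernel_iff[OF G fin_subgroup2D(5)[OF G y(1) y(1)]] sq(1)
      by simp
    ultimately have "y * z \<in> kr G" using n(1) fin_subgroupD(2)[OF fN] by auto
    then show False using kernel_iff[OF G fin_subgroup2D(5)[OF G y(1) z(1)]] nab by simp
  qed
  have yR: "y \<in> rgt G" and zR: "z0 \<in> rgt G" "inverse z0 \<in> rgt G"
    using rgtI[OF y(1)] rgtI[OF z0(1)] rgtI[OF z0'] .
  have zi: "qre (inverse z0) = c4" using z0(2) n by simp
  from braid_pair_exists(2)[OF R Q(10,11) yR y(2) zR(1) z0(2) noncomm[OF z0] Q(13)]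
  show ?thesis
  proof
    assume "qre (y * z0) = 1 / 2"
    then have "polyhedral (rgt G) c4 y z0"
      by (rule polyhedral_change_generators[OF R q yR y(2) zR(1) z0(2) _ noncomm[OF z0]])
    then show ?thesis using y(1) z0(1) by blast
  next
    assume "qre (y * inverse z0) = 1 / 2"
    then have "polyhedral (rgt G) c4 y (inverse z0)"
      by (rule polyhedral_change_generators[OF R q yR y(2) zR(2) zi _ noncomm[OF z0' zi]])
    then show ?thesis using y(1) z0' by blast
  qed
qed

text \<open>For \<open>c3\<close> the quotient by the quaternion group has no element of order 2: an
  element outside has real part 1/2 or -1/2, and its square has real part -1/2. For
  \<open>c4\<close> the class of \<open>\<alpha>\<close> does have order 2.\<close>

lemma polyhedral_q8_same_c:
  assumes G: "fin_subgroup2 G" and p: "polyhedral (lft G) c a b" and q: "polyhedral (rgt G) c' \<alpha> \<beta>"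
    and dM: "dihedral (kl G) m1 m2" "qre m1 = 0" and dN: "dihedral (kr G) n1 n2" "qre n1 = 0"
      and c: "c = c3"
  shows "c' = c3"
proof (rule ccontr)
  note L = fin_subgroup_lft[OF G] and R = fin_subgroup_rgt[OF G]
  note P = polyhedralD[OF L p] and Q = polyhedralD[OF R q]
  note M = normal_sub_kl[OF G] and N = normal_sub_kr[OF G]
  assume "c' \<noteq> c3"
  then have c4: "c' = c4" using polyhedral_normal_q8(2)[OF R q N dN] by blast
  have aa: "\<alpha> * \<alpha> \<in> kr G" by (rule polyhedral_over_normal_q8(2)[OF R q N dN Q(1,6) c4])
  have "\<alpha> \<notin> kr G" using polyhedral_normal_q8(3)[OF R q N dN] Q(6) c4 sqrt_bounds by fastforce
  moreover obtain l where l: "(l, \<alpha>) \<in> G" using Q(1) by (rule rgtE)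
  ultimately have lM: "l \<notin> kl G" using kernel_iff[OF G l] by simp
  have ll: "l * l \<in> kl G" using kernel_iff[OF G fin_subgroup2D(5)[OF G l l]] aa by simp
  have lL: "l \<in> lft G" by (rule lftI[OF l])
  have nl: "qnorm2 l = 1" by (rule fin_subgroupD(3)[OF L lL])
  have "kl G = {x \<in> lft G. qre x \<in> {0, 1, - 1}}"
    using polyhedral_normal_q8(1)[OF L p M dM] c by (simp add: quaternion_core_def)
  then have "qre l \<notin> {0, 1, - 1}" using lM lL by blast
  then have "qre l = 1 / 2 \<or> qre l = - 1 / 2" using polyhedral_values(1)[OF L p lL c] by auto
  then have "(qre l - 1 / 2) * (qre l + 1 / 2) = 0" by auto
  then have "qre l * qre l = 1 / 4" by (simp add: algebra_simps)
  moreover have "qre (l * l) = 2 * (qre l * qre l) - 1" using uq_quadratic[OF nl] by simp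
  ultimately have "qre (l * l) = - 1 / 2" by simp
  then show False using polyhedral_normal_q8(3)[OF L p M dM] ll by fastforce
qed

text \<open>For \<open>c3\<close> the elements \<open>a\<close> and \<open>b\<close> agree modulo
  \<open>M\<close>, so only the lift of \<open>a\<close> has to be matched; its real part is made
  1/2 by a sign, and \<open>N\<close> is described by real parts. For \<open>c4\<close> the lifts
  are polyhedral generators of \<open>R\<close> themselves, and \<open>N\<close> is generated by
  their squares.\<close>

lemma conj_equiv_polyhedral_polyhedral_q8:
  assumes t: "twins G H L M R N" and L: "polyhedral L c a b" and R: "polyhedral R c' \<alpha> \<beta>"
    and dM: "dihedral M m1 m2" "qre m1 = 0" and dN: "dihedral N n1 n2" "qre n1 = 0"
  shows "conj_equiv G H"
proof -
  note T = twinsD[OF t]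
  note P = polyhedralD[OF T(12) L] and Q = polyhedralD[OF T(13) R]
  have m1N: "- 1 \<in> N" using dihedralD(12)[OF T(17) dN(1)] .
  have c: "c = c3 \<or> c = c4" "c' = c3 \<or> c' = c4"
    using polyhedral_normal_q8(2)[OF T(12) L T(14) dM] polyhedral_normal_q8(2)[OF T(13) R T(15) dN]
      by blast+
  have "c = c3 \<longleftrightarrow> c' = c3"
  proof
    assume "c = c3"
    then show "c' = c3" using polyhedral_q8_same_c[OF T(1), of c a b c' \<alpha> \<beta> m1 m2 n1 n2] L R dM dN
      T(4,6,8,10) by blast
  next
    assume "c' = c3"
    then show "c = c3"
      using polyhedral_q8_same_c[OF fin_subgroup2_swap[OF T(1)], unfolded swap_simps T(4,6,8,10), OF
        R L dN dM] by blast
  qed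
  then consider "c = c3" "c' = c3" | "c = c4" "c' = c4" using c by blast
  then show ?thesis
  proof cases
    case 1
    have Mk: "M = {x \<in> L. qre x \<in> {0, 1, - 1}}"
      using polyhedral_normal_q8(1)[OF T(12) L T(14) dM] 1 by (simp add: quaternion_core_def)
    have Nk: "N = {x \<in> R. qre x \<in> {0, 1, - 1}}"
      using polyhedral_normal_q8(1)[OF T(13) R T(15) dN] 1 by (simp add: quaternion_core_def)
    have iab: "qre (a * inverse b) = 0" using qre_mult_inverse[OF P(4), of a] P(6,7,8) 1 by simp
    then have abM: "a * inverse b \<in> M" unfolding Mk
      using fin_subgroupD(4)[OF T(12) P(1) fin_subgroup_inverse[OF T(12) P(2)]] by simp
    have aM: "a \<notin> M" using P(6) 1 by (simp add: Mk)
    have lift: "\<exists>y z. (a, y) \<in> K \<and> (b, z) \<in> K \<and> qre y = c' \<and> z * inverse y \<in> N"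
      if K: "fin_subgroup2 K" "lft K = L" "rgt K = R" "kl K = M" "kr K = N" for K
    proof -
      obtain y0 where y0: "(a, y0) \<in> K" using P(1) K(2) lftE by metis
      have y0R: "y0 \<in> R" using rgtI[OF y0] K(3) by simp
      have "y0 \<notin> N" using kernel_iff[OF K(1) y0] aM K(4,5) by simp
      then have "qre y0 = c3 \<or> qre y0 = - c3"
        using polyhedral_values(1)[OF T(13) R y0R 1(2)] y0R by (auto simp: Nk)
      moreover have "(a, - y0) \<in> K" using fiber_mult[OF K(1) y0, of "- 1"] m1N K(5) by simp
      ultimately obtain y where y: "(a, y) \<in> K" "qre y = c'"
        using y0 1(2) by (metis quat_sel(5) minus_minus)
      obtain z where z: "(b, z) \<in> K" using P(2) K(2) lftE by metis
      have "(a * inverse b, y * inverse z) \<in> K"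
        by (rule fin_subgroup2D(5)[OF K(1) y(1) fin_subgroup2_inverse[OF K(1) z]])
      then have "y * inverse z \<in> N" using kernel_iff[OF K(1)] abM K(4,5) by blast
      then have "inverse (y * inverse z) \<in> N" by (rule fin_subgroup_inverse[OF T(17)])
      moreover have "inverse (y * inverse z) = z * inverse y"
        using fin_subgroup2D(4)[OF K(1) y(1)] fin_subgroup2D(4)[OF K(1) z]
          by (simp add: nonzero_inverse_mult_distrib uq_nonzero)
      ultimately show ?thesis using y z by auto
    qed
    obtain y1 z1 where 1: "(a, y1) \<in> G" "(b, z1) \<in> G" "qre y1 = c'" "z1 * inverse y1 \<in> N"
      using lift[OF T(1,4,8,6,10)] by blast
    obtain y2 z2 where 2: "(a, y2) \<in> H" "(b, z2) \<in> H" "qre y2 = c'" "z2 * inverse y2 \<in> N"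
      using lift[OF T(2,5,9,7,11)] by blast
    have yR: "y1 \<in> R" "y2 \<in> R" using rgtI[OF 1(1)] rgtI[OF 2(1)] T(8,9) by auto
    obtain h1 where h1: "qnorm2 h1 = 1" "cj h1 y1 = \<alpha>" "cj h1 ` R = R"
      using polyhedral_conj_to_generator[OF T(13) R yR(1) 1(3)] by blast
    obtain h2 where h2: "qnorm2 h2 = 1" "cj h2 y2 = \<alpha>" "cj h2 ` R = R"
      using polyhedral_conj_to_generator[OF T(13) R yR(2) 2(3)] by blast
    have h20: "h2 \<noteq> 0" using h2 by auto
    define h where "h = inverse h2 * h1"
    have h: "qnorm2 h = 1" using h1 h2 by (simp add: h_def)
    have h0: "h \<noteq> 0" using h by auto
    have hy: "cj h y1 = y2" unfolding h_def cj_cj[symmetric] h1(2)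
      using cj_cancel(1)[OF h20, of y2] unfolding h2(2) .
    have "cj h ` R = cj (inverse h2) ` cj h1 ` R" unfolding h_def image_image cj_cj ..
    then have hR: "cj h ` R = R" unfolding h1(3) conj_sym(2)[OF h2(1,3)] .
    have "cj h n \<in> N" if "n \<in> N" for n
      using that hR qre_cj[OF h0, of n] unfolding Nk by auto
    then have hN: "cj h ` N = N" by (intro cj_image_self[OF T(17) h]) blast
    show ?thesis
    proof (rule conj_equiv_two_lifts[OF t P(12) _ h hN 1(1,2), of 1 y2 z2])
      show "qnorm2 1 = 1" "(cj 1 a, y2) \<in> H" "(cj 1 b, z2) \<in> H" using 2 by simp_all
      have n2: "qnorm2 y2 = 1" "qnorm2 z2 = 1"
        using fin_subgroup2D(4)[OF T(2) 2(1)] fin_subgroup2D(4)[OF T(2) 2(2)] .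
      have n1: "qnorm2 y1 = 1" by (rule fin_subgroup2D(4)[OF T(1) 1(1)])
      show "inverse y2 * cj h y1 \<in> N" unfolding hy using n2 fin_subgroupD(2)[OF T(17)] by simp
      define u where "u = z1 * inverse y1"
      define v where "v = z2 * inverse y2"
      have uv: "u \<in> N" "v \<in> N" using 1(4) 2(4) by (simp_all add: u_def v_def)
      have z1: "z1 = u * y1" and z2: "z2 = v * y2"
        using n1 n2 by (simp_all add: u_def v_def mult.assoc)
      have v0: "v \<noteq> 0" using fin_subgroupD(3)[OF T(17) uv(2)] by auto
      have e: "inverse z2 * cj h z1 = inverse y2 * (inverse v * cj h u) * y2"
        unfolding z1 z2 cj_mult[OF h0] hy
          using v0 n2 by (simp add: nonzero_inverse_mult_distrib uq_nonzero mult.assoc)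
      have "cj h u \<in> N" using uv hN by blast
      then have "inverse v * cj h u \<in> N"
        by (rule fin_subgroupD(4)[OF T(17) fin_subgroup_inverse[OF T(17) uv(2)]])
      then show "inverse z2 * cj h z1 \<in> N"
        unfolding e by (rule normal_sub_factor[OF T(13,15) yR(2)])
    qed
  next
    case 2
    obtain y1 z1 where 1: "(a, y1) \<in> G" "(b, z1) \<in> G" "polyhedral R c4 y1 z1"
      using polyhedral_polyhedral_c4_lift[OF T(1), of a b \<alpha> \<beta> m1 m2 n1 n2] L R dM dN 2 T(4,6,8,10)
        by blast
    obtain y2 z2 where 2: "(a, y2) \<in> H" "(b, z2) \<in> H" "polyhedral R c4 y2 z2"
      using polyhedral_polyhedral_c4_lift[OF T(2), of a b \<alpha> \<beta> m1 m2 n1 n2] L R dM dN 2 T(5,7,9,11)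
        by blast
    note P1 = polyhedralD[OF T(13) 1(3)] and P2 = polyhedralD[OF T(13) 2(3)]
    obtain h where h: "qnorm2 h = 1" "cj h y1 = y2" "cj h z1 = z2"
      using conj_pair[OF P1(3,4) P2(3,4)] P1(6,7,8) P2(6,7,8) by auto
    have h0: "h \<noteq> 0" using h by auto
    have neq: "c4 \<noteq> c3" using sqrt_bounds by auto
    have N1: "N = {x. \<exists>k. x = (y1 * y1) ^ k \<or> x = z1 * z1 * (y1 * y1) ^ k}"
      and N2: "N = {x. \<exists>k. x = (y2 * y2) ^ k \<or> x = z2 * z2 * (y2 * y2) ^ k}"
      using polyhedral_normal_q8(1)[OF T(13) 1(3) T(15) dN] polyhedral_normal_q8(1)[OF T(13) 2(3)
        T(15) dN] neq by (simp_all add: quaternion_core_def)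
    have "cj h n \<in> N" if n: "n \<in> N" for n
    proof -
      obtain k where "n = (y1 * y1) ^ k \<or> n = z1 * z1 * (y1 * y1) ^ k" using n N1 by blast
      then have "cj h n = (y2 * y2) ^ k \<or> cj h n = z2 * z2 * (y2 * y2) ^ k"
        by (elim disjE) (simp_all only: cj_mult[OF h0] cj_power[OF h0] h(2,3) simp_thms)
      then show ?thesis unfolding N2 by blast
    qed
    then have hN: "cj h ` N = N" by (intro cj_image_self[OF T(17) h(1)]) blast
    show ?thesis by (rule conj_equiv_equal_lifts[OF t P(12) h(1) hN 1(1,2) 2(1,2) h(2,3)])
  qed
qed

lemma conj_equiv_polyhedral_polyhedral:
  assumes t: "twins G H L M R N" and L: "polyhedral L c a b" and R: "polyhedral R c' \<alpha> \<beta>"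
    and i: "\<not> index_le_2 L M" "\<not> index_le_2 R N"
  shows "conj_equiv G H"
proof -
  note T = twinsD[OF t]
  consider "N \<subseteq> {1, - 1}" | "M \<subseteq> {1, - 1}" | "\<not> N \<subseteq> {1, - 1}" "\<not> M \<subseteq> {1, - 1}" by blast
  then show ?thesis
  proof cases
    case 1 show ?thesis by (rule conj_equiv_polyhedral_central[OF t L 1])
  next
    case 2 show ?thesis by (rule conj_equiv_swap[OF conj_equiv_polyhedral_central[OF twins_swap[OF
      t] R 2]])
  next
    case 3
    then obtain x y where x: "x \<in> N" "x \<noteq> 1" "x \<noteq> - 1" and y: "y \<in> M" "y \<noteq> 1" "y \<noteq> - 1" by blast
    obtain m1 m2 where m: "dihedral M m1 m2" "qre m1 = 0"
      using polyhedral_normal_cases[OF T(12) L T(14) y] i by blast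
    obtain n1 n2 where n: "dihedral N n1 n2" "qre n1 = 0"
      using polyhedral_normal_cases[OF T(13) R T(15) x] i by blast
    show ?thesis by (rule conj_equiv_polyhedral_polyhedral_q8[OF t L R m n])
  qed
qed

section \<open>Two dihedral projections\<close>

lemma lifts_noncommuting:
  assumes G: "fin_subgroup2 G" and L: "lft G = mgen {a, b}" and p: "(a, y) \<in> G" "(b, z) \<in> G"
    and N: "kr G \<subseteq> {1, - 1}"
    and r: "\<alpha> \<in> rgt G" "\<beta> \<in> rgt G" "\<alpha> * \<beta> \<noteq> \<beta> * \<alpha>"
  shows "y * z \<noteq> z * y"
proof
  assume yz: "y * z = z * y"
  \<comment> \<open>The bicommutant of \<open>y\<close> and \<open>z\<close>. It contains the right
    projection, and if \<open>y\<close> and \<open>z\<close> commute, its elements commute with both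
    and therefore with each other.\<close>
  define C where "C = {u. \<forall>v. v * y = y * v \<longrightarrow> v * z = z * v \<longrightarrow> u * v = v * u}"
  have CI: "u * w \<in> C" if "u \<in> C" "w \<in> C" for u w
    unfolding C_def
  proof (intro CollectI allI impI)
    fix v assume "v * y = y * v" "v * z = z * v"
    then have c: "u * v = v * u" "w * v = v * w" using that by (auto simp: C_def)
    have "u * w * v = u * v * w" using c(2) by (simp add: mult.assoc)
    then show "u * w * v = v * (u * w)" using c(1) by (simp add: mult.assoc)
  qed
  have yC: "y \<in> C" and zC: "z \<in> C" by (auto simp: C_def)
  have sub: "rgt G \<subseteq> C"
  proof (rule rgt_span[OF G L])
    show "1 \<in> C" by (simp add: C_def)
    show "u * n \<in> C" if "u \<in> C" "n \<in> kr G" for u n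
      using CI[OF that(1), of n] that(2) N by (auto simp: C_def)
    show "\<exists>y. (s, y) \<in> G \<and> (\<forall>u\<in>C. y * u \<in> C)" if "s \<in> {a, b}" for s
      using that p CI yC zC by blast
  qed
  have "\<alpha> * y = y * \<alpha>" "\<alpha> * z = z * \<alpha>" using sub r(1) yz by (auto simp: C_def)
  then have "\<beta> * \<alpha> = \<alpha> * \<beta>" using sub r(2) unfolding C_def by blast
  then show False using r(3) by simp
qed

text \<open>In the quaternion group \<open>\<alpha>\<close> and \<open>\<beta>\<close> may be
  exchanged, so \<open>N\<close> consists of rotations about both axes and is central. The lifts of
  \<open>a\<close> and \<open>b\<close> do not commute, hence they and their product are imaginary,
  and \<open>conj_pair\<close> matches them.\<close>

lemma conj_equiv_dihedral_q8:
  assumes t: "twins G H L M R N" and L: "dihedral L a b" and R: "dihedral R \<alpha> \<beta>" "qre \<alpha> = 0"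
    and i: "\<not> index_le_2 R N" shows "conj_equiv G H"
proof -
  note T = twinsD[OF t]
  note D = dihedralD[OF T(12) L] and E = dihedralD[OF T(13) R(1)]
  have Lm: "L = mgen {a, b}" by (rule dihedral_mgen[OF T(12) L])
  have m0: "maxre R 0" using E(11) R(2) by simp
  have "dihedral R \<beta> \<alpha>" by (rule quaternion_group[OF T(13) E(12) m0 E(2,1)]) (use E(8) in simp)
  then have rot: "n * \<alpha> = \<alpha> * n" "n * \<beta> = \<beta> * n" if "n \<in> N" for n
    using dihedral_normal_rotations[OF T(13) R(1) T(15) i that] dihedral_normal_rotations[OF T(13) _
      T(15) i that] by blast+
  have N: "N \<subseteq> {1, - 1}"
  proof
    fix n assume n: "n \<in> N"
    show "n \<in> {1, - 1}"
    proof (rule ccontr)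
      assume "n \<notin> {1, - 1}"
      then have "\<alpha> * \<beta> = \<beta> * \<alpha>" using commute_trans[of n \<alpha> \<beta>] fin_subgroupD(3)[OF T(17) n] rot[OF n]
        by simp
      then show False using E(8) by simp
    qed
  qed
  have lift: "\<exists>y z. (a, y) \<in> K \<and> (b, z) \<in> K \<and> qnorm2 y = 1 \<and> qnorm2 z = 1 \<and> qre y = 0 \<and> qre z = 0
    \<and> qre (y * z) = 0"
    if K: "fin_subgroup2 K" "lft K = L" "rgt K = R" "kr K = N" for K
  proof -
    obtain y where y: "(a, y) \<in> K" using D(1) K(2) lftE by metis
    obtain z where z: "(b, z) \<in> K" using D(2) K(2) lftE by metis
    have yzR: "y \<in> R" "z \<in> R" using rgtI[OF y] rgtI[OF z] K(3) by simp_all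
    have "y * z \<noteq> z * y" by (rule lifts_noncommuting[OF K(1) _ y z]) (use K Lm N E(1,2,8) in
      simp_all)
    note nc = noncommuting_noncentral[OF this]
    have "qre y = 0" "qre z = 0" "qre (y * z) = 0"
      using pure_maxre_0[OF T(13) E(12) m0 yzR(1)] pure_maxre_0[OF T(13) E(12) m0 yzR(2)]
        pure_maxre_0[OF T(13) E(12) m0 fin_subgroupD(4)[OF T(13) yzR]] nc by blast+
    then show ?thesis using y z fin_subgroupD(3)[OF T(13)] yzR by blast
  qed
  obtain y1 z1 where 1: "(a, y1) \<in> G" "(b, z1) \<in> G" "qnorm2 y1 = 1" "qnorm2 z1 = 1" "qre y1 = 0"
    "qre z1 = 0" "qre (y1 * z1) = 0"
    using lift[OF T(1,4,8,10)] by blast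
  obtain y2 z2 where 2: "(a, y2) \<in> H" "(b, z2) \<in> H" "qnorm2 y2 = 1" "qnorm2 z2 = 1" "qre y2 = 0"
    "qre z2 = 0" "qre (y2 * z2) = 0"
    using lift[OF T(2,5,9,11)] by blast
  obtain h where h: "qnorm2 h = 1" "cj h y1 = y2" "cj h z1 = z2"
    using conj_pair[OF 1(3,4) 2(3,4)] 1(5,6,7) 2(5,6,7) by auto
  have h0: "h \<noteq> 0" using h by auto
  have "cj h n = n" if "n \<in> N" for n using that N h0 by auto
  then have hN: "cj h ` N = N" by simp
  show ?thesis by (rule conj_equiv_equal_lifts[OF t Lm h(1) hN 1(1,2) 2(1,2) h(2,3)])
qed

text \<open>The first conjugation commutes with \<open>a\<close> and carries \<open>x\<close> to
  \<open>y\<close>. Following it by conjugation with \<open>y\<close> keeps the image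
  \<open>y\<close> and inverts the rotations.\<close>

lemma reflect_conj_normal:
  assumes F: "fin_subgroup F" and d: "dihedral F a b" and N: "normal_sub N F" "\<And>n. n \<in> N
    \<Longrightarrow> n * a = a * n"
    and x: "x \<in> F" "x * a \<noteq> a * x" and y: "y \<in> F" "y * a \<noteq> a * y"
  shows "\<exists>h\<in>uq. cj h ` N = N \<and> cj h x = y \<and> (\<forall>r\<in>F. r * a = a * r \<longrightarrow> cj h r = r)"
    and "\<exists>h\<in>uq. cj h ` N = N \<and> cj h x = y \<and> (\<forall>r\<in>F. r * a = a * r \<longrightarrow> cj h r = inverse r)"
proof -
  obtain h where h: "qnorm2 h = 1" "cj h a = a" "cj h x = y" using reflect_conj[OF F d x y] by blast
  have fixr: "cj h r = r" if "r \<in> F" "r * a = a * r" for r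
    by (rule rotation_fix[OF F d h(1,2) that])
  have "cj h n = n" if "n \<in> N" for n by (rule fixr[OF normal_subD(2)[OF N(1) that] N(2)[OF that]])
  then have hN: "cj h ` N = N" by simp
  then show "\<exists>h\<in>uq. cj h ` N = N \<and> cj h x = y \<and> (\<forall>r\<in>F. r * a = a * r \<longrightarrow> cj h r = r)"
    using h fixr by blast
  define k where "k = y * h"
  have ny: "qnorm2 y = 1" by (rule fin_subgroupD(3)[OF F y(1)])
  have k: "qnorm2 k = 1" using h(1) ny by (simp add: k_def)
  have kc: "cj k x = cj y (cj h x)" for x unfolding k_def cj_cj ..
  have ky: "cj k x = y" unfolding kc h(3) using ny by (simp add: mult.assoc)
  have inv: "cj k r = inverse r" if "r \<in> F" "r * a = a * r" for r
    unfolding kc fixr[OF that] by (rule reflect_rotation(3)[OF F d y that])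
  have "cj k n \<in> N" if "n \<in> N" for n
    unfolding inv[OF normal_subD(2)[OF N(1) that] N(2)[OF that]]
      by (rule fin_subgroup_inverse[OF normal_subD(1)[OF N(1)] that])
  then have "cj k ` N = N" by (intro cj_image_self[OF normal_subD(1)[OF N(1)] k]) blast
  then show "\<exists>h\<in>uq. cj h ` N = N \<and> cj h x = y \<and> (\<forall>r\<in>F. r * a = a * r \<longrightarrow> cj h r = inverse r)"
    using k ky inv by blast
qed

lemma power_minus_one_square:
  assumes "y * y = (- 1 :: quat)" shows "y ^ k \<in> {1, - 1, y, - y}"
proof (induction k)
  case (Suc k) then show ?case using assms by (auto simp: minus_equation_iff)
qed simp

lemma rotation_cancel:
  assumes "u * v * a = a * (u * v)" "v * a = a * v" "v \<noteq> (0 :: quat)" shows "u * a = a * u"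
proof -
  have "u * a * v = a * u * v" using assms(1,2) by (simp add: mult.assoc)
  then show ?thesis using assms(3) by simp
qed

text \<open>The relation \<open>b * a = inverse a * b\<close> lifts to a statement modulo the
  kernel. For a rotation \<open>w\<close> and a reflection \<open>y\<close> it says that
  \<open>w * w\<close> is congruent to -1, so the fourth power of \<open>w\<close> is trivial. As
  \<open>\<alpha>\<close> is congruent to \<open>y ^ j\<close> or \<open>w * y ^ j\<close> and is a
  rotation, the power of \<open>y\<close> is 1 or -1, and -1 is congruent to
  \<open>w * w\<close>.\<close>

lemma rotation_lift_order:
  assumes G: "fin_subgroup2 G" and d: "dihedral (lft G) a b" "dihedral (rgt G) \<alpha> \<beta>"
    and N: "\<And>n. n \<in> kr G \<Longrightarrow> n * \<alpha> = \<alpha> * n"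
    and y: "(a, y) \<in> G" "y * \<alpha> \<noteq> \<alpha> * y" and w: "(b, w) \<in> G" "w * \<alpha> = \<alpha> * w"
  shows "w ^ 4 \<in> kr G" "\<exists>k. inverse (w ^ k) * \<alpha> \<in> kr G"
proof -
  note L = fin_subgroup_lft[OF G] and R = fin_subgroup_rgt[OF G] and K = normal_sub_kr[OF G]
  note fN = normal_subD(1)[OF K]
  note D = dihedralD[OF L d(1)] and E = dihedralD[OF R d(2)]
  have wR: "w \<in> rgt G" and yR: "y \<in> rgt G" using rgtI w(1) y(1) by blast+
  have nz: "qnorm2 w = 1" "qnorm2 y = 1" "w \<noteq> 0" "y \<noteq> 0"
    using fin_subgroupD(3)[OF R] wR yR uq_nonzero by blast+
  note Y = dihedral_reflect[OF R d(2) yR y(2)]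
  have ww: "- (inverse w * inverse w) \<in> kr G"
  proof -
    have "inverse (inverse y * w) * (w * y) \<in> kr G"
      by (rule fiber_diff[OF G, of "inverse a * b"])
        (use fin_subgroup2D(5)[OF G fin_subgroup2_inverse[OF G y(1)] w(1)] fin_subgroup2D(5)[OF G
          w(1) y(1)] D(7) in simp_all)
    moreover have "inverse (inverse y * w) * (w * y) = inverse w * (y * w) * y"
      using nz by (simp add: nonzero_inverse_mult_distrib mult.assoc)
    moreover have "y * w = inverse w * y" by (rule reflect_rotation(1)[OF R d(2) yR y(2) wR w(2)])
    moreover have "inverse w * (inverse w * y) * y = - (inverse w * inverse w)"
      using Y(2) by (simp add: mult.assoc)
    ultimately show ?thesis by simp
  qed
  have "inverse w * inverse w * (inverse w * inverse w) \<in> kr G"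
    using fin_subgroupD(4)[OF fN ww ww] by simp
  then have "inverse (inverse w * inverse w * (inverse w * inverse w)) \<in> kr G"
    by (rule fin_subgroup_inverse[OF fN])
  then show "w ^ 4 \<in> kr G" using nz
    by (simp add: nonzero_inverse_mult_distrib numeral_eq_Suc mult.assoc)
  obtain l where l: "(l, \<alpha>) \<in> G" using E(1) by (rule rgtE)
  have yj: "y ^ j \<in> {1, - 1, y, - y}" for j by (rule power_minus_one_square[OF Y(2)])
  have cases: "inverse (x * y ^ j) * \<alpha> \<in> kr G \<Longrightarrow> x * \<alpha> = \<alpha> * x \<Longrightarrow> x \<in> rgt G \<Longrightarrow> inverse x * \<alpha> \<in> kr G
    \<or> inverse (- x) * \<alpha> \<in> kr G" for x j
  proof -
    assume n: "inverse (x * y ^ j) * \<alpha> \<in> kr G" and x: "x * \<alpha> = \<alpha> * x" "x \<in> rgt G"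
    let ?n = "inverse (x * y ^ j) * \<alpha>"
    have x0: "qnorm2 x = 1" "x \<noteq> 0" using fin_subgroupD(3)[OF R x(2)] by auto
    have n0: "?n \<noteq> 0" by (rule uq_nonzero[OF fin_subgroupD(3)[OF fN n]])
    have "x * y ^ j * ?n = \<alpha>" using x0 nz by simp
    then have "x * y ^ j * ?n * \<alpha> = \<alpha> * (x * y ^ j * ?n)" by simp
    then have "x * y ^ j * \<alpha> = \<alpha> * (x * y ^ j)" by (rule rotation_cancel[OF _ N[OF n] n0])
    then have "x * (y ^ j * \<alpha>) = x * (\<alpha> * y ^ j)" using x(1) by (metis mult.assoc)
    then have "y ^ j * \<alpha> = \<alpha> * y ^ j" using x0 by simp
    then have "y ^ j \<in> {1, - 1}" using yj[of j] y(2) by auto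
    then show ?thesis using n by auto
  qed
  have "(\<exists>k. l = a ^ k) \<or> (\<exists>k. l = b * a ^ k)" by (rule D(14)[OF lftI[OF l]])
  then show "\<exists>k. inverse (w ^ k) * \<alpha> \<in> kr G"
  proof (elim disjE exE)
    fix j assume "l = a ^ j"
    then have "inverse (1 * y ^ j) * \<alpha> \<in> kr G"
      using fiber_diff[OF G fin_subgroup2_power[OF G y(1), of j]] l by simp
    then have "inverse 1 * \<alpha> \<in> kr G \<or> inverse (- 1) * \<alpha> \<in> kr G"
      by (rule cases) (use fin_subgroupD(2)[OF R] in simp_all)
    then show ?thesis
    proof
      assume "inverse 1 * \<alpha> \<in> kr G"
      then show ?thesis by (intro exI[of _ 0]) simp
    next
      assume "inverse (- 1) * \<alpha> \<in> kr G"
      from fin_subgroupD(4)[OF fN ww this] show ?thesis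
        using nz by (intro exI[of _ 2]) (simp add: power2_eq_square nonzero_inverse_mult_distrib)
    qed
  next
    fix j assume "l = b * a ^ j"
    then have "inverse (w * y ^ j) * \<alpha> \<in> kr G"
      using fiber_diff[OF G fin_subgroup2D(5)[OF G w(1) fin_subgroup2_power[OF G y(1), of j]]] l
      by simp
    then have "inverse w * \<alpha> \<in> kr G \<or> inverse (- w) * \<alpha> \<in> kr G"
      by (rule cases) (use w(2) wR in simp_all)
    then show ?thesis
    proof
      assume "inverse w * \<alpha> \<in> kr G"
      then show ?thesis by (intro exI[of _ 1]) simp
    next
      assume "inverse (- w) * \<alpha> \<in> kr G"
      from fin_subgroupD(4)[OF fN ww this] show ?thesis
        using nz by (intro exI[of _ 3]) (simp add: numeral_3_eq_3 nonzero_inverse_mult_distrib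
          mult.assoc)
    qed
  qed
qed

text \<open>All lifts of \<open>a\<close> in \<open>G\<close> are reflections, hence imaginary, so
  all lifts \<open>y2 * n\<close> in \<open>H\<close> would be imaginary too, which forces
  \<open>N\<close> to be central. Then \<open>\<alpha>\<close> would be 1, -1, \<open>y2\<close> or
  \<open>- y2\<close>, against its positive real part; the lift of \<open>b\<close> cannot
  contribute to it, being a reflection.\<close>

lemma no_mixed_lift:
  assumes t: "twins G H L M R N" and L: "dihedral L a b" and R: "dihedral R \<alpha> \<beta>"
    and p: "0 < qre a" "0 < qre \<alpha>"
    and rot: "\<And>n. n \<in> N \<Longrightarrow> n * \<alpha> = \<alpha> * n"
    and y: "(a, y1) \<in> G" "y1 * \<alpha> \<noteq> \<alpha> * y1" "(a, y2) \<in> H" "y2 * \<alpha> = \<alpha> * y2"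
  shows "qre y2 \<noteq> qre y1"
proof
  assume re: "qre y2 = qre y1"
  note T = twinsD[OF t]
  note D = dihedralD[OF T(12) L] and E = dihedralD[OF T(13) R]
  have y1R: "y1 \<in> R" and y2R: "y2 \<in> R" using rgtI[OF y(1)] rgtI[OF y(3)] T(8,9) by auto
  have ny: "qnorm2 y1 = 1" "qnorm2 y2 = 1" using fin_subgroupD(3)[OF T(13)] y1R y2R by blast+
  have refl0: "qre x = 0" if "(a, x) \<in> G" for x
  proof -
    have "inverse y1 * x \<in> N" using fiber_diff[OF T(1) y(1) that] T(10) by simp
    then have c: "inverse y1 * x * \<alpha> = \<alpha> * (inverse y1 * x)" by (rule rot)
    have "x * \<alpha> \<noteq> \<alpha> * x"
    proof
      assume x: "x * \<alpha> = \<alpha> * x"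
      have "x \<noteq> 0" using fin_subgroup2D(4)[OF T(1) that] by auto
      then have "inverse y1 * \<alpha> = \<alpha> * inverse y1" by (rule rotation_cancel[OF c x])
      then have "y1 * (inverse y1 * \<alpha>) * y1 = y1 * (\<alpha> * inverse y1) * y1" by simp
      then show False using y(2) ny by (simp add: mult.assoc uq_nonzero)
    qed
    then show ?thesis using dihedral_reflect(3)[OF T(13) R] rgtI[OF that] T(8) by blast
  qed
  have y20: "qre y2 = 0" using refl0[OF y(1)] re by simp
  have N: "N \<subseteq> {1, - 1}"
  proof
    fix n assume n: "n \<in> N"
    have nn: "qnorm2 n = 1" by (rule fin_subgroupD(3)[OF T(17) n])
    have "(a, y2 * n) \<in> H" by (rule fiber_mult[OF T(2) y(3)]) (use n T(11) in simp)
    then obtain y' where "(a, y') \<in> G" "qre y' = qre (y2 * n)"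
      using match_lift[OF twins_sym[OF t] _ dihedral_re_eq[OF T(12) L _ _ p(1)]] by blast
    then have re0: "qre (y2 * n) = 0" using refl0 by simp
    have "y2 * n = n * y2" by (rule commute_trans[OF E(3,5,6) y(4) rot[OF n]])
    then have "y2 * (y2 * n) = y2 * (n * y2)" by (simp only:)
    then have "y2 * (y2 * n) = y2 * n * y2" by (simp only: mult.assoc)
    then have "y2 * n = y2 \<or> y2 * n = inverse y2"
      using commuting_same_re[OF ny(2), of "y2 * n"] ny(2) nn re0 y20 by simp
    moreover have "inverse y2 = - y2" using uq_add_inverse[OF ny(2)] y20 by (simp add: add_eq_0_iff)
    ultimately have "y2 * n = y2 * 1 \<or> y2 * n = y2 * - 1" by simp
    then show "n \<in> {1, - 1}" using uq_nonzero[OF ny(2)] unfolding mult_cancel_left by blast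
  qed
  have yy: "y2 * y2 = - 1" using uq_quadratic[OF ny(2)] y20 by simp
  obtain z2 where z2: "(b, z2) \<in> H" using D(2) T(5) lftE by metis
  have z2r: "z2 * \<alpha> \<noteq> \<alpha> * z2"
  proof
    assume z: "z2 * \<alpha> = \<alpha> * z2"
    show False
      by (rule not_all_rotations[OF T(2), of \<alpha> \<beta> "{a, b}"]) (use T(5,9,11) R rot dihedral_mgen[OF
        T(12) L] y(3,4) z2 z in auto)
  qed
  obtain l where l: "(l, \<alpha>) \<in> H" using E(1) T(9) rgtE by metis
  have yj: "y2 ^ j \<in> {1, - 1, y2, - y2}" for j by (rule power_minus_one_square[OF yy])
  have c: "x * y2 ^ j = \<alpha> \<or> x * y2 ^ j = - \<alpha>" if "(l, x * y2 ^ j) \<in> H" for x j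
  proof -
    have "inverse (x * y2 ^ j) * \<alpha> \<in> N" using fiber_diff[OF T(2) that l] T(11) by simp
    then have *: "inverse (x * y2 ^ j) * \<alpha> = 1 \<or> inverse (x * y2 ^ j) * \<alpha> = - 1" using N by blast
    have "x * y2 ^ j \<noteq> 0" by (rule uq_nonzero[OF fin_subgroup2D(4)[OF T(2) that]])
    then have "x * y2 ^ j * (inverse (x * y2 ^ j) * \<alpha>) = \<alpha>" by (simp add: mult.assoc[symmetric])
    then show ?thesis using * by auto
  qed
  have "(\<exists>k. l = a ^ k) \<or> (\<exists>k. l = b * a ^ k)" by (rule D(14)) (use lftI[OF l] T(5) in simp)
  then show False
  proof (elim disjE exE)
    fix j assume "l = a ^ j"
    then have "1 * y2 ^ j = \<alpha> \<or> 1 * y2 ^ j = - \<alpha>"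
      by (intro c) (use fin_subgroup2_power[OF T(2) y(3), of j] in simp)
    then have "\<alpha> = y2 ^ j \<or> \<alpha> = - (y2 ^ j)" by auto
    then have "\<alpha> \<in> {1, - 1, y2, - y2}" using yj[of j] by auto
    then show False using E(5,6) p(2) y20 by auto
  next
    fix j assume "l = b * a ^ j"
    then have "z2 * y2 ^ j = \<alpha> \<or> z2 * y2 ^ j = - \<alpha>"
      by (intro c) (use fin_subgroup2D(5)[OF T(2) z2 fin_subgroup2_power[OF T(2) y(3), of j]] in
      simp)
    then have "z2 * y2 ^ j * \<alpha> = \<alpha> * (z2 * y2 ^ j)" by auto
    moreover have "y2 ^ j * \<alpha> = \<alpha> * y2 ^ j" using yj[of j] y(4) by auto
    moreover have "y2 ^ j \<noteq> 0" using uq_nonzero[OF ny(2)] by simp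
    ultimately show False using z2r rotation_cancel by blast
  qed
qed

text \<open>If the lifts of \<open>a\<close> are rotations, they are equal or inverse, the lifts of
  \<open>b\<close> are reflections, and a conjugation that matches the latter can be chosen to fix
  or to invert rotations. If the lifts of \<open>a\<close> are reflections, \<open>b\<close> is
  chosen with rotations \<open>w1\<close>, \<open>w2\<close> as lifts; modulo \<open>N\<close> these
  generate the same cyclic group of order dividing 4, and if they are inverse, \<open>b2\<close> is
  replaced by its inverse.\<close>

lemma conj_equiv_dihedral_dihedral_pos:
  assumes t: "twins G H L M R N" and L: "dihedral L a b" and R: "dihedral R \<alpha> \<beta>"
    and p: "0 < qre a" "0 < qre \<alpha>" and i: "\<not> index_le_2 R N"
  shows "conj_equiv G H"
proof -
  note T = twinsD[OF t]
  note D = dihedralD[OF T(12) L] and E = dihedralD[OF T(13) R]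
  note rot = dihedral_normal_rotations[OF T(13) R T(15) i]
  have Lm: "L = mgen {a, b}" by (rule dihedral_mgen[OF T(12) L])
  obtain y1 where y1: "(a, y1) \<in> G" using D(1) T(4) lftE by metis
  obtain y2 where y2: "(a, y2) \<in> H" "qre y2 = qre y1"
    using match_lift[OF t y1 dihedral_re_eq[OF T(12) L _ _ p(1)]] by blast
  have yR: "y1 \<in> R" "y2 \<in> R" using rgtI[OF y1] rgtI[OF y2(1)] T(8,9) by auto
  have ny: "qnorm2 y1 = 1" "qnorm2 y2 = 1" using fin_subgroupD(3)[OF T(13)] yR by blast+
  obtain z1 where z1: "(b, z1) \<in> G" using D(2) T(4) lftE by metis
  obtain z2 where z2: "(b, z2) \<in> H" using D(2) T(5) lftE by metis
  have zR: "z1 \<in> R" "z2 \<in> R" using rgtI[OF z1] rgtI[OF z2] T(8,9) by auto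
  consider "y1 * \<alpha> = \<alpha> * y1" "y2 * \<alpha> = \<alpha> * y2" | "y1 * \<alpha> \<noteq> \<alpha> * y1" "y2 * \<alpha> \<noteq> \<alpha> * y2"
    using no_mixed_lift[OF t L R p rot y1 _ y2(1)] no_mixed_lift[OF twins_sym[OF t] L R p rot y2(1)
      _ y1] y2(2) by metis
  then show ?thesis
  proof cases
    case 1
    have z1r: "z1 * \<alpha> \<noteq> \<alpha> * z1"
    proof
      assume "z1 * \<alpha> = \<alpha> * z1"
      then show False by (intro not_all_rotations[OF T(1), of \<alpha> \<beta> "{a, b}"]) (use T(4,8,10) R rot Lm
        y1 1 z1 in auto)
    qed
    have z2r: "z2 * \<alpha> \<noteq> \<alpha> * z2"
    proof
      assume "z2 * \<alpha> = \<alpha> * z2"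
      then show False by (intro not_all_rotations[OF T(2), of \<alpha> \<beta> "{a, b}"]) (use T(5,9,11) R rot Lm
        y2 1 z2 in auto)
    qed
    have "y1 * y2 = y2 * y1" by (rule commute_trans[OF E(3,5,6) 1])
    then have "y2 = y1 \<or> y2 = inverse y1" using commuting_same_re[OF ny] y2(2) by simp
    then show ?thesis
    proof
      assume e: "y2 = y1"
      obtain h where h: "qnorm2 h = 1" "cj h ` N = N" "cj h z1 = z2" "\<forall>r\<in>R. r * \<alpha> = \<alpha> * r
        \<longrightarrow> cj h r = r"
        using reflect_conj_normal(1)[OF T(13) R T(15) rot zR(1) z1r zR(2) z2r] by blast
      have "cj h y1 = y2" using h(4) yR(1) 1(1) unfolding e by blast
      then show ?thesis by (rule conj_equiv_equal_lifts[OF t Lm h(1,2) y1 z1 y2(1) z2 _ h(3)])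
    next
      assume e: "y2 = inverse y1"
      obtain h where h: "qnorm2 h = 1" "cj h ` N = N" "cj h z1 = z2" "\<forall>r\<in>R. r * \<alpha> = \<alpha> * r
        \<longrightarrow> cj h r = inverse r"
        using reflect_conj_normal(2)[OF T(13) R T(15) rot zR(1) z1r zR(2) z2r] by blast
      have "cj h y1 = y2" using h(4) yR(1) 1(1) unfolding e by blast
      then show ?thesis by (rule conj_equiv_equal_lifts[OF t Lm h(1,2) y1 z1 y2(1) z2 _ h(3)])
    qed
  next
    case 2
    \<comment> \<open>The product of two reflections is a rotation, so \<open>b\<close> or
      \<open>a * b\<close> has a rotation as a lift, and either serves as the second generator of
      \<open>L\<close>.\<close>
    have lift: "\<exists>b' w. dihedral L a b' \<and> (b', w) \<in> K \<and> w * \<alpha> = \<alpha> * w"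
      if K: "fin_subgroup2 K" "rgt K = R" "(a, y) \<in> K" "(b, z) \<in> K" "y * \<alpha> \<noteq> \<alpha> * y" for K y z
    proof (cases "z * \<alpha> = \<alpha> * z")
      case True then show ?thesis using L K(4) by blast
    next
      case False
      have "y \<in> R" "z \<in> R" using rgtI K(2-4) by blast+
      then have "y * z * \<alpha> = \<alpha> * (y * z)" using reflect_mult[OF T(13) R] K(5) False by blast
      moreover have "(a * b, y * z) \<in> K" by (rule fin_subgroup2D(5)[OF K(1,3,4)])
      moreover have "a * b * a \<noteq> a * (a * b)"
      proof
        assume "a * b * a = a * (a * b)"
        then have "b * a = a * b" using uq_nonzero[OF D(3)] by (simp add: mult.assoc)
        then show False using D(8) by simp
      qed
      then have "dihedral L a (a * b)"
        by (rule dihedral_change_reflection[OF T(12) L fin_subgroupD(4)[OF T(12) D(1,2)]])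
      ultimately show ?thesis by blast
    qed
    obtain b1 w1 where 1: "dihedral L a b1" "(b1, w1) \<in> G" "w1 * \<alpha> = \<alpha> * w1"
      using lift[OF T(1,8) y1 z1 2(1)] by blast
    obtain b2 w2 where b2: "dihedral L a b2" "(b2, w2) \<in> H" "w2 * \<alpha> = \<alpha> * w2"
      using lift[OF T(2,9) y2(1) z2 2(2)] by blast
    have o1: "w1 ^ 4 \<in> N" "\<exists>k. inverse (w1 ^ k) * \<alpha> \<in> N"
      using rotation_lift_order[OF T(1), unfolded T(4,8,10), OF 1(1) R rot y1 2(1) 1(2,3)] by blast+
    have o2: "w2 ^ 4 \<in> N" "\<exists>k. inverse (w2 ^ k) * \<alpha> \<in> N"
      using rotation_lift_order[OF T(2), unfolded T(5,9,11), OF b2(1) R rot y2(1) 2(2) b2(2,3)]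
        by blast+
    have wR: "w1 \<in> R" "w2 \<in> R" using rgtI[OF 1(2)] rgtI[OF b2(2)] T(8,9) by auto
    obtain i j where "w1 = \<alpha> ^ i" "w2 = \<alpha> ^ j"
      using dihedral_rotation[OF T(13) R wR(1) 1(3)] dihedral_rotation[OF T(13) R wR(2) b2(3)]
      by blast
    then have key: "inverse w2 * w1 \<in> N \<or> w1 * w2 \<in> N"
      using cyclic_order_4[OF T(13) E(1) T(17) _ _ o1(1) o2(1)] o1(2) o2(2) by blast
    obtain h where h: "qnorm2 h = 1" "cj h ` N = N" "cj h y1 = y2" "\<forall>r\<in>R. r * \<alpha> = \<alpha> * r
      \<longrightarrow> cj h r = r"
      using reflect_conj_normal(1)[OF T(13) R T(15) rot yR(1) 2(1) yR(2) 2(2)] by blast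
    have hw: "cj h w1 = w1" using h(4) wR(1) 1(3) by blast
    have iy: "inverse y2 * cj h y1 \<in> N" unfolding h(3) using ny fin_subgroupD(2)[OF T(17)] by simp
    note B1 = dihedralD[OF T(12) 1(1)] and B2 = dihedralD[OF T(12) b2(1)]
    have step: "conj_equiv G H" if c: "dihedral L a c" "(c, w) \<in> H" "inverse w * w1 \<in> N" for c w
    proof -
      note C = dihedralD[OF T(12) c(1)]
      obtain g where g: "qnorm2 g = 1" "cj g a = a" "cj g b1 = c"
        using conj_pair[OF B1(3,4) C(3,4)] B1(9,10) C(9,10) by auto
      show ?thesis
        by (rule conj_equiv_two_lifts[OF t dihedral_mgen[OF T(12) 1(1)] g(1) h(1,2) y1 1(2), of y2
          w])
          (unfold g(2,3) hw, use y2(1) c(2,3) iy in simp_all)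
    qed
    from key show ?thesis
    proof
      assume "inverse w2 * w1 \<in> N" then show ?thesis by (rule step[OF b2(1,2)])
    next
      assume m: "w1 * w2 \<in> N"
      have "w1 * w2 = w2 * w1" by (rule commute_trans[OF E(3,5,6) 1(3) b2(3)])
      then have m': "inverse (inverse w2) * w1 \<in> N" using m by simp
      have "inverse b2 * a \<noteq> a * inverse b2"
      proof
        assume "inverse b2 * a = a * inverse b2"
        then have "b2 * (inverse b2 * a) * b2 = b2 * (a * inverse b2) * b2" by simp
        then show False using B2(8) B2(4) by (simp add: mult.assoc uq_nonzero)
      qed
      then have "dihedral L a (inverse b2)"
        by (rule dihedral_change_reflection[OF T(12) L fin_subgroup_inverse[OF T(12) B2(2)]])
      then show ?thesis by (rule step[OF _ fin_subgroup2_inverse[OF T(2) b2(2)] m'])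
    qed
  qed
qed

lemma conj_equiv_dihedral_dihedral:
  assumes t: "twins G H L M R N" and L: "dihedral L a b" and R: "dihedral R \<alpha> \<beta>"
    and i: "\<not> index_le_2 L M" "\<not> index_le_2 R N"
  shows "conj_equiv G H"
proof -
  note T = twinsD[OF t]
  consider "qre \<alpha> = 0" | "qre a = 0" | "0 < qre a" "0 < qre \<alpha>"
    using dihedralD(16)[OF T(12) L] dihedralD(16)[OF T(13) R] by linarith
  then show ?thesis
  proof cases
    case 1 show ?thesis by (rule conj_equiv_dihedral_q8[OF t L R 1 i(2)])
  next
    case 2 show ?thesis by (rule conj_equiv_swap[OF conj_equiv_dihedral_q8[OF twins_swap[OF t] R L 2
      i(1)]])
  next
    case 3 show ?thesis by (rule conj_equiv_dihedral_dihedral_pos[OF t L R 3 i(2)])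
  qed
qed

lemma conj_equiv_twins:
  assumes t: "twins G H L M R N" shows "conj_equiv G H"
proof (cases "index_le_2 L M \<or> index_le_2 R N")
  case True then show ?thesis by (rule twins_index_le_2_conj_equiv[OF t])
next
  case False
  then have i: "\<not> index_le_2 L M" "\<not> index_le_2 R N" by simp_all
  note T = twinsD[OF t] and s = twins_swap[OF t]
  show ?thesis
  proof (rule fin_subgroup_cases[OF T(12)]; rule fin_subgroup_cases[OF T(13)])
    fix a \<alpha> assume "cyclic L a" "cyclic R \<alpha>" then show ?thesis
      by (rule conj_equiv_cyclic_cyclic[OF t])
  next
    fix a \<alpha> \<beta> assume "cyclic L a" "dihedral R \<alpha> \<beta>" then show ?thesis
      by (rule conj_equiv_cyclic_dihedral[OF t _ _ i(2)])
  next
    fix a c \<alpha> \<beta> assume "cyclic L a" "polyhedral R c \<alpha> \<beta>" then show ?thesis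
      by (intro conj_equiv_swap[OF conj_equiv_polyhedral_cyclic[OF s]])
  next
    fix a b \<alpha> assume "dihedral L a b" "cyclic R \<alpha>" then show ?thesis
      by (intro conj_equiv_swap[OF conj_equiv_cyclic_dihedral[OF s _ _ i(1)]])
  next
    fix a b \<alpha> \<beta> assume "dihedral L a b" "dihedral R \<alpha> \<beta>" then show ?thesis
      by (rule conj_equiv_dihedral_dihedral[OF t _ _ i])
  next
    fix a b c \<alpha> \<beta> assume "dihedral L a b" "polyhedral R c \<alpha> \<beta>" then show ?thesis
      by (intro conj_equiv_swap[OF conj_equiv_polyhedral_dihedral[OF s _ _ i(1)]])
  next
    fix c a b \<alpha> assume "polyhedral L c a b" "cyclic R \<alpha>" then show ?thesis
      by (rule conj_equiv_polyhedral_cyclic[OF t])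
  next
    fix c a b \<alpha> \<beta> assume "polyhedral L c a b" "dihedral R \<alpha> \<beta>" then show ?thesis
      by (rule conj_equiv_polyhedral_dihedral[OF t _ _ i(2)])
  next
    fix c a b c' \<alpha> \<beta> assume "polyhedral L c a b" "polyhedral R c' \<alpha> \<beta>" then show ?thesis
      by (rule conj_equiv_polyhedral_polyhedral[OF t _ _ i])
  qed
qed

theorem re_dist2_conj_equiv:
  assumes "fin_subgroup2 G" "fin_subgroup2 H" "re_dist2 G H" shows "conj_equiv G H"
  using twins_exist[OF assms] conj_equiv_twins conj_equiv_trans by blast

section \<open>The special unitary group\<close>

definition almost_conjugates_conjugate :: "('a, 'b) monoid_scheme \<Rightarrow> bool" where
  "almost_conjugates_conjugate G \<longleftrightarrow> (\<forall>A B. almost_conjugate G A B \<longrightarrow> conjugate_subgroups G A B)"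

lemma almost_conjugate_iso:
  assumes G: "group G" "group H" and i: "\<psi> \<in> iso G H" and ac: "almost_conjugate G A B"
  shows "almost_conjugate H (\<psi> ` A) (\<psi> ` B)"
proof -
  interpret group_hom G H \<psi> using G i by (simp add: group_hom_def group_hom_axioms_def iso_def)
  obtain f where AB: "subgroup A G" "finite A" "subgroup B G" "finite B" and f: "bij_betw f A B"
    "\<And>\<gamma>. \<gamma> \<in> A \<Longrightarrow> \<exists>x\<in>carrier G. f \<gamma> = x \<otimes>\<^bsub>G\<^esub> \<gamma> \<otimes>\<^bsub>G\<^esub> inv\<^bsub>G\<^esub> x"
    using ac unfolding almost_conjugate_def by blast
  have inj: "inj_on \<psi> (carrier G)" using i by (simp add: iso_def bij_betw_def)
  have sub: "A \<subseteq> carrier G" "B \<subseteq> carrier G" using AB subgroup.subset by blast+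
  have bA: "bij_betw \<psi> A (\<psi> ` A)" and bB: "bij_betw \<psi> B (\<psi> ` B)"
    using inj_on_subset[OF inj] sub by (simp_all add: bij_betw_def)
  have "bij_betw (\<psi> \<circ> (f \<circ> inv_into A \<psi>)) (\<psi> ` A) (\<psi> ` B)"
    by (rule bij_betw_trans[OF bij_betw_trans[OF bij_betw_inv_into[OF bA] f(1)] bB])
  moreover have "\<exists>x\<in>carrier H. (\<psi> \<circ> (f \<circ> inv_into A \<psi>)) \<gamma> = x \<otimes>\<^bsub>H\<^esub> \<gamma> \<otimes>\<^bsub>H\<^esub> inv\<^bsub>H\<^esub> x"
    if \<gamma>: "\<gamma> \<in> \<psi> ` A" for \<gamma>
  proof -
    obtain a where a: "a \<in> A" "\<gamma> = \<psi> a" using \<gamma> by blast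
    obtain x where x: "x \<in> carrier G" "f a = x \<otimes>\<^bsub>G\<^esub> a \<otimes>\<^bsub>G\<^esub> inv\<^bsub>G\<^esub> x" using f(2)[OF a(1)] by blast
    have "inv_into A \<psi> \<gamma> = a" unfolding a(2)
      by (rule inv_into_f_f[OF bij_betw_imp_inj_on[OF bA] a(1)])
    then have "(\<psi> \<circ> (f \<circ> inv_into A \<psi>)) \<gamma> = \<psi> x \<otimes>\<^bsub>H\<^esub> \<gamma> \<otimes>\<^bsub>H\<^esub> inv\<^bsub>H\<^esub> (\<psi> x)"
      using x a sub by auto
    then show ?thesis using x(1) hom_closed by blast
  qed
  ultimately show ?thesis
    using AB subgroup_img_is_subgroup unfolding almost_conjugate_def by blast
qed

lemma conjugate_subgroups_iso:
  assumes G: "group G" "group H" and i: "\<psi> \<in> iso G H" and A: "A \<subseteq> carrier G"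
    and c: "conjugate_subgroups G A B"
  shows "conjugate_subgroups H (\<psi> ` A) (\<psi> ` B)"
proof -
  interpret group_hom G H \<psi> using G i by (simp add: group_hom_def group_hom_axioms_def iso_def)
  obtain x where x: "x \<in> carrier G" "B = (\<lambda>\<gamma>. x \<otimes>\<^bsub>G\<^esub> \<gamma> \<otimes>\<^bsub>G\<^esub> inv\<^bsub>G\<^esub> x) ` A"
    using c unfolding conjugate_subgroups_def by blast
  have "\<psi> ` B = (\<lambda>\<gamma>. \<psi> x \<otimes>\<^bsub>H\<^esub> \<gamma> \<otimes>\<^bsub>H\<^esub> inv\<^bsub>H\<^esub> (\<psi> x)) ` \<psi> ` A"
    unfolding x(2) image_image using x(1) A by (intro image_cong) auto
  then show ?thesis unfolding conjugate_subgroups_def using x(1) hom_closed by blast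
qed

lemma almost_conjugates_conjugate_iso:
  assumes G: "group G" "group H" and i: "\<psi> \<in> iso G H" and r: "almost_conjugates_conjugate G"
  shows "almost_conjugates_conjugate H"
  unfolding almost_conjugates_conjugate_def
proof (intro allI impI)
  fix A B assume ac: "almost_conjugate H A B"
  let ?\<phi> = "inv_into (carrier G) \<psi>"
  have i': "?\<phi> \<in> iso H G" by (rule group.iso_set_sym[OF G(1) i])
  have AB: "A \<subseteq> carrier H" "B \<subseteq> carrier H"
    using ac subgroup.subset unfolding almost_conjugate_def by blast+
  have img: "\<psi> ` ?\<phi> ` C = C" if "C \<subseteq> carrier H" for C
  proof -
    have "\<psi> ` carrier G = carrier H" using i by (simp add: iso_def bij_betw_def)
    then show ?thesis using that by (simp add: image_image f_inv_into_f subset_eq)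
  qed
  have "conjugate_subgroups G (?\<phi> ` A) (?\<phi> ` B)"
    using r almost_conjugate_iso[OF G(2,1) i' ac] unfolding almost_conjugates_conjugate_def by blast
  moreover have "?\<phi> ` A \<subseteq> carrier G" using i' AB by (auto simp: iso_def bij_betw_def)
  ultimately have "conjugate_subgroups H (\<psi> ` ?\<phi> ` A) (\<psi> ` ?\<phi> ` B)"
    using conjugate_subgroups_iso[OF G i] by blast
  then show "conjugate_subgroups H A B" unfolding img[OF AB(1)] img[OF AB(2)] .
qed

lemma group_iso_image:
  assumes "group G" "\<psi> \<in> iso G H" "\<psi> \<one>\<^bsub>G\<^esub> = \<one>\<^bsub>H\<^esub>" shows "group H"
  using group.iso_imp_img_group[OF assms(1,2)] unfolding assms(3) by simp

definition quat_group :: "quat monoid" where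
  "quat_group = \<lparr>carrier = uq, monoid.mult = (*), one = 1\<rparr>"

lemma quat_group_simps [simp]: "carrier quat_group = uq" "x \<otimes>\<^bsub>quat_group\<^esub> y = x * y" "\<one>\<^bsub>quat_group\<^esub>
  = 1"
  by (simp_all add: quat_group_def)

lemma quat_group: "group quat_group"
proof (rule groupI)
  show "\<exists>y\<in>carrier quat_group. y \<otimes>\<^bsub>quat_group\<^esub> x = \<one>\<^bsub>quat_group\<^esub>" if "x \<in> carrier quat_group" for x
    using that by (intro bexI[of _ "inverse x"]) auto
qed (auto simp: mult.assoc)

lemma quat_group_inv: "qnorm2 x = 1 \<Longrightarrow> inv\<^bsub>quat_group\<^esub> x = inverse x"
  by (rule group.inv_equality[OF quat_group]) auto

lemma almost_conjugates_conjugate_quat_group: "almost_conjugates_conjugate quat_group"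
  unfolding almost_conjugates_conjugate_def
proof (intro allI impI)
  fix A B assume "almost_conjugate quat_group A B"
  then obtain f where AB: "subgroup A quat_group" "finite A" "subgroup B quat_group" "finite B"
    and f: "bij_betw f A B"
    "\<And>\<gamma>. \<gamma> \<in> A \<Longrightarrow> \<exists>x\<in>carrier quat_group. f \<gamma> = x \<otimes>\<^bsub>quat_group\<^esub> \<gamma> \<otimes>\<^bsub>quat_group\<^esub> inv\<^bsub>quat_group\<^esub> x"
    unfolding almost_conjugate_def by blast
  have fs: "fin_subgroup C" if "subgroup C quat_group" "finite C" for C
    using that subgroup.subset[OF that(1)] subgroup.one_closed[OF that(1)] subgroup.m_closed[OF
      that(1)]
    by (auto simp: fin_subgroup_def)
  have "qre (f x) = qre x" if x: "x \<in> A" for x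
  proof -
    obtain g where "qnorm2 g = 1" "f x = cj g x" using f(2)[OF x] by (auto simp: quat_group_inv)
    then show ?thesis using qre_cj[OF uq_nonzero, of g x] by simp
  qed
  then have "re_dist A B" by (rule re_dist_bij[OF f(1)])
  then obtain g where "qnorm2 g = 1" "cj g ` A = B"
    using re_dist_conj[OF fs[OF AB(1,2)] fs[OF AB(3,4)]] by blast
  then show "conjugate_subgroups quat_group A B"
    unfolding conjugate_subgroups_def by (intro bexI[of _ g]) (auto simp: quat_group_inv)
qed

lemma re_dist2_bij:
  assumes b: "bij_betw f A B" and p: "\<And>x. x \<in> A \<Longrightarrow> qre (fst (f x)) = qre (fst x)
    \<and> qre (snd (f x)) = qre (snd x)" shows "re_dist2 A B"
  unfolding re_dist2_def
proof (intro allI)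
  fix s t
  have "bij_betw f {x \<in> A. qre (fst x) = s \<and> qre (snd x) = t} {x \<in> B. qre (fst x) = s
    \<and> qre (snd x) = t}"
    using b p unfolding bij_betw_def by (auto simp: inj_on_def)
  then show "card {x \<in> A. qre (fst x) = s \<and> qre (snd x) = t} = card {x \<in> B. qre (fst x) = s
    \<and> qre (snd x) = t}"
    by (rule bij_betw_same_card)
qed

lemma almost_conjugates_conjugate_quat_group_prod: "almost_conjugates_conjugate (quat_group \<times>\<times>
  quat_group)"
  unfolding almost_conjugates_conjugate_def
proof (intro allI impI)
  let ?Q = "quat_group \<times>\<times> quat_group"
  fix A B assume "almost_conjugate ?Q A B"
  then obtain f where AB: "subgroup A ?Q" "finite A" "subgroup B ?Q" "finite B"
    and f: "bij_betw f A B"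
    "\<And>\<gamma>. \<gamma> \<in> A \<Longrightarrow> \<exists>x\<in>carrier ?Q. f \<gamma> = x \<otimes>\<^bsub>?Q\<^esub> \<gamma> \<otimes>\<^bsub>?Q\<^esub> inv\<^bsub>?Q\<^esub> x"
    unfolding almost_conjugate_def by blast
  have fs: "fin_subgroup2 C" if "subgroup C ?Q" "finite C" for C
    using that subgroup.subset[OF that(1)] subgroup.one_closed[OF that(1)] subgroup.m_closed[OF
      that(1)]
    by (fastforce simp: fin_subgroup2_def)
  have iv: "inv\<^bsub>?Q\<^esub> (g, h) = (inverse g, inverse h)" if "qnorm2 g = 1" "qnorm2 h = 1" for g h
    using that by (simp add: inv_DirProd[OF quat_group quat_group] quat_group_inv)
  have "qre (fst (f x)) = qre (fst x) \<and> qre (snd (f x)) = qre (snd x)" if x: "x \<in> A" for x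
  proof -
    obtain g h where g: "qnorm2 g = 1" "qnorm2 h = 1" "f x = (g, h) \<otimes>\<^bsub>?Q\<^esub> x \<otimes>\<^bsub>?Q\<^esub> inv\<^bsub>?Q\<^esub> (g, h)"
      using f(2)[OF x] by auto
    then have "f x = (cj g (fst x), cj h (snd x))"
      unfolding iv[OF g(1,2)] by (simp add: mult_DirProd')
    then show ?thesis using qre_cj[OF uq_nonzero[OF g(1)], of "fst x"] qre_cj[OF uq_nonzero[OF
      g(2)], of "snd x"] by simp
  qed
  then have "re_dist2 A B" by (rule re_dist2_bij[OF f(1)])
  then obtain g h where g: "qnorm2 g = 1" "qnorm2 h = 1" "cj2 g h ` A = B"
    using re_dist2_conj_equiv[OF fs[OF AB(1,2)] fs[OF AB(3,4)]] unfolding conj_equiv_def by blast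
  have "B = (\<lambda>\<gamma>. (g, h) \<otimes>\<^bsub>?Q\<^esub> \<gamma> \<otimes>\<^bsub>?Q\<^esub> inv\<^bsub>?Q\<^esub> (g, h)) ` A"
    unfolding g(3)[symmetric] iv[OF g(1,2)] by (simp add: mult_DirProd')
  then show "conjugate_subgroups ?Q A B"
    unfolding conjugate_subgroups_def using g(1,2) by (intro bexI[of _ "(g, h)"]) auto
qed

text \<open>With complex \<open>p\<close>, \<open>q\<close> such that the quaternion is
  \<open>p + q j\<close>, the rows are \<open>p\<close>, \<open>q\<close> and
  \<open>- cnj q\<close>, \<open>cnj p\<close>.\<close>

definition quat_matrix :: "quat \<Rightarrow> complex^2^2" where
  "quat_matrix x = vector [vector [Complex (qre x) (qi x), Complex (qj x) (qk x)],
     vector [Complex (- qj x) (qk x), Complex (qre x) (- qi x)]]"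

lemma quat_matrix_nth [simp]:
  "quat_matrix x $ 1 $ 1 = Complex (qre x) (qi x)" "quat_matrix x $ 1 $ 2 = Complex (qj x) (qk x)"
  "quat_matrix x $ 2 $ 1 = Complex (- qj x) (qk x)" "quat_matrix x $ 2 $ 2 = Complex (qre x) (- qi
    x)"
  by (simp_all add: quat_matrix_def)

lemma quat_matrix_mult: "quat_matrix (x * y) = quat_matrix x ** quat_matrix y"
  by (simp add: vec_eq_iff forall_2 matrix_matrix_mult_def sum_2 complex_eq_iff quat_defs
    algebra_simps)

lemma quat_matrix_one: "quat_matrix 1 = mat 1"
  by (simp add: vec_eq_iff forall_2 mat_def complex_eq_iff quat_defs)

lemma quat_matrix_qcnj: "quat_matrix (qcnj x) = conj_transpose (quat_matrix x)"
  by (simp add: vec_eq_iff forall_2 conj_transpose_def complex_eq_iff quat_defs)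

lemma det_quat_matrix: "det (quat_matrix x) = of_real (qnorm2 x)"
  by (simp add: det_2 complex_eq_iff qnorm2_def power2_eq_square)

lemma quat_matrix_inject: "quat_matrix x = quat_matrix y \<longleftrightarrow> x = y"
  by (auto simp: vec_eq_iff forall_2 quat_eq_iff)

lemma special_unitary_quat:
  assumes A: "A ** conj_transpose A = mat 1" "det A = 1" shows "\<exists>x. qnorm2 x = 1
    \<and> A = quat_matrix x"
proof -
  define a b c d where "a = A $ 1 $ 1" "b = A $ 1 $ 2" "c = A $ 2 $ 1" "d = A $ 2 $ 2"
  have det: "a * d - b * c = 1" using A(2) by (simp add: det_2 a_b_c_d_def)
  have ab: "a * cnj a + b * cnj b = 1" and cd: "c * cnj a + d * cnj b = 0"
    using A(1) by (simp_all add: vec_eq_iff forall_2 matrix_matrix_mult_def sum_2 conj_transpose_def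
      mat_def a_b_c_d_def)
  have "d = d * (a * cnj a + b * cnj b) - b * (c * cnj a + d * cnj b)" unfolding ab cd by simp
  also have "\<dots> = cnj a * (a * d - b * c)" by (simp add: algebra_simps)
  finally have d: "d = cnj a" unfolding det by simp
  have "c = c * (a * cnj a + b * cnj b) - a * (c * cnj a + d * cnj b)" unfolding ab cd by simp
  also have "\<dots> = - cnj b * (a * d - b * c)" by (simp add: algebra_simps)
  finally have c: "c = - cnj b" unfolding det by simp
  define x where "x = Quat (Re a) (Im a) (Re b) (Im b)"
  have e: "A = quat_matrix x"
    using c d by (simp add: vec_eq_iff forall_2 x_def complex_eq_iff flip: a_b_c_d_def)
  have "qnorm2 x = 1" using A(2) unfolding e det_quat_matrix by (metis of_real_eq_1_iff)
  then show ?thesis using e by blast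
qed

lemma quat_matrix_iso: "quat_matrix \<in> iso quat_group special_unitary_group"
  unfolding iso_def hom_def bij_betw_def
proof (intro CollectI conjI ballI)
  have mem: "quat_matrix x \<in> carrier special_unitary_group" if "qnorm2 x = 1" for x
  proof -
    have "conj_transpose (quat_matrix x) ** quat_matrix x = mat 1" "quat_matrix x ** conj_transpose
      (quat_matrix x) = mat 1"
      unfolding quat_matrix_qcnj[symmetric] quat_matrix_mult[symmetric] uq_inverse[OF that,
        symmetric]
      using that by (simp_all add: quat_matrix_one)
    then show ?thesis using that by (simp add: special_unitary_group_def det_quat_matrix)
  qed
  then show "quat_matrix \<in> carrier quat_group \<rightarrow> carrier special_unitary_group" by auto
  show "quat_matrix (x \<otimes>\<^bsub>quat_group\<^esub> y) = quat_matrix x \<otimes>\<^bsub>special_unitary_group\<^esub> quat_matrix y" for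
    x y
    by (simp add: quat_matrix_mult special_unitary_group_def)
  show "inj_on quat_matrix (carrier quat_group)" by (simp add: inj_on_def quat_matrix_inject)
  show "quat_matrix ` carrier quat_group = carrier special_unitary_group"
  proof (intro equalityI subsetI)
    fix A :: "complex^2^2" assume "A \<in> carrier special_unitary_group"
    then have "A ** conj_transpose A = mat 1" "det A = 1"
      by (simp_all add: special_unitary_group_def)
    then show "A \<in> quat_matrix ` carrier quat_group" using special_unitary_quat[of A] by auto
  qed (use mem in auto)
qed

lemma special_unitary_group: "group (special_unitary_group :: (complex^2^2) monoid)"
  by (rule group_iso_image[OF quat_group quat_matrix_iso]) (simp add: quat_matrix_one
    special_unitary_group_def)

lemma almost_conjugates_conjugate_SU2: "almost_conjugates_conjugate (special_unitary_group ::
  (complex^2^2) monoid)"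
  by (rule almost_conjugates_conjugate_iso[OF quat_group special_unitary_group quat_matrix_iso
    almost_conjugates_conjugate_quat_group])

lemma almost_conjugates_conjugate_SU2_prod:
  "almost_conjugates_conjugate ((special_unitary_group :: (complex^2^2) monoid) \<times>\<times>
    (special_unitary_group :: (complex^2^2) monoid))"
  by (rule almost_conjugates_conjugate_iso[OF DirProd_group[OF quat_group quat_group]
    DirProd_group[OF special_unitary_group special_unitary_group]
    group.DirProd_iso_set_trans[OF quat_group quat_matrix_iso quat_matrix_iso]
    almost_conjugates_conjugate_quat_group_prod])

section \<open>Pin and Spin groups\<close>

lemma pin_group_simps [simp]:
  "x \<otimes>\<^bsub>pin_group\<^esub> y = x * y" "\<one>\<^bsub>pin_group\<^esub> = 1"
  by (simp_all add: pin_group_def units_of_def clifford_monoid_def)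

lemma spin_group_simps [simp]:
  "x \<otimes>\<^bsub>spin_group\<^esub> y = x * y" "\<one>\<^bsub>spin_group\<^esub> = 1"
  "x \<in> carrier spin_group \<longleftrightarrow> x \<in> carrier pin_group \<and> rotation_matrix (pin_cover x)"
  by (simp_all add: spin_group_def)

lemma pin_mult: "x \<in> carrier pin_group \<Longrightarrow> y \<in> carrier pin_group \<Longrightarrow> x * y \<in> carrier pin_group"
  using monoid.m_closed[OF group.is_monoid[OF pin_group], of x y] by simp

lemma pin_one: "1 \<in> carrier pin_group"
  using monoid.one_closed[OF group.is_monoid[OF pin_group]] by simp

lemma pin_vec: "norm v = 1 \<Longrightarrow> cl_vec v \<in> carrier pin_group"
  by (auto simp: pin_group_def intro: generate.incl)

lemma pin_inverse:
  assumes "x \<in> carrier pin_group"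
  obtains y where "y \<in> carrier pin_group" "x * y = 1" "y * x = 1" "inv\<^bsub>clifford_monoid\<^esub> x = y"
    "inv\<^bsub>pin_group\<^esub> x = y"
proof -
  let ?y = "inv\<^bsub>pin_group\<^esub> x"
  have "?y \<in> carrier pin_group" "x * ?y = 1" "?y * x = 1"
    using group.inv_closed[OF pin_group assms] group.r_inv[OF pin_group assms] group.l_inv[OF
      pin_group assms] by simp_all
  then show ?thesis using clifford_inv_eq that by blast
qed

text \<open>The inverse of a unit vector \<open>v\<close> is the unit vector \<open>- v\<close>, so
  inverses of generators lead to no case of their own.\<close>

lemma pin_induct [consumes 1, case_names one vec mult]:
  assumes "x \<in> carrier pin_group" and one: "P 1" and vec: "\<And>v. norm v = 1 \<Longrightarrow> P (cl_vec v)"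
    and mult: "\<And>x y. x \<in> carrier pin_group \<Longrightarrow> y \<in> carrier pin_group \<Longrightarrow> P x \<Longrightarrow> P y \<Longrightarrow> P (x * y)"
  shows "P x"
proof -
  have u: "carrier pin_group = generate (units_of clifford_monoid) {cl_vec v |v. norm v = 1}"
    by (simp add: pin_group_def)
  have "x \<in> generate (units_of clifford_monoid) {cl_vec v |v. norm v = 1}"
    using assms(1) unfolding u .
  then show ?thesis
  proof induction
    case one then show ?case using assms(2) by (simp add: units_of_def clifford_monoid_def)
  next
    case (incl h) then show ?case using vec by auto
  next
    case (inv h)
    then obtain v where v: "h = cl_vec v" "norm v = 1" by auto
    have h: "h * - h = 1" "- h * h = 1" using cl_vec_unit_inverse[OF v(2)] v(1) by simp_all
    then have "h \<in> Units clifford_monoid" using clifford_Units_iff by blast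
    then have "inv\<^bsub>units_of clifford_monoid\<^esub> h = - h"
      using clifford_inv_eq[OF h] by (simp add: monoid.units_of_inv[OF clifford_monoid])
    moreover have "- h = cl_vec (- v)" using cl_vec_scaleR[of "- 1" v] v(1) by simp
    ultimately show ?case using vec[of "- v"] v(2) by simp
  next
    case (eng x y)
    then show ?case using mult[of x y] unfolding u by (simp add: units_of_def clifford_monoid_def)
  qed
qed

lemma pin_cover_mult:
  assumes "x \<in> carrier pin_group" "y \<in> carrier pin_group"
  shows "pin_cover (x * y) = pin_cover x ** pin_cover y"
proof (rule pin_cover_eqI)
  fix v
  obtain x' where x': "x * x' = 1" "x' * x = 1" "inv\<^bsub>clifford_monoid\<^esub> x = x'"
    using pin_inverse[OF assms(1)] by metis
  obtain y' where y': "y * y' = 1" "y' * y = 1" "inv\<^bsub>clifford_monoid\<^esub> y = y'"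
    using pin_inverse[OF assms(2)] by metis
  have "x * y * (y' * x') = x * (y * y') * x'" "y' * x' * (x * y) = y' * (x' * x) * y"
    by (simp_all only: mult.assoc)
  then have "inv\<^bsub>clifford_monoid\<^esub> (x * y) = y' * x'" using x' y' by (intro clifford_inv_eq) simp_all
  then show "cl_vec (pin_cover x ** pin_cover y *v v) = cl_grade (x * y) * cl_vec v *
    inv\<^bsub>clifford_monoid\<^esub> (x * y)"
    unfolding matrix_vector_mul_assoc[symmetric] pin_cover(2)[OF assms(1)] pin_cover(2)[OF assms(2)]
      cl_grade_mult x'(3) y'(3)
    by (simp add: mult.assoc)
qed

lemma pin_cover_one: "pin_cover 1 = mat 1"
proof (rule pin_cover_eqI)
  have "inv\<^bsub>clifford_monoid\<^esub> 1 = (1 :: 'a clifford)" by (rule clifford_inv_eq) simp_all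
  then show "cl_vec (mat 1 *v v) = cl_grade 1 * cl_vec v * inv\<^bsub>clifford_monoid\<^esub> (1 :: 'a clifford)"
    for v
    by (simp add: cl_grade_one)
qed

lemma pin_cover_vec:
  assumes h: "norm h = 1"
  shows "pin_cover (cl_vec h) *v v = v - (2 * (h \<bullet> v)) *\<^sub>R h"
proof -
  have i: "inv\<^bsub>clifford_monoid\<^esub> (cl_vec h) = - cl_vec h"
    by (rule clifford_inv_eq[OF cl_vec_unit_inverse[OF h]])
  have hh: "cl_vec h * cl_vec h = - 1" using cl_vec_square[of h] h by simp
  have "cl_vec v * cl_vec h = (- 2 * (h \<bullet> v)) *\<^sub>R 1 - cl_vec h * cl_vec v"
    using cl_vec_anticommute[of h v] by (simp add: algebra_simps)
  then have "cl_vec h * (cl_vec v * cl_vec h) = (- 2 * (h \<bullet> v)) *\<^sub>R cl_vec h - cl_vec h * cl_vec h *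
    cl_vec v"
    by (simp add: right_diff_distrib mult.assoc)
  also have "\<dots> = cl_vec (v - (2 * (h \<bullet> v)) *\<^sub>R h)"
    unfolding hh by (simp add: cl_vec_diff cl_vec_scaleR)
  finally have "cl_vec (pin_cover (cl_vec h) *v v) = cl_vec (v - (2 * (h \<bullet> v)) *\<^sub>R h)"
    unfolding pin_cover(2)[OF pin_vec[OF h]] i cl_grade_cl_vec by (simp add: mult.assoc)
  then show ?thesis unfolding cl_vec_inject .
qed

text \<open>An orthogonal map taking a coordinate vector to \<open>h\<close> conjugates the
  reflection to a diagonal matrix with a single entry -1.\<close>

lemma det_pin_cover_vec:
  fixes h :: "real^('n::{finite,linorder})"
  assumes h: "norm h = 1" shows "det (pin_cover (cl_vec h)) = - 1"
proof -
  fix k :: 'n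
  let ?e = "axis k 1 :: real^('n::{finite,linorder})"
  obtain f where f: "orthogonal_transformation f" "f ?e = h"
    using orthogonal_transformation_exists[of ?e h] h by (auto simp: norm_axis_1)
  let ?Q = "matrix f" and ?A = "pin_cover (cl_vec h)"
  let ?D = "(\<chi> i j. if i = j then if i = k then - 1 else 1 else 0) ::
    real^('n::{finite,linorder})^('n::{finite,linorder})"
  have lin: "linear f" using f(1) by (simp add: orthogonal_transformation_def)
  have Q: "?Q *v v = f v" for v by (simp add: matrix_works lin)
  have D: "?D *v v = v - (2 * v $ k) *\<^sub>R ?e" for v
  proof -
    have "(\<Sum>j\<in>UNIV. (if i = j then if i = k then - 1 else 1 else 0) * v $ j) = (if i = k then - 1
      else 1) * v $ i" for i
      by (simp add: if_distrib[of "\<lambda>x. x * _"] cong: if_cong)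
    then show ?thesis by (simp add: vec_eq_iff matrix_vector_mult_def axis_def)
  qed
  have AQ: "?A ** ?Q = ?Q ** ?D"
  proof (rule matrix_eq[THEN iffD2], rule allI)
    fix v
    have "h \<bullet> f v = v $ k"
      using f(1) unfolding f(2)[symmetric]
        by (simp add: orthogonal_transformation_def cart_eq_inner_axis inner_commute)
    then show "?A ** ?Q *v v = ?Q ** ?D *v v"
      unfolding matrix_vector_mul_assoc[symmetric] Q D pin_cover_vec[OF h]
      by (simp add: linear_diff[OF lin] linear_cmul[OF lin] f(2))
  qed
  have "det ?A * det ?Q = det ?Q * det ?D" unfolding det_mul[symmetric] AQ ..
  moreover have "det ?Q \<noteq> 0" using det_orthogonal_matrix[of ?Q] f(1)
    by (auto simp: orthogonal_transformation_matrix)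
  ultimately have "det ?A = det ?D" by simp
  also have "\<dots> = (\<Prod>i\<in>UNIV. if i = k then - 1 else 1)" by (subst det_diagonal) simp_all
  finally show ?thesis by simp
qed

lemma rotation_matrix_pin_cover: "x \<in> carrier pin_group
  \<Longrightarrow> rotation_matrix (pin_cover x) \<longleftrightarrow> det (pin_cover x) = 1"
  using pin_cover(1)[of x] by (simp add: rotation_matrix_def)

lemma cl_gen_square: "cl_basis {i} * cl_basis {i} = (- 1 :: 'n::{finite,linorder} clifford)"
proof -
  have "cl_basis {i} * cl_basis {i} = (cl_sign {i} {i}) *\<^sub>R (1 :: 'n clifford)"
    by (simp add: cl_basis_mult cl_basis_empty)
  then show ?thesis by (simp add: cl_sign_prod)
qed

lemma cl_gen_anticommute: "i \<noteq> j \<Longrightarrow> cl_basis {j} * cl_basis {i} = - (cl_basis {i} * (cl_basis {j} ::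
  'n::{finite,linorder} clifford))"
  using cl_basis_singleton_anticommute[of i j] by (simp add: eq_neg_iff_add_eq_0 add.commute)

abbreviation cl_gen :: "'n \<Rightarrow> 'n::{finite,linorder} clifford" where "cl_gen i \<equiv> cl_basis {i}"

lemma cl_vec_axis: "cl_vec (axis i 1) = cl_gen i"
proof -
  have "cl_vec (axis i 1) = (\<Sum>j\<in>UNIV. if j = i then cl_gen i else 0)"
    unfolding cl_vec_def by (intro sum.cong) (auto simp: axis_def)
  then show ?thesis by simp
qed

lemma pin_gen: "cl_gen i \<in> carrier pin_group"
  using pin_vec[of "axis i 1"] by (simp add: cl_vec_axis norm_axis_1)

section \<open>Spin(4)\<close>

text \<open>The even subalgebra of three of the four generators is a copy of the quaternions. The
  sign comes from i j = k: the product of \<open>e1 e2\<close> and \<open>e2 e3\<close> is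
  \<open>- e1 e3\<close>.\<close>

definition cl4_quat :: "quat \<Rightarrow> 4 clifford" where
  "cl4_quat x = qre x *\<^sub>R 1 + qi x *\<^sub>R (cl_gen 1 * cl_gen 2) + qj x *\<^sub>R (cl_gen 2 * cl_gen 3)
     - qk x *\<^sub>R (cl_gen 1 * cl_gen 3)"

definition cl4_vol :: "4 clifford" where
  "cl4_vol = cl_gen 1 * (cl_gen 2 * (cl_gen 3 * cl_gen 4))"

text \<open>The volume element is a central involution of the even subalgebra; its eigenspaces give the
  two factors of \<open>Spin(4)\<close>.\<close>

definition quat_spin :: "quat \<times> quat \<Rightarrow> 4 clifford" where
  "quat_spin p = (1 / 2) *\<^sub>R (cl4_quat (fst p) * (1 + cl4_vol) + cl4_quat (snd p) * (1 - cl4_vol))"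

lemma cl_gen_rules:
  "cl_gen i * (cl_gen i * x) = - x"
  "i \<noteq> j \<Longrightarrow> cl_gen j * (cl_gen i * x) = - (cl_gen i * (cl_gen j * x))"
proof -
  show "cl_gen i * (cl_gen i * x) = - x" unfolding mult.assoc[symmetric] cl_gen_square by simp
  show "cl_gen j * (cl_gen i * x) = - (cl_gen i * (cl_gen j * x))" if "i \<noteq> j"
    unfolding mult.assoc[symmetric] cl_gen_anticommute[OF that] by simp
qed

lemmas cl_gen_sort =
  cl_gen_square cl_gen_rules(1)
  cl_gen_anticommute[of 1 2] cl_gen_rules(2)[of 1 2] cl_gen_anticommute[of 1 3] cl_gen_rules(2)[of 1
    3]
  cl_gen_anticommute[of 1 4] cl_gen_rules(2)[of 1 4] cl_gen_anticommute[of 2 3] cl_gen_rules(2)[of 2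
    3]
  cl_gen_anticommute[of 2 4] cl_gen_rules(2)[of 2 4] cl_gen_anticommute[of 3 4] cl_gen_rules(2)[of 3
    4]

lemma cl4_quat_mult: "cl4_quat (x * y) = cl4_quat x * cl4_quat y"
  by (simp add: cl4_quat_def quat_defs cl_gen_sort mult.assoc algebra_simps)

lemma cl4_quat_one: "cl4_quat 1 = 1"
  by (simp add: cl4_quat_def quat_defs)

lemma cl4_vol_square: "cl4_vol * cl4_vol = 1"
  by (simp add: cl4_vol_def cl_gen_sort mult.assoc)

lemma cl4_vol_quat: "cl4_vol * cl4_quat x = cl4_quat x * cl4_vol"
  by (simp add: cl4_vol_def cl4_quat_def cl_gen_sort mult.assoc algebra_simps)

lemma cl4_vol_gen: "cl4_vol * cl_gen 1 = - (cl_gen 1 * cl4_vol)"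
  by (simp add: cl4_vol_def cl_gen_sort mult.assoc)

text \<open>Up to the factor 1/2 these are orthogonal idempotents; together with
  \<open>cl4_proj_quat\<close> they make the multiplication of \<open>quat_spin\<close>
  componentwise.\<close>

lemma cl4_proj_mult:
  "(1 + cl4_vol) * (1 + cl4_vol) = 2 *\<^sub>R (1 + cl4_vol)" "(1 - cl4_vol) * (1 - cl4_vol) = 2 *\<^sub>R (1 -
    cl4_vol)"
  "(1 + cl4_vol) * (1 - cl4_vol) = 0" "(1 - cl4_vol) * (1 + cl4_vol) = 0"
  by (simp_all add: algebra_simps cl4_vol_square scaleR_2)

lemma cl4_proj_quat:
  "(1 + cl4_vol) * cl4_quat x = cl4_quat x * (1 + cl4_vol)" "(1 - cl4_vol) * cl4_quat x = cl4_quat x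
    * (1 - cl4_vol)"
  by (simp_all add: algebra_simps cl4_vol_quat)

lemma quat_spin_mult: "quat_spin (a, b) * quat_spin (c, d) = quat_spin (a * c, b * d)"
proof -
  let ?p = "1 + cl4_vol" and ?q = "1 - cl4_vol" and ?k = cl4_quat
  have e: "?k x * P * (?k y * Q) = ?k x * ?k y * (P * Q)" if "P * ?k y = ?k y * P" for x y P Q
  proof -
    have "?k x * P * (?k y * Q) = ?k x * (P * ?k y) * Q" by (simp only: mult.assoc)
    then show ?thesis unfolding that by (simp only: mult.assoc)
  qed
  have "(?k a * ?p + ?k b * ?q) * (?k c * ?p + ?k d * ?q)
      = ?k a * ?p * (?k c * ?p) + ?k a * ?p * (?k d * ?q) + (?k b * ?q * (?k c * ?p) + ?k b * ?q *
        (?k d * ?q))"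
    by (simp only: distrib_left distrib_right ac_simps)
  also have "\<dots> = 2 *\<^sub>R (?k (a * c) * ?p) + 2 *\<^sub>R (?k (b * d) * ?q)"
    unfolding e[OF cl4_proj_quat(1)] e[OF cl4_proj_quat(2)] cl4_proj_mult cl4_quat_mult
    by (simp only: mult_scaleR_right mult_zero_right add_0_left add_0_right)
  finally have "(?k a * ?p + ?k b * ?q) * (?k c * ?p + ?k d * ?q) = 2 *\<^sub>R (?k (a * c) * ?p + ?k (b *
    d) * ?q)"
    by (simp only: scaleR_right_distrib[of 2 "?k (a * c) * ?p"])
  then show ?thesis by (simp add: quat_spin_def)
qed

lemma quat_spin_one: "quat_spin (1, 1) = 1"
  by (simp add: quat_spin_def cl4_quat_one flip: scaleR_2)

lemma quat_spin_uminus: "quat_spin (- a, - b) = - quat_spin (a, b)"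
proof -
  have "cl4_quat (- x) = - cl4_quat x" for x by (simp add: cl4_quat_def quat_defs)
  then have "quat_spin (- a, - b) = (1 / 2) *\<^sub>R - (cl4_quat a * (1 + cl4_vol) + cl4_quat b * (1 -
    cl4_vol))"
    by (simp add: quat_spin_def)
  then show ?thesis unfolding quat_spin_def by (simp only: scaleR_minus_right fst_conv snd_conv)
qed

lemma quat_spin_vol: "cl4_vol * quat_spin p = quat_spin p * cl4_vol"
proof -
  have "cl4_vol * (cl4_quat x * (1 + cl4_vol)) = cl4_quat x * (1 + cl4_vol) * cl4_vol"
    "cl4_vol * (cl4_quat x * (1 - cl4_vol)) = cl4_quat x * (1 - cl4_vol) * cl4_vol" for x
    by (simp_all add: cl4_vol_quat cl4_vol_square algebra_simps flip: mult.assoc)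
  then show ?thesis by (simp add: quat_spin_def distrib_left distrib_right)
qed

text \<open>The volume element anticommutes with a generator, whereas 1 and -1 commute with
  it.\<close>

lemma cl4_vol_nontrivial: "1 + cl4_vol \<noteq> 0" "1 - cl4_vol \<noteq> 0"
proof -
  have n: "cl_gen (1 :: 4) \<noteq> 0" using cl_gen_square[of "1 :: 4"] by auto
  have f: False if "cl4_vol * cl_gen 1 = cl_gen 1 * cl4_vol"
  proof -
    have "cl_gen 1 * cl4_vol = - (cl_gen 1 * cl4_vol)" using that cl4_vol_gen by simp
    then have "2 *\<^sub>R (cl_gen 1 * cl4_vol) = 0" unfolding scaleR_2 by (simp add: eq_neg_iff_add_eq_0)
    then have "cl_gen 1 * cl4_vol = 0" by simp
    then have "cl_gen 1 * (cl4_vol * cl4_vol) = 0" by (simp flip: mult.assoc)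
    then show False using n by (simp add: cl4_vol_square)
  qed
  show "1 + cl4_vol \<noteq> 0"
  proof
    assume "1 + cl4_vol = 0"
    then have v: "cl4_vol = - 1" by (simp add: add_eq_0_iff)
    have "cl4_vol * cl_gen 1 = cl_gen 1 * cl4_vol" unfolding v by simp
    then show False by (rule f)
  qed
  show "1 - cl4_vol \<noteq> 0"
  proof
    assume "1 - cl4_vol = 0"
    then have v: "cl4_vol = 1" by simp
    have "cl4_vol * cl_gen 1 = cl_gen 1 * cl4_vol" unfolding v by simp
    then show False by (rule f)
  qed
qed

lemma quat_spin_kernel:
  assumes "quat_spin (a, b) = 1" shows "a = 1 \<and> b = 1"
proof -
  let ?p = "1 + cl4_vol" and ?q = "1 - cl4_vol" and ?k = cl4_quat
  have e: "?k a * ?p + ?k b * ?q = 2 *\<^sub>R 1"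
    using arg_cong[OF assms, of "\<lambda>x. 2 *\<^sub>R x"] by (simp add: quat_spin_def)
  have cancel: "x = 1" if P: "P \<noteq> 0" "?k x * P = P" for x P
  proof (rule ccontr)
    assume "x \<noteq> 1"
    then have "inverse (x - 1) * (x - 1) = 1" by simp
    moreover have "?k (x - 1) * P = 0"
    proof -
      have "?k (x - 1) = ?k x - ?k 1" by (simp add: cl4_quat_def quat_defs algebra_simps)
      then show ?thesis using P(2) by (simp add: cl4_quat_one left_diff_distrib)
    qed
    moreover have "?k (inverse (x - 1)) * (?k (x - 1) * P) = ?k (inverse (x - 1) * (x - 1)) * P"
      unfolding cl4_quat_mult mult.assoc ..
    ultimately show False using P(1) by (simp add: cl4_quat_one)
  qed
  have "(?k a * ?p + ?k b * ?q) * ?p = 2 *\<^sub>R (?k a * ?p)" "(?k a * ?p + ?k b * ?q) * ?q = 2 *\<^sub>R (?k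
    b * ?q)"
    by (simp_all only: distrib_right[of "?k a * ?p"] mult.assoc cl4_proj_mult mult_scaleR_right
      mult_zero_right add_0_left add_0_right)
  then have "2 *\<^sub>R (?k a * ?p) = 2 *\<^sub>R ?p" "2 *\<^sub>R (?k b * ?q) = 2 *\<^sub>R ?q" unfolding e by simp_all
  then have "?k a * ?p = ?p" "?k b * ?q = ?q" by (simp_all only: scaleR_cancel_left) simp_all
  then show ?thesis using cancel cl4_vol_nontrivial by blast
qed

lemma quat_spin_inject:
  assumes n: "qnorm2 a = 1" "qnorm2 b = 1" and e: "quat_spin (a, b) = quat_spin (c, d)" shows "a = c
    \<and> b = d"
proof -
  have "quat_spin (inverse a * c, inverse b * d) = quat_spin (inverse a * a, inverse b * b)"
    unfolding quat_spin_mult[symmetric] e ..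
  then have "inverse a * c = 1 \<and> inverse b * d = 1"
    using n quat_spin_kernel by (simp add: quat_spin_one)
  moreover have "a * (inverse a * c) = c" "b * (inverse b * d) = d"
    using uq_nonzero[OF n(1)] uq_nonzero[OF n(2)] by simp_all
  ultimately show ?thesis by simp
qed

text \<open>Conjugation by the first generator negates the volume element, so it exchanges the two
  factors; on the quaternion units it negates i and k.\<close>

lemma gen1_quat_spin:
  "cl_gen 1 * quat_spin (a, b) = quat_spin (Quat (qre b) (- qi b) (qj b) (- qk b), Quat (qre a) (-
    qi a) (qj a) (- qk a)) * cl_gen 1"
proof -
  let ?s = "\<lambda>x. Quat (qre x) (- qi x) (qj x) (- qk x)"
  have q: "cl_gen 1 * cl4_quat x = cl4_quat (?s x) * cl_gen 1" for x
    by (simp add: cl4_quat_def cl_gen_sort mult.assoc algebra_simps)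
  have v: "cl_gen 1 * (1 + cl4_vol) = (1 - cl4_vol) * cl_gen 1" "cl_gen 1 * (1 - cl4_vol) = (1 +
    cl4_vol) * cl_gen 1"
    by (simp_all add: algebra_simps cl4_vol_gen)
  have "cl_gen 1 * (cl4_quat x * P) = cl4_quat (?s x) * (cl_gen 1 * P)" for x P
    unfolding mult.assoc[symmetric] q ..
  then have "cl_gen 1 * (cl4_quat a * (1 + cl4_vol)) = cl4_quat (?s a) * (1 - cl4_vol) * cl_gen 1"
    "cl_gen 1 * (cl4_quat b * (1 - cl4_vol)) = cl4_quat (?s b) * (1 + cl4_vol) * cl_gen 1"
    by (simp_all only: v mult.assoc)
  then show ?thesis unfolding quat_spin_def by (simp add: distrib_left distrib_right add.commute)
qed

text \<open>As the square of the first generator is -1, this writes every vector as that generator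
  times an element of the image of \<open>quat_spin\<close>.\<close>

lemma quat_spin_vec:
  "cl_gen 1 * cl_vec v = quat_spin (Quat (- v $ 1) (v $ 2) (- v $ 4) (- v $ 3), Quat (- v $ 1) (v $
    2) (v $ 4) (- v $ 3))"
proof -
  have half: "(r / 2) *\<^sub>R x + (r / 2) *\<^sub>R x = r *\<^sub>R x" "(r / 2) *\<^sub>R x + ((r / 2) *\<^sub>R x + y) = r *\<^sub>R
    x + y" for r and x y :: "4 clifford"
    by (simp_all flip: scaleR_left_distrib add.assoc)
  show ?thesis
    unfolding quat_spin_def cl4_quat_def cl4_vol_def cl_vec_def sum_4
    by (simp add: cl_gen_sort mult.assoc algebra_simps half)
qed

definition qflip :: "quat \<Rightarrow> quat" where
  "qflip x = Quat (qre x) (- qi x) (qj x) (- qk x)"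

lemma qflip: "qflip (qflip x) = x" "qnorm2 (qflip x) = qnorm2 x"
  by (simp_all add: qflip_def qnorm2_def)

lemma quat_spin_gen1: "quat_spin (a, b) * cl_gen 1 = cl_gen 1 * quat_spin (qflip b, qflip a)"
  unfolding gen1_quat_spin qflip_def[symmetric] qflip ..

text \<open>The image of \<open>quat_spin\<close> and its translate by the first generator are
  together closed under multiplication, and the determinant of the covered matrix keeps track of
  which of the two occurs.\<close>

lemma pin4_cases:
  assumes "x \<in> carrier (pin_group :: 4 clifford monoid)"
  shows "(\<exists>a b. qnorm2 a = 1 \<and> qnorm2 b = 1 \<and> x = quat_spin (a, b) \<and> det (pin_cover x) = 1) \<or>
    (\<exists>a b. qnorm2 a = 1 \<and> qnorm2 b = 1 \<and> x = cl_gen 1 * quat_spin (a, b) \<and> det (pin_cover x) = - 1)"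
  using assms
proof (induction rule: pin_induct)
  case one
  then show ?case using quat_spin_one[symmetric]
    by (intro disjI1 exI[of _ 1]) (simp add: pin_cover_one)
next
  case (vec v)
  let ?a = "Quat (- v $ 1) (v $ 2) (- v $ 4) (- v $ 3)"
    and ?b = "Quat (- v $ 1) (v $ 2) (v $ 4) (- v $ 3)"
  have "v \<bullet> v = 1" using vec by (simp add: norm_eq_1)
  then have n: "qnorm2 (- ?a) = 1" "qnorm2 (- ?b) = 1"
    by (simp_all add: qnorm2_def quat_defs inner_vec_def sum_4 power2_eq_square)
  have "cl_vec v = cl_gen 1 * quat_spin (- ?a, - ?b)"
    unfolding quat_spin_uminus quat_spin_vec[symmetric] by (simp add: cl_gen_rules(1))
  then show ?case using n det_pin_cover_vec[OF vec] by blast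
next
  case (mult x y)
  have d: "det (pin_cover (x * y)) = det (pin_cover x) * det (pin_cover y)"
    unfolding pin_cover_mult[OF mult.hyps] by (rule det_mul)
  have m1: "- quat_spin (a, b) = quat_spin (- a, - b)" for a b by (rule quat_spin_uminus[symmetric])
  from mult.IH show ?case
  proof (elim disjE exE conjE)
    fix a b a' b' assume *: "qnorm2 a = 1" "qnorm2 b = 1" "qnorm2 a' = 1" "qnorm2 b' = 1"
    { assume "x = quat_spin (a, b)" "det (pin_cover x) = 1" "y = quat_spin (a', b')" "det (pin_cover
      y) = 1"
      then show ?thesis using * d by (intro disjI1 exI[of _ "a * a'"] exI[of _ "b * b'"]) (simp add:
        quat_spin_mult) }
    { assume 1: "x = quat_spin (a, b)" "det (pin_cover x) = 1" "y = cl_gen 1 * quat_spin (a', b')"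
      "det (pin_cover y) = - 1"
      have "x * y = cl_gen 1 * quat_spin (qflip b * a', qflip a * b')"
        unfolding 1 quat_spin_mult[symmetric] by (simp only: mult.assoc[symmetric] quat_spin_gen1)
      then show ?thesis using * d 1(2,4)
        by (intro disjI2 exI[of _ "qflip b * a'"] exI[of _ "qflip a * b'"]) (simp add: qflip) }
    { assume 1: "x = cl_gen 1 * quat_spin (a, b)" "det (pin_cover x) = - 1" "y = quat_spin (a', b')"
      "det (pin_cover y) = 1"
      have "x * y = cl_gen 1 * quat_spin (a * a', b * b')"
        unfolding 1 quat_spin_mult[symmetric] by (simp only: mult.assoc)
      then show ?thesis using * d 1(2,4)
        by (intro disjI2 exI[of _ "a * a'"] exI[of _ "b * b'"]) simp }
    { assume 1: "x = cl_gen 1 * quat_spin (a, b)" "det (pin_cover x) = - 1" "y = cl_gen 1 *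
      quat_spin (a', b')" "det (pin_cover y) = - 1"
      have "x * y = cl_gen 1 * (quat_spin (a, b) * cl_gen 1) * quat_spin (a', b')"
        unfolding 1 by (simp only: mult.assoc)
      also have "\<dots> = - (quat_spin (qflip b, qflip a) * quat_spin (a', b'))"
        unfolding quat_spin_gen1 by (simp add: cl_gen_rules(1))
      finally have "x * y = quat_spin (- (qflip b * a'), - (qflip a * b'))"
        unfolding quat_spin_mult quat_spin_uminus .
      then show ?thesis using * d 1(2,4)
        by (intro disjI1 exI[of _ "- (qflip b * a')"] exI[of _ "- (qflip a * b')"]) (simp add:
          qflip) }
  qed
qed

text \<open>Halving the angle: \<open>(1 + p) * (1 + p)\<close> is \<open>2 + 2 * qre p\<close>
  times \<open>p\<close>, and the same number is the squared norm of \<open>1 + p\<close>.\<close>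

lemma uq_sqrt:
  assumes p: "qnorm2 p = 1" obtains x where "qnorm2 x = 1" "x * x = p"
proof (cases "p = - 1")
  case True
  have "qnorm2 (Quat 0 1 0 0) = 1" "Quat 0 1 0 0 * Quat 0 1 0 0 = p"
    using True by (simp_all add: qnorm2_def quat_defs)
  then show ?thesis by (rule that)
next
  case False
  let ?s = "2 + 2 * qre p"
  have n: "qnorm2 (1 + p) = ?s" using p
    by (simp add: qnorm2_def quat_defs power2_eq_square algebra_simps)
  have "1 + p \<noteq> 0" using False by (simp add: add_eq_0_iff)
  then have "?s \<noteq> 0" using n qnorm2_eq_0_iff[of "1 + p"] by simp
  moreover have "0 \<le> ?s" unfolding n[symmetric] by (simp add: qnorm2_def)
  ultimately have s: "?s > 0" by simp
  let ?r = "1 / sqrt ?s"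
  have rr: "?r * ?r * ?s = 1" using s by (simp add: field_simps)
  show ?thesis
  proof (rule that[of "?r *\<^sub>R (1 + p)"])
    have nr: "qnorm2 (r *\<^sub>R x) = r * r * qnorm2 x" for r x
      by (simp add: qnorm2_def quat_defs power2_eq_square algebra_simps)
    show "qnorm2 (?r *\<^sub>R (1 + p)) = 1" unfolding nr n by (rule rr)
    have "(1 + p) * (1 + p) = 1 + 2 *\<^sub>R p + p * p" by (simp add: algebra_simps scaleR_2)
    also have "\<dots> = ?s *\<^sub>R p" unfolding uq_quadratic[OF p] by (simp add: algebra_simps)
    finally have "?r *\<^sub>R (1 + p) * (?r *\<^sub>R (1 + p)) = (?r * ?r * ?s) *\<^sub>R p" by simp
    then show "?r *\<^sub>R (1 + p) * (?r *\<^sub>R (1 + p)) = p" unfolding rr by simp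
  qed
qed

text \<open>Take a square root \<open>x\<close> of \<open>p\<close>. It is conjugate to its inverse,
  so that the commutator of \<open>x\<close> with the conjugating element is
  \<open>x * x\<close>.\<close>

lemma uq_commutator:
  assumes p: "qnorm2 p = 1" obtains a b where "qnorm2 a = 1" "qnorm2 b = 1" "a * b * inverse (b * a)
    = p"
proof -
  obtain x where x: "qnorm2 x = 1" "x * x = p" using uq_sqrt[OF p] .
  obtain b where b: "qnorm2 b = 1" "b * inverse x * inverse b = x"
    using conj_same_re[of "inverse x" x] x(1) by auto
  have "x * b * inverse (b * x) = x * (b * inverse x * inverse b)"
    using uq_nonzero[OF x(1)] uq_nonzero[OF b(1)]
      by (simp add: nonzero_inverse_mult_distrib mult.assoc)
  then show ?thesis using that[OF x(1) b(1)] unfolding b(2) x(2) by blast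
qed

text \<open>Quaternion conjugation followed by conjugation with j, hence an
  anti-automorphism.\<close>

definition qanti :: "quat \<Rightarrow> quat" where
  "qanti x = Quat (qre x) (qi x) (- qj x) (qk x)"

lemma qanti: "qanti (x * y) = qanti y * qanti x" "qanti (qanti x) = x" "qnorm2 (qanti x) = qnorm2 x"
  "qanti 1 = 1"
  by (simp_all add: qanti_def qnorm2_def quat_defs algebra_simps)

lemma qanti_inverse: "qnorm2 x = 1 \<Longrightarrow> qanti (inverse x) = inverse (qanti x)"
  by (simp add: uq_inverse qanti(3)) (simp add: qanti_def quat_defs)

text \<open>These elements are the products of \<open>e\<^sub>1\<close> with a unit vector. As \<open>qanti\<close> reverses products,
  they generate all \<open>(1, p)\<close> with \<open>p\<close> a commutator, and every unit quaternion is a commutator.\<close>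

lemma quat_spin_qanti:
  assumes h: "qnorm2 h = 1" shows "quat_spin (h, qanti h) \<in> carrier pin_group"
proof -
  define v :: "real^4" where
    "v = (\<chi> i. if i = 1 then - qre h else if i = 2 then qi h else if i = 3 then - qk h else - qj h)"
  have v: "v $ 1 = - qre h" "v $ 2 = qi h" "v $ 3 = - qk h" "v $ 4 = - qj h"
    by (simp_all add: v_def)
  have "v \<bullet> v = 1" using h by (simp add: inner_vec_def sum_4 v qnorm2_def power2_eq_square)
  then have "cl_gen 1 * cl_vec v \<in> carrier pin_group"
    by (intro pin_mult pin_gen pin_vec) (simp add: norm_eq_1)
  then show ?thesis unfolding quat_spin_vec v by (simp add: qanti_def)
qed

lemma quat_spin_in_pin:
  assumes n: "qnorm2 a = 1" "qnorm2 b = 1" shows "quat_spin (a, b) \<in> carrier pin_group"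
proof -
  have comm: "quat_spin (1, x * y * inverse (y * x)) \<in> carrier pin_group"
    if xy: "qnorm2 x = 1" "qnorm2 y = 1" for x y
  proof -
    let ?g = "qanti x" and ?h = "qanti y"
    have g: "qnorm2 ?g = 1" "qnorm2 ?h = 1" using xy by (simp_all add: qanti)
    then have gh: "qnorm2 (?g * ?h) = 1" by simp
    \<comment> \<open>The third factor is again of the form \<open>(h, qanti h)\<close>, because
      \<open>qanti\<close> reverses \<open>?g * ?h\<close> to \<open>y * x\<close>. The left
      components cancel and the right ones form the commutator.\<close>
    have "quat_spin (?g, x) * quat_spin (?h, y) * quat_spin (inverse (?g * ?h), inverse (y * x)) \<in>
      carrier pin_group"
      using quat_spin_qanti[OF g(1)] quat_spin_qanti[OF g(2)] quat_spin_qanti[OF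
        uq_inverse_closed[OF gh]]
      unfolding qanti_inverse[OF gh] qanti(1,2) by (intro pin_mult)
    then show ?thesis unfolding quat_spin_mult using gh by simp
  qed
  have "qnorm2 (inverse (qanti a) * b) = 1" using n by (simp add: qanti)
  then obtain x y where "qnorm2 x = 1" "qnorm2 y = 1" "x * y * inverse (y * x) = inverse (qanti a) *
    b" by (rule uq_commutator)
  then have "quat_spin (1, inverse (qanti a) * b) \<in> carrier pin_group" using comm by metis
  then have "quat_spin (a, qanti a) * quat_spin (1, inverse (qanti a) * b) \<in> carrier pin_group"
    by (rule pin_mult[OF quat_spin_qanti[OF n(1)]])
  moreover have "qanti a * (inverse (qanti a) * b) = b"
    using n(1) by (simp add: qanti uq_nonzero flip: mult.assoc)
  ultimately show ?thesis unfolding quat_spin_mult by simp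
qed

lemma quat_spin_not_odd:
  assumes n: "qnorm2 a = 1" "qnorm2 b = 1" shows "quat_spin (a, b) \<noteq> cl_gen 1 * quat_spin (c, d)"
proof
  let ?x = "quat_spin (a, b)"
  assume e: "?x = cl_gen 1 * quat_spin (c, d)"
  have "cl4_vol * ?x = cl4_vol * cl_gen 1 * quat_spin (c, d)" unfolding e by (simp only: mult.assoc)
  also have "\<dots> = - (cl_gen 1 * (cl4_vol * quat_spin (c, d)))"
    unfolding cl4_vol_gen by (simp add: mult.assoc)
  also have "\<dots> = - (?x * cl4_vol)" unfolding quat_spin_vol e by (simp only: mult.assoc)
  finally have "?x * cl4_vol = - (?x * cl4_vol)" unfolding quat_spin_vol .
  then have "2 *\<^sub>R (?x * cl4_vol) = 0" unfolding scaleR_2 by (simp add: eq_neg_iff_add_eq_0)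
  then have "?x * cl4_vol * cl4_vol = 0" by simp
  then have "?x = 0" by (simp add: mult.assoc cl4_vol_square)
  moreover have "quat_spin (inverse a, inverse b) * ?x = 1" unfolding quat_spin_mult
    using n by (simp add: quat_spin_one)
  ultimately show False by simp
qed

lemma quat_spin_iso: "quat_spin \<in> iso (quat_group \<times>\<times> quat_group) spin_group"
  unfolding iso_def hom_def bij_betw_def
proof (intro CollectI conjI ballI)
  have mem: "quat_spin p \<in> carrier spin_group" if "p \<in> carrier (quat_group \<times>\<times> quat_group)" for p
  proof -
    obtain a b where p: "p = (a, b)" by fastforce
    have n: "qnorm2 a = 1" "qnorm2 b = 1" using that p by auto
    have m: "quat_spin (a, b) \<in> carrier pin_group" by (rule quat_spin_in_pin[OF n])
    then have "det (pin_cover (quat_spin (a, b))) = 1"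
      using pin4_cases[OF m] quat_spin_not_odd[OF n] by blast
    then show ?thesis using m p by (simp add: rotation_matrix_pin_cover)
  qed
  then show "quat_spin \<in> carrier (quat_group \<times>\<times> quat_group) \<rightarrow> carrier spin_group" by blast
  show "quat_spin (p \<otimes>\<^bsub>quat_group \<times>\<times> quat_group\<^esub> q) = quat_spin p \<otimes>\<^bsub>spin_group\<^esub> quat_spin q" for p q
    by (cases p; cases q) (simp add: quat_spin_mult)
  show "inj_on quat_spin (carrier (quat_group \<times>\<times> quat_group))"
    by (rule inj_onI) (use quat_spin_inject in auto)
  show "quat_spin ` carrier (quat_group \<times>\<times> quat_group) = carrier spin_group"
  proof (intro equalityI subsetI)
    fix x :: "4 clifford" assume "x \<in> carrier spin_group"
    then have x: "x \<in> carrier pin_group" "det (pin_cover x) = 1"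
      by (auto simp: rotation_matrix_pin_cover)
    then obtain a b where "qnorm2 a = 1" "qnorm2 b = 1" "x = quat_spin (a, b)"
      using pin4_cases[OF x(1)] by auto
    then show "x \<in> quat_spin ` carrier (quat_group \<times>\<times> quat_group)" by auto
  qed (use mem in auto)
qed

lemma almost_conjugates_conjugate_spin4: "almost_conjugates_conjugate (spin_group :: 4 clifford
  monoid)"
proof -
  note Q = DirProd_group[OF quat_group quat_group]
  have "group (spin_group :: 4 clifford monoid)"
    by (rule group_iso_image[OF Q quat_spin_iso]) (simp add: quat_spin_one)
  then show ?thesis
    by (rule almost_conjugates_conjugate_iso[OF Q _ quat_spin_iso
      almost_conjugates_conjugate_quat_group_prod])
qed

section \<open>Two codes of length six\<close>

lemma exhaust_6: fixes x :: 6 shows "x = 1 \<or> x = 2 \<or> x = 3 \<or> x = 4 \<or> x = 5 \<or> x = 6"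
proof (induct x)
  case (of_int z)
  then have "z = 0 \<or> z = 1 \<or> z = 2 \<or> z = 3 \<or> z = 4 \<or> z = 5" by simp arith
  then show ?case by auto
qed

lemma UNIV_6: "UNIV = {1, 2, 3, 4, 5, 6 :: 6}"
  using exhaust_6 by blast

definition word6 :: "bool \<Rightarrow> bool \<Rightarrow> bool \<Rightarrow> bool \<Rightarrow> bool \<Rightarrow> bool \<Rightarrow> 6 set" where
  "word6 a b c d e f = {i. (i = 1 \<longrightarrow> a) \<and> (i = 2 \<longrightarrow> b) \<and> (i = 3 \<longrightarrow> c) \<and> (i = 4 \<longrightarrow> d) \<and> (i = 5 \<longrightarrow> e)
    \<and> (i = 6 \<longrightarrow> f)}"

lemma word6_mem [simp]:
  "1 \<in> word6 a b c d e f \<longleftrightarrow> a" "2 \<in> word6 a b c d e f \<longleftrightarrow> b" "3 \<in> word6 a b c d e f \<longleftrightarrow> c"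
  "4 \<in> word6 a b c d e f \<longleftrightarrow> d" "5 \<in> word6 a b c d e f \<longleftrightarrow> e" "6 \<in> word6 a b c d e f \<longleftrightarrow> f"
  by (simp_all add: word6_def)

lemma set6_eq_iff: "A = B \<longleftrightarrow> (1 \<in> A \<longleftrightarrow> 1 \<in> B) \<and> (2 \<in> A \<longleftrightarrow> 2 \<in> B) \<and> (3 \<in> A \<longleftrightarrow> 3 \<in> B) \<and>
    (4 \<in> A \<longleftrightarrow> 4 \<in> B) \<and> (5 \<in> A \<longleftrightarrow> 5 \<in> B) \<and> (6 \<in> A \<longleftrightarrow> 6 \<in> B)" for A B :: "6 set"
proof -
  have "(\<forall>i. i \<in> A \<longleftrightarrow> i \<in> B) \<longleftrightarrow> (\<forall>i\<in>{1, 2, 3, 4, 5, 6}. i \<in> A \<longleftrightarrow> i \<in> B)"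
    unfolding UNIV_6[symmetric] by simp
  then show ?thesis unfolding set_eq_iff by simp
qed

lemma card6: "card A = of_bool (1 \<in> A) + of_bool (2 \<in> A) + of_bool (3 \<in> A) + of_bool (4 \<in> A) +
  of_bool (5 \<in> A) + of_bool (6 \<in> A)"
  for A :: "6 set"
proof -
  have "card A = (\<Sum>i\<in>UNIV. of_bool (i \<in> A))" by simp
  then show ?thesis unfolding UNIV_6 by simp
qed

text \<open>\<open>code1\<close> is spanned by \<open>12 = {1, 2}\<close>, \<open>34\<close>, \<open>56\<close> and \<open>code2\<close> by \<open>12\<close>, \<open>23\<close>, \<open>123456\<close>: both
  have one word of weight 0, three of weight 2, three of weight 4 and one of weight 6, but the
  words of weight 2 are disjoint only in \<open>code1\<close>.\<close>

definition code1 :: "6 set set" where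
  "code1 = {A. (1 \<in> A \<longleftrightarrow> 2 \<in> A) \<and> (3 \<in> A \<longleftrightarrow> 4 \<in> A) \<and> (5 \<in> A \<longleftrightarrow> 6 \<in> A)}"

definition code2 :: "6 set set" where
  "code2 = {A. (4 \<in> A \<longleftrightarrow> 5 \<in> A) \<and> (5 \<in> A \<longleftrightarrow> 6 \<in> A) \<and> ((1 \<in> A \<longleftrightarrow> 2 \<in> A) \<longleftrightarrow> (3 \<in> A \<longleftrightarrow> 4 \<in> A))}"

definition linear_code :: "'n set set \<Rightarrow> bool" where
  "linear_code C \<longleftrightarrow> {} \<in> C \<and> (\<forall>A\<in>C. \<forall>B\<in>C. sym_diff A B \<in> C)"

lemma linear_codes: "linear_code code1" "linear_code code2"
  unfolding linear_code_def code1_def code2_def by simp_all blast+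

abbreviation maj :: "bool \<Rightarrow> bool \<Rightarrow> bool \<Rightarrow> bool" where
  "maj p q r \<equiv> p \<and> q \<or> p \<and> r \<or> q \<and> r"

text \<open>\<open>code_map\<close> is not linear: it sends \<open>12\<close>, \<open>34\<close>, \<open>56\<close> to \<open>23\<close>, \<open>13\<close>, \<open>12\<close> and commutes with
  complements.\<close>

definition code_map :: "6 set \<Rightarrow> 6 set" where
  "code_map A = (let p = 1 \<in> A; q = 3 \<in> A; r = 5 \<in> A; t = maj p q r
     in word6 ((q \<noteq> r) \<noteq> t) ((p \<noteq> r) \<noteq> t) ((p \<noteq> q) \<noteq> t) t t t)"

definition code_map_inv :: "6 set \<Rightarrow> 6 set" where
  "code_map_inv B = (let x = 1 \<in> B; y = 2 \<in> B; z = 3 \<in> B; t = 4 \<in> B; p = maj y z t; q = maj x z t; r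
    = maj x y t
     in word6 p p q q r r)"

lemma code_map_bij: "bij_betw code_map code1 code2"
proof (rule bij_betw_byWitness[of _ code_map_inv])
  show "\<forall>A\<in>code1. code_map_inv (code_map A) = A"
  proof
    fix A assume "A \<in> code1" then show "code_map_inv (code_map A) = A"
      by (cases "1 \<in> A"; cases "3 \<in> A"; cases "5 \<in> A") (simp_all add: code1_def code_map_def
        code_map_inv_def set6_eq_iff)
  qed
  show "\<forall>B\<in>code2. code_map (code_map_inv B) = B"
  proof
    fix B assume "B \<in> code2" then show "code_map (code_map_inv B) = B"
      by (cases "1 \<in> B"; cases "2 \<in> B"; cases "3 \<in> B") (simp_all add: code2_def code_map_def
        code_map_inv_def set6_eq_iff)
  qed
  show "code_map ` code1 \<subseteq> code2"
  proof clarify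
    fix A assume "A \<in> code1" then show "code_map A \<in> code2"
      by (cases "1 \<in> A"; cases "3 \<in> A"; cases "5 \<in> A") (simp_all add: code1_def code2_def
        code_map_def)
  qed
  show "code_map_inv ` code2 \<subseteq> code1"
    by (simp add: image_subset_iff code1_def code_map_inv_def Let_def)
qed

lemma card_code_map: "A \<in> code1 \<Longrightarrow> card (code_map A) = card A"
  by (cases "1 \<in> A"; cases "3 \<in> A"; cases "5 \<in> A") (simp_all add: card6 code1_def code_map_def
    Let_def)

lemma even_code1: "A \<in> code1 \<Longrightarrow> even (card A)"
  by (cases "1 \<in> A"; cases "3 \<in> A"; cases "5 \<in> A") (simp_all add: card6 code1_def)

lemma even_code2:
  assumes "A \<in> code2" shows "even (card A)"
proof -
  have "A \<in> code_map ` code1" using assms code_map_bij by (simp add: bij_betw_def)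
  then show ?thesis using card_code_map even_code1 by auto
qed

lemma code1_pairs:
  assumes "A \<in> code1" "B \<in> code1" "card A = 2" "card B = 2" shows "card (sym_diff A B) \<noteq> 2"
  using assms
  by (cases "1 \<in> A"; cases "3 \<in> A"; cases "5 \<in> A"; cases "1 \<in> B"; cases "3 \<in> B"; cases "5 \<in> B")
    (simp_all add: card6 code1_def)

lemma code2_pairs: "{1, 2} \<in> code2" "{1, 3} \<in> code2" "sym_diff {1, 2} {1, 3} = {2, 3 :: 6}"
  "card {1, 2 :: 6} = 2" "card {1, 3 :: 6} = 2" "card {2, 3 :: 6} = 2"
  by (auto simp: code2_def)

section \<open>Diagonal subgroups of the orthogonal group\<close>

definition diag_sign :: "'n::finite set \<Rightarrow> real^'n^'n" where
  "diag_sign A = (\<chi> i j. if i = j then if i \<in> A then - 1 else 1 else 0)"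

lemma diag_sign_mult: "diag_sign A ** diag_sign B = diag_sign (sym_diff A B)"
proof -
  have "(\<Sum>k\<in>UNIV. (if i = k then a else 0) * (if k = j then b k else 0)) = (if i = j then a * b i
    else (0::real))" for i j :: 'a and a b
  proof -
    have "(\<Sum>k\<in>UNIV. (if i = k then a else 0) * (if k = j then b k else 0)) = (\<Sum>k\<in>UNIV. if i = k then
      if k = j then a * b k else 0 else 0)"
      by (intro sum.cong) auto
    then show ?thesis by simp
  qed
  then show ?thesis by (auto simp: diag_sign_def vec_eq_iff matrix_matrix_mult_def)
qed

lemma diag_sign_empty: "diag_sign {} = mat 1"
  by (simp add: diag_sign_def mat_def vec_eq_iff)

lemma diag_sign_orthogonal: "orthogonal_matrix (diag_sign A)"
proof -
  have "transpose (diag_sign A) = diag_sign A" by (simp add: diag_sign_def transpose_def vec_eq_iff)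
  then show ?thesis by (simp add: orthogonal_matrix_def diag_sign_mult diag_sign_empty)
qed

lemma diag_sign_inj: "inj diag_sign"
proof (rule injI)
  fix A B :: "'a set" assume "diag_sign A = diag_sign B"
  then have "diag_sign A $ i $ i = diag_sign B $ i $ i" for i by simp
  then have "(if i \<in> A then - 1 else 1 :: real) = (if i \<in> B then - 1 else 1)" for i
    by (simp add: diag_sign_def)
  then show "A = B" by (metis one_neq_neg_one subsetI subset_antisym)
qed

lemma trace_diag_sign: "trace (diag_sign A) = real CARD('n) - 2 * real (card A)" for A ::
  "'n::finite set"
proof -
  have "trace (diag_sign A) = (\<Sum>i\<in>UNIV. 1 - 2 * of_bool (i \<in> A))"
    unfolding trace_def diag_sign_def by (intro sum.cong) auto
  also have "\<dots> = real CARD('n) - 2 * (\<Sum>i\<in>UNIV. of_bool (i \<in> A))"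
    by (simp add: sum_subtractf flip: sum_distrib_left)
  finally show ?thesis by simp
qed

lemma orthogonal_group_simps [simp]:
  "x \<in> carrier orthogonal_group \<longleftrightarrow> orthogonal_matrix x" "x \<otimes>\<^bsub>orthogonal_group\<^esub> y = x ** y"
    "\<one>\<^bsub>orthogonal_group\<^esub> = mat 1"
  by (simp_all add: orthogonal_group_def)

lemma orthogonal_group: "group orthogonal_group"
proof (rule groupI)
  show "\<exists>y\<in>carrier orthogonal_group. y \<otimes>\<^bsub>orthogonal_group\<^esub> x = \<one>\<^bsub>orthogonal_group\<^esub>"
    if "x \<in> carrier orthogonal_group" for x :: "real^'n^'n"
    using that by (intro bexI[of _ "transpose x"]) (auto simp: orthogonal_matrix_def)
qed (auto simp: matrix_mul_assoc orthogonal_matrix_mul orthogonal_matrix_id)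

lemma orthogonal_group_inv: "orthogonal_matrix x \<Longrightarrow> inv\<^bsub>orthogonal_group\<^esub> x = transpose x"
  by (rule group.inv_equality[OF orthogonal_group]) (auto simp: orthogonal_matrix_def)

lemma diag_sign_conj:
  fixes A B :: "'n::finite set"
  assumes c: "card A = card B"
  shows "\<exists>P. orthogonal_matrix P \<and> diag_sign B = P ** diag_sign A ** transpose P"
proof -
  obtain f where f: "bij_betw f B A" using finite_same_card_bij[of B A] c by auto
  obtain g where g: "bij_betw g (- B) (- A)"
    using finite_same_card_bij[of "- B" "- A"] c by (auto simp: Compl_eq_Diff_UNIV card_Diff_subset)
  define \<sigma> where "\<sigma> i = (if i \<in> B then f i else g i)" for i
  have mem: "\<sigma> i \<in> A \<longleftrightarrow> i \<in> B" for i
    using bij_betw_apply[OF f, of i] bij_betw_apply[OF g, of i] by (auto simp: \<sigma>_def)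
  have inj: "\<sigma> i = \<sigma> j \<longleftrightarrow> i = j" for i j
    using mem[of i] mem[of j] inj_onD[OF bij_betw_imp_inj_on[OF f], of i j] inj_onD[OF
      bij_betw_imp_inj_on[OF g], of i j]
    by (auto simp: \<sigma>_def split: if_splits)
  define P :: "real^'n^'n" where "P = (\<chi> i j. if \<sigma> i = j then 1 else 0)"
  \<comment> \<open>Stated for every \<open>D\<close>: the empty set yields
    \<open>P ** transpose P = mat 1\<close>, and \<open>A\<close> yields the required
    conjugation.\<close>
  have e: "P ** diag_sign D ** transpose P = (\<chi> i k. if i = k then
    if \<sigma> i \<in> D then - 1 else 1 else 0)" for D
  proof -
    have "(P ** diag_sign D) $ i $ j = (if \<sigma> i = j then if j \<in> D then - 1 else 1 else 0)" for i j
    proof -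
      have "(P ** diag_sign D) $ i $ j = (\<Sum>k\<in>UNIV. P $ i $ k * diag_sign D $ k $ j)"
        by (simp add: matrix_matrix_mult_def)
      also have "\<dots> = (\<Sum>k\<in>UNIV. if \<sigma> i = k then if k = j then
        if j \<in> D then - 1 else 1 else 0 else 0)"
        by (intro sum.cong) (auto simp: P_def diag_sign_def)
      finally have "(P ** diag_sign D) $ i $ j = \<dots>" .
      then show ?thesis by simp
    qed
    note PD = this
    have "(P ** diag_sign D ** transpose P) $ i $ k = (if i = k then
      if \<sigma> i \<in> D then - 1 else 1 else 0)" for i k
    proof -
      have "(P ** diag_sign D ** transpose P) $ i $ k = (\<Sum>j\<in>UNIV. (P ** diag_sign D) $ i $ j * P $ k
        $ j)"
        by (subst matrix_matrix_mult_def) (simp add: transpose_def)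
      also have "\<dots> = (\<Sum>j\<in>UNIV. if \<sigma> i = j then if \<sigma> k = j then
        if j \<in> D then - 1 else 1 else 0 else 0)"
        unfolding PD by (intro sum.cong) (auto simp: P_def)
      also have "\<dots> = (if \<sigma> k = \<sigma> i then if \<sigma> i \<in> D then - 1 else 1 else 0)" by simp
      finally show ?thesis by (auto simp: inj)
    qed
    then show ?thesis by (simp add: vec_eq_iff)
  qed
  have "P ** transpose P = P ** diag_sign {} ** transpose P" by (simp add: diag_sign_empty)
  also have "\<dots> = mat 1" unfolding e by (simp add: mat_def vec_eq_iff)
  finally have "P ** transpose P = mat 1" .
  then have "orthogonal_matrix P" using matrix_left_right_inverse[of P "transpose P"]
    by (auto simp: orthogonal_matrix_def)
  moreover have "diag_sign B = P ** diag_sign A ** transpose P"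
    unfolding e mem by (simp add: diag_sign_def)
  ultimately show ?thesis by blast
qed

lemma diag_sign_subgroup:
  assumes C: "linear_code C" shows "subgroup (diag_sign ` C) orthogonal_group"
proof (rule group.subgroupI[OF orthogonal_group])
  show "diag_sign ` C \<subseteq> carrier orthogonal_group" using diag_sign_orthogonal by auto
  show "diag_sign ` C \<noteq> {}" using C by (auto simp: linear_code_def)
  show "x \<otimes>\<^bsub>orthogonal_group\<^esub> y \<in> diag_sign ` C" if "x \<in> diag_sign ` C" "y \<in> diag_sign ` C" for x y
    using that C by (auto simp: linear_code_def diag_sign_mult)
  show "inv\<^bsub>orthogonal_group\<^esub> x \<in> diag_sign ` C" if x: "x \<in> diag_sign ` C" for x
  proof -
    obtain A where A: "A \<in> C" "x = diag_sign A" using x by blast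
    have "inv\<^bsub>orthogonal_group\<^esub> x = x"
      by (rule group.inv_equality[OF orthogonal_group]) (simp_all add: A diag_sign_mult
        diag_sign_empty diag_sign_orthogonal)
    then show ?thesis using x by simp
  qed
qed

lemma almost_conjugate_diag_sign:
  fixes C C' :: "'n::finite set set"
  assumes C: "linear_code C" "linear_code C'" and b: "bij_betw f C C'" and c: "\<And>A. A \<in> C
    \<Longrightarrow> card (f A) = card A"
  shows "almost_conjugate orthogonal_group (diag_sign ` C) (diag_sign ` C')"
proof -
  have bC: "bij_betw diag_sign D (diag_sign ` D)" for D :: "'n set set"
    using diag_sign_inj inj_on_subset by (auto simp: bij_betw_def)
  let ?\<phi> = "diag_sign \<circ> (f \<circ> inv_into C diag_sign)"
  have "bij_betw ?\<phi> (diag_sign ` C) (diag_sign ` C')"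
    by (rule bij_betw_trans[OF bij_betw_trans[OF bij_betw_inv_into[OF bC] b] bC])
  moreover have "\<exists>x\<in>carrier orthogonal_group. ?\<phi> \<gamma> = x \<otimes>\<^bsub>orthogonal_group\<^esub> \<gamma> \<otimes>\<^bsub>orthogonal_group\<^esub>
    inv\<^bsub>orthogonal_group\<^esub> x"
    if \<gamma>: "\<gamma> \<in> diag_sign ` C" for \<gamma>
  proof -
    obtain A where A: "A \<in> C" "\<gamma> = diag_sign A" using \<gamma> by blast
    have "?\<phi> \<gamma> = diag_sign (f A)"
      using inv_into_f_f[OF bij_betw_imp_inj_on[OF bC] A(1)] by (simp add: A(2))
    moreover obtain P where "orthogonal_matrix P" "diag_sign (f A) = P ** diag_sign A ** transpose
      P"
      using diag_sign_conj[of A "f A"] c[OF A(1)] by auto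
    ultimately show ?thesis by (intro bexI[of _ P]) (simp_all add: A(2) orthogonal_group_inv)
  qed
  ultimately show ?thesis
    unfolding almost_conjugate_def using diag_sign_subgroup C by (intro conjI exI[of _ ?\<phi>]) simp_all
qed

text \<open>The trace recovers the weight of a word and conjugation respects products, so the words
  12, 13 and their sum 23 of \<open>code2\<close> would come from two words of weight 2 in
  \<open>code1\<close> whose sum also has weight 2.\<close>

lemma not_conjugate_O6: "\<not> conjugate_subgroups (orthogonal_group :: (real^6^6) monoid) (diag_sign `
  code1) (diag_sign ` code2)"
proof
  assume "conjugate_subgroups (orthogonal_group :: (real^6^6) monoid) (diag_sign ` code1) (diag_sign
    ` code2)"
  then obtain P :: "real^6^6" where P: "orthogonal_matrix P"
    and e: "diag_sign ` code2 = (\<lambda>\<gamma>. P ** \<gamma> ** transpose P) ` diag_sign ` code1"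
    unfolding conjugate_subgroups_def by (auto simp: orthogonal_group_inv)
  have PP: "transpose P ** P = mat 1" using P by (simp add: orthogonal_matrix_def)
  have tr: "trace (P ** X ** transpose P) = trace X" for X
  proof -
    have "trace (P ** X ** transpose P) = trace (transpose P ** (P ** X))" by (rule trace_mul_sym)
    then show ?thesis by (simp add: matrix_mul_assoc PP)
  qed
  have crd: "card A = card B" if "diag_sign B = P ** diag_sign A ** transpose P" for A B
    using tr[of "diag_sign A"] unfolding that[symmetric] trace_diag_sign by simp
  have "\<exists>A\<in>code1. diag_sign B = P ** diag_sign A ** transpose P" if "B \<in> code2" for B
    using that e by blast
  then obtain A B where A: "A \<in> code1" "diag_sign {1, 2} = P ** diag_sign A ** transpose P"
    and B: "B \<in> code1" "diag_sign {1, 3} = P ** diag_sign B ** transpose P"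
      using code2_pairs(1,2) by blast
  have "diag_sign {2, 3} = diag_sign {1, 2} ** (diag_sign {1, 3} :: real^6^6)"
    unfolding diag_sign_mult code2_pairs(3) ..
  also have "\<dots> = P ** diag_sign A ** (transpose P ** P) ** diag_sign B ** transpose P"
    unfolding A(2) B(2) by (simp only: matrix_mul_assoc)
  also have "\<dots> = P ** (diag_sign A ** diag_sign B) ** transpose P"
    unfolding PP by (simp add: matrix_mul_assoc)
  finally have "diag_sign {2, 3} = P ** diag_sign (sym_diff A B) ** transpose P"
    unfolding diag_sign_mult .
  then have "card (sym_diff A B) = 2" using crd code2_pairs(6) by metis
  moreover have "card A = 2" "card B = 2"
    using crd[OF A(2)] crd[OF B(2)] code2_pairs(4,5) by simp_all
  ultimately show False using code1_pairs A(1) B(1) by blast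
qed

section \<open>Monomial subgroups of the Spin group\<close>

lemma spin_subgroup: "subgroup (carrier spin_group) (pin_group :: 'n::{finite,linorder} clifford
  monoid)"
proof (rule group.subgroupI[OF pin_group])
  show "carrier spin_group \<subseteq> carrier (pin_group :: 'n clifford monoid)" by auto
  have one: "1 \<in> carrier (spin_group :: 'n clifford monoid)"
    by (simp add: pin_one pin_cover_one rotation_matrix_def orthogonal_matrix_id)
  then show "carrier (spin_group :: 'n clifford monoid) \<noteq> {}" by blast
  have d: "det (pin_cover (x * y)) = det (pin_cover x) * det (pin_cover y)"
    if "x \<in> carrier pin_group" "y \<in> carrier pin_group" for x y :: "'n clifford"
    unfolding pin_cover_mult[OF that] by (rule det_mul)
  show "inv\<^bsub>pin_group\<^esub> x \<in> carrier spin_group" if "x \<in> carrier spin_group" for x :: "'n clifford"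
  proof -
    have x: "x \<in> carrier pin_group" "det (pin_cover x) = 1"
      using that by (auto simp: rotation_matrix_pin_cover)
    obtain y where "y \<in> carrier pin_group" "x * y = 1" "inv\<^bsub>pin_group\<^esub> x = y"
      using pin_inverse[OF x(1)] .
    then show ?thesis using d[OF x(1), of y] x(2)
      by (simp add: rotation_matrix_pin_cover pin_cover_one)
  qed
  show "x \<otimes>\<^bsub>pin_group\<^esub> y \<in> carrier spin_group" if "x \<in> carrier spin_group" "y \<in> carrier spin_group"
    for x y :: "'n clifford"
    using that d[of x y] by (auto simp: rotation_matrix_pin_cover pin_mult)
qed

lemma spin_group: "group spin_group"
  using group.subgroup_imp_group[OF pin_group spin_subgroup] by (simp add: spin_group_def)

lemma spin_group_eq: "spin_group = pin_group\<lparr>carrier := carrier spin_group\<rparr>"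
  by (simp add: spin_group_def)

text \<open>Almost conjugacy passes to the larger group and non-conjugacy to the smaller one. So the
  former is established in \<open>Spin(6)\<close> and the latter in \<open>Pin(6)\<close>.\<close>

lemma almost_conjugate_supergroup:
  assumes G: "group G" and H: "subgroup H G" and ac: "almost_conjugate (G\<lparr>carrier := H\<rparr>) A B"
  shows "almost_conjugate G A B"
proof -
  have "subgroup X G" if "subgroup X (G\<lparr>carrier := H\<rparr>)" for X
    by (rule group.incl_subgroup[OF G H that])
  moreover have "inv\<^bsub>G\<lparr>carrier := H\<rparr>\<^esub> x = inv\<^bsub>G\<^esub> x" if "x \<in> H" for x
    by (rule group.m_inv_consistent[OF G H that])
  ultimately show ?thesis using ac subgroup.subset[OF H]
    unfolding almost_conjugate_def by simp (metis subsetD)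
qed

lemma conjugate_subgroups_supergroup:
  assumes G: "group G" and H: "subgroup H G" and c: "conjugate_subgroups (G\<lparr>carrier := H\<rparr>) A B"
  shows "conjugate_subgroups G A B"
proof -
  obtain x where x: "x \<in> H" "B = (\<lambda>\<gamma>. x \<otimes>\<^bsub>G\<^esub> \<gamma> \<otimes>\<^bsub>G\<^esub> inv\<^bsub>G\<lparr>carrier := H\<rparr>\<^esub> x) ` A"
    using c unfolding conjugate_subgroups_def by auto
  then show ?thesis
    unfolding conjugate_subgroups_def group.m_inv_consistent[OF G H x(1)]
      using subgroup.subset[OF H] by blast
qed

lemma cl_sign_cases: "cl_sign A B = 1 \<or> cl_sign A B = - 1"
  using cl_sign_square[of A B] by (simp add: square_eq_1_iff)

lemma cl_basis_square: "cl_basis A * cl_basis A = cl_sign A A *\<^sub>R 1"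
  by (simp add: cl_basis_mult cl_basis_empty)

text \<open>Each pair of different indices costs one sign, which gives the exponent
  \<open>card A * card B - card (A \<inter> B)\<close>, and \<open>card B\<close> is even.\<close>

lemma cl_basis_commute:
  assumes "even (card B)"
  shows "cl_basis A * cl_basis B = (- 1) ^ card (A \<inter> B) *\<^sub>R (cl_basis B * cl_basis A ::
    'n::{finite,linorder} clifford)"
proof -
  have row: "(\<Prod>j\<in>B. (if j \<le> i then - 1 else 1) * (if i \<le> j then - 1 else 1)) = (if i \<in> B then - 1
    else 1 :: real)" for i
  proof -
    have "(\<Prod>j\<in>B. (if j \<le> i then - 1 else 1) * (if i \<le> j then - 1 else 1)) = (\<Prod>j\<in>B. - 1 * (if j = i
      then - 1 else 1 :: real))"
      by (intro prod.cong) auto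
    also have "\<dots> = (\<Prod>j\<in>B. if j = i then - 1 else 1)" using assms by (simp only: prod.distrib) simp
    finally show ?thesis by simp
  qed
  have "cl_sign B A = (\<Prod>i\<in>A. \<Prod>j\<in>B. if i \<le> j then - 1 else 1)"
    unfolding cl_sign_prod by (rule prod.swap)
  then have "cl_sign A B * cl_sign B A = (\<Prod>i\<in>A. \<Prod>j\<in>B. (if j \<le> i then - 1 else 1) * (if i \<le> j then -
    1 else 1))"
    unfolding cl_sign_prod[of A B] by (simp only: prod.distrib)
  also have "\<dots> = (- 1) ^ card (A \<inter> B)" unfolding row by (simp add: prod.If_cases)
  finally have s: "cl_sign A B * cl_sign B A = (- 1) ^ card (A \<inter> B)" .
  have "cl_sign A B = cl_sign A B * cl_sign B A * cl_sign B A"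
    by (simp add: mult.assoc cl_sign_square)
  moreover have "sym_diff B A = sym_diff A B" by blast
  ultimately show ?thesis unfolding cl_basis_mult scaleR_scaleR s by simp
qed

text \<open>Multiplication by -1 is multiplication by a generator twice, and the two determinants -1
  cancel.\<close>

lemma pin_uminus:
  assumes x: "x \<in> carrier (pin_group :: 'n::{finite,linorder} clifford monoid)"
  shows "- x \<in> carrier pin_group" "det (pin_cover (- x)) = det (pin_cover x)"
proof -
  fix k :: 'n
  have k: "- x = cl_gen k * (cl_gen k * x)" by (simp add: cl_gen_rules(1))
  have kx: "cl_gen k * x \<in> carrier pin_group" by (rule pin_mult[OF pin_gen x])
  show "- x \<in> carrier pin_group" unfolding k by (rule pin_mult[OF pin_gen kx])
  have "det (pin_cover (cl_gen k)) = - 1"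
    using det_pin_cover_vec[of "axis k 1"] by (simp add: cl_vec_axis norm_axis_1)
  then show "det (pin_cover (- x)) = det (pin_cover x)"
    unfolding k pin_cover_mult[OF pin_gen kx] pin_cover_mult[OF pin_gen x] det_mul by simp
qed

lemma cl_basis_pin:
  fixes A :: "'n::{finite,linorder} set"
  shows "cl_basis A \<in> carrier pin_group \<and> det (pin_cover (cl_basis A)) = (- 1) ^ card A"
proof -
  have "finite A" by simp
  then show ?thesis
  proof induction
    case empty then show ?case by (simp add: cl_basis_empty pin_one pin_cover_one)
  next
    case (insert i A)
    have "sym_diff {i} A = insert i A" using insert.hyps by blast
    then have m: "cl_gen i * cl_basis A = cl_sign {i} A *\<^sub>R cl_basis (insert i A)"
      by (simp only: cl_basis_mult)
    then have "cl_basis (insert i A) = cl_gen i * cl_basis A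
      \<or> cl_basis (insert i A) = - (cl_gen i * cl_basis A)"
      using cl_sign_cases[of "{i}" A] by auto
    moreover have p: "cl_gen i * cl_basis A \<in> carrier pin_group"
      using pin_mult[OF pin_gen] insert.IH by blast
    moreover have "det (pin_cover (cl_gen i)) = - 1"
      using det_pin_cover_vec[of "axis i 1"] by (simp add: cl_vec_axis norm_axis_1)
    then have "det (pin_cover (cl_gen i * cl_basis A)) = (- 1) ^ card (insert i A)"
      using insert.IH insert.hyps by (simp add: pin_cover_mult[OF pin_gen] det_mul)
    ultimately show ?case using pin_uminus[OF p] by auto
  qed
qed

lemma cl_basis_spin:
  assumes "even (card A)" shows "cl_basis A \<in> carrier spin_group" "- cl_basis A \<in> carrier
    spin_group"
  using cl_basis_pin[of A] pin_uminus[of "cl_basis A"] assms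
    by (simp_all add: rotation_matrix_pin_cover)

text \<open>The inverse is kept as a second witness, so that conjugations are composed by computing
  in the Clifford algebra.\<close>

definition spin_conj :: "'n::{finite,linorder} clifford \<Rightarrow> 'n clifford \<Rightarrow> bool" where
  "spin_conj x y \<longleftrightarrow> (\<exists>r\<in>carrier spin_group. \<exists>r'\<in>carrier spin_group. r * r' = 1 \<and> r' * r = 1
    \<and> y = r * x * r')"

lemma spin_mult: "x \<in> carrier spin_group \<Longrightarrow> y \<in> carrier spin_group \<Longrightarrow> x * y \<in> carrier spin_group"
  using monoid.m_closed[OF group.is_monoid[OF spin_group], of x y]
    by (simp del: spin_group_simps(3))

lemma spin_conj_refl: "spin_conj x x"
proof -
  have "1 \<in> carrier spin_group" using monoid.one_closed[OF group.is_monoid[OF spin_group]]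
    by (simp del: spin_group_simps(3))
  then show ?thesis unfolding spin_conj_def
    by (intro bexI[of _ 1]) (auto simp del: spin_group_simps(3))
qed

lemma spin_conj_trans:
  assumes "spin_conj x y" "spin_conj y z" shows "spin_conj x z"
proof -
  obtain r r' where r: "r \<in> carrier spin_group" "r' \<in> carrier spin_group" "r * r' = 1" "r' * r = 1"
    "y = r * x * r'"
    using assms(1) unfolding spin_conj_def by blast
  obtain s s' where s: "s \<in> carrier spin_group" "s' \<in> carrier spin_group" "s * s' = 1" "s' * s = 1"
    "z = s * y * s'"
    using assms(2) unfolding spin_conj_def by blast
  have "s * r * (r' * s') = s * (r * r') * s'" "r' * s' * (s * r) = r' * (s' * s) * r" "z = s * r *
    x * (r' * s')"
    unfolding s(5) r(5) by (simp_all only: mult.assoc)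
  then show ?thesis
    unfolding spin_conj_def using r s spin_mult[OF s(1) r(1)] spin_mult[OF r(2) s(2)]
    by (intro bexI[of _ "s * r"] bexI[of _ "r' * s'"]) simp_all
qed

lemma spin_conj_uminus: "spin_conj x y \<Longrightarrow> spin_conj (- x) (- y)"
  unfolding spin_conj_def by (metis mult_minus_left mult_minus_right)

lemma spin_conjE:
  assumes "spin_conj x y"
  obtains r where "r \<in> carrier spin_group" "y = r \<otimes>\<^bsub>spin_group\<^esub> x \<otimes>\<^bsub>spin_group\<^esub> inv\<^bsub>spin_group\<^esub> r"
proof -
  obtain r r' where r: "r \<in> carrier spin_group" "r' \<in> carrier spin_group" "r * r' = 1" "r' * r = 1"
    "y = r * x * r'"
    using assms(1) unfolding spin_conj_def by blast
  have "inv\<^bsub>spin_group\<^esub> r = r'" by (rule group.inv_equality[OF spin_group _ r(1,2)]) (simp add: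
    r(4))
  then show ?thesis using that r by simp
qed

text \<open>Conjugation by the rotor \<open>(1 + e\<^sub>i e\<^sub>j) / sqrt 2\<close> multiplies every element that anticommutes
  with \<open>e\<^sub>i e\<^sub>j\<close> by \<open>e\<^sub>i e\<^sub>j\<close>.\<close>

lemma rotor_spin:
  fixes i j :: "'n::{finite,linorder}"
  assumes ij: "i \<noteq> j" shows "(1 / sqrt 2) *\<^sub>R (1 + cl_gen i * cl_gen j) \<in> carrier spin_group"
proof -
  \<comment> \<open>Chosen so that \<open>cl_gen i * cl_vec ?v\<close> is the rotor: the square -1
    of the generator turns the component \<open>- axis i 1\<close> into 1.\<close>
  let ?v = "(1 / sqrt 2) *\<^sub>R (axis j 1 - axis i 1) :: real^('n::{finite,linorder})"
  have "?v \<bullet> ?v = 1"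
    using ij by (simp add: inner_diff_left inner_diff_right inner_axis_axis)
  then have v: "norm ?v = 1" by (simp only: norm_eq_1)
  have "cl_gen i * cl_vec ?v = (1 / sqrt 2) *\<^sub>R (1 + cl_gen i * cl_gen j)"
    by (simp add: cl_vec_scaleR cl_vec_diff cl_vec_axis right_diff_distrib cl_gen_square
      add.commute)
  moreover have "det (pin_cover (cl_gen i)) = - 1"
    using det_pin_cover_vec[of "axis i 1"] by (simp add: cl_vec_axis norm_axis_1)
  then have "det (pin_cover (cl_gen i * cl_vec ?v)) = 1"
    unfolding pin_cover_mult[OF pin_gen pin_vec[OF v]] det_mul det_pin_cover_vec[OF v] by simp
  moreover have "cl_gen i * cl_vec ?v \<in> carrier pin_group"
    by (rule pin_mult[OF pin_gen pin_vec[OF v]])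
  ultimately show ?thesis by (simp add: rotation_matrix_pin_cover)
qed

lemma rotor_conj:
  assumes ij: "i \<noteq> j" and x: "x * (cl_gen i * cl_gen j) = - (cl_gen i * cl_gen j * x)"
  shows "spin_conj x (cl_gen i * cl_gen j * x)"
proof -
  let ?g = "cl_gen i * cl_gen j"
  let ?r = "(1 / sqrt 2) *\<^sub>R (1 + ?g)" and ?s = "(1 / sqrt 2) *\<^sub>R (1 + cl_gen j * cl_gen i)"
  have ji: "cl_gen j * cl_gen i = - ?g" by (rule cl_gen_anticommute[OF ij])
  have gg: "?g * ?g = - 1"
  proof -
    have "?g * ?g = cl_gen i * (cl_gen j * cl_gen i) * cl_gen j" by (simp only: mult.assoc)
    also have "\<dots> = - (cl_gen i * cl_gen i * (cl_gen j * cl_gen j))"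
      unfolding ji by (simp add: mult.assoc)
    finally show ?thesis by (simp add: cl_gen_square)
  qed
  have rs: "?r * ?s = 1" "?s * ?r = 1"
  proof -
    have "(1 + ?g) * (1 - ?g) = 2 *\<^sub>R 1" "(1 - ?g) * (1 + ?g) = 2 *\<^sub>R 1"
      by (simp_all add: distrib_left distrib_right left_diff_distrib right_diff_distrib gg scaleR_2)
    then show "?r * ?s = 1" "?s * ?r = 1" unfolding ji by simp_all
  qed
  have "?r * x * ?s = (1 / 2) *\<^sub>R ((1 + ?g) * (x * (1 - ?g)))"
    unfolding ji by (simp add: mult.assoc)
  also have "x * (1 - ?g) = (1 + ?g) * x" using x by (simp add: algebra_simps)
  also have "(1 + ?g) * ((1 + ?g) * x) = (1 + ?g) * (1 + ?g) * x" by (simp only: mult.assoc)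
  also have "(1 + ?g) * (1 + ?g) = 2 *\<^sub>R ?g"
    unfolding distrib_left distrib_right gg by (simp add: scaleR_2)
  finally have "?r * x * ?s = ?g * x" by simp
  then show ?thesis
    unfolding spin_conj_def using rotor_spin[OF ij] rotor_spin[OF ij[symmetric]] rs
    by (intro bexI[of _ ?r] bexI[of _ ?s]) simp_all
qed

text \<open>With \<open>i\<close> in \<open>A\<close> and \<open>j\<close> outside,
  \<open>e\<^sub>i e\<^sub>j\<close> anticommutes with the product over \<open>A\<close>, and the
  rotor turns this product into the exchanged one up to sign. The opposite rotor, with
  \<open>i\<close> and \<open>j\<close> swapped, gives the other sign.\<close>

lemma spin_conj_exchange:
  assumes A: "even (card A)" and i: "i \<in> A" and j: "j \<notin> A"
  shows "spin_conj (cl_basis A) (cl_basis (insert j (A - {i})))"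
proof -
  have ij: "i \<noteq> j" using i j by blast
  have ac: "cl_basis A * cl_gen k = - (cl_gen k * cl_basis A)" if "k \<in> A" for k
  proof -
    have "cl_gen k * cl_basis A = (- 1) ^ card ({k} \<inter> A) *\<^sub>R (cl_basis A * cl_gen k)"
      by (rule cl_basis_commute[OF A])
    then show ?thesis using that by simp
  qed
  have c: "cl_basis A * cl_gen k = cl_gen k * cl_basis A" if "k \<notin> A" for k
  proof -
    have "cl_gen k * cl_basis A = (- 1) ^ card ({k} \<inter> A) *\<^sub>R (cl_basis A * cl_gen k)"
      by (rule cl_basis_commute[OF A])
    then show ?thesis using that by simp
  qed
  have 1: "cl_basis A * (cl_gen i * cl_gen j) = - (cl_gen i * cl_gen j * cl_basis A)"
    "cl_basis A * (cl_gen j * cl_gen i) = - (cl_gen j * cl_gen i * cl_basis A)"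
    unfolding mult.assoc[symmetric] ac[OF i] c[OF j] by (simp_all add: mult.assoc ac[OF i] c[OF j])
  have "sym_diff {i} (sym_diff {j} A) = insert j (A - {i})" using i j by blast
  then have "cl_gen i * cl_gen j * cl_basis A = (cl_sign {j} A * cl_sign {i} (sym_diff {j} A)) *\<^sub>R
    cl_basis (insert j (A - {i}))"
    unfolding mult.assoc[of "cl_gen i"] cl_basis_mult[of "{j}" A] mult_scaleR_right cl_basis_mult[of
      "{i}" "sym_diff {j} A"] scaleR_scaleR
    by (simp only:)
  then have "cl_gen i * cl_gen j * cl_basis A = cl_basis (insert j (A - {i})) \<or>
      cl_gen i * cl_gen j * cl_basis A = - cl_basis (insert j (A - {i}))"
    using cl_sign_cases[of "{j}" A] cl_sign_cases[of "{i}" "sym_diff {j} A"] by auto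
  moreover have "cl_gen j * cl_gen i * cl_basis A = - (cl_gen i * cl_gen j * cl_basis A)"
    unfolding cl_gen_anticommute[OF ij] by simp
  ultimately show ?thesis
    using rotor_conj[OF ij 1(1)] rotor_conj[OF ij[symmetric] 1(2)] by auto
qed

lemma spin_conj_cl_basis:
  fixes A B :: "'n::{finite,linorder} set"
  assumes "card A = card B" "even (card A)" shows "spin_conj (cl_basis A) (cl_basis B)"
  using assms
proof (induction "card (A - B)" arbitrary: A)
  case 0
  then have "A \<subseteq> B" by simp
  then have "A = B" using 0 by (metis card_subset_eq finite_code)
  then show ?case by (simp add: spin_conj_refl)
next
  case (Suc n)
  then obtain i where i: "i \<in> A" "i \<notin> B"
    by (metis DiffD1 DiffD2 card.empty ex_in_conv nat.distinct(1))
  have "card (B - A) = card (A - B)"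
    using Suc.prems(1) by (metis add_diff_cancel_left' card_Diff_subset_Int finite_code Int_commute)
  then have "card (B - A) \<noteq> 0" using Suc.hyps(2) by linarith
  then have "B - A \<noteq> {}" by (metis card.empty)
  then obtain j where j: "j \<in> B" "j \<notin> A" by blast
  let ?A = "insert j (A - {i})"
  have c: "card ?A = card A" using i j
    by (simp add: card_Diff_singleton card_gt_0_iff) (metis Suc_pred card_gt_0_iff empty_iff
    finite_code)
  have "?A - B = A - B - {i}" using j by blast
  then have "n = card (?A - B)" using Suc.hyps(2) i by simp
  then have "spin_conj (cl_basis ?A) (cl_basis B)" using Suc.hyps(1)[of ?A] Suc.prems c by simp
  moreover have "spin_conj (cl_basis A) (cl_basis ?A)"
    by (rule spin_conj_exchange[OF Suc.prems(2) i(1) j(2)])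
  ultimately show ?case using spin_conj_trans by blast
qed

text \<open>Both signs occur because products of basis elements carry the sign
  \<open>cl_sign\<close>; the result is the preimage of the diagonal group of the code in the Pin
  group.\<close>

definition code_spin :: "'n set set \<Rightarrow> 'n::{finite,linorder} clifford set" where
  "code_spin C = (\<lambda>(s, A). s *\<^sub>R cl_basis A) ` ({1, - 1} \<times> C)"

lemma code_spin_inj: "inj_on (\<lambda>(s, A). s *\<^sub>R cl_basis A) ({1, - 1} \<times> (C :: 'n::{finite,linorder} set
  set))"
proof (rule inj_onI, clarify)
  fix s t :: real and A B :: "'n set"
  assume st: "s \<in> {1, - 1}" "t \<in> {1, - 1}" and e: "s *\<^sub>R cl_basis A = t *\<^sub>R cl_basis B"
  have co: "cl_coeff (r *\<^sub>R cl_basis D) X = (if X = D then r else 0)" for r and D X :: "'n set"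
    by (simp add: scaleR_clifford_def cl_basis_def)
  have "(if X = A then s else 0) = (if X = B then t else 0)" for X
    using arg_cong[OF e, of "\<lambda>x. cl_coeff x X"] unfolding co .
  from this[of A] show "s = t \<and> A = B" using st by (auto split: if_splits)
qed

lemma code_spin_subgroup:
  assumes C: "linear_code C" "\<And>A. A \<in> C \<Longrightarrow> even (card A)" shows "subgroup (code_spin C) spin_group"
proof (rule group.subgroupI[OF spin_group])
  have mem: "s *\<^sub>R cl_basis A \<in> code_spin C" if "s = 1 \<or> s = - 1" "A \<in> C" for s A
    using that by (auto simp: code_spin_def)
  have memE: "\<exists>s A. (s = 1 \<or> s = - 1) \<and> A \<in> C \<and> x = s *\<^sub>R cl_basis A" if "x \<in> code_spin C" for x
    using that by (auto simp: code_spin_def)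
  show sub: "code_spin C \<subseteq> carrier spin_group"
  proof
    fix x assume "x \<in> code_spin C"
    then obtain s A where "s = 1 \<or> s = - 1" "A \<in> C" "x = s *\<^sub>R cl_basis A" using memE by blast
    then show "x \<in> carrier spin_group" using cl_basis_spin[OF C(2)] by auto
  qed
  show "code_spin C \<noteq> {}" using C(1) by (auto simp: code_spin_def linear_code_def)
  show "x \<otimes>\<^bsub>spin_group\<^esub> y \<in> code_spin C" if xy: "x \<in> code_spin C" "y \<in> code_spin C" for x y
  proof -
    obtain s A where x: "s = 1 \<or> s = - 1" "A \<in> C" "x = s *\<^sub>R cl_basis A"
      using memE[OF xy(1)] by blast
    obtain t B where y: "t = 1 \<or> t = - 1" "B \<in> C" "y = t *\<^sub>R cl_basis B"
      using memE[OF xy(2)] by blast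
    have "x * y = (s * t * cl_sign A B) *\<^sub>R cl_basis (sym_diff A B)"
      by (simp add: x(3) y(3) cl_basis_mult mult.commute mult.left_commute)
    moreover have "sym_diff A B \<in> C" using C(1) x(2) y(2) by (simp add: linear_code_def)
    moreover have "s * t * cl_sign A B = 1 \<or> s * t * cl_sign A B = - 1"
      using x(1) y(1) cl_sign_cases[of A B] by auto
    ultimately show ?thesis using mem by simp
  qed
  show "inv\<^bsub>spin_group\<^esub> x \<in> code_spin C" if xc: "x \<in> code_spin C" for x
  proof -
    obtain s A where x: "s = 1 \<or> s = - 1" "A \<in> C" "x = s *\<^sub>R cl_basis A" using memE[OF xc] by blast
    let ?y = "(s * cl_sign A A) *\<^sub>R cl_basis A"
    have y: "?y \<in> code_spin C" by (rule mem) (use x(1,2) cl_sign_cases[of A A] in auto)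
    have "?y * x = 1" using x(1) by (auto simp: x(3) cl_basis_square cl_sign_square)
    then have "inv\<^bsub>spin_group\<^esub> x = ?y"
      using group.inv_equality[OF spin_group _ subsetD[OF sub xc] subsetD[OF sub y]] by simp
    then show ?thesis using y by simp
  qed
qed

lemma almost_conjugate_code_spin:
  fixes C C' :: "'n::{finite,linorder} set set"
  assumes C: "linear_code C" "linear_code C'" "\<And>A. A \<in> C \<Longrightarrow> even (card A)" "\<And>A. A \<in> C'
    \<Longrightarrow> even (card A)"
    and b: "bij_betw f C C'" and c: "\<And>A. A \<in> C \<Longrightarrow> card (f A) = card A"
  shows "almost_conjugate spin_group (code_spin C) (code_spin C')"
proof -
  let ?p = "\<lambda>(s, A). s *\<^sub>R cl_basis A :: 'n clifford" and ?I = "{1, - 1 :: real}"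
  have bC: "bij_betw ?p (?I \<times> D) (code_spin D)" for D :: "'n set set"
    using code_spin_inj by (auto simp: bij_betw_def code_spin_def)
  have bm: "bij_betw (map_prod id f) (?I \<times> C) (?I \<times> C')"
    by (rule bij_betw_map_prod[OF bij_betw_id b])
  let ?\<phi> = "?p \<circ> (map_prod id f \<circ> inv_into (?I \<times> C) ?p)"
  have "bij_betw ?\<phi> (code_spin C) (code_spin C')"
    by (rule bij_betw_trans[OF bij_betw_trans[OF bij_betw_inv_into[OF bC] bm] bC])
  moreover have "\<exists>x\<in>carrier spin_group. ?\<phi> \<gamma> = x \<otimes>\<^bsub>spin_group\<^esub> \<gamma> \<otimes>\<^bsub>spin_group\<^esub> inv\<^bsub>spin_group\<^esub> x"
    if \<gamma>: "\<gamma> \<in> code_spin C" for \<gamma>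
  proof -
    obtain s A where A: "(s, A) \<in> ?I \<times> C" "\<gamma> = ?p (s, A)" using \<gamma> unfolding code_spin_def by blast
    have "inv_into (?I \<times> C) ?p \<gamma> = (s, A)"
      unfolding A(2) by (rule inv_into_f_f[OF code_spin_inj A(1)])
    then have "?\<phi> \<gamma> = s *\<^sub>R cl_basis (f A)" by simp
    moreover have "spin_conj (cl_basis A) (cl_basis (f A))"
      using spin_conj_cl_basis[of A "f A"] c C(3) A(1) by auto
    then have "spin_conj \<gamma> (s *\<^sub>R cl_basis (f A))" using spin_conj_uminus A by auto
    ultimately have "spin_conj \<gamma> (?\<phi> \<gamma>)" by simp
    then show ?thesis by (rule spin_conjE) blast
  qed
  moreover have "finite (code_spin D)" for D :: "'n set set" by (simp add: code_spin_def)
  ultimately show ?thesis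
    unfolding almost_conjugate_def
    using code_spin_subgroup[OF C(1,3)] code_spin_subgroup[OF C(2,4)]
      by (intro conjI exI[of _ ?\<phi>] ballI) blast+
qed

text \<open>The intersection of two words of \<open>code1\<close> is again a word, so it has an even
  number of elements and the corresponding products commute. The words 12 and 13 of
  \<open>code2\<close> meet in a single index, so their products anticommute.\<close>

lemma not_conjugate_pin6: "\<not> conjugate_subgroups (pin_group :: 6 clifford monoid) (code_spin code1)
  (code_spin code2)"
proof
  assume "conjugate_subgroups (pin_group :: 6 clifford monoid) (code_spin code1) (code_spin code2)"
  then obtain g :: "6 clifford" where g: "g \<in> carrier pin_group" "code_spin code2 = (\<lambda>\<gamma>. g * \<gamma> *
    inv\<^bsub>pin_group\<^esub> g) ` code_spin code1"
    unfolding conjugate_subgroups_def by auto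
  obtain g' where g': "g' * g = 1" "inv\<^bsub>pin_group\<^esub> g = g'" using pin_inverse[OF g(1)] by metis
  have comm: "x * y = y * x" if "x \<in> code_spin code1" "y \<in> code_spin code1" for x y
  proof -
    have "cl_basis A * cl_basis B = cl_basis B * cl_basis A" if "A \<in> code1" "B \<in> code1" for A B
    proof -
      have "A \<inter> B \<in> code1" using that by (simp add: code1_def)
      then show ?thesis using cl_basis_commute[OF even_code1[OF that(2)], of A] even_code1[of "A \<inter>
        B"] by simp
    qed
    then show ?thesis using that by (auto simp: code_spin_def)
  qed
  have comm2: "x * y = y * x" if xy: "x \<in> code_spin code2" "y \<in> code_spin code2" for x y
  proof -
    obtain u v where u: "u \<in> code_spin code1" "v \<in> code_spin code1" "x = g * u * g'" "y = g * v *
      g'"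
      using xy unfolding g(2) g'(2) by blast
    have "x * y = g * u * (g' * g) * v * g'" "y * x = g * v * (g' * g) * u * g'"
      unfolding u by (simp_all only: mult.assoc)
    then show ?thesis using comm[OF u(1,2)] by (simp add: g'(1) mult.assoc)
  qed
  have mem: "cl_basis A \<in> code_spin code2" if "A \<in> code2" for A
    using that unfolding code_spin_def by (intro image_eqI[of _ _ "(1, A)"]) auto
  let ?x = "cl_basis {1, 2} :: 6 clifford" and ?y = "cl_basis {1, 3} :: 6 clifford"
  have xy: "?x * ?y = ?y * ?x" using comm2 mem code2_pairs(1,2) by blast
  have "{1, 2} \<inter> {1, 3 :: 6} = {1}" by auto
  then have "?x * ?y = - (?y * ?x)"
    using cl_basis_commute[of "{1, 3 :: 6}" "{1, 2}"] code2_pairs(5) by simp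
  then have "?y * ?x = - (?y * ?x)" unfolding xy .
  then have "2 *\<^sub>R (?y * ?x) = 0" unfolding scaleR_2 by (simp only: eq_neg_iff_add_eq_0)
  then have "?y * (?x * ?x) = 0" unfolding mult.assoc[symmetric] by simp
  then have "?y * ?y = 0" using cl_sign_cases[of "{1, 2 :: 6}" "{1, 2}"]
    unfolding cl_basis_square[of "{1, 2}"] by auto
  then show False using cl_sign_cases[of "{1, 3 :: 6}" "{1, 3}"] unfolding cl_basis_square by auto
qed

theorem proposition2p4:
  shows
    "(\<forall>\<Gamma>\<^sub>1 \<Gamma>\<^sub>2. almost_conjugate (special_unitary_group :: (complex^2^2) monoid) \<Gamma>\<^sub>1 \<Gamma>\<^sub>2 \<longrightarrow>
        conjugate_subgroups (special_unitary_group :: (complex^2^2) monoid) \<Gamma>\<^sub>1 \<Gamma>\<^sub>2)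
   \<and> ((\<forall>\<Gamma>\<^sub>1 \<Gamma>\<^sub>2. almost_conjugate (spin_group :: 4 clifford monoid) \<Gamma>\<^sub>1 \<Gamma>\<^sub>2 \<longrightarrow>
          conjugate_subgroups (spin_group :: 4 clifford monoid) \<Gamma>\<^sub>1 \<Gamma>\<^sub>2)
      \<and> (\<forall>\<Gamma>\<^sub>1 \<Gamma>\<^sub>2.
          almost_conjugate ((special_unitary_group :: (complex^2^2) monoid)
            \<times>\<times> (special_unitary_group :: (complex^2^2) monoid)) \<Gamma>\<^sub>1 \<Gamma>\<^sub>2 \<longrightarrow>
          conjugate_subgroups ((special_unitary_group :: (complex^2^2) monoid)
            \<times>\<times> (special_unitary_group :: (complex^2^2) monoid)) \<Gamma>\<^sub>1 \<Gamma>\<^sub>2))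
   \<and> ((\<exists>\<Gamma>\<^sub>1 \<Gamma>\<^sub>2. almost_conjugate (orthogonal_group :: (real^6^6) monoid) \<Gamma>\<^sub>1 \<Gamma>\<^sub>2 \<and>
          \<not> conjugate_subgroups (orthogonal_group :: (real^6^6) monoid) \<Gamma>\<^sub>1 \<Gamma>\<^sub>2)
      \<and> (\<exists>\<Gamma>\<^sub>1 \<Gamma>\<^sub>2. almost_conjugate (spin_group :: 6 clifford monoid) \<Gamma>\<^sub>1 \<Gamma>\<^sub>2 \<and>
          \<not> conjugate_subgroups (spin_group :: 6 clifford monoid) \<Gamma>\<^sub>1 \<Gamma>\<^sub>2)
      \<and> (\<exists>\<Gamma>\<^sub>1 \<Gamma>\<^sub>2. almost_conjugate (pin_group :: 6 clifford monoid) \<Gamma>\<^sub>1 \<Gamma>\<^sub>2 \<and>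
          \<not> conjugate_subgroups (pin_group :: 6 clifford monoid) \<Gamma>\<^sub>1 \<Gamma>\<^sub>2))"
proof -
  have O6: "almost_conjugate (orthogonal_group :: (real^6^6) monoid) (diag_sign ` code1) (diag_sign
    ` code2)"
    by (rule almost_conjugate_diag_sign[OF linear_codes code_map_bij card_code_map])
  have S6: "almost_conjugate spin_group (code_spin code1) (code_spin code2)"
    by (rule almost_conjugate_code_spin[OF linear_codes even_code1 even_code2 code_map_bij
      card_code_map])
  note sub = pin_group spin_subgroup
  have P6: "almost_conjugate pin_group (code_spin code1) (code_spin code2)"
    by (rule almost_conjugate_supergroup[OF sub]) (use S6 in \<open>simp only: spin_group_eq[symmetric]\<close>)
  have nS6: "\<not> conjugate_subgroups spin_group (code_spin code1) (code_spin code2)"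
    using conjugate_subgroups_supergroup[OF sub, of "code_spin code1" "code_spin code2"]
      not_conjugate_pin6
    unfolding spin_group_eq[symmetric] by blast
  show ?thesis
    using almost_conjugates_conjugate_SU2 almost_conjugates_conjugate_spin4
      almost_conjugates_conjugate_SU2_prod
    unfolding almost_conjugates_conjugate_def
    using O6 not_conjugate_O6 S6 nS6 P6 not_conjugate_pin6 by blast
qed

end
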